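(* Let $Q$ be a translation surface, let $\xi_0\in\mathbb{S}^1$ and let $\varepsilon>0$. There exists a continuous family of quasimodes $\{\Lambda_\lambda\}_{\lambda>0}$, $\Lambda_\lambda\in C^2(Q)$, for the Laplacian $\Delta$ on $Q$ of spectral width $O(\lambda^{3/8+\varepsilon})$, i.e. $$\frac{\|(\Delta+\lambda)\Lambda_\lambda\|_{L^2(Q)}}{\|\Lambda_\lambda\|_{L^2(Q)}}=O(\lambda^{3/8+\varepsilon}),$$ such that the associated momentum distributions satisfy $$d\mu_{\Lambda_\lambda}(\xi)\xrightarrow{\;w*\;}\delta(\xi-\xi_0),\qquad \lambda\to\infty.$$
   Context: Translation surface: take a finite collection of polygons in the Euclidean plane, each with boundary oriented so that the polygon lies to the left, whose edges are paired so that the two edges of a pair are parallel, of equal length and of opposite orientation; $Q$ is the space obtained by gluing the two edges of each pair by the parallel translation $x\mapsto x+\tau$ carrying one to the other. It is a compact flat surface with finitely many conical singularities, regarded as a compact flat Riemannian manifold with periodic boundary; $\Delta=\partial_x^2+\partial_y^2$ in local Euclidean coordinates is its Laplace–Beltrami operator. The phase space is $TQ$ (tangent and cotangent bundles identified), and directions $\xi$ are globally defined since gluings are translations; $\mathbb{S}^1\subset\mathbb{R}^2$ is the unit circle. Semiclassical parameter: $\hbar=\lambda^{-1/2}$. $\mathrm{Op}^w_\hbar(a)$ is the standard Weyl quantization, given in local Euclidean coordinates by $$[\mathrm{Op}^w_\hbar(a)\psi](x)=\frac{1}{(2\pi\hbar)^2}\int_{\mathbb{R}^2}\int_{\mathbb{R}^2}e^{\frac{i}{\hbar}(x-y)\cdot\xi}\,a\Big(\frac{x+y}{2},\xi\Big)\psi(y)\,dy\,d\xi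 .$$ For an $L^2$-normalized $\psi$ the Wigner distribution $d\mu_\psi(x,\xi)$ on $TQ$ is defined by duality: $\langle \mathrm{Op}^w_\hbar(a)\psi,\psi\rangle_Q=\int_{TQ}a(x,\xi)\,d\mu_\psi(x,\xi)$ for observables $a$; for a non-normalized $\psi\neq0$, $\mu_\psi$ means the Wigner distribution of $\psi/\|\psi\|_{L^2(Q)}$. Its restriction (projection) to momentum space is $d\mu_\psi(\xi)=\int_Q d\mu_\psi(x,\xi)$, i.e. it is tested against observables $a=a(\xi)\in C_c^\infty(\mathbb{R}^2)$ depending only on $\xi$. Weak-* convergence means convergence of the integrals against every such test function. A quasimode of quasienergy $\lambda$ and spectral width $O(\lambda^\delta)$ is a family $\Lambda_\lambda$ with $\|(\Delta+\lambda)\Lambda_\lambda\|_{L^2(Q)}/\|\Lambda_\lambda\|_{L^2(Q)}=O(\lambda^\delta)$ as $\lambda\to\infty$. *)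

theory Defs
  imports "HOL-Analysis.Analysis" "HOL-Library.Landau_Symbols"
begin

text \<open>The Euclidean plane is the type \<^typ>\<open>complex\<close>; its dot product is \<open>x \<bullet> y = Re x * Re y + Im x * Im y\<close>.\<close>

section \<open>Translation surfaces\<close>

text \<open>A polygon is given by the cyclic list of its vertices; straight angles are allowed.\<close>

definition next_vertex :: "complex list \<Rightarrow> nat \<Rightarrow> complex" where
  "next_vertex vs k = vs ! (Suc k mod length vs)"

definition polygon_boundary :: "complex list \<Rightarrow> complex set" where
  "polygon_boundary vs = (\<Union>k<length vs. closed_segment (vs ! k) (next_vertex vs k))"

definition polygon_region :: "complex list \<Rightarrow> complex set" where
  "polygon_region vs = polygon_boundary vs \<union> inside (polygon_boundary vs)"

definition simple_polygon :: "complex list \<Rightarrow> bool" where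
  "simple_polygon vs \<longleftrightarrow> 3 \<le> length vs \<and> distinct vs \<and>
     (\<forall>k<length vs. \<forall>l<length vs. k \<noteq> l \<longrightarrow>
        open_segment (vs ! k) (next_vertex vs k) \<inter> closed_segment (vs ! l) (next_vertex vs l) = {})"

text \<open>The polygon lies to the left of each of its oriented edges.\<close>

definition lies_to_the_left :: "complex list \<Rightarrow> bool" where
  "lies_to_the_left vs \<longleftrightarrow> (\<forall>k<length vs. \<forall>p\<in>open_segment (vs ! k) (next_vertex vs k).
     \<forall>\<^sub>F t in at_right 0. p + of_real t * (\<i> * (next_vertex vs k - vs ! k)) \<in> inside (polygon_boundary vs))"

text \<open>The pair \<open>(j, k)\<close> stands for the edge number \<open>k\<close> of the polygon number \<open>j\<close>.\<close>

record gluing =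
  polys :: "complex list list"
  pairing :: "nat \<times> nat \<Rightarrow> nat \<times> nat"

definition edges :: "gluing \<Rightarrow> (nat \<times> nat) set" where
  "edges S = {(j, k). j < length (polys S) \<and> k < length (polys S ! j)}"

definition edge_start :: "gluing \<Rightarrow> nat \<times> nat \<Rightarrow> complex" where
  "edge_start S e = polys S ! fst e ! snd e"

definition edge_end :: "gluing \<Rightarrow> nat \<times> nat \<Rightarrow> complex" where
  "edge_end S e = next_vertex (polys S ! fst e) (snd e)"

text \<open>Since edge vectors are nonzero, the last condition (parallel, of equal length, of opposite
  orientation) also says that no edge is paired with itself.\<close>

definition translation_surface :: "gluing \<Rightarrow> bool" where
  "translation_surface S \<longleftrightarrow>
     polys S \<noteq> [] \<and>
     (\<forall>vs\<in>set (polys S). simple_polygon vs \<and> lies_to_the_left vs) \<and>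
     (\<forall>e\<in>edges S. pairing S e \<in> edges S \<and> pairing S (pairing S e) = e \<and>
        edge_end S (pairing S e) - edge_start S (pairing S e) = - (edge_end S e - edge_start S e))"

text \<open>The translation carrying an edge onto its partner; as the orientations are opposite, it
  carries the start of the edge to the end of the partner.\<close>

definition edge_shift :: "gluing \<Rightarrow> nat \<times> nat \<Rightarrow> complex" where
  "edge_shift S e = edge_end S (pairing S e) - edge_start S e"

type_synonym point = "(nat \<times> complex) set"

definition disjoint_union :: "gluing \<Rightarrow> (nat \<times> complex) set" where
  "disjoint_union S = {(j, z). j < length (polys S) \<and> z \<in> polygon_region (polys S ! j)}"

definition glue :: "gluing \<Rightarrow> ((nat \<times> complex) \<times> (nat \<times> complex)) set" where
  "glue S = {((fst e, z), (fst (pairing S e), z + edge_shift S e)) | e z.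
     e \<in> edges S \<and> z \<in> closed_segment (edge_start S e) (edge_end S e)}"

definition cls :: "gluing \<Rightarrow> nat \<times> complex \<Rightarrow> point" where
  "cls S p = (glue S)\<^sup>* `` {p}"

definition surface :: "gluing \<Rightarrow> point set" where
  "surface S = disjoint_union S // (glue S)\<^sup>*"

text \<open>All vertices are removed, also those with total angle \<open>2\<pi>\<close>, where the surface is flat.
  In the notions below this is harmless: a continuous function that is differentiable
  off a point, with derivatives extending continuously to it, is differentiable there.\<close>

definition regular_points :: "gluing \<Rightarrow> point set" where
  "regular_points S = surface S - {cls S (j, z) | j z. j < length (polys S) \<and> z \<in> set (polys S ! j)}"

text \<open>Continuity for the quotient topology.\<close>

definition continuous_on_surface :: "gluing \<Rightarrow> (point \<Rightarrow> complex) \<Rightarrow> bool" where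
  "continuous_on_surface S f \<longleftrightarrow>
     (\<forall>j<length (polys S). continuous_on (polygon_region (polys S ! j)) (\<lambda>z. f (cls S (j, z))))"

text \<open>Integration against the Euclidean area; the edges, which are counted twice, are null sets.\<close>

definition surface_integral :: "gluing \<Rightarrow> (point \<Rightarrow> 'b) \<Rightarrow> 'b::{banach, second_countable_topology}" where
  "surface_integral S f =
     (\<Sum>j<length (polys S). LINT z:polygon_region (polys S ! j)|lborel. f (cls S (j, z)))"

definition L2_inner :: "gluing \<Rightarrow> (point \<Rightarrow> complex) \<Rightarrow> (point \<Rightarrow> complex) \<Rightarrow> complex" where
  "L2_inner S f g = surface_integral S (\<lambda>q. f q * cnj (g q))"

definition L2_norm :: "gluing \<Rightarrow> (point \<Rightarrow> complex) \<Rightarrow> real" where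
  "L2_norm S f = sqrt (surface_integral S (\<lambda>q. (cmod (f q))\<^sup>2))"

section \<open>Local Euclidean coordinates\<close>

text \<open>\<open>\<eta>\<close> is a map from an open set of the plane to the regular part of the surface that is, near each
  point and in each polygon (for a point on an edge: on both sides of the edge), a translation.
  Such a map is a local homeomorphism; its local inverses are the Euclidean coordinates.
  It need not be injective on all of \<open>W\<close>.\<close>

definition local_coords :: "gluing \<Rightarrow> complex set \<Rightarrow> (complex \<Rightarrow> point) \<Rightarrow> bool" where
  "local_coords S W \<eta> \<longleftrightarrow> open W \<and> \<eta> ` W \<subseteq> regular_points S \<and>
     (\<forall>z\<in>W. \<forall>(j, p)\<in>\<eta> z. \<forall>\<^sub>F p' in at p within polygon_region (polys S ! j).
        \<eta> (z + (p' - p)) = cls S (j, p'))"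

text \<open>\<open>translate S x v\<close> is the point \<open>x + v\<close>: the end of the straight segment that starts
  in \<open>x\<close> and has displacement vector \<open>v\<close>. It exists unless the segment runs into a vertex. For given
  regular \<open>x\<close> this excludes only vectors \<open>v\<close> in countably many directions, hence a null set.\<close>

definition translatable :: "gluing \<Rightarrow> point \<Rightarrow> complex set" where
  "translatable S x = {v. \<exists>W \<eta>. local_coords S W \<eta> \<and> closed_segment 0 v \<subseteq> W \<and> \<eta> 0 = x}"

definition translate :: "gluing \<Rightarrow> point \<Rightarrow> complex \<Rightarrow> point" where
  "translate S x v =
     (THE y. \<exists>W \<eta>. local_coords S W \<eta> \<and> closed_segment 0 v \<subseteq> W \<and> \<eta> 0 = x \<and> \<eta> v = y)"

text \<open>Derivative at a regular point in the direction \<open>v\<close>; for \<open>v = 1\<close> and \<open>v = \<i>\<close> these are the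
  partial derivatives with respect to the Euclidean coordinates.\<close>

definition partial :: "gluing \<Rightarrow> complex \<Rightarrow> (point \<Rightarrow> complex) \<Rightarrow> point \<Rightarrow> complex" where
  "partial S v f q = vector_derivative (\<lambda>t. f (translate S q (of_real t * v))) (at 0)"

definition laplacian :: "gluing \<Rightarrow> (point \<Rightarrow> complex) \<Rightarrow> point \<Rightarrow> complex" where
  "laplacian S f q = partial S 1 (partial S 1 f) q + partial S \<i> (partial S \<i> f) q"

definition has_gradient :: "gluing \<Rightarrow> (point \<Rightarrow> complex) \<Rightarrow> (point \<Rightarrow> complex) \<Rightarrow> (point \<Rightarrow> complex) \<Rightarrow> bool" where
  "has_gradient S f g h \<longleftrightarrow> (\<forall>W \<eta>. local_coords S W \<eta> \<longrightarrow> (\<forall>z\<in>W.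
     ((\<lambda>w. f (\<eta> w)) has_derivative (\<lambda>v. of_real (Re v) * g (\<eta> z) + of_real (Im v) * h (\<eta> z))) (at z)))"

text \<open>\<open>Ck_surface S 2\<close> is \<open>C\<^sup>2(Q)\<close>: twice continuously differentiable off the vertices, the function and
  its partial derivatives up to order two extending continuously to the whole compact surface.\<close>

primrec Ck_surface :: "gluing \<Rightarrow> nat \<Rightarrow> (point \<Rightarrow> complex) \<Rightarrow> bool" where
  "Ck_surface S 0 f \<longleftrightarrow> continuous_on_surface S f"
| "Ck_surface S (Suc k) f \<longleftrightarrow> continuous_on_surface S f \<and>
     (\<exists>g h. has_gradient S f g h \<and> Ck_surface S k g \<and> Ck_surface S k h)"

definition C2_norm :: "gluing \<Rightarrow> (point \<Rightarrow> complex) \<Rightarrow> real" where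
  "C2_norm S f = (SUP q\<in>regular_points S. cmod (f q) + (\<Sum>v\<in>{1, \<i>}. cmod (partial S v f q))
     + (\<Sum>v\<in>{1, \<i>}. \<Sum>w\<in>{1, \<i>}. cmod (partial S v (partial S w f) q)))"

text \<open>Continuity in the parameter for the topology of \<open>C\<^sup>2(Q)\<close>.\<close>

definition continuous_C2_family :: "gluing \<Rightarrow> (real \<Rightarrow> point \<Rightarrow> complex) \<Rightarrow> bool" where
  "continuous_C2_family S \<Lambda> \<longleftrightarrow> (\<forall>l>0. Ck_surface S 2 (\<Lambda> l)) \<and>
     (\<forall>l>0. ((\<lambda>m. C2_norm S (\<lambda>q. \<Lambda> m q - \<Lambda> l q)) \<longlongrightarrow> 0) (at l))"

section \<open>Weyl quantization and Wigner distributions\<close>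

text \<open>The Weyl quantization of a symbol \<open>a(x, \<xi>)\<close> on the phase space \<open>Q \<times> \<real>\<^sup>2\<close>, written in the
  Euclidean coordinates centred at \<open>x\<close>, with \<open>y = x + v\<close>, so that \<open>x - y = - v\<close> and the midpoint of
  \<open>x\<close> and \<open>y\<close> is \<open>x + v/2\<close>. The wave function is continued along straight lines over the (periodic)
  boundary of the polygons; on a flat torus this is the usual periodic continuation.
  As \<open>v\<close> ranges over the whole plane and the continued wave function does not decay, the double integral
  is an oscillatory integral; as usual the integration over \<open>\<xi>\<close> is done first.\<close>

definition Op_weyl :: "gluing \<Rightarrow> real \<Rightarrow> (point \<Rightarrow> complex \<Rightarrow> complex) \<Rightarrow> (point \<Rightarrow> complex) \<Rightarrow> point \<Rightarrow> complex" where
  "Op_weyl S h a \<psi> x = 1 / (2 * of_real pi * of_real h)\<^sup>2 *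
     (LINT v:translatable S x|lborel.
        (LINT \<xi>|lborel. exp (\<i> / of_real h * of_real ((- v) \<bullet> \<xi>)) * a (translate S x (v / 2)) \<xi>)
        * \<psi> (translate S x v))"

text \<open>The pairing of the Wigner distribution of \<open>\<psi> / \<parallel>\<psi>\<parallel>\<close> with the observable \<open>a\<close>.\<close>

definition wigner :: "gluing \<Rightarrow> real \<Rightarrow> (point \<Rightarrow> complex) \<Rightarrow> (point \<Rightarrow> complex \<Rightarrow> complex) \<Rightarrow> complex" where
  "wigner S h \<psi> a = (let \<phi> = (\<lambda>q. \<psi> q / of_real (L2_norm S \<psi>)) in L2_inner S (Op_weyl S h a \<phi>) \<phi>)"

definition momentum_distribution :: "gluing \<Rightarrow> real \<Rightarrow> (point \<Rightarrow> complex) \<Rightarrow> (complex \<Rightarrow> complex) \<Rightarrow> complex" where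
  "momentum_distribution S h \<psi> b = wigner S h \<psi> (\<lambda>x \<xi>. b \<xi>)"

primrec Ck_plane :: "nat \<Rightarrow> (complex \<Rightarrow> complex) \<Rightarrow> bool" where
  "Ck_plane 0 f \<longleftrightarrow> continuous_on UNIV f"
| "Ck_plane (Suc k) f \<longleftrightarrow> continuous_on UNIV f \<and>
     (\<exists>g h. (\<forall>z. (f has_derivative (\<lambda>v. of_real (Re v) * g z + of_real (Im v) * h z)) (at z))
        \<and> Ck_plane k g \<and> Ck_plane k h)"

definition test_function :: "(complex \<Rightarrow> complex) \<Rightarrow> bool" where
  "test_function b \<longleftrightarrow> (\<forall>k. Ck_plane k b) \<and> compact (closure {\<xi>. b \<xi> \<noteq> 0})"

text \<open>A distribution on momentum space is represented by its pairing with test functions.\<close>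

definition weak_star_limit :: "(real \<Rightarrow> (complex \<Rightarrow> complex) \<Rightarrow> complex) \<Rightarrow> ((complex \<Rightarrow> complex) \<Rightarrow> complex) \<Rightarrow> bool" where
  "weak_star_limit \<mu> \<nu> \<longleftrightarrow> (\<forall>b. test_function b \<longrightarrow> ((\<lambda>l. \<mu> l b) \<longlongrightarrow> \<nu> b) at_top)"

definition dirac :: "complex \<Rightarrow> (complex \<Rightarrow> complex) \<Rightarrow> complex" where
  "dirac \<xi>\<^sub>0 b = b \<xi>\<^sub>0"

end

theory Submission
  imports Defs "HOL-Probability.Probability"
begin

text \<open>Where the surface carries Euclidean coordinates, a plane wave with wave vector \<open>k\<close>, \<open>k \<bullet> k = \<lambda>\<close>, times an amplitude
  is an eigenfunction up to derivatives of the amplitude: if the amplitude varies on the scale \<open>T\<close> in the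
  direction of \<open>k\<close> and on the scale \<open>w\<close> across it, the defect has the order \<open>\<surd>\<lambda> / T + 1 / w\<^sup>2\<close>. Directions make sense
  globally, so the task is to find regions on which \<open>k\<close> can be taken close to \<open>\<surd>\<lambda> \<xi>\<^sub>0\<close>.

  The vertices limit \<open>T\<close> and \<open>w\<close>. Cut a fixed disc into \<open>N\<close> parallel strips and let them flow in the direction
  \<open>\<xi>\<^sub>0\<close>. A strip that comes close to a vertex occupies area there, and strips that do so at about the same time are
  disjoint; hence only \<open>O(l)\<close> of them are lost up to the length \<open>l\<close>, and for every \<open>l\<close> there is a strip of length \<open>l\<close> and
  of width of order \<open>1 / l\<close> that avoids the vertices (\<open>long_tube\<close>). With \<open>T\<close> of order \<open>\<lambda>\<^bsup>1/8\<^esup>\<close> and \<open>w\<close> of order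
  \<open>\<lambda>\<^bsup>-1/8\<^esup>\<close> the defect is \<open>\<lambda>\<^bsup>3/8\<^esup>\<close>, if the strip does not overlap itself (\<open>embedded_strip_quasimode\<close>).

  If it does overlap itself, it winds around a cylinder of closed geodesics with holonomy \<open>h\<close>, where \<open>h / |h|\<close>
  is within \<open>O(\<lambda>\<^bsup>-1/8\<^esup>)\<close> of \<open>\<xi>\<^sub>0\<close>. Then the amplitude only has to vary across the cylinder, but the wave must be periodic,
  \<open>k \<bullet> h \<in> 2\<pi>\<int>\<close>. This and \<open>k \<bullet> k = \<lambda>\<close> can be achieved with a component of \<open>k\<close> of order \<open>\<lambda>\<^bsup>1/4\<^esup>\<close> across the cylinder,
  which contributes \<open>\<lambda>\<^bsup>1/4\<^esup> / w\<close>, again \<open>\<lambda>\<^bsup>3/8\<^esup>\<close>, to the defect (\<open>cylinder_quasimode\<close>).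

  The packets for integral \<open>\<lambda>\<close> are joined by linear interpolation. Changing \<open>\<lambda>\<close> by at most one changes the defect by a
  bounded amount only, and if the signs are chosen successively such that neighbours have a nonnegative real inner product,
  the norm stays bounded below (\<open>interpolation_lower_bound\<close>).

  The kernel of the quantization of a test function \<open>b(\<xi>)\<close> is its Fourier transform on the scale \<open>\<lambda>\<^bsup>-1/2\<^esup>\<close>. The gradient of
  a packet is \<open>\<i>k\<close> times the packet up to \<open>O(\<lambda>\<^bsup>1/4\<^esup>)\<close>, and its support keeps a distance of order \<open>\<lambda>\<^bsup>-1/8\<^esup>\<close> from the vertices;
  so on this scale it is a plane wave, on which the operator acts by multiplication with \<open>b(\<lambda>\<^bsup>-1/2\<^esup> k)\<close> by Fourier
  inversion (\<open>Op_weyl_plane_wave\<close>). As \<open>\<lambda>\<^bsup>-1/2\<^esup> k\<close> tends to \<open>\<xi>\<^sub>0\<close>, this gives the limit of the momentum distributions. The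
  estimate is linear in the packet and thus survives the interpolation.

  All of this rests on the rigidity of coordinates: they are determined on connected sets by their value at one point
  (\<open>local_coords_unique\<close>), they preserve area (\<open>area_image\<close>), and a regular point at distance \<open>d\<close> from the vertices has
  coordinates on a disc of radius proportional to \<open>d\<close> (\<open>chart_linear\<close>).\<close>

section \<open>Polygons\<close>

primrec chain :: "(nat \<Rightarrow> complex) \<Rightarrow> nat \<Rightarrow> real \<Rightarrow> complex" where
  "chain v 0 = linepath (v 0) (v 1)"
| "chain v (Suc n) = chain v n +++ linepath (v (n + 1)) (v (n + 2))"

lemma chain_ends [simp]: "pathstart (chain v n) = v 0" "pathfinish (chain v n) = v (Suc n)"
  by (induction n) auto

lemma path_image_chain: "path_image (chain v n) = (\<Union>k\<le>n. closed_segment (v k) (v (Suc k)))"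
proof (induction n)
  case (Suc n)
  have "path_image (chain v (Suc n)) = path_image (chain v n) \<union> closed_segment (v (Suc n)) (v (Suc (Suc n)))"
    by (simp add: path_image_join)
  then show ?case using Suc by (auto simp: atMost_Suc)
qed simp

lemma arc_chain:
  assumes "\<And>k l. k < l \<Longrightarrow> l \<le> n \<Longrightarrow>
      closed_segment (v k) (v (Suc k)) \<inter> closed_segment (v l) (v (Suc l)) \<subseteq> {v l}"
    and "\<And>k. k \<le> n \<Longrightarrow> v k \<noteq> v (Suc k)"
  shows "arc (chain v n)"
  using assms
proof (induction n)
  case (Suc n)
  have "arc (chain v n)" using Suc by (simp add: le_SucI)
  moreover have "arc (linepath (v (n + 1)) (v (n + 2)))" using Suc.prems(2)[of "Suc n"] by (intro arc_linepath) simp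
  moreover have "path_image (chain v n) \<inter> path_image (linepath (v (n + 1)) (v (n + 2))) \<subseteq> {v (n+1)}"
  proof
    fix x assume x: "x \<in> path_image (chain v n) \<inter> path_image (linepath (v (n + 1)) (v (n + 2)))"
    then obtain k where "k \<le> n" "x \<in> closed_segment (v k) (v (Suc k))" by (auto simp: path_image_chain)
    then show "x \<in> {v (n+1)}" using Suc.prems(1)[of k "Suc n"] x by auto
  qed
  ultimately show ?case by (simp add: arc_join)
qed (use assms in \<open>auto intro: arc_linepath\<close>)

lemma closed_polygon_boundary: "closed (polygon_boundary vs)" "bounded (polygon_boundary vs)" "compact (polygon_boundary vs)"
proof -
  show "compact (polygon_boundary vs)" unfolding polygon_boundary_def by (auto intro!: compact_UN)
  then show "closed (polygon_boundary vs)" "bounded (polygon_boundary vs)"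
    by (auto simp: compact_imp_closed compact_imp_bounded)
qed

lemma next_vertex_eq: "k < length vs \<Longrightarrow> next_vertex vs k = vs ! (if Suc k = length vs then 0 else Suc k)"
  by (auto simp: next_vertex_def)

lemma next_vertex_neq:
  assumes "simple_polygon vs" "k < length vs"
  shows "next_vertex vs k \<noteq> vs ! k"
proof -
  have "(if Suc k = length vs then 0 else Suc k) \<noteq> k" "(if Suc k = length vs then 0 else Suc k) < length vs"
    using assms by (auto simp: simple_polygon_def)
  then show ?thesis using assms unfolding simple_polygon_def next_vertex_eq[OF assms(2)] by (simp add: nth_eq_iff_index_eq)
qed

lemma edges_meet_at_vertices:
  assumes "simple_polygon vs" "k < length vs" "l < length vs" "k \<noteq> l"
  shows "closed_segment (vs ! k) (next_vertex vs k) \<inter> closed_segment (vs ! l) (next_vertex vs l)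
     \<subseteq> {vs ! k, next_vertex vs k} \<inter> {vs ! l, next_vertex vs l}"
proof
  fix x assume x: "x \<in> closed_segment (vs ! k) (next_vertex vs k) \<inter> closed_segment (vs ! l) (next_vertex vs l)"
  have "x \<notin> open_segment (vs ! k) (next_vertex vs k)" "x \<notin> open_segment (vs ! l) (next_vertex vs l)"
    using assms x unfolding simple_polygon_def by blast+
  then show "x \<in> {vs ! k, next_vertex vs k} \<inter> {vs ! l, next_vertex vs l}"
    using x by (auto simp: open_segment_def)
qed

text \<open>The boundary of a simple polygon is a Jordan curve, so both complementary components accumulate
  at every boundary point. This is what separates the two sides of an edge.\<close>

lemma polygon_frontier_outside:
  assumes "simple_polygon vs"
  shows "frontier (outside (polygon_boundary vs)) = polygon_boundary vs"
proof -
  define n where "n = length vs"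
  define v where "v k = vs ! (k mod n)" for k
  have n: "3 \<le> n" and d: "distinct vs" using assms by (auto simp: simple_polygon_def n_def)
  have v: "vs ! k = v k" "next_vertex vs k = v (Suc k)" if "k < n" for k
    using that by (auto simp: v_def next_vertex_def n_def)
  have inj: "v k = v l \<longleftrightarrow> k mod n = l mod n" for k l
    unfolding v_def using n d by (subst nth_eq_iff_index_eq) (auto simp: n_def intro!: mod_less_divisor)
  have inters: "closed_segment (v k) (v (Suc k)) \<inter> closed_segment (v l) (v (Suc l)) \<subseteq> {v k, v (Suc k)} \<inter> {v l, v (Suc l)}"
    if "k < n" "l < n" "k \<noteq> l" for k l
    using edges_meet_at_vertices[OF assms, of k l] that by (simp add: v n_def[symmetric])
  define c where "c = chain v (n - 2) +++ linepath (v (n - 1)) (v n)"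
  have Suc2: "Suc (n - 2) = n - 1" using n by simp
  have neq: "v k \<noteq> v (Suc k)" if "k < n" for k
    using that n by (auto simp: inj mod_Suc)
  have 1: "arc (chain v (n - 2))"
  proof (rule arc_chain)
    fix k l assume kl: "k < l" "l \<le> n - 2"
    have "v k \<noteq> v (Suc l)" "v k \<noteq> v l" using kl n by (auto simp: inj)
    moreover have "v (Suc k) = v (Suc l) \<Longrightarrow> False" using kl n by (auto simp: inj)
    ultimately show "closed_segment (v k) (v (Suc k)) \<inter> closed_segment (v l) (v (Suc l)) \<subseteq> {v l}"
      using inters[of k l] kl n by fastforce
  qed (use n neq in auto)
  have 2: "arc (linepath (v (n - 1)) (v n))" using neq[of "n - 1"] n by (intro arc_linepath) auto
  have v0: "v n = v 0" by (simp add: v_def)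
  have sub: "path_image (chain v (n - 2)) \<inter> closed_segment (v (n - 1)) (v n) \<subseteq> {v 0, v (n - 1)}"
  proof -
    have "closed_segment (v k) (v (Suc k)) \<inter> closed_segment (v (n - 1)) (v n) \<subseteq> {v 0, v (n - 1)}" if "k \<le> n - 2" for k
    proof -
      have "k < n" "k \<noteq> n - 1" "n - 1 < n" "Suc (n - 1) = n" using that n by auto
      then show ?thesis using inters[of k "n - 1"] v0 by auto
    qed
    then show ?thesis by (fastforce simp: path_image_chain)
  qed
  have c: "simple_path c" unfolding c_def using 1 2 sub v0 by (intro simple_path_join_loop) (auto simp: Suc2)
  have "path_image c = (\<Union>k\<le>n - 2. closed_segment (v k) (v (Suc k))) \<union> closed_segment (v (n - 1)) (v n)"
    by (simp add: c_def path_image_join path_image_chain Suc2)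
  also have "\<dots> = (\<Union>k<n. closed_segment (v k) (v (Suc k)))"
  proof -
    have "{..<n} = insert (n - 1) {..n - 2}" using n by auto
    then show ?thesis using n by auto
  qed
  also have "\<dots> = polygon_boundary vs"
    unfolding polygon_boundary_def n_def[symmetric] using v by auto
  finally have "path_image c = polygon_boundary vs" .
  then show ?thesis using Jordan_inside_outside[OF c] v0 by (simp add: c_def)
qed

text \<open>Twice the signed area of the triangle \<open>a b z\<close>; it is positive to the left of the line from \<open>a\<close> to \<open>b\<close>.\<close>

definition left_of :: "complex \<Rightarrow> complex \<Rightarrow> complex \<Rightarrow> real" where
  "left_of a b z = Im ((z - a) * cnj (b - a))"

lemma left_of_affine: "left_of a b (p + of_real t * (\<i> * (b - a))) = left_of a b p + t * (cmod (b - a))\<^sup>2"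
proof -
  have "(p + of_real t * (\<i> * (b - a)) - a) * cnj (b - a) = (p - a) * cnj (b - a) + \<i> * of_real t * ((b - a) * cnj (b - a))"
    by (simp only: algebra_simps)
  then show ?thesis unfolding left_of_def complex_norm_square[symmetric] by (simp del: complex_cnj_diff)
qed

lemma left_of_zero_line:
  assumes "left_of a b z = 0" "a \<noteq> b"
  obtains t where "z = a + of_real t * (b - a)"
proof
  have "(z - a) * cnj (b - a) = of_real (Re ((z - a) * cnj (b - a)))"
    using assms(1) by (simp add: complex_eq_iff left_of_def)
  then have "(z - a) * (cnj (b - a) * (b - a)) = of_real (Re ((z - a) * cnj (b - a))) * (b - a)"
    by (metis mult.assoc)
  moreover have "cnj (b - a) * (b - a) = of_real ((cmod (b - a))\<^sup>2)"
    by (metis complex_norm_square mult.commute)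
  moreover have nz: "complex_of_real ((cmod (b - a))\<^sup>2) \<noteq> 0" using assms(2) by simp
  ultimately have "z - a = of_real (Re ((z - a) * cnj (b - a))) * (b - a) / of_real ((cmod (b - a))\<^sup>2)"
    by (metis nonzero_eq_divide_eq)
  then show "z = a + of_real (Re ((z - a) * cnj (b - a)) / (cmod (b - a))\<^sup>2) * (b - a)"
    by (simp add: diff_eq_eq add.commute)
qed

lemma left_of_segment:
  assumes "z \<in> closed_segment a b" shows "left_of a b z = 0"
proof -
  obtain u where "z = (1 - u) *\<^sub>R a + u *\<^sub>R b" using assms by (auto simp: closed_segment_def)
  then have "z - a = of_real u * (b - a)" by (simp add: algebra_simps scaleR_conv_of_real)
  then have "(z - a) * cnj (b - a) = of_real (u * (cmod (b - a))\<^sup>2)"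
    by (metis complex_norm_square mult.assoc of_real_mult)
  then show ?thesis unfolding left_of_def by (metis Im_complex_of_real)
qed

lemma convex_left_of: "convex {z. 0 < left_of a b z}" "convex {z. left_of a b z < 0}"
proof -
  have eq: "left_of a b = (\<lambda>z. (\<i> * (b - a)) \<bullet> z - (\<i> * (b - a)) \<bullet> a)"
    by (auto simp: left_of_def inner_complex_def algebra_simps)
  have "{z. 0 < left_of a b z} = {z. (\<i> * (b - a)) \<bullet> z > (\<i> * (b - a)) \<bullet> a}"
    "{z. left_of a b z < 0} = {z. (\<i> * (b - a)) \<bullet> z < (\<i> * (b - a)) \<bullet> a}"
    unfolding eq by auto
  then show "convex {z. 0 < left_of a b z}" "convex {z. left_of a b z < 0}"
    by (simp_all only: convex_halfspace_lt convex_halfspace_gt)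
qed

lemma left_of_line_in_segment:
  assumes "left_of a b z = 0" "a \<noteq> b" "x \<in> closed_segment a b" "cmod (z - x) < cmod (x - a)" "cmod (z - x) < cmod (x - b)"
  shows "z \<in> open_segment a b"
proof -
  obtain t where t: "z = a + of_real t * (b - a)" using left_of_zero_line assms by blast
  obtain u where u: "0 \<le> u" "u \<le> 1" "x = (1 - u) *\<^sub>R a + u *\<^sub>R b" using assms by (auto simp: closed_segment_def)
  have x: "x - a = of_real u * (b - a)" "x - b = of_real (u - 1) * (b - a)" "z - x = of_real (t - u) * (b - a)"
    by (simp_all add: u t algebra_simps scaleR_conv_of_real)
  have "\<bar>t - u\<bar> < \<bar>u\<bar>" "\<bar>t - u\<bar> < \<bar>u - 1\<bar>" using assms(4,5) \<open>a \<noteq> b\<close> unfolding x norm_mult norm_of_real by auto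
  then have "0 < t" "t < 1" using u by auto
  then show ?thesis using \<open>a \<noteq> b\<close> t by (auto simp: in_segment algebra_simps scaleR_conv_of_real intro!: exI[of _ t])
qed

text \<open>The point \<open>x\<close> of an edge has distance at least \<open>r\<close> from the other edges and the end points. The two
  half discs do not meet the boundary; the left one is inside, hence the right one is not,
  as otherwise \<open>x\<close> would not be an accumulation point of the outside.\<close>

lemma polygon_sides_of_edge:
  assumes sp: "simple_polygon vs" and left: "lies_to_the_left vs" and k: "k < length vs"
    and x: "x \<in> closed_segment (vs ! k) (next_vertex vs k)"
    and r: "0 < r" "r \<le> cmod (x - vs ! k)" "r \<le> cmod (x - next_vertex vs k)"
    and other: "\<And>l. l < length vs \<Longrightarrow> l \<noteq> k \<Longrightarrow> ball x r \<inter> closed_segment (vs ! l) (next_vertex vs l) = {}"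
    and z: "z \<in> ball x r"
  shows "z \<in> inside (polygon_boundary vs) \<longleftrightarrow> 0 < left_of (vs ! k) (next_vertex vs k) z"
    and "z \<in> polygon_boundary vs \<longleftrightarrow> left_of (vs ! k) (next_vertex vs k) z = 0"
proof -
  let ?a = "vs ! k" and ?b = "next_vertex vs k" and ?B = "polygon_boundary vs"
  have ab: "?a \<noteq> ?b" using next_vertex_neq[OF sp k] by auto
  have bd: "w \<in> ?B \<longleftrightarrow> left_of ?a ?b w = 0" if "w \<in> ball x r" for w
  proof
    assume "w \<in> ?B"
    then obtain l where "l < length vs" "w \<in> closed_segment (vs ! l) (next_vertex vs l)"
      by (auto simp: polygon_boundary_def)
    then have "w \<in> closed_segment ?a ?b" using other[of l] that by (cases "l = k") auto
    then show "left_of ?a ?b w = 0" by (rule left_of_segment)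
  next
    assume 0: "left_of ?a ?b w = 0"
    have "cmod (w - x) < r" using that by (simp add: dist_norm norm_minus_commute)
    then have "w \<in> open_segment ?a ?b" using left_of_line_in_segment[OF 0 ab x] r by linarith
    then show "w \<in> ?B" using k unfolding polygon_boundary_def by (auto simp: open_segment_def)
  qed
  show "z \<in> ?B \<longleftrightarrow> left_of ?a ?b z = 0" by (rule bd[OF z])
  let ?L = "ball x r \<inter> {z. 0 < left_of ?a ?b z}" and ?R = "ball x r \<inter> {z. left_of ?a ?b z < 0}"
  have conn: "connected ?L" "connected ?R"
    by (auto intro!: convex_connected convex_Int convex_left_of)
  have disj: "?L \<inter> ?B = {}" "?R \<inter> ?B = {}" using bd by fastforce+
  have cl: "X \<subseteq> inside ?B" if "connected X" "X \<inter> ?B = {}" "X \<inter> inside ?B \<noteq> {}" for X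
  proof (rule ccontr)
    assume "\<not> X \<subseteq> inside ?B"
    then have "X \<inter> outside ?B \<noteq> {}" using that(2) inside_Un_outside[of ?B] by blast
    moreover have "open (inside ?B)" "open (outside ?B)"
      by (simp_all add: open_inside open_outside closed_polygon_boundary)
    moreover have "X \<subseteq> inside ?B \<union> outside ?B" using that(2) inside_Un_outside[of ?B] by blast
    ultimately show False using connectedD[OF that(1)] that(3) inside_Int_outside[of ?B] by blast
  qed
  have xo: "x \<in> open_segment ?a ?b" using x r by (auto simp: open_segment_def)
  have L: "?L \<subseteq> inside ?B"
  proof (rule cl[OF conn(1) disj(1)])
    have "\<forall>\<^sub>F t in at_right 0. x + of_real t * (\<i> * (?b - ?a)) \<in> inside ?B"
      using left k xo unfolding lies_to_the_left_def by blast
    moreover have "\<forall>\<^sub>F t in at_right 0. x + of_real t * (\<i> * (?b - ?a)) \<in> ball x r"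
    proof -
      have "((\<lambda>t. x + of_real t * (\<i> * (?b - ?a))) \<longlongrightarrow> x + of_real 0 * (\<i> * (?b - ?a))) (at_right 0)"
        by (intro tendsto_intros)
      then show ?thesis using r(1) by (auto dest!: tendstoD simp: dist_commute)
    qed
    moreover have "\<forall>\<^sub>F t in at_right (0::real). 0 < t" by (rule eventually_at_right_less)
    ultimately have "\<forall>\<^sub>F t in at_right 0. x + of_real t * (\<i> * (?b - ?a)) \<in> ?L \<inter> inside ?B"
    proof eventually_elim
      case (elim t)
      then show ?case using ab left_of_segment[OF x] left_of_affine[of ?a ?b x t] by simp
    qed
    then show "?L \<inter> inside ?B \<noteq> {}" using eventually_happens by (metis empty_iff trivial_limit_at_right_real)
  qed
  have R: "?R \<inter> inside ?B = {}"
  proof (rule ccontr)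
    assume "?R \<inter> inside ?B \<noteq> {}"
    then have "?R \<subseteq> inside ?B" by (rule cl[OF conn(2) disj(2)])
    then have "ball x r \<inter> outside ?B = {}"
      using L bd inside_Int_outside[of ?B] inside_Un_outside[of ?B] by (smt (verit, ccfv_SIG) Compl_iff Int_iff UnI2 disjoint_iff mem_Collect_eq subset_eq)
    moreover have "x \<in> closure (outside ?B)"
      using polygon_frontier_outside[OF sp] bd[of x] r(1) left_of_segment[OF x] by (auto simp: frontier_def)
    ultimately show False using r(1) by (metis closure_approachable disjoint_iff dist_commute mem_ball)
  qed
  show "z \<in> inside ?B \<longleftrightarrow> 0 < left_of ?a ?b z"
    using L R z bd[OF z] inside_no_overlap[of ?B] by (smt (verit, ccfv_SIG) IntI disjoint_iff mem_Collect_eq subset_eq)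
qed

text \<open>Distinct segments starting at a common point diverge linearly; disjoint ones are a positive distance apart.\<close>

lemma segments_diverge:
  fixes a b v :: complex
  assumes "closed_segment v a \<inter> closed_segment v b = {v}" "a \<noteq> v" "b \<noteq> v"
  shows "\<exists>c>0. \<forall>x\<in>closed_segment v a. \<forall>y\<in>closed_segment v b. c * cmod (x - v) \<le> cmod (x - y)"
proof -
  define R where "R = (\<lambda>t. of_real t * (b - v)) ` {0::real..}"
  have R: "closed R"
  proof -
    have "R = (\<lambda>t. t *\<^sub>R (b - v)) ` {0..}" by (simp add: R_def scaleR_conv_of_real)
    moreover have "linear (\<lambda>t. t *\<^sub>R (b - v))" by (rule bounded_linear.linear[OF bounded_linear_scaleR_left])
    moreover have "inj (\<lambda>t. t *\<^sub>R (b - v))" using assms(3) by (auto simp: inj_on_def)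
    ultimately show ?thesis using closed_injective_linear_image[of "{0::real..}" "\<lambda>t. t *\<^sub>R (b - v)"] by simp
  qed
  have "a - v \<notin> R"
  proof
    assume "a - v \<in> R"
    then obtain t where t: "0 \<le> t" "a - v = of_real t * (b - v)" by (auto simp: R_def)
    have tp: "t > 0" using t assms(2) by (cases "t = 0") auto
    define s where "s = min 1 (1/t)"
    have s: "0 < s" "s \<le> 1" "s * t \<le> 1" using tp by (auto simp: s_def min_def field_simps)
    define p where "p = v + of_real s * (a - v)"
    have "p \<in> closed_segment v a" using s by (auto simp: p_def closed_segment_def scaleR_conv_of_real algebra_simps intro!: exI[of _ s])
    moreover have "p = v + of_real (s * t) * (b - v)" by (simp add: p_def t(2))
    then have "p \<in> closed_segment v b" using s tp by (auto simp: closed_segment_def scaleR_conv_of_real algebra_simps intro!: exI[of _ "s * t"])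
    ultimately have "p = v" using assms(1) by blast
    then show False using s assms(2) by (simp add: p_def)
  qed
  then have pos: "0 < setdist {a - v} R"
  proof -
    have "R \<noteq> {}" by (auto simp: R_def)
    then have "setdist {a - v} R \<noteq> 0" using R \<open>a - v \<notin> R\<close> by (simp add: setdist_eq_0_sing_1)
    then show ?thesis using setdist_pos_le[of "{a - v}" R] by linarith
  qed
  define c where "c = setdist {a - v} R / cmod (a - v)"
  have "c * cmod (x - v) \<le> cmod (x - y)" if x: "x \<in> closed_segment v a" and y: "y \<in> closed_segment v b" for x y
  proof -
    obtain s where s: "0 \<le> s" "x = (1 - s) *\<^sub>R v + s *\<^sub>R a" using x by (auto simp: closed_segment_def)
    obtain t where t: "0 \<le> t" "y = (1 - t) *\<^sub>R v + t *\<^sub>R b" using y by (auto simp: closed_segment_def)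
    have xv: "x - v = of_real s * (a - v)" "y - v = of_real t * (b - v)"
      using s t by (simp_all add: scaleR_conv_of_real algebra_simps)
    show ?thesis
    proof (cases "s = 0")
      case False
      then have sp: "s > 0" using s by simp
      have "of_real (t / s) * (b - v) \<in> R" using t sp by (auto simp: R_def intro!: image_eqI[of _ _ "t/s"])
      then have "setdist {a - v} R \<le> dist (a - v) (of_real (t / s) * (b - v))"
        by (intro setdist_le_dist) auto
      also have "\<dots> = cmod (x - y) / s"
      proof -
        have "x - y = of_real s * ((a - v) - of_real (t / s) * (b - v))"
        proof -
          have "x - y = (x - v) - (y - v)" by simp
          also have "\<dots> = of_real s * (a - v) - of_real s * (of_real (t / s) * (b - v))"
            unfolding xv using sp by simp
          finally show ?thesis by (simp only: right_diff_distrib)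
        qed
        then have "cmod (x - y) = s * cmod ((a - v) - of_real (t / s) * (b - v))" 
          using sp by (metis norm_mult norm_of_real abs_of_pos)
        then show ?thesis using sp by (simp add: dist_norm)
      qed
      finally have "setdist {a - v} R * s \<le> cmod (x - y)" using sp by (simp add: field_simps)
      then show ?thesis using xv sp assms(2) by (simp add: c_def norm_mult)
    qed (use xv in simp)
  qed
  moreover have "c > 0" using pos assms(2) by (simp add: c_def)
  ultimately show ?thesis by blast
qed

section \<open>The quotient by the gluing\<close>

lemma finite_uniform_constant:
  fixes R :: "'a \<Rightarrow> real \<Rightarrow> bool"
  assumes "finite A" "\<And>a. a \<in> A \<Longrightarrow> \<exists>c>0. R a c" "\<And>a c d. R a c \<Longrightarrow> 0 < d \<Longrightarrow> d \<le> c \<Longrightarrow> R a d"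
  shows "\<exists>c>0. \<forall>a\<in>A. R a c"
  using assms(1,2)
proof (induction A rule: finite_induct)
  case empty then show ?case by (auto intro: exI[of _ 1])
next
  case (insert x A)
  obtain c d where "c > 0" "\<forall>a\<in>A. R a c" "d > 0" "R x d" using insert by (metis insertCI)
  then show ?case using assms(3)[of _ c "min c d"] assms(3)[of x d "min c d"] by (intro exI[of _ "min c d"]) auto
qed

locale flat_surface =
  fixes S :: gluing
  assumes surf: "translation_surface S"
begin

abbreviation num where "num \<equiv> length (polys S)"
abbreviation corners where "corners j \<equiv> set (polys S ! j)"
abbreviation bdry where "bdry j \<equiv> polygon_boundary (polys S ! j)"
abbreviation interior_part where "interior_part j \<equiv> inside (polygon_boundary (polys S ! j))"
abbreviation region where "region j \<equiv> polygon_region (polys S ! j)"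
abbreviation side where "side e \<equiv> closed_segment (edge_start S e) (edge_end S e)"

lemma simple: "j < num \<Longrightarrow> simple_polygon (polys S ! j)"
  and left: "j < num \<Longrightarrow> lies_to_the_left (polys S ! j)"
  and num_pos: "0 < num"
  using surf by (auto simp: translation_surface_def)

lemma pairing: "e \<in> edges S \<Longrightarrow> pairing S e \<in> edges S" "e \<in> edges S \<Longrightarrow> pairing S (pairing S e) = e"
  "e \<in> edges S \<Longrightarrow> edge_end S (pairing S e) - edge_start S (pairing S e) = - (edge_end S e - edge_start S e)"
  using surf by (auto simp: translation_surface_def)

lemma finite_edges: "finite (edges S)"
proof -
  have "edges S = (SIGMA j:{..<num}. {..<length (polys S ! j)})" by (auto simp: edges_def)
  then show ?thesis by simp
qed

lemma shift_ends: 
  assumes "e \<in> edges S"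
  shows "edge_start S e + edge_shift S e = edge_end S (pairing S e)"
    "edge_end S e + edge_shift S e = edge_start S (pairing S e)"
    "edge_shift S (pairing S e) = - edge_shift S e"
  using pairing[OF assms] by (auto simp: edge_shift_def algebra_simps)

lemma side_shift: "e \<in> edges S \<Longrightarrow> z \<in> side e \<Longrightarrow> z + edge_shift S e \<in> side (pairing S e)"
  using shift_ends[of e] closed_segment_translation_eq[of "edge_shift S e" z "edge_start S e" "edge_end S e"]
  by (simp add: add.commute closed_segment_commute)

lemma edges_iff: "(j, k) \<in> edges S \<longleftrightarrow> j < num \<and> k < length (polys S ! j)"
  by (simp add: edges_def)

lemma edge_start_pair: "edge_start S (j, k) = polys S ! j ! k" and edge_end_pair: "edge_end S (j, k) = next_vertex (polys S ! j) k"
  by (simp_all add: edge_start_def edge_end_def)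

lemma edge_ends_corners:
  assumes "e \<in> edges S" shows "edge_start S e \<in> corners (fst e)" "edge_end S e \<in> corners (fst e)"
proof -
  obtain j k where e: "e = (j, k)" "k < length (polys S ! j)" using assms by (cases e) (auto simp: edges_iff)
  moreover have "Suc k mod length (polys S ! j) < length (polys S ! j)" using e(2) by (intro mod_less_divisor) auto
  ultimately show "edge_start S e \<in> corners (fst e)" "edge_end S e \<in> corners (fst e)"
    by (auto simp: edge_start_pair edge_end_pair next_vertex_def)
qed

lemma edge_start_neq_end: "e \<in> edges S \<Longrightarrow> edge_start S e \<noteq> edge_end S e"
proof -
  assume "e \<in> edges S"
  then obtain j k where "e = (j, k)" "j < num" "k < length (polys S ! j)" by (cases e) (auto simp: edges_iff)
  then show ?thesis using next_vertex_neq[OF simple, of j k] by (metis edge_start_pair edge_end_pair)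
qed

lemma side_bdry: "e \<in> edges S \<Longrightarrow> side e \<subseteq> bdry (fst e)"
  by (cases e) (auto simp: edges_iff edge_start_pair edge_end_pair polygon_boundary_def)

lemma bdry_side: "j < num \<Longrightarrow> z \<in> bdry j \<Longrightarrow> \<exists>e\<in>edges S. fst e = j \<and> z \<in> side e"
proof -
  assume j: "j < num" "z \<in> bdry j"
  then obtain k where k: "k < length (polys S ! j)" "z \<in> closed_segment (polys S ! j ! k) (next_vertex (polys S ! j) k)"
    by (auto simp: polygon_boundary_def)
  then show ?thesis using j by (intro bexI[of _ "(j, k)"]) (simp_all add: edges_iff edge_start_pair edge_end_pair)
qed

lemma corner_on_side:
  assumes "e \<in> edges S" "z \<in> side e" "z \<in> corners (fst e)"
  shows "z = edge_start S e \<or> z = edge_end S e"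
proof -
  obtain j k where e: "e = (j, k)" by (cases e)
  obtain l where l: "l < length (polys S ! j)" "z = polys S ! j ! l" using assms(3) e by (auto simp: in_set_conv_nth)
  show ?thesis
  proof (cases "l = k")
    case False
    have "z \<in> closed_segment (polys S ! j ! l) (next_vertex (polys S ! j) l)" using l by simp
    then show ?thesis using edges_meet_at_vertices[OF simple, of j k l] assms False l e
      by (auto simp: edges_iff edge_start_pair edge_end_pair)
  qed (use l e in \<open>simp add: edge_start_pair\<close>)
qed

lemma side_unique:
  assumes "e \<in> edges S" "f \<in> edges S" "fst e = fst f" "z \<in> side e" "z \<in> side f" "z \<notin> corners (fst e)"
  shows "e = f"
proof (rule ccontr)
  assume "e \<noteq> f"
  obtain j k l where e: "e = (j, k)" "f = (j, l)" using assms(3) by (cases e; cases f) auto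
  then have "z \<in> {edge_start S e, edge_end S e}"
    using edges_meet_at_vertices[OF simple, of j k l] assms \<open>e \<noteq> f\<close>
    by (auto simp: edges_iff edge_start_pair edge_end_pair)
  then show False using edge_ends_corners[OF assms(1)] assms(6) by auto
qed

lemma shift_corner:
  assumes "e \<in> edges S" "z \<in> side e" "z \<notin> corners (fst e)"
  shows "z + edge_shift S e \<notin> corners (fst (pairing S e))"
proof
  assume "z + edge_shift S e \<in> corners (fst (pairing S e))"
  then have "z + edge_shift S e \<in> {edge_start S (pairing S e), edge_end S (pairing S e)}"
    using corner_on_side[OF pairing(1)[OF assms(1)] side_shift[OF assms(1,2)]] by auto
  then have "z = edge_start S e \<or> z = edge_end S e" using shift_ends[OF assms(1)] by (metis add_right_cancel insertE singletonD)
  then show False using edge_ends_corners[OF assms(1)] assms(3) by auto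
qed

lemma corners_bdry: "j < num \<Longrightarrow> corners j \<subseteq> bdry j"
  by (fastforce simp: in_set_conv_nth polygon_boundary_def)

lemma compact_region: "j < num \<Longrightarrow> compact (region j)"
proof -
  have "open (outside (bdry j))" by (simp add: open_outside closed_polygon_boundary)
  moreover have "region j = - outside (bdry j)"
    unfolding polygon_region_def outside_inside by simp
  moreover have "bounded (interior_part j)" by (simp add: bounded_inside closed_polygon_boundary)
  ultimately show ?thesis using closed_polygon_boundary(2)[of "polys S ! j"]
    unfolding compact_eq_bounded_closed by (metis polygon_region_def bounded_Un closed_open double_complement)
qed

lemma open_interior_part: "open (interior_part j)"
  by (simp add: open_inside closed_polygon_boundary)

lemma interior_part_nonempty: "j < num \<Longrightarrow> interior_part j \<noteq> {}"
proof -
  assume j: "j < num"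
  then have "3 \<le> length (polys S ! j)" using simple by (auto simp: simple_polygon_def)
  then have k: "0 < length (polys S ! j)" by linarith
  have "next_vertex (polys S ! j) 0 \<noteq> polys S ! j ! 0" using next_vertex_neq simple j k by blast
  then obtain p where "p \<in> open_segment (polys S ! j ! 0) (next_vertex (polys S ! j) 0)"
    using open_segment_eq_empty by (metis all_not_in_conv)
  then have "\<forall>\<^sub>F t in at_right 0. p + of_real t * (\<i> * (next_vertex (polys S ! j) 0 - polys S ! j ! 0)) \<in> interior_part j"
    using left j k unfolding lies_to_the_left_def by blast
  then show ?thesis using eventually_happens by (metis empty_iff trivial_limit_at_right_real)
qed

lemma glue_iff: "((j, z), q) \<in> glue S \<longleftrightarrow> (\<exists>e\<in>edges S. fst e = j \<and> z \<in> side e \<and> q = (fst (pairing S e), z + edge_shift S e))"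
  unfolding glue_def by blast

lemma glueI: "e \<in> edges S \<Longrightarrow> z \<in> side e \<Longrightarrow> ((fst e, z), (fst (pairing S e), z + edge_shift S e)) \<in> glue S"
  unfolding glue_def by blast

lemma sym_glue: "sym (glue S)"
proof (rule symI)
  fix p q assume "(p, q) \<in> glue S"
  then obtain e z where e: "e \<in> edges S" "z \<in> side e" "p = (fst e, z)" "q = (fst (pairing S e), z + edge_shift S e)"
    by (auto simp: glue_def)
  show "(q, p) \<in> glue S"
    using glueI[OF pairing(1)[OF e(1)] side_shift[OF e(1,2)]] shift_ends[OF e(1)] pairing(2)[OF e(1)] e by simp
qed

lemma cls_eq_iff: "cls S p = cls S q \<longleftrightarrow> (p, q) \<in> (glue S)\<^sup>*"
proof -
  have "(q, p) \<in> (glue S)\<^sup>*" if "(p, q) \<in> (glue S)\<^sup>*" for p q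
    using that sym_rtrancl[OF sym_glue] by (meson symD)
  then have "cls S p = cls S q" if "(p, q) \<in> (glue S)\<^sup>*" for p q
    using that unfolding cls_def Image_singleton by (blast intro: rtrancl_trans)
  moreover have "(p, q) \<in> (glue S)\<^sup>*" if "cls S p = cls S q"
    using that unfolding cls_def by (metis Image_singleton_iff rtrancl.rtrancl_refl)
  ultimately show ?thesis by blast
qed

lemma cls_glue: "e \<in> edges S \<Longrightarrow> z \<in> side e \<Longrightarrow> cls S (fst (pairing S e), z + edge_shift S e) = cls S (fst e, z)"
  using glueI cls_eq_iff by (metis r_into_rtrancl)

lemma in_cls: "p \<in> cls S p" by (simp add: cls_def)

text \<open>A point of the boundary that is not a vertex lies on one side only, and the pairing is an involution; so the only way to
  continue from its partner is back.\<close>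

lemma glue_star_nonvertex:
  assumes "((j, z), q) \<in> (glue S)\<^sup>*" "z \<notin> corners j"
  shows "q = (j, z) \<or> ((j, z), q) \<in> glue S"
  using assms(1)
proof (induction rule: rtrancl_induct)
  case (step q r)
  show ?case
  proof (cases "q = (j, z)")
    case False
    then obtain e where e: "e \<in> edges S" "z \<in> side e" "j = fst e" "q = (fst (pairing S e), z + edge_shift S e)"
      using step.IH unfolding glue_iff by blast
    obtain f where f: "f \<in> edges S" "snd q \<in> side f" "fst q = fst f" "r = (fst (pairing S f), snd q + edge_shift S f)"
      using step.hyps(2) glue_iff[of "fst q" "snd q" r] by auto
    have "f = pairing S e"
    proof (rule side_unique[of f "pairing S e" "snd q"])
      show "snd q \<notin> corners (fst f)" using shift_corner[OF e(1,2)] assms(2) e f(3) by simp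
    qed (use f e pairing(1)[OF e(1)] side_shift[OF e(1,2)] in simp_all)
    then show ?thesis using f(4) e pairing(2) shift_ends(3) by simp
  qed (use step in auto)
qed simp

text \<open>The representatives of the regular points.\<close>

definition good where "good j z \<longleftrightarrow> j < num \<and> z \<in> region j \<and> z \<notin> corners j"

lemma good_glue:
  assumes "good j z" "((j, z), (i, w)) \<in> glue S"
  shows "good i w"
proof -
  obtain e where e: "e \<in> edges S" "z \<in> side e" "j = fst e" "i = fst (pairing S e)" "w = z + edge_shift S e"
    using assms(2) unfolding glue_iff by blast
  have "i < num" using pairing(1)[OF e(1)] e by (cases "pairing S e") (auto simp: edges_iff)
  then show ?thesis using e side_shift[OF e(1,2)] side_bdry[OF pairing(1)[OF e(1)]] shift_corner[OF e(1,2)] assms(1)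
    by (auto simp: good_def polygon_region_def)
qed

lemma good_cls_mem:
  assumes "good j z" "(i, w) \<in> cls S (j, z)"
  shows "good i w" "cls S (i, w) = cls S (j, z)" "(i, w) = (j, z) \<or> ((j, z), (i, w)) \<in> glue S"
proof -
  have "((j, z), (i, w)) \<in> (glue S)\<^sup>*" using assms(2) by (simp add: cls_def)
  then show 1: "(i, w) = (j, z) \<or> ((j, z), (i, w)) \<in> glue S" and "cls S (i, w) = cls S (j, z)"
    using glue_star_nonvertex[of j z "(i, w)"] assms(1) cls_eq_iff[of "(j, z)" "(i, w)"] by (auto simp: good_def)
  then show "good i w" using good_glue assms(1) by auto
qed

lemma surface_iff: "q \<in> surface S \<longleftrightarrow> (\<exists>j z. j < num \<and> z \<in> region j \<and> q = cls S (j, z))"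
  unfolding surface_def disjoint_union_def quotient_def cls_def by auto

lemma good_regular: assumes "good j z" shows "cls S (j, z) \<in> regular_points S"
proof -
  have "cls S (j, z) \<noteq> cls S (i, w)" if "w \<in> corners i" for i w
  proof
    assume "cls S (j, z) = cls S (i, w)"
    then have "(i, w) \<in> cls S (j, z)" using in_cls by simp
    then show False using good_cls_mem(1)[OF assms] that by (auto simp: good_def)
  qed
  then show ?thesis using assms unfolding regular_points_def good_def Diff_iff surface_iff by blast
qed

lemma regular_good:
  assumes "q \<in> regular_points S" "(j, z) \<in> q"
  shows "good j z" "q = cls S (j, z)"
proof -
  obtain i w where i: "i < num" "w \<in> region i" "q = cls S (i, w)"
    using assms(1) unfolding regular_points_def Diff_iff surface_iff by blast
  then have "w \<notin> corners i" using assms(1) unfolding regular_points_def by blast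
  then have "good i w" using i by (simp add: good_def)
  then show "good j z" "q = cls S (j, z)" using good_cls_mem[of i w j z] assms(2) i by simp_all
qed

lemma regular_rep: "q \<in> regular_points S \<Longrightarrow> \<exists>j z. (j, z) \<in> q"
proof -
  assume "q \<in> regular_points S"
  then obtain j z where "q = cls S (j, z)" unfolding regular_points_def Diff_iff surface_iff by blast
  then show ?thesis using in_cls by blast
qed

lemma interior_good: "j < num \<Longrightarrow> z \<in> interior_part j \<Longrightarrow> good j z"
  using corners_bdry[of j] inside_no_overlap[of "bdry j"] unfolding good_def polygon_region_def by blast

lemma cls_interior: "j < num \<Longrightarrow> z \<in> interior_part j \<Longrightarrow> cls S (j, z) = {(j, z)}"
proof -
  assume j: "j < num" "z \<in> interior_part j"
  have "((j, z), q) \<notin> glue S" for q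
    using side_bdry j inside_no_overlap[of "bdry j"] unfolding glue_iff by blast
  then show ?thesis using good_cls_mem(3)[OF interior_good[OF j]] in_cls by fastforce
qed

text \<open>Limits of identified points are identified; the identifications are finitely many closed relations.\<close>

lemma cls_separated:
  assumes "good j' p'" "cls S (j, z) \<noteq> cls S (j', p')"
  shows "\<exists>d>0. \<forall>a\<in>ball z d. \<forall>b\<in>ball p' d. good j' b \<longrightarrow> cls S (j, a) \<noteq> cls S (j', b)"
proof -
  define C where "C e = {(a, b). fst e = j' \<and> fst (pairing S e) = j \<and> b \<in> side e \<and> a - b = edge_shift S e}" for e
  define D where "D = (\<Union>e\<in>edges S. C e) \<union> {(a, b). j = j' \<and> a = b}"
  have iff: "cls S (j, a) = cls S (j', b) \<longleftrightarrow> (a, b) \<in> D" if "good j' b" for a b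
  proof -
    have "cls S (j, a) = cls S (j', b) \<longleftrightarrow> ((j', b), (j, a)) \<in> (glue S)\<^sup>*" by (metis cls_eq_iff)
    also have "\<dots> \<longleftrightarrow> (j, a) = (j', b) \<or> ((j', b), (j, a)) \<in> glue S"
      using glue_star_nonvertex[of j' b] that by (auto simp: good_def)
    also have "\<dots> \<longleftrightarrow> (a, b) \<in> D" unfolding glue_iff D_def C_def by (auto simp del: split_paired_Ex split_paired_All simp: algebra_simps)
    finally show ?thesis .
  qed
  have "closed (C e)" for e
  proof -
    have "closed ((UNIV :: complex set) \<times> side e)" "closed {x :: complex \<times> complex. fst x - snd x = edge_shift S e}"
      by (auto intro!: closed_Times closed_Collect_eq continuous_intros)
    moreover have "C e = (if fst e = j' \<and> fst (pairing S e) = j then (UNIV \<times> side e) \<inter> {x. fst x - snd x = edge_shift S e} else {})"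
      by (auto simp: C_def)
    ultimately show ?thesis by auto
  qed
  moreover have "closed {(a, b). j = j' \<and> (a :: complex) = b}"
  proof (cases "j = j'")
    case True
    have "{(a, b). j = j' \<and> (a :: complex) = b} = {x. fst x = snd x}" using True by auto
    then show ?thesis by (auto intro!: closed_Collect_eq continuous_intros)
  qed simp
  ultimately have "closed D" unfolding D_def using finite_edges by (intro closed_Un closed_UN) auto
  moreover have "(z, p') \<notin> D" using iff assms by auto
  ultimately obtain d where d: "d > 0" "ball (z, p') d \<subseteq> - D" using open_contains_ball[of "- D"] by auto
  have "(a, b) \<in> ball (z, p') d" if "a \<in> ball z (d/2)" "b \<in> ball p' (d/2)" for a b
  proof -
    have "dist (z, p') (a, b) \<le> dist z a + dist p' b" by (simp add: dist_Pair_Pair sqrt_sum_squares_le_sum)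
    then show ?thesis using that by simp
  qed
  then have "\<forall>a\<in>ball z (d/2). \<forall>b\<in>ball p' (d/2). good j' b \<longrightarrow> cls S (j, a) \<noteq> cls S (j', b)"
    using d(2) iff by blast
  then show ?thesis using d(1) by (intro exI[of _ "d/2"]) auto
qed

text \<open>Near a corner the sides of a polygon diverge linearly.\<close>

lemma sides_isolated:
  "\<exists>c>0. c \<le> 1 \<and> (\<forall>e\<in>edges S. \<forall>f\<in>edges S. fst e = fst f \<longrightarrow> e \<noteq> f \<longrightarrow>
     (\<forall>x\<in>side e. \<forall>y\<in>side f. c * min (cmod (x - edge_start S e)) (cmod (x - edge_end S e)) \<le> cmod (x - y)))"
proof -
  define R where "R = (\<lambda>(e, f) c. \<forall>x\<in>side e. \<forall>y\<in>side f.
     c * min (cmod (x - edge_start S e)) (cmod (x - edge_end S e)) \<le> cmod (x - y))"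
  have "\<exists>c>0. R (e, f) c" if ef: "e \<in> edges S" "f \<in> edges S" "fst e = fst f" "e \<noteq> f" for e f
  proof -
    obtain j k l where e: "e = (j, k)" "f = (j, l)" "k \<noteq> l" using ef by (cases e; cases f) auto
    let ?vs = "polys S ! j"
    let ?a = "edge_start S e" and ?b = "edge_end S e" and ?a' = "edge_start S f" and ?b' = "edge_end S f"
    have jkl: "j < num" "k < length ?vs" "l < length ?vs" using ef e by (auto simp: edges_iff)
    have meet: "side e \<inter> side f \<subseteq> {?a, ?b} \<inter> {?a', ?b'}"
      using edges_meet_at_vertices[OF simple, of j k l] jkl e by (simp add: edge_start_pair edge_end_pair)
    have neq: "?a \<noteq> ?b" "?a' \<noteq> ?b'" using edge_start_neq_end ef by auto
    have d: "distinct ?vs" "3 \<le> length ?vs" using simple[OF jkl(1)] by (auto simp: simple_polygon_def)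
    have aa: "?a \<noteq> ?a'" using e jkl d by (simp add: edge_start_pair nth_eq_iff_index_eq)
    have bb: "\<not> (?a = ?b' \<and> ?b = ?a')"
    proof -
      define m where "m = (if Suc l = length ?vs then 0 else Suc l)"
      define n where "n = (if Suc k = length ?vs then 0 else Suc k)"
      have "m < length ?vs" "n < length ?vs" "\<not> (k = m \<and> n = l)" using jkl d(2) by (auto simp: m_def n_def)
      then show ?thesis using e jkl d(1)
        by (simp add: edge_start_pair edge_end_pair next_vertex_eq m_def[symmetric] n_def[symmetric] nth_eq_iff_index_eq)
    qed
    show ?thesis
    proof (cases "side e \<inter> side f = {}")
      case True
      then obtain D where D: "D > 0" "\<forall>x\<in>side e. \<forall>y\<in>side f. D \<le> dist x y"
        using separate_compact_closed[of "side e" "side f"] by auto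
      have "D / cmod (?b - ?a) * min (cmod (x - ?a)) (cmod (x - ?b)) \<le> cmod (x - y)" if "x \<in> side e" "y \<in> side f" for x y
      proof -
        have "cmod (x - ?a) \<le> cmod (?b - ?a)" using segment_bound(1)[OF that(1)] by simp
        then have "min (cmod (x - ?a)) (cmod (x - ?b)) \<le> cmod (?b - ?a)" by simp
        then have "D / cmod (?b - ?a) * min (cmod (x - ?a)) (cmod (x - ?b)) \<le> D"
          using D(1) neq(1) by (simp add: divide_simps mult_left_mono)
        then show ?thesis using D(2) that by (fastforce simp: dist_norm)
      qed
      then show ?thesis using D(1) neq by (intro exI[of _ "D / cmod (?b - ?a)"]) (auto simp: R_def)
    next
      case False
      then obtain v where v: "v \<in> {?a, ?b}" "v \<in> {?a', ?b'}" "v \<in> side e" "v \<in> side f" using meet by blast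
      define a where "a = (if v = ?a then ?b else ?a)"
      define b where "b = (if v = ?a' then ?b' else ?a')"
      have a: "side e = closed_segment v a" "a \<noteq> v" "{?a, ?b} = {v, a}"
        using v(1) neq(1) by (auto simp: a_def closed_segment_commute)
      have b: "side f = closed_segment v b" "b \<noteq> v" "{?a', ?b'} = {v, b}"
        using v(2) neq(2) by (auto simp: b_def closed_segment_commute)
      have "a \<noteq> b" using aa bb a b neq by (metis doubleton_eq_iff)
      then have "closed_segment v a \<inter> closed_segment v b = {v}" using meet a b by auto
      then obtain c where c: "c > 0" "\<forall>x\<in>side e. \<forall>y\<in>side f. c * cmod (x - v) \<le> cmod (x - y)"
        using segments_diverge[of v a b] a b by auto
      have "c * min (cmod (x - ?a)) (cmod (x - ?b)) \<le> c * cmod (x - v)" for x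
        using c(1) v(1) by auto
      then have "R (e, f) c" using c(2) unfolding R_def prod.case by (meson order_trans)
      then show ?thesis using c(1) by blast
    qed
  qed
  then have "\<exists>c>0. \<forall>p\<in>{(e, f). e \<in> edges S \<and> f \<in> edges S \<and> fst e = fst f \<and> e \<noteq> f}. R p c"
  proof (intro finite_uniform_constant)
    show "finite {(e, f). e \<in> edges S \<and> f \<in> edges S \<and> fst e = fst f \<and> e \<noteq> f}"
      by (rule finite_subset[of _ "edges S \<times> edges S"]) (auto simp: finite_edges)
    show "R p d" if "R p c" "0 < d" "d \<le> c" for p c d
    proof -
      obtain e f where p: "p = (e, f)" by (cases p)
      have "d * min (cmod (x - edge_start S e)) (cmod (x - edge_end S e)) \<le> c * min (cmod (x - edge_start S e)) (cmod (x - edge_end S e))" for x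
        using that by (intro mult_right_mono) auto
      then show ?thesis using that(1) unfolding R_def p prod.case by (meson order_trans)
    qed
  qed auto
  then obtain c where c: "c > 0" "\<forall>e f. e \<in> edges S \<and> f \<in> edges S \<and> fst e = fst f \<and> e \<noteq> f \<longrightarrow> R (e, f) c" by blast
  show ?thesis
  proof (intro exI[of _ "min c 1"] conjI ballI impI)
    fix e f x y assume ef: "e \<in> edges S" "f \<in> edges S" "fst e = fst f" "e \<noteq> f" and xy: "x \<in> side e" "y \<in> side f"
    let ?m = "min (cmod (x - edge_start S e)) (cmod (x - edge_end S e))"
    have "min c 1 * ?m \<le> c * ?m" by (intro mult_right_mono) auto
    also have "\<dots> \<le> cmod (x - y)" using c(2) ef xy unfolding R_def by blast
    finally show "min c 1 * ?m \<le> cmod (x - y)" .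
  qed (use c in auto)
qed

end

section \<open>Euclidean coordinates\<close>

text \<open>How far one can walk from a point in every direction without running into a vertex.\<close>

definition chart :: "gluing \<Rightarrow> real \<Rightarrow> point \<Rightarrow> bool" where
  "chart S r q \<longleftrightarrow> (\<exists>\<eta>. local_coords S (ball 0 r) \<eta> \<and> \<eta> 0 = q)"

lemma local_coords_open: "local_coords S W \<eta> \<Longrightarrow> open W" by (simp add: local_coords_def)

lemma local_coords_regular: "local_coords S W \<eta> \<Longrightarrow> z \<in> W \<Longrightarrow> \<eta> z \<in> regular_points S"
  by (auto simp: local_coords_def)

lemma local_coords_subset: "local_coords S W \<eta> \<Longrightarrow> open V \<Longrightarrow> V \<subseteq> W \<Longrightarrow> local_coords S V \<eta>"
  by (force simp: local_coords_def)

lemma local_coords_shift: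
  assumes "local_coords S W \<eta>" shows "local_coords S {z. z + a \<in> W} (\<lambda>z. \<eta> (z + a))"
proof -
  have "open ((\<lambda>z. z + a) -` W)" using assms by (intro open_vimage) (auto simp: local_coords_def intro!: continuous_intros)
  then show ?thesis using assms by (fastforce simp: local_coords_def vimage_def algebra_simps)
qed

lemma local_coords_shift_ball:
  assumes "local_coords S W \<eta>" "ball a r \<subseteq> W" shows "local_coords S (ball 0 r) (\<lambda>z. \<eta> (z + a))"
  using assms(2) by (intro local_coords_subset[OF local_coords_shift[OF assms(1), of a]]) (auto simp: subset_eq dist_norm algebra_simps)

lemma chart_ball: "local_coords S W \<eta> \<Longrightarrow> ball a r \<subseteq> W \<Longrightarrow> chart S r (\<eta> a)"
  unfolding chart_def using local_coords_shift_ball[of S W \<eta> a r] by (intro exI[of _ "\<lambda>z. \<eta> (z + a)"]) auto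

lemma chart_mono: "chart S r q \<Longrightarrow> s \<le> r \<Longrightarrow> chart S s q"
  unfolding chart_def using local_coords_subset[OF _ open_ball subset_ball] by blast

lemma inside_connected:
  assumes "connected X" "X \<inter> B = {}" "z \<in> X" "z \<in> inside B" shows "X \<subseteq> inside B"
proof
  fix y assume "y \<in> X"
  then have "connected_component (- B) z y" using assms unfolding connected_component_def by (intro exI[of _ X]) auto
  then show "y \<in> inside B" using assms(4) inside_same_component by blast
qed

context flat_surface
begin

lemma finite_cls: "good j z \<Longrightarrow> finite (cls S (j, z))"
proof -
  assume g: "good j z"
  have "cls S (j, z) \<subseteq> insert (j, z) ((\<lambda>e. (fst (pairing S e), z + edge_shift S e)) ` edges S)"
    using good_cls_mem(3)[OF g] by (force simp: glue_def)
  then show ?thesis using finite_edges finite_subset by blast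
qed

lemma finite_regular: "q \<in> regular_points S \<Longrightarrow> finite q"
  using regular_rep regular_good finite_cls by metis

text \<open>A regular class is finite, so the conditions at its representatives hold on discs of a common radius.\<close>

lemma local_coords_rep:
  assumes "local_coords S W \<eta>" "z \<in> W"
  shows "\<exists>d>0. \<forall>(j, p)\<in>\<eta> z. \<forall>p'\<in>region j. dist p' p < d \<longrightarrow> z + (p' - p) \<in> W \<and> \<eta> (z + (p' - p)) = cls S (j, p')"
proof -
  obtain r where r: "r > 0" "ball z r \<subseteq> W" using assms local_coords_open open_contains_ball by meson
  show ?thesis
  proof (rule finite_uniform_constant)
    show "finite (\<eta> z)" by (rule finite_regular[OF local_coords_regular[OF assms]])
  next
    fix q assume q: "q \<in> \<eta> z"
    obtain j p where jp: "q = (j, p)" by (cases q)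
    have "\<forall>\<^sub>F p' in at p within region j. \<eta> (z + (p' - p)) = cls S (j, p')"
      using assms q jp unfolding local_coords_def by auto
    then obtain d where d: "d > 0" "\<forall>p'\<in>region j. p' \<noteq> p \<and> dist p' p < d \<longrightarrow> \<eta> (z + (p' - p)) = cls S (j, p')"
      by (auto simp: eventually_at)
    have "\<eta> z = cls S (j, p)" using regular_good(2)[OF local_coords_regular[OF assms]] q jp by simp
    then have "\<eta> (z + (p' - p)) = cls S (j, p')" if "p' \<in> region j" "dist p' p < d" for p'
      using d(2) that by (cases "p' = p") auto
    moreover have "z + (p' - p) \<in> W" if "dist p' p < r" for p'
      using r(2) that by (auto simp: subset_eq dist_norm norm_minus_commute)
    ultimately show "\<exists>d>0. case q of (j, p) \<Rightarrow> \<forall>p'\<in>region j. dist p' p < d \<longrightarrow> z + (p' - p) \<in> W \<and> \<eta> (z + (p' - p)) = cls S (j, p')"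
      using d(1) r(1) jp by (intro exI[of _ "min d r"]) auto
  qed auto
qed

text \<open>The constant of divergence of the sides is fixed, so that the radius of the half discs at a side is a function of the
  side and the point.\<close>

definition isolation :: real where
  "isolation = (SOME c. c > 0 \<and> c \<le> 1 \<and> (\<forall>e\<in>edges S. \<forall>f\<in>edges S. fst e = fst f \<longrightarrow> e \<noteq> f \<longrightarrow>
     (\<forall>x\<in>side e. \<forall>y\<in>side f. c * min (cmod (x - edge_start S e)) (cmod (x - edge_end S e)) \<le> cmod (x - y))))"

lemma isolation:
  "isolation > 0" "isolation \<le> 1"
  "e \<in> edges S \<Longrightarrow> f \<in> edges S \<Longrightarrow> fst e = fst f \<Longrightarrow> e \<noteq> f \<Longrightarrow> x \<in> side e \<Longrightarrow> y \<in> side f \<Longrightarrow>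
    isolation * min (cmod (x - edge_start S e)) (cmod (x - edge_end S e)) \<le> cmod (x - y)"
  using someI_ex[OF sides_isolated] unfolding isolation_def[symmetric] by auto

definition edge_radius :: "nat \<times> nat \<Rightarrow> complex \<Rightarrow> real" where
  "edge_radius e x = isolation * min (cmod (x - edge_start S e)) (cmod (x - edge_end S e))"

abbreviation left_side where "left_side e z \<equiv> left_of (edge_start S e) (edge_end S e) z"

lemma edge_disc:
  assumes e: "e \<in> edges S" and x: "x \<in> side e" and z: "z \<in> ball x (edge_radius e x)"
  shows "z \<in> interior_part (fst e) \<longleftrightarrow> 0 < left_side e z" "z \<in> bdry (fst e) \<longleftrightarrow> left_side e z = 0"
    "z \<in> side e \<longleftrightarrow> left_side e z = 0" "z \<notin> corners (fst e)"
    "z \<in> region (fst e) \<longleftrightarrow> 0 \<le> left_side e z"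
proof -
  obtain j k where jk: "e = (j, k)" by (cases e)
  then have jk': "j < num" "k < length (polys S ! j)" using e by (auto simp: edges_iff)
  define r where "r = edge_radius e x"
  have z': "z \<in> ball x r" using z by (simp add: r_def)
  have r: "0 < r" using z by (metis r_def empty_iff ball_empty not_less)
  have rle: "r \<le> cmod (x - edge_start S e)" "r \<le> cmod (x - edge_end S e)"
    using isolation(1,2) mult_right_mono[of isolation 1 "min (cmod (x - edge_start S e)) (cmod (x - edge_end S e))"]
    by (auto simp: r_def edge_radius_def)
  have other: "ball x r \<inter> side f = {}" if "f \<in> edges S" "fst f = j" "f \<noteq> e" for f
    using isolation(3)[OF e that(1) _ _ x] that jk by (fastforce simp: r_def edge_radius_def dist_norm)
  have o: "ball x r \<inter> closed_segment (polys S ! j ! l) (next_vertex (polys S ! j) l) = {}"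
    if "l < length (polys S ! j)" "l \<noteq> k" for l
    using other[of "(j, l)"] that jk jk' by (simp add: edges_iff edge_start_pair edge_end_pair)
  note * = polygon_sides_of_edge[OF simple[OF jk'(1)] left[OF jk'(1)] jk'(2) _ r _ _ o z', folded edge_start_pair[of j k] edge_end_pair[of j k], folded jk]
  show 1: "z \<in> interior_part (fst e) \<longleftrightarrow> 0 < left_side e z" and 2: "z \<in> bdry (fst e) \<longleftrightarrow> left_side e z = 0"
    using * x rle jk by auto
  then show "z \<in> region (fst e) \<longleftrightarrow> 0 \<le> left_side e z" unfolding polygon_region_def by auto
  show "z \<in> side e \<longleftrightarrow> left_side e z = 0"
    using 2 bdry_side[of "fst e" z] side_bdry[OF e] other z' jk jk' by (metis disjoint_iff fst_conv subsetD)
  show "z \<notin> corners (fst e)"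
  proof
    assume "z \<in> corners (fst e)"
    then obtain l where l: "l < length (polys S ! j)" "z = polys S ! j ! l" using jk by (auto simp: in_set_conv_nth)
    then have "z \<in> closed_segment (polys S ! j ! l) (next_vertex (polys S ! j) l)" by simp
    then have "l = k" using o l z' by blast
    then show False using l rle(1) z' jk by (simp add: dist_norm edge_start_pair)
  qed
qed

lemma edge_radius_partner:
  "e \<in> edges S \<Longrightarrow> edge_radius (pairing S e) (x + edge_shift S e) = edge_radius e x"
  unfolding edge_radius_def shift_ends(1,2)[symmetric] by (simp add: min.commute)

lemma left_side_partner:
  "e \<in> edges S \<Longrightarrow> left_side (pairing S e) (z + edge_shift S e) = - left_side e z"
  unfolding left_of_def shift_ends(1,2)[symmetric] by (simp add: algebra_simps)

definition edge_chart :: "nat \<times> nat \<Rightarrow> complex \<Rightarrow> complex \<Rightarrow> point" where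
  "edge_chart e x z = (if 0 \<le> left_side e (x + z) then cls S (fst e, x + z)
     else cls S (fst (pairing S e), x + edge_shift S e + z))"

text \<open>The left half disc in the polygon of \<open>e\<close> and the right half disc in the polygon of its partner
  fit together along the side.\<close>

lemma edge_chart:
  assumes e: "e \<in> edges S" and x: "x \<in> side e"
  shows "local_coords S (ball 0 (edge_radius e x)) (edge_chart e x)"
    and "\<And>z. z \<in> ball x (edge_radius e x) \<Longrightarrow> z \<in> region (fst e) \<Longrightarrow> edge_chart e x (z - x) = cls S (fst e, z)"
    and "\<And>v. v \<in> ball 0 (edge_radius e x) \<Longrightarrow> x + v \<in> region (fst e) \<or> x + edge_shift S e + v \<in> region (fst (pairing S e))"
proof -
  let ?r = "edge_radius e x" and ?f = "pairing S e" and ?s = "edge_shift S e"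
  note d = edge_disc[OF e x]
  note d' = edge_disc[OF pairing(1)[OF e] side_shift[OF e x], unfolded edge_radius_partner[OF e]]
  have num: "fst e < num" "fst ?f < num" using e pairing(1)[OF e] by (auto simp: edges_def)
  have b: "x + v \<in> ball x ?r" "x + ?s + v \<in> ball (x + ?s) ?r" if "v \<in> ball 0 ?r" for v
    using that by (auto simp: dist_norm)
  have ls: "left_side ?f (x + ?s + v) = - left_side e (x + v)" for v
    using left_side_partner[OF e, of "x + v"] by (simp add: algebra_simps)
  show C1: "edge_chart e x (z - x) = cls S (fst e, z)" if "z \<in> ball x ?r" "z \<in> region (fst e)" for z
    using d(5)[OF that(1)] that(2) by (simp add: edge_chart_def)
  have C2: "edge_chart e x (z - x - ?s) = cls S (fst ?f, z)" if "z \<in> ball (x + ?s) ?r" "z \<in> region (fst ?f)" for z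
  proof -
    define v where "v = z - x - ?s"
    have v: "z = x + ?s + v" "v \<in> ball 0 ?r" using that(1) by (auto simp: v_def dist_norm algebra_simps norm_minus_commute)
    have "left_side e (x + v) \<le> 0" using d'(5)[OF that(1)] that(2) ls[of v] v(1) by simp
    moreover have "cls S (fst ?f, z) = cls S (fst e, x + v)" if "left_side e (x + v) = 0"
      using d(3)[OF b(1)[OF v(2)]] that cls_glue[OF e, of "x + v"] v(1) by (simp add: algebra_simps)
    ultimately show ?thesis unfolding v_def[symmetric] by (auto simp: edge_chart_def v(1) algebra_simps)
  qed
  show cov: "x + v \<in> region (fst e) \<or> x + ?s + v \<in> region (fst ?f)" if "v \<in> ball 0 ?r" for v
    using d(5)[OF b(1)[OF that]] d'(5)[OF b(2)[OF that]] ls[of v] by auto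
  have good1: "good (fst e) (x + v)" if "v \<in> ball 0 ?r" "0 \<le> left_side e (x + v)" for v
    using d(4,5)[OF b(1)[OF that(1)]] that num by (auto simp: good_def)
  have good2: "good (fst ?f) (x + ?s + v)" if "v \<in> ball 0 ?r" "left_side e (x + v) \<le> 0" for v
    using d'(4,5)[OF b(2)[OF that(1)]] that ls[of v] num by (auto simp: good_def)
  have reps: "q = (fst e, x + v) \<or> q = (fst ?f, x + ?s + v)" if v: "v \<in> ball 0 ?r" and q: "q \<in> edge_chart e x v" for v q
  proof (cases "left_side e (x + v) = 0")
    case True
    have "edge_chart e x v = cls S (fst e, x + v)" using True by (simp add: edge_chart_def)
    then have "q = (fst e, x + v) \<or> ((fst e, x + v), q) \<in> glue S" 
      using good_cls_mem(3)[OF good1[OF v]] True q by (cases q) auto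
    then show ?thesis
    proof
      assume "((fst e, x + v), q) \<in> glue S"
      then obtain f where f: "f \<in> edges S" "fst e = fst f" "x + v \<in> side f" "q = (fst (pairing S f), x + v + edge_shift S f)"
        by (auto simp: glue_def)
      have "e = f" using side_unique[OF e f(1,2) _ f(3)] d(3,4)[OF b(1)[OF v]] True by auto
      then show ?thesis using f(4) by (simp add: algebra_simps)
    qed auto
  next
    case False
    then consider "left_side e (x + v) > 0" | "left_side e (x + v) < 0" by linarith
    then show ?thesis
    proof cases
      case 1
      then have "cls S (fst e, x + v) = {(fst e, x + v)}" using d(1)[OF b(1)[OF v]] num cls_interior by simp
      then show ?thesis using 1 q by (simp add: edge_chart_def)
    next
      case 2
      then have "cls S (fst ?f, x + ?s + v) = {(fst ?f, x + ?s + v)}" using d'(1)[OF b(2)[OF v]] ls[of v] num cls_interior by simp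
      then show ?thesis using 2 q by (simp add: edge_chart_def)
    qed
  qed
  show "local_coords S (ball 0 ?r) (edge_chart e x)"
    unfolding local_coords_def
  proof (intro conjI ballI)
    show "edge_chart e x ` ball 0 ?r \<subseteq> regular_points S"
      using good_regular good1 good2 by (auto simp: edge_chart_def)
    fix v q assume v: "v \<in> ball 0 ?r" and q: "q \<in> edge_chart e x v"
    have ev: "\<forall>\<^sub>F p' in at p within T. p' \<in> ball c ?r" if "p \<in> ball c ?r" for p c T
      by (rule topological_tendstoD[OF tendsto_ident_at open_ball that])
    consider "q = (fst e, x + v)" | "q = (fst ?f, x + ?s + v)" using reps[OF v q] by blast
    then show "case q of (j, p) \<Rightarrow> \<forall>\<^sub>F p' in at p within region j. edge_chart e x (v + (p' - p)) = cls S (j, p')"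
    proof cases
      case 1
      have "\<forall>\<^sub>F p' in at (x + v) within region (fst e). p' \<in> ball x ?r \<and> p' \<in> region (fst e)"
        using ev[OF b(1)[OF v]] by (auto intro: eventually_conj simp: eventually_at_filter)
      then show ?thesis unfolding 1 prod.case
        by eventually_elim (use C1 in \<open>force simp: algebra_simps\<close>)
    next
      case 2
      have "\<forall>\<^sub>F p' in at (x + ?s + v) within region (fst ?f). p' \<in> ball (x + ?s) ?r \<and> p' \<in> region (fst ?f)"
        using ev[OF b(2)[OF v]] by (auto intro: eventually_conj simp: eventually_at_filter)
      then show ?thesis unfolding 2 prod.case
        by eventually_elim (use C2 in \<open>force simp: algebra_simps\<close>)
    qed
  qed simp
qed

lemma interior_chart:
  assumes "j < num" "ball c r \<subseteq> interior_part j"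
  shows "local_coords S (ball 0 r) (\<lambda>z. cls S (j, c + z))"
  unfolding local_coords_def
proof (intro conjI ballI)
  have b: "c + z \<in> interior_part j" if "z \<in> ball 0 r" for z using assms(2) that by (auto simp: subset_eq dist_norm)
  show "(\<lambda>z. cls S (j, c + z)) ` ball 0 r \<subseteq> regular_points S"
    using b good_regular interior_good assms(1) by auto
  fix z q assume z: "z \<in> ball 0 r" and q: "q \<in> cls S (j, c + z)"
  have "q = (j, c + z)" using q cls_interior[OF assms(1) b[OF z]] by simp
  then show "case q of (i, p) \<Rightarrow> \<forall>\<^sub>F p' in at p within region i. cls S (j, c + (z + (p' - p))) = cls S (i, p')"
    by (simp add: algebra_simps)
qed simp

text \<open>At an inner point a polygon contains a full disc, at a side the half discs of the two partners complement each other.\<close>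

lemma reps_cover:
  assumes "q \<in> regular_points S"
  shows "\<exists>d>0. \<forall>v\<in>ball (0::complex) d. \<exists>(j, p)\<in>q. p + v \<in> region j"
proof -
  obtain j p where jp: "(j, p) \<in> q" using regular_rep assms by blast
  note g = regular_good[OF assms jp]
  show ?thesis
  proof (cases "p \<in> interior_part j")
    case True
    then obtain d where "d > 0" "ball p d \<subseteq> interior_part j" using open_interior_part open_contains_ball by blast
    then show ?thesis using jp by (intro exI[of _ d]) (force simp: polygon_region_def dist_norm subset_eq)
  next
    case False
    then obtain e where e: "e \<in> edges S" "fst e = j" "p \<in> side e"
      using bdry_side[of j p] g by (auto simp: good_def polygon_region_def)
    have pe: "p \<noteq> edge_start S e" "p \<noteq> edge_end S e" using g edge_ends_corners[OF e(1)] e(2) by (auto simp: good_def)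
    have 2: "(fst (pairing S e), p + edge_shift S e) \<in> q"
      using cls_glue[OF e(1,3)] in_cls[of "(fst (pairing S e), p + edge_shift S e)"] g(2) e(2) by simp
    show ?thesis
    proof (intro exI[of _ "edge_radius e p"] conjI ballI)
      show "edge_radius e p > 0" using pe isolation by (simp add: edge_radius_def)
      fix v :: complex assume "v \<in> ball 0 (edge_radius e p)"
      then show "\<exists>(j, p)\<in>q. p + v \<in> region j" using edge_chart(3)[OF e(1,3)] jp e(2) 2 by fastforce
    qed
  qed
qed

lemma local_coords_cover:
  assumes "local_coords S W \<eta>" "z \<in> W"
  shows "\<exists>d>0. \<forall>v\<in>ball (0::complex) d. z + v \<in> W \<and> (\<exists>(j, p)\<in>\<eta> z. p + v \<in> region j \<and> \<eta> (z + v) = cls S (j, p + v))"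
proof -
  obtain d where d: "d > 0" "\<forall>v\<in>ball (0::complex) d. \<exists>(j, p)\<in>\<eta> z. p + v \<in> region j"
    using reps_cover[OF local_coords_regular[OF assms]] by auto
  obtain d' where d': "d' > 0" "\<forall>(j, p)\<in>\<eta> z. \<forall>p'\<in>region j. dist p' p < d' \<longrightarrow> z + (p' - p) \<in> W \<and> \<eta> (z + (p' - p)) = cls S (j, p')"
    using local_coords_rep[OF assms] by auto
  have "z + v \<in> W \<and> (\<exists>(j, p)\<in>\<eta> z. p + v \<in> region j \<and> \<eta> (z + v) = cls S (j, p + v))" if v: "v \<in> ball 0 (min d d')" for v
  proof -
    obtain j p where jp: "(j, p) \<in> \<eta> z" "p + v \<in> region j" using d(2) v by fastforce
    then have "z + v \<in> W \<and> \<eta> (z + v) = cls S (j, p + v)" using d'(2) v by (fastforce simp: dist_norm)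
    then show ?thesis using jp by blast
  qed
  then show ?thesis using d(1) d'(1) by (intro exI[of _ "min d d'"]) auto
qed

text \<open>Near a point all values of the coordinates are forced by the gluing, because the polygons at the representatives cover a
  full disc of displacements.\<close>

lemma local_coords_agree_near:
  assumes "local_coords S W \<eta>" "z \<in> W" "local_coords S W' \<eta>'" "z' \<in> W'" "\<eta> z = \<eta>' z'"
  shows "\<exists>d>0. \<forall>v\<in>ball (0::complex) d. z + v \<in> W \<and> z' + v \<in> W' \<and> \<eta> (z + v) = \<eta>' (z' + v)"
proof -
  obtain d where d: "d > 0" "\<forall>v\<in>ball (0::complex) d. z + v \<in> W \<and> (\<exists>(j, p)\<in>\<eta> z. p + v \<in> region j \<and> \<eta> (z + v) = cls S (j, p + v))"
    using local_coords_cover[OF assms(1,2)] by blast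
  obtain d' where d': "d' > 0" "\<forall>(j, p)\<in>\<eta>' z'. \<forall>p'\<in>region j. dist p' p < d' \<longrightarrow> z' + (p' - p) \<in> W' \<and> \<eta>' (z' + (p' - p)) = cls S (j, p')"
    using local_coords_rep[OF assms(3,4)] by blast
  have "z + v \<in> W \<and> z' + v \<in> W' \<and> \<eta> (z + v) = \<eta>' (z' + v)" if v: "v \<in> ball 0 (min d d')" for v
  proof -
    obtain j p where jp: "(j, p) \<in> \<eta> z" "p + v \<in> region j" "\<eta> (z + v) = cls S (j, p + v)" "z + v \<in> W" using d(2) v by fastforce
    then have "z' + v \<in> W' \<and> \<eta>' (z' + v) = cls S (j, p + v)" using d'(2) v assms(5) by (fastforce simp: dist_norm)
    then show ?thesis using jp by simp
  qed
  then show ?thesis using d(1) d'(1) by (intro exI[of _ "min d d'"]) auto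
qed

text \<open>The surface is Hausdorff at its regular points.\<close>

lemma local_coords_separated:
  assumes "local_coords S W \<eta>" "z \<in> W" "local_coords S W' \<eta>'" "z' \<in> W'" "\<eta> z \<noteq> \<eta>' z'"
  shows "\<exists>d>0. \<forall>v\<in>ball (0::complex) d. \<forall>v'\<in>ball 0 d. z + v \<in> W \<and> z' + v' \<in> W' \<and> \<eta> (z + v) \<noteq> \<eta>' (z' + v')"
proof -
  obtain d where d: "d > 0" "\<forall>v\<in>ball (0::complex) d. z + v \<in> W \<and> (\<exists>(j, p)\<in>\<eta> z. p + v \<in> region j \<and> \<eta> (z + v) = cls S (j, p + v))"
    using local_coords_cover[OF assms(1,2)] by blast
  obtain d' where d': "d' > 0" "\<forall>v\<in>ball (0::complex) d'. z' + v \<in> W' \<and> (\<exists>(j, p)\<in>\<eta>' z'. p + v \<in> region j \<and> \<eta>' (z' + v) = cls S (j, p + v))"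
    using local_coords_cover[OF assms(3,4)] by blast
  define R where "R = (\<lambda>((j, p), (j', p')) d. \<forall>a\<in>ball p d. \<forall>b\<in>ball p' d. good j' b \<longrightarrow> cls S (j, a) \<noteq> cls S (j', b))"
  have "\<exists>d>0. \<forall>x\<in>\<eta> z \<times> \<eta>' z'. R x d"
  proof (rule finite_uniform_constant)
    show "finite (\<eta> z \<times> \<eta>' z')" using finite_regular local_coords_regular assms by blast
    fix x assume x: "x \<in> \<eta> z \<times> \<eta>' z'"
    obtain j p j' p' where xx: "x = ((j, p), (j', p'))" by (metis prod.exhaust)
    have "good j' p'" "cls S (j, p) \<noteq> cls S (j', p')"
      using regular_good[OF local_coords_regular[OF assms(1,2)]] regular_good[OF local_coords_regular[OF assms(3,4)]] x xx assms(5) by auto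
    then show "\<exists>d>0. R x d" using cls_separated[of j' p' j p] unfolding R_def xx by simp
  next
    show "R x d" if "R x c" "0 < d" "d \<le> c" for x c d
      using that unfolding R_def by (auto split: prod.splits) 
  qed
  then obtain s where s: "s > 0" "\<forall>x\<in>\<eta> z \<times> \<eta>' z'. R x s" by blast
  have "z + v \<in> W \<and> z' + v' \<in> W' \<and> \<eta> (z + v) \<noteq> \<eta>' (z' + v')" if v: "v \<in> ball 0 (min (min d d') s)" "v' \<in> ball 0 (min (min d d') s)" for v v'
  proof -
    obtain j p where jp: "(j, p) \<in> \<eta> z" "\<eta> (z + v) = cls S (j, p + v)" "z + v \<in> W" using d(2) v by fastforce
    obtain j' p' where jp': "(j', p') \<in> \<eta>' z'" "\<eta>' (z' + v') = cls S (j', p' + v')" "z' + v' \<in> W'" using d'(2) v by fastforce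
    have "R ((j, p), (j', p')) s" using s(2) jp jp' by blast
    moreover have "good j' (p' + v')" using regular_good(1)[OF local_coords_regular[OF assms(3) jp'(3)]] jp'(2) in_cls by auto
    ultimately show ?thesis using jp jp' v by (auto simp: R_def dist_norm)
  qed
  then show ?thesis using d(1) d'(1) s(1) by (intro exI[of _ "min (min d d') s"]) auto
qed

text \<open>The identity theorem: the points of agreement and those of disagreement form open sets.\<close>

lemma local_coords_unique:
  assumes "local_coords S W \<eta>" "local_coords S W' \<eta>'" "connected X"
    "\<And>x. x \<in> X \<Longrightarrow> x \<in> W \<and> x + h \<in> W'" "a \<in> X" "\<eta> a = \<eta>' (a + h)" "x \<in> X"
  shows "\<eta> x = \<eta>' (x + h)"
proof -
  let ?V = "{x. x \<in> W \<and> x + h \<in> W'}"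
  let ?A = "{x \<in> ?V. \<eta> x = \<eta>' (x + h)}" and ?B = "{x \<in> ?V. \<eta> x \<noteq> \<eta>' (x + h)}"
  have bz: "\<exists>v\<in>ball 0 d. y = z + v" if "y \<in> ball z d" for y z :: complex and d
    using that by (intro bexI[of _ "y - z"]) (auto simp: dist_norm norm_minus_commute)
  have oA: "open ?A" unfolding open_contains_ball
  proof
    fix z assume "z \<in> ?A"
    then obtain d where "d > 0" and d: "\<forall>v\<in>ball (0::complex) d. z + v \<in> W \<and> (z + h) + v \<in> W' \<and> \<eta> (z + v) = \<eta>' ((z + h) + v)"
      using local_coords_agree_near[OF assms(1) _ assms(2), of z "z + h"] by blast
    have "y \<in> ?A" if "y \<in> ball z d" for y
      using d bz[OF that] by (auto simp: add.assoc add.commute[of h])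
    then show "\<exists>e>0. ball z e \<subseteq> ?A" using \<open>d > 0\<close> by blast
  qed
  have oB: "open ?B" unfolding open_contains_ball
  proof
    fix z assume "z \<in> ?B"
    then obtain d where "d > 0" and d: "\<forall>v\<in>ball (0::complex) d. \<forall>v'\<in>ball 0 d. z + v \<in> W \<and> (z + h) + v' \<in> W' \<and> \<eta> (z + v) \<noteq> \<eta>' ((z + h) + v')"
      using local_coords_separated[OF assms(1) _ assms(2), of z "z + h"] by blast
    have "y \<in> ?B" if "y \<in> ball z d" for y
      using d bz[OF that] by (auto simp: add.assoc add.commute[of h])
    then show "\<exists>e>0. ball z e \<subseteq> ?B" using \<open>d > 0\<close> by blast
  qed
  have "X \<subseteq> ?A \<union> ?B" using assms(4) by blast
  moreover have "?A \<inter> ?B \<inter> X = {}" by blast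
  ultimately have "?A \<inter> X = {} \<or> ?B \<inter> X = {}" by (rule connectedD[OF assms(3) oA oB, rotated])
  moreover have "a \<in> ?A \<inter> X" using assms(4)[OF assms(5)] assms(5,6) by blast
  ultimately have "?B \<inter> X = {}" by blast
  then show ?thesis using assms(4,7) by auto
qed

lemma local_coords_Union:
  assumes "\<And>i. i \<in> I \<Longrightarrow> local_coords S (W i) (\<eta> i)"
    and "\<And>i k z. i \<in> I \<Longrightarrow> k \<in> I \<Longrightarrow> z \<in> W i \<Longrightarrow> z \<in> W k \<Longrightarrow> \<eta> i z = \<eta> k z"
  shows "\<exists>\<eta>'. local_coords S (\<Union>i\<in>I. W i) \<eta>' \<and> (\<forall>i\<in>I. \<forall>z\<in>W i. \<eta>' z = \<eta> i z)"
proof -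
  define \<eta>' where "\<eta>' z = \<eta> (SOME i. i \<in> I \<and> z \<in> W i) z" for z
  have eq: "\<eta>' z = \<eta> i z" if "i \<in> I" "z \<in> W i" for i z
    unfolding \<eta>'_def by (rule assms(2)) (use someI[of "\<lambda>i. i \<in> I \<and> z \<in> W i" i] that in auto)
  have "local_coords S (\<Union>i\<in>I. W i) \<eta>'"
    unfolding local_coords_def
  proof (intro conjI ballI)
    show "open (\<Union>i\<in>I. W i)" using assms(1) by (auto simp: local_coords_def)
    show "\<eta>' ` (\<Union>i\<in>I. W i) \<subseteq> regular_points S" using assms(1) eq by (auto simp: local_coords_def image_subset_iff)
    fix z q assume "z \<in> (\<Union>i\<in>I. W i)" "q \<in> \<eta>' z"
    then obtain i where i: "i \<in> I" "z \<in> W i" "q \<in> \<eta> i z" using eq by auto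
    obtain j p where q: "q = (j, p)" by (cases q)
    have "\<forall>\<^sub>F p' in at p within region j. \<eta> i (z + (p' - p)) = cls S (j, p')"
      using assms(1)[OF i(1)] i q by (auto simp: local_coords_def)
    moreover have "\<forall>\<^sub>F p' in at p within region j. z + (p' - p) \<in> W i"
    proof -
      have "((\<lambda>p'. z + (p' - p)) \<longlongrightarrow> z + (p - p)) (at p within region j)" by (intro tendsto_intros)
      then show ?thesis using topological_tendstoD[OF _ local_coords_open[OF assms(1)[OF i(1)]]] i(2) by simp
    qed
    ultimately show "case q of (j, p) \<Rightarrow> \<forall>\<^sub>F p' in at p within region j. \<eta>' (z + (p' - p)) = cls S (j, p')"
      unfolding q prod.case by eventually_elim (use eq i in simp)
  qed
  then show ?thesis using eq by blast
qed

lemma translate_eq: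
  assumes "local_coords S W \<eta>" "closed_segment 0 v \<subseteq> W" "\<eta> 0 = x"
  shows "v \<in> translatable S x" "translate S x v = \<eta> v"
proof -
  show "v \<in> translatable S x" using assms by (auto simp: translatable_def)
  show "translate S x v = \<eta> v" unfolding translate_def
  proof (rule the_equality)
    show "\<exists>W \<eta>'. local_coords S W \<eta>' \<and> closed_segment 0 v \<subseteq> W \<and> \<eta>' 0 = x \<and> \<eta>' v = \<eta> v" using assms by blast
    fix y assume "\<exists>W \<eta>. local_coords S W \<eta> \<and> closed_segment 0 v \<subseteq> W \<and> \<eta> 0 = x \<and> \<eta> v = y"
    then obtain W' \<eta>' where l: "local_coords S W' \<eta>'" "closed_segment 0 v \<subseteq> W'" "\<eta>' 0 = x" "\<eta>' v = y" by blast
    have "\<eta>' v = \<eta> (v + 0)"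
      by (rule local_coords_unique[OF l(1) assms(1) connected_segment(1)[of 0 v], of 0 0]) (use l assms in auto)
    then show "y = \<eta> v" using l by simp
  qed
qed

lemma translate_local_coords:
  assumes "local_coords S W \<eta>" "closed_segment z (z + v) \<subseteq> W"
  shows "v \<in> translatable S (\<eta> z)" "translate S (\<eta> z) v = \<eta> (z + v)"
proof -
  have "closed_segment z (z + v) = (+) z ` closed_segment 0 v"
    using closed_segment_translation[of z 0 v] by simp
  then have "closed_segment 0 v \<subseteq> {y. y + z \<in> W}" using assms(2) by (auto simp: algebra_simps)
  then show "v \<in> translatable S (\<eta> z)" "translate S (\<eta> z) v = \<eta> (z + v)"
    using translate_eq[OF local_coords_shift[OF assms(1), of z], of v "\<eta> z"] by (auto simp: algebra_simps)
qed

text \<open>The disc around the second point lies in the disc around the first one, and by the identity theorem the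
  coordinates that are given along the segment agree with those on this disc.\<close>

lemma chart_move:
  assumes "local_coords S U \<eta>" "convex U" "z \<in> U" "z' \<in> U" "chart S r (\<eta> z)" "cmod (z' - z) + s \<le> r" "0 < s"
  shows "chart S s (\<eta> z')"
proof -
  obtain \<zeta> where z: "local_coords S (ball 0 r) \<zeta>" "\<zeta> 0 = \<eta> z" using assms(5) by (auto simp: chart_def)
  have "\<zeta> (z' - z) = \<eta> ((z' - z) + z)"
  proof (rule local_coords_unique[OF z(1) assms(1), of "closed_segment 0 (z' - z)" _ 0])
    fix x assume x: "x \<in> closed_segment 0 (z' - z)"
    have "cmod x \<le> cmod (z' - z)" using segment_bound(1)[OF x] by simp
    moreover have "x + z \<in> closed_segment z z'" 
      using x closed_segment_translation_eq[of z x 0 "z' - z"] by (simp add: add.commute)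
    moreover have "closed_segment z z' \<subseteq> U" using assms by (simp add: closed_segment_subset)
    ultimately show "x \<in> ball 0 r \<and> x + z \<in> U" using assms by auto
  qed (use z in auto)
  moreover have "ball (z' - z) s \<subseteq> ball 0 r"
  proof
    fix x assume "x \<in> ball (z' - z) s"
    then have "cmod (z' - z - x) < s" by (simp add: dist_norm)
    moreover have "cmod x \<le> cmod (z' - z) + cmod (z' - z - x)" by (metis norm_triangle_sub norm_minus_commute)
    ultimately show "x \<in> ball 0 r" using assms(6) by simp
  qed
  ultimately show ?thesis using chart_ball[OF z(1), of "z' - z" s] by simp
qed

text \<open>For convex \<open>U\<close>, two of the added discs that meet also meet \<open>U\<close>, at the midpoint of their centres;
  so the coordinates on them agree.\<close>

lemma local_coords_extend:
  assumes U: "local_coords S U \<eta>" "convex U" and r: "0 < r" "\<And>u. u \<in> U \<Longrightarrow> chart S r (\<eta> u)"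
  shows "\<exists>\<eta>'. local_coords S (\<Union>u\<in>U. ball u r) \<eta>' \<and> (\<forall>u\<in>U. \<eta>' u = \<eta> u)"
proof -
  have "\<exists>\<zeta>. local_coords S (ball u r) \<zeta> \<and> \<zeta> u = \<eta> u" if u: "u \<in> U" for u
  proof -
    obtain \<zeta> where z: "local_coords S (ball 0 r) \<zeta>" "\<zeta> 0 = \<eta> u" using r(2)[OF u] by (auto simp: chart_def)
    have "{z. z + - u \<in> ball 0 r} = ball u r" by (auto simp: dist_norm norm_minus_commute)
    then show ?thesis using local_coords_shift[OF z(1), of "- u"] z(2) by (intro exI[of _ "\<lambda>z. \<zeta> (z + - u)"]) auto
  qed
  then obtain \<zeta> where z: "\<And>u. u \<in> U \<Longrightarrow> local_coords S (ball u r) (\<zeta> u)" "\<And>u. u \<in> U \<Longrightarrow> \<zeta> u u = \<eta> u" by metis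
  have on_U: "\<zeta> u z = \<eta> z" if "u \<in> U" "z \<in> U" "z \<in> ball u r" for u z
  proof -
    have "\<zeta> u z = \<eta> (z + 0)"
    proof (rule local_coords_unique[OF z(1)[OF that(1)] U(1), of "ball u r \<inter> U" 0 u z])
      show "connected (ball u r \<inter> U)" by (intro convex_connected convex_Int convex_ball U(2))
    qed (use that z(2)[OF that(1)] r(1) in auto)
    then show ?thesis by simp
  qed
  have agree: "\<zeta> u z = \<zeta> w z" if uw: "u \<in> U" "w \<in> U" "z \<in> ball u r" "z \<in> ball w r" for u w z
  proof -
    define m where "m = midpoint u w"
    have mU: "m \<in> U" using U(2) uw closed_segment_subset[OF uw(1,2)] unfolding m_def by (meson midpoint_in_closed_segment subsetD)
    have "dist u w \<le> dist u z + dist w z" by (metis dist_triangle dist_commute)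
    then have "dist u w < 2 * r" using uw(3,4) by simp
    then have m: "m \<in> ball u r" "m \<in> ball w r" by (auto simp: m_def dist_midpoint dist_commute)
    have "\<zeta> u z = \<zeta> w (z + 0)"
    proof (rule local_coords_unique[OF z(1)[OF uw(1)] z(1)[OF uw(2)], of "ball u r \<inter> ball w r" 0 m z])
      show "connected (ball u r \<inter> ball w r)" by (intro convex_connected convex_Int convex_ball)
      show "\<zeta> u m = \<zeta> w (m + 0)" using on_U[OF uw(1) mU m(1)] on_U[OF uw(2) mU m(2)] by simp
    qed (use m uw in auto)
    then show ?thesis by simp
  qed
  obtain \<eta>' where e: "local_coords S (\<Union>u\<in>U. ball u r) \<eta>'" "\<forall>u\<in>U. \<forall>z\<in>ball u r. \<eta>' z = \<zeta> u z"
    using local_coords_Union[of U "\<lambda>u. ball u r" \<zeta>] z(1) agree by blast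
  then have "\<forall>u\<in>U. \<eta>' u = \<eta> u" using z(2) r(1) by simp
  then show ?thesis using e by blast
qed

text \<open>A point at distance \<open>d\<close> from the corners is either at distance of order \<open>d\<close> from the boundary or lies
  in the disc around a point of the only side that is so close.\<close>

lemma chart_linear:
  assumes "good j z" "\<And>v. v \<in> corners j \<Longrightarrow> d \<le> cmod (z - v)" "0 < d"
  shows "chart S (isolation / 4 * d) (cls S (j, z))"
proof -
  define s where "s = isolation / 4 * d"
  have s: "0 < s" "s \<le> d / 4" using isolation assms(3) by (auto simp: s_def)
  have j: "j < num" "z \<in> region j" using assms(1) by (auto simp: good_def)
  show ?thesis
  proof (cases "\<exists>e\<in>edges S. fst e = j \<and> (\<exists>x\<in>side e. cmod (z - x) < s)")
    case True
    then obtain e x where e: "e \<in> edges S" "fst e = j" "x \<in> side e" "cmod (z - x) < s" by auto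
    have "d \<le> cmod (z - edge_start S e)" "d \<le> cmod (z - edge_end S e)" using assms(2) edge_ends_corners[OF e(1)] e(2) by auto
    moreover have "cmod (z - p) \<le> cmod (z - x) + cmod (x - p)" for p using norm_triangle_ineq[of "z - x" "x - p"] by simp
    ultimately have "d \<le> s + cmod (x - edge_start S e)" "d \<le> s + cmod (x - edge_end S e)"
      using e(4) by (meson add_right_mono less_imp_le order_trans)+
    then have "d / 2 \<le> min (cmod (x - edge_start S e)) (cmod (x - edge_end S e))" using s assms(3) by auto
    then have "isolation * (d / 2) \<le> edge_radius e x" unfolding edge_radius_def using isolation(1) by (intro mult_left_mono) auto
    then have R: "2 * s \<le> edge_radius e x" by (simp add: s_def mult.commute)
    have "z \<in> ball x (edge_radius e x)" using e(4) R s by (simp add: dist_norm norm_minus_commute)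
    then have "edge_chart e x (z - x) = cls S (j, z)" using edge_chart(2)[OF e(1,3)] e(2) j(2) by simp
    moreover have "ball (z - x) s \<subseteq> ball 0 (edge_radius e x)"
    proof
      fix y assume "y \<in> ball (z - x) s"
      then have "cmod (z - x - y) < s" by (simp add: dist_norm)
      moreover have "cmod y \<le> cmod (z - x) + cmod (z - x - y)" by (metis norm_triangle_sub norm_minus_commute)
      ultimately show "y \<in> ball 0 (edge_radius e x)" using e(4) R by simp
    qed
    ultimately show ?thesis using chart_ball[OF edge_chart(1)[OF e(1,3)], of "z - x" s] by (simp add: s_def)
  next
    case False
    then have "ball z s \<inter> bdry j = {}" using bdry_side[OF j(1)] by (fastforce simp: dist_norm)
    moreover have zs: "z \<in> ball z s" using s by simp
    moreover have "z \<in> interior_part j" using calculation j(2) unfolding polygon_region_def by blast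
    ultimately have "ball z s \<subseteq> interior_part j"
      by (intro inside_connected[of _ "bdry j" z]) auto
    then show ?thesis using interior_chart[OF j(1), of z s] unfolding chart_def s_def[symmetric]
      by (intro exI[of _ "\<lambda>w. cls S (j, z + w)"]) auto
  qed
qed

lemma regular_chart:
  assumes "q \<in> regular_points S" shows "\<exists>r>0. chart S r q"
proof -
  obtain j z where jz: "(j, z) \<in> q" using regular_rep assms by blast
  note g = regular_good[OF assms jz]
  have "finite (corners j)" "z \<notin> corners j" using g by (auto simp: good_def)
  then obtain d where "d > 0" "\<forall>v\<in>corners j. d \<le> dist z v" using finite_set_avoid[of "corners j" z] by (metis dist_commute)
  then show ?thesis using chart_linear[OF g(1), of d] g(2) isolation(1)
    by (intro exI[of _ "isolation / 4 * d"]) (auto simp: dist_norm)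
qed

end

section \<open>Area and integrals\<close>

context flat_surface
begin

lemma negligible_side: "e \<in> edges S \<Longrightarrow> negligible (side e)"
proof -
  assume e: "e \<in> edges S"
  define n where "n = \<i> * (edge_end S e - edge_start S e)"
  have eq: "left_side e z = n \<bullet> z - n \<bullet> edge_start S e" for z
    by (simp add: n_def left_of_def inner_complex_def algebra_simps)
  have "side e \<subseteq> {z. n \<bullet> z = n \<bullet> edge_start S e}"
  proof
    fix z assume "z \<in> side e"
    then show "z \<in> {z. n \<bullet> z = n \<bullet> edge_start S e}" using left_of_segment[of z] eq[of z] by simp
  qed
  moreover have "n \<noteq> 0" using edge_start_neq_end[OF e] by (simp add: n_def)
  ultimately show ?thesis using negligible_hyperplane negligible_subset by blast
qed

lemma negligible_bdry: "j < num \<Longrightarrow> negligible (bdry j)"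
proof -
  assume "j < num"
  then have "bdry j \<subseteq> (\<Union>e\<in>edges S. side e)" using bdry_side by blast
  moreover have "negligible (\<Union>e\<in>edges S. side e)" using finite_edges negligible_side by (intro negligible_Union) auto
  ultimately show ?thesis using negligible_subset by blast
qed

lemma bdry_null: "j < num \<Longrightarrow> bdry j \<in> null_sets lborel"
  using negligible_bdry closed_polygon_boundary(1) null_sets_completion_iff[of "bdry j" lborel]
  by (auto simp: negligible_iff_null_sets)

lemma AE_interior: "j < num \<Longrightarrow> AE z in lborel. z \<in> region j \<longrightarrow> z \<in> interior_part j"
proof -
  assume "j < num"
  from AE_not_in[OF bdry_null[OF this]] show ?thesis by eventually_elim (auto simp: polygon_region_def)
qed

lemma AE_good: "j < num \<Longrightarrow> AE z in lborel. z \<in> region j \<longrightarrow> good j z"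
proof -
  assume j: "j < num"
  from AE_interior[OF j] show ?thesis by eventually_elim (auto intro: interior_good[OF j])
qed

text \<open>Coordinates map into a polygon by translations, but not by the same one everywhere. A sheet collects the points with a
  common translation.\<close>

definition sheet :: "complex set \<Rightarrow> (complex \<Rightarrow> point) \<Rightarrow> nat \<Rightarrow> complex \<Rightarrow> complex set" where
  "sheet W \<eta> j c = {z \<in> W. z + c \<in> interior_part j \<and> \<eta> z = cls S (j, z + c)}"

lemma open_sheet:
  assumes "local_coords S W \<eta>" "j < num" shows "open (sheet W \<eta> j c)"
  unfolding open_contains_ball
proof
  fix z assume z: "z \<in> sheet W \<eta> j c"
  obtain d where d: "d > 0" "\<forall>(j, p)\<in>\<eta> z. \<forall>p'\<in>region j. dist p' p < d \<longrightarrow> z + (p' - p) \<in> W \<and> \<eta> (z + (p' - p)) = cls S (j, p')"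
    using local_coords_rep[OF assms(1), of z] z unfolding sheet_def by blast
  obtain r where r: "r > 0" "ball (z + c) r \<subseteq> interior_part j" using z open_interior_part[of j] unfolding sheet_def open_contains_ball by blast
  have "y \<in> sheet W \<eta> j c" if y: "y \<in> ball z (min d r)" for y
  proof -
    have yi: "y + c \<in> interior_part j" using r(2) y by (auto simp: subset_eq dist_norm)
    have "(j, z + c) \<in> \<eta> z" using z in_cls by (auto simp: sheet_def)
    moreover have "dist (y + c) (z + c) < d" using y by (simp add: dist_norm norm_minus_commute)
    ultimately have "z + (y + c - (z + c)) \<in> W \<and> \<eta> (z + (y + c - (z + c))) = cls S (j, y + c)"
      using d(2) yi by (fastforce simp: polygon_region_def)
    then show ?thesis using yi by (simp add: sheet_def)
  qed
  then show "\<exists>e>0. ball z e \<subseteq> sheet W \<eta> j c" using d(1) r(1) by (intro exI[of _ "min d r"]) auto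
qed

lemma sheet_disjoint:
  assumes "j < num" "i < num" "z \<in> sheet W \<eta> j c" "z \<in> sheet W \<eta> i b" shows "j = i" "c = b"
proof -
  have "cls S (j, z + c) = cls S (i, z + b)" using assms by (simp add: sheet_def)
  then show "j = i" "c = b" using cls_interior[OF assms(1), of "z + c"] cls_interior[OF assms(2), of "z + b"] assms(3,4)
    by (auto simp: sheet_def)
qed

text \<open>The sheets are disjoint open sets, hence countably many; outside of them only the boundaries are met.\<close>

lemma sheets_countable:
  assumes "local_coords S W \<eta>"
  shows "countable {(j, c). j < num \<and> sheet W \<eta> j c \<noteq> {}}" (is "countable ?I")
proof -
  let ?f = "\<lambda>(j, c). sheet W \<eta> j c"
  have dis: "x = y" if "x \<in> ?I" "y \<in> ?I" "z \<in> ?f x" "z \<in> ?f y" for x y z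
  proof -
    obtain j c i b where "x = (j, c)" "y = (i, b)" by (cases x; cases y)
    then show ?thesis using sheet_disjoint[of j i z W \<eta> c b] that by simp
  qed
  have "inj_on ?f ?I"
  proof (rule inj_onI)
    fix x y assume xy: "x \<in> ?I" "y \<in> ?I" "?f x = ?f y"
    then obtain z where "z \<in> ?f x" by auto
    then show "x = y" using dis[OF xy(1,2), of z] xy(3) by simp
  qed
  moreover have "countable (?f ` ?I)"
  proof (rule countable_disjoint_open_subsets)
    show "pairwise disjnt (?f ` ?I)" unfolding pairwise_def disjnt_def using dis by blast
  qed (use open_sheet[OF assms] in auto)
  ultimately show ?thesis by (simp add: countable_image_inj_eq)
qed

lemma sheets_conull:
  assumes "local_coords S W \<eta>"
  defines "N \<equiv> W - (\<Union>j<num. \<Union>c. sheet W \<eta> j c)"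
  shows "N \<in> null_sets lborel"
proof -
  have "open (\<Union>j<num. \<Union>c. sheet W \<eta> j c)" using open_sheet[OF assms(1)] by auto
  then have N: "N \<in> sets lborel" using local_coords_open[OF assms(1)] unfolding N_def
    by (intro sets.Diff) (simp_all add: borel_open)
  have "negligible N"
  proof (subst locally_negligible_alt, rule ballI)
    fix x assume x: "x \<in> N"
    then have xW: "x \<in> W" by (simp add: N_def)
    obtain d where d: "d > 0" "\<forall>v\<in>ball (0::complex) d. x + v \<in> W \<and> (\<exists>(j, p)\<in>\<eta> x. p + v \<in> region j \<and> \<eta> (x + v) = cls S (j, p + v))"
      using local_coords_cover[OF assms(1) xW] by blast
    have sub: "N \<inter> ball x d \<subseteq> (\<Union>(j, p)\<in>\<eta> x. (+) (x - p) ` bdry j)"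
    proof
      fix z assume z: "z \<in> N \<inter> ball x d"
      then have "z - x \<in> ball 0 d" by (simp add: dist_norm norm_minus_commute)
      then obtain j p where jp: "(j, p) \<in> \<eta> x" "p + (z - x) \<in> region j" "\<eta> (x + (z - x)) = cls S (j, p + (z - x))" using d(2) by blast
      have j: "j < num" using regular_good(1)[OF local_coords_regular[OF assms(1) xW] jp(1)] by (simp add: good_def)
      have "z \<notin> sheet W \<eta> j (p - x)" using z j by (auto simp: N_def)
      then have "p + (z - x) \<notin> interior_part j" using z jp by (auto simp: sheet_def N_def algebra_simps)
      then have "p + (z - x) \<in> bdry j" using jp(2) by (auto simp: polygon_region_def)
      then have "z \<in> (+) (x - p) ` bdry j" by (intro image_eqI[of _ _ "p + (z - x)"]) auto
      then show "z \<in> (\<Union>(j, p)\<in>\<eta> x. (+) (x - p) ` bdry j)" using jp(1) by blast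
    qed
    have "negligible (\<Union>(j, p)\<in>\<eta> x. (+) (x - p) ` bdry j)"
      using finite_regular[OF local_coords_regular[OF assms(1) xW]]
      by (intro negligible_Union)
         (auto intro!: negligible_translation negligible_bdry dest: regular_good(1)[OF local_coords_regular[OF assms(1) xW]] simp: good_def)
    then have "negligible (N \<inter> ball x d)" using sub negligible_subset by blast
    then show "\<exists>U. openin (top_of_set N) U \<and> x \<in> U \<and> negligible U"
      using x d(1) by (intro exI[of _ "N \<inter> ball x d"]) (auto intro: openin_open_Int)
  qed
  then show ?thesis using N null_sets_completion_iff[of N lborel] by (simp add: negligible_iff_null_sets)
qed

definition interior_trace :: "point set \<Rightarrow> nat \<Rightarrow> complex set" where
  "interior_trace A j = {p \<in> interior_part j. cls S (j, p) \<in> A}"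

text \<open>Coordinates preserve area: on each sheet they are a translation.\<close>

lemma area_image:
  assumes l: "local_coords S W \<eta>" and G: "G \<in> sets lborel" "G \<subseteq> W" "inj_on \<eta> G"
  shows "\<And>j. j < num \<Longrightarrow> interior_trace (\<eta> ` G) j \<in> sets lborel"
    and "(\<Sum>j<num. emeasure lborel (interior_trace (\<eta> ` G) j)) = emeasure lborel G"
proof -
  define I where "I j = {c. sheet W \<eta> j c \<noteq> {}}" for j
  have cI: "countable (I j)" if "j < num" for j
    by (rule countable_subset[OF _ countable_image[OF sheets_countable[OF l], of snd]]) (use that in \<open>force simp: I_def\<close>)
  define X where "X j c = G \<inter> sheet W \<eta> j c" for j c
  define Y where "Y j c = (+) (- c) -` X j c" for j c
  have X: "X j c \<in> sets lborel" if "j < num" for j c using G open_sheet[OF l that] by (auto simp: X_def)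
  have Y: "Y j c \<in> sets lborel" if "j < num" for j c
    using measurable_sets[of "(+) (- c)" lborel lborel "X j c"] X[OF that] by (auto simp: Y_def)
  have XY: "emeasure lborel (Y j c) = emeasure lborel (X j c)" if "j < num" for j c
  proof -
    have "emeasure lborel (X j c) = emeasure (distr lborel borel ((+) (- c))) (X j c)" by (simp add: lborel_distr_plus)
    also have "\<dots> = emeasure lborel (Y j c)" using X[OF that, of c] by (subst emeasure_distr) (auto simp: Y_def)
    finally show ?thesis by simp
  qed
  have trace: "interior_trace (\<eta> ` G) j = (\<Union>c\<in>I j. Y j c)" if "j < num" for j
  proof safe
    fix p assume "p \<in> interior_trace (\<eta> ` G) j"
    then obtain z where z: "z \<in> G" "p \<in> interior_part j" "cls S (j, p) = \<eta> z" by (auto simp: interior_trace_def)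
    then have "z \<in> sheet W \<eta> j (p - z)" using G(2) by (auto simp: sheet_def)
    then show "p \<in> (\<Union>c\<in>I j. Y j c)" using z(1) by (intro UN_I[of "p - z"]) (auto simp: I_def Y_def X_def)
  next
    fix p c assume "p \<in> Y j c"
    then have "- c + p \<in> G" "- c + p \<in> sheet W \<eta> j c" by (auto simp: Y_def X_def)
    then have "p \<in> interior_part j" "cls S (j, p) = \<eta> (- c + p)" "- c + p \<in> G" by (auto simp: sheet_def)
    then show "p \<in> interior_trace (\<eta> ` G) j" unfolding interior_trace_def by blast
  qed
  show "interior_trace (\<eta> ` G) j \<in> sets lborel" if "j < num" for j
    unfolding trace[OF that] using Y[OF that] cI[OF that] by auto
  have dX: "disjoint_family_on (X j) (I j)" if "j < num" for j
    unfolding disjoint_family_on_def X_def using sheet_disjoint(2)[OF that that] by blast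
  have dY: "disjoint_family_on (Y j) (I j)" if "j < num" for j
    unfolding disjoint_family_on_def
  proof (intro ballI impI)
    fix b c assume bc: "b \<in> I j" "c \<in> I j" "b \<noteq> c"
    show "Y j b \<inter> Y j c = {}"
    proof (rule ccontr)
      assume "Y j b \<inter> Y j c \<noteq> {}"
      then obtain p where p: "p \<in> Y j b" "p \<in> Y j c" by blast
      then have "\<eta> (- b + p) = cls S (j, p)" "\<eta> (- c + p) = cls S (j, p)" "- b + p \<in> G" "- c + p \<in> G"
        by (auto simp: Y_def X_def sheet_def)
      then have "- b + p = - c + p" using G(3) by (simp add: inj_on_def)
      then show False using bc(3) by simp
    qed
  qed
  define B where "B j = (\<Union>c\<in>I j. X j c)" for j
  have B: "B j \<in> sets lborel" if "j < num" for j unfolding B_def using X[OF that] cI[OF that] by auto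
  have "emeasure lborel (interior_trace (\<eta> ` G) j) = emeasure lborel (B j)" if "j < num" for j
    unfolding trace[OF that] B_def
    using emeasure_UN_countable[of "I j" "Y j" lborel] emeasure_UN_countable[of "I j" "X j" lborel] X Y dX dY cI XY that by simp
  then have "(\<Sum>j<num. emeasure lborel (interior_trace (\<eta> ` G) j)) = (\<Sum>j<num. emeasure lborel (B j))" by simp
  also have "\<dots> = emeasure lborel (\<Union>j<num. B j)"
  proof (rule sum_emeasure)
    show "disjoint_family_on B {..<num}" 
      unfolding disjoint_family_on_def B_def X_def using sheet_disjoint(1) by blast
  qed (use B in auto)
  also have "\<dots> = emeasure lborel G"
  proof (rule emeasure_eq_AE)
    show "AE x in lborel. x \<in> (\<Union>j<num. B j) \<longleftrightarrow> x \<in> G"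
      using AE_not_in[OF sheets_conull[OF l]]
    proof (eventually_elim)
      case (elim x)
      then show ?case using G(2) by (auto simp: B_def X_def I_def)
    qed
  qed (use B G in auto)
  finally show "(\<Sum>j<num. emeasure lborel (interior_trace (\<eta> ` G) j)) = emeasure lborel G" .
qed

definition surface_integrable :: "(point \<Rightarrow> 'b::{banach, second_countable_topology}) \<Rightarrow> bool" where
  "surface_integrable f \<longleftrightarrow> (\<forall>j<num. set_integrable lborel (region j) (\<lambda>z. f (cls S (j, z))))"

lemma region_borel: "j < num \<Longrightarrow> region j \<in> sets borel"
  by (simp add: borel_closed compact_imp_closed compact_region)

lemma continuous_integrable:
  assumes "\<And>j. j < num \<Longrightarrow> continuous_on (region j) (\<lambda>z. f (cls S (j, z)))"
  shows "surface_integrable f"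
  using borel_integrable_compact[OF compact_region assms] by (auto simp: surface_integrable_def set_integrable_def)

lemma surface_integral_add:
  "surface_integrable f \<Longrightarrow> surface_integrable g \<Longrightarrow> surface_integral S (\<lambda>q. f q + g q) = surface_integral S f + surface_integral S g"
  by (simp add: surface_integral_def surface_integrable_def set_integral_add sum.distrib)

lemma surface_integral_mult:
  fixes c :: "'b::{real_normed_field, banach, second_countable_topology}"
  shows "surface_integral S (\<lambda>q. c * f q) = c * surface_integral S f"
  by (simp add: surface_integral_def sum_distrib_left)

lemma surface_integral_mono:
  fixes f g :: "point \<Rightarrow> real"
  assumes g: "surface_integrable g" and le: "\<And>q. q \<in> regular_points S \<Longrightarrow> f q \<le> g q"
    and pos: "\<And>q. q \<in> regular_points S \<Longrightarrow> 0 \<le> g q"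
  shows "surface_integral S f \<le> surface_integral S g"
  unfolding surface_integral_def set_lebesgue_integral_def
proof (rule sum_mono)
  fix j assume "j \<in> {..<num}"
  then have j: "j < num" by simp
  show "(LINT z|lborel. indicator (region j) z *\<^sub>R f (cls S (j, z))) \<le> (LINT z|lborel. indicator (region j) z *\<^sub>R g (cls S (j, z)))"
  proof (rule integral_mono_AE')
    show "integrable lborel (\<lambda>z. indicator (region j) z *\<^sub>R g (cls S (j, z)))"
      using g j by (simp add: surface_integrable_def set_integrable_def)
    show "AE z in lborel. indicator (region j) z *\<^sub>R f (cls S (j, z)) \<le> indicator (region j) z *\<^sub>R g (cls S (j, z))"
      using AE_good[OF j] by eventually_elim (auto simp: indicator_def intro: le good_regular)
    show "AE z in lborel. 0 \<le> indicator (region j) z *\<^sub>R g (cls S (j, z))"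
      using AE_good[OF j] by eventually_elim (auto simp: indicator_def intro: pos good_regular)
  qed
qed

definition total_area :: real where "total_area = surface_integral S (\<lambda>_. 1)"

lemma surface_integral_const: "surface_integral S (\<lambda>_. c) = c * (total_area :: real)"
  using surface_integral_mult[of c "\<lambda>_. 1"] by (simp add: total_area_def)

lemma surface_integrable_const: "surface_integrable (\<lambda>_. c)"
  by (intro continuous_integrable) auto

text \<open>On an injective image of a plane set the area is that of the plane set, so bounds there give bounds for the integral.\<close>

lemma surface_integral_ge_image:
  fixes u :: "point \<Rightarrow> real"
  assumes l: "local_coords S W \<eta>" and G: "G \<in> sets lborel" "G \<subseteq> W" "inj_on \<eta> G" "emeasure lborel G < \<infinity>"
    and u: "surface_integrable u" "\<And>q. q \<in> regular_points S \<Longrightarrow> 0 \<le> u q" "\<And>z. z \<in> G \<Longrightarrow> a \<le> u (\<eta> z)"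
  shows "a * measure lborel G \<le> surface_integral S u"
proof -
  let ?T = "interior_trace (\<eta> ` G)"
  note T = area_image[OF l G(1-3)]
  have fin: "emeasure lborel (?T j) < \<infinity>" if "j < num" for j
    using member_le_sum[of j "{..<num}" "\<lambda>j. emeasure lborel (?T j)"] that T(2) G(4) by simp
  have meas: "(\<Sum>j<num. measure lborel (?T j)) = measure lborel G"
  proof -
    have "(\<Sum>j<num. ennreal (measure lborel (?T j))) = ennreal (measure lborel G)"
      using T(2) fin G(4) by (simp add: emeasure_eq_ennreal_measure less_top)
    then show ?thesis by (subst (asm) sum_ennreal) (auto simp: sum_nonneg)
  qed
  have "a * measure lborel (?T j) \<le> (LINT z|lborel. indicator (region j) z *\<^sub>R u (cls S (j, z)))" if j: "j < num" for j
  proof -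
    have "a * measure lborel (?T j) = (LINT z|lborel. indicator (?T j) z *\<^sub>R a)"
      using T(1)[OF j] fin[OF j] by (simp add: mult.commute)
    also have "\<dots> \<le> (LINT z|lborel. indicator (region j) z *\<^sub>R u (cls S (j, z)))"
    proof (rule integral_mono_AE)
      show "integrable lborel (\<lambda>z. indicator (?T j) z *\<^sub>R a)" using T(1)[OF j] fin[OF j] by simp
      show "integrable lborel (\<lambda>z. indicator (region j) z *\<^sub>R u (cls S (j, z)))"
        using u(1) j by (simp add: surface_integrable_def set_integrable_def)
      show "AE z in lborel. indicator (?T j) z *\<^sub>R a \<le> indicator (region j) z *\<^sub>R u (cls S (j, z))"
        using AE_good[OF j]
      proof eventually_elim
        case (elim z)
        have "z \<in> region j \<and> a \<le> u (cls S (j, z))" if "z \<in> ?T j"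
          using that u(3) by (auto simp: interior_trace_def polygon_region_def)
        moreover have "0 \<le> u (cls S (j, z))" if "z \<in> region j" using that elim u(2) good_regular by blast
        ultimately show ?case by (auto simp: indicator_def)
      qed
    qed
    finally show ?thesis .
  qed
  then show ?thesis unfolding surface_integral_def set_lebesgue_integral_def meas[symmetric] sum_distrib_left
    by (intro sum_mono) simp
qed

lemma surface_integral_le_image:
  fixes u :: "point \<Rightarrow> real"
  assumes l: "local_coords S W \<eta>" and G: "G \<in> sets lborel" "G \<subseteq> W" "inj_on \<eta> G" "emeasure lborel G < \<infinity>"
    and b: "0 \<le> b" and u: "\<And>q. q \<in> regular_points S \<Longrightarrow> u q \<le> b" "\<And>q. q \<in> regular_points S \<Longrightarrow> q \<notin> \<eta> ` G \<Longrightarrow> u q \<le> 0"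
  shows "surface_integral S u \<le> b * measure lborel G"
proof -
  let ?T = "interior_trace (\<eta> ` G)"
  note T = area_image[OF l G(1-3)]
  have fin: "emeasure lborel (?T j) < \<infinity>" if "j < num" for j
    using member_le_sum[of j "{..<num}" "\<lambda>j. emeasure lborel (?T j)"] that T(2) G(4) by simp
  have meas: "(\<Sum>j<num. measure lborel (?T j)) = measure lborel G"
  proof -
    have "(\<Sum>j<num. ennreal (measure lborel (?T j))) = ennreal (measure lborel G)"
      using T(2) fin G(4) by (simp add: emeasure_eq_ennreal_measure less_top)
    then show ?thesis by (subst (asm) sum_ennreal) (auto simp: sum_nonneg)
  qed
  have "(LINT z|lborel. indicator (region j) z *\<^sub>R u (cls S (j, z))) \<le> b * measure lborel (?T j)" if j: "j < num" for j
  proof -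
    have "(LINT z|lborel. indicator (region j) z *\<^sub>R u (cls S (j, z))) \<le> (LINT z|lborel. indicator (?T j) z *\<^sub>R b)"
    proof (rule integral_mono_AE')
      show "integrable lborel (\<lambda>z. indicator (?T j) z *\<^sub>R b)" using T(1)[OF j] fin[OF j] by simp
      show "AE z in lborel. indicator (region j) z *\<^sub>R u (cls S (j, z)) \<le> indicator (?T j) z *\<^sub>R b"
        using AE_interior[OF j]
      proof eventually_elim
        case (elim z)
        show ?case
        proof (cases "z \<in> region j")
          case True
          then have z: "z \<in> interior_part j" "cls S (j, z) \<in> regular_points S" using elim interior_good[OF j] good_regular by auto
          then have "z \<notin> ?T j \<Longrightarrow> u (cls S (j, z)) \<le> 0" using u(2) by (auto simp: interior_trace_def)
          then show ?thesis using True u(1)[OF z(2)] by (auto simp: indicator_def)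
        qed (use b in \<open>auto simp: indicator_def\<close>)
      qed
    qed (use b in auto)
    then show ?thesis using T(1)[OF j] fin[OF j] by (simp add: mult.commute)
  qed
  then show ?thesis unfolding surface_integral_def set_lebesgue_integral_def meas[symmetric] sum_distrib_left
    by (intro sum_mono) simp
qed

end

section \<open>Long strips without vertices\<close>

text \<open>Coordinates along the direction \<open>\<xi>\<close> and to the left of it.\<close>

definition lon :: "complex \<Rightarrow> complex \<Rightarrow> real" where "lon \<xi> z = Re (cnj \<xi> * z)"
definition lat :: "complex \<Rightarrow> complex \<Rightarrow> real" where "lat \<xi> z = Im (cnj \<xi> * z)"

lemma lon_lat_linear [simp]:
  "lon \<xi> (z + w) = lon \<xi> z + lon \<xi> w" "lat \<xi> (z + w) = lat \<xi> z + lat \<xi> w"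
  "lon \<xi> (z - w) = lon \<xi> z - lon \<xi> w" "lat \<xi> (z - w) = lat \<xi> z - lat \<xi> w"
  by (simp_all add: lon_def lat_def algebra_simps)

lemma lon_lat_inner: "lon \<xi> z = \<xi> \<bullet> z" "lat \<xi> z = (\<i> * \<xi>) \<bullet> z"
  by (simp_all add: lon_def lat_def inner_complex_def)

definition strip :: "complex \<Rightarrow> real \<Rightarrow> real \<Rightarrow> real \<Rightarrow> complex set" where
  "strip \<xi> l y w = {z. 0 < lon \<xi> z \<and> lon \<xi> z < l \<and> \<bar>lat \<xi> z - y\<bar> < w}"

lemma open_strip: "open (strip \<xi> l y w)"
  unfolding strip_def lon_lat_inner by (intro open_Collect_conj open_Collect_less continuous_intros)

lemma convex_strip: "convex (strip \<xi> l y w)"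
proof -
  have eq: "strip \<xi> l y w = {z. 0 < \<xi> \<bullet> z} \<inter> {z. \<xi> \<bullet> z < l} \<inter> {z. y - w < (\<i> * \<xi>) \<bullet> z} \<inter> {z. (\<i> * \<xi>) \<bullet> z < y + w}"
    unfolding strip_def lon_lat_inner by auto
  show ?thesis unfolding eq
    using convex_halfspace_gt[of 0 \<xi>] convex_halfspace_lt[of \<xi> l] convex_halfspace_gt[of "y - w" "\<i> * \<xi>"] convex_halfspace_lt[of "\<i> * \<xi>" "y + w"]
    by (intro convex_Int) auto
qed

lemma strip_mono: "l \<le> l' \<Longrightarrow> strip \<xi> l y w \<subseteq> strip \<xi> l' y w"
  by (auto simp: strip_def)

context flat_surface
begin

text \<open>Discs in which no point has coordinates on a disc four times as large lie close to the corners; so the area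
  bounds their number when they do not overlap.\<close>

lemma few_discs_near_corners:
  "\<exists>M::nat. \<forall>w>0. \<forall>(B :: nat set) W \<eta> z. finite B \<longrightarrow> (\<forall>i\<in>B. local_coords S (W i) (\<eta> i)) \<longrightarrow>
     (\<forall>i\<in>B. \<forall>k\<in>B. i \<noteq> k \<longrightarrow> W i \<inter> W k = {}) \<longrightarrow> (\<forall>i\<in>B. ball (z i) w \<subseteq> W i) \<longrightarrow>
     (\<forall>i\<in>B. \<forall>u\<in>ball (z i) w. \<not> chart S (4 * w) (\<eta> i u)) \<longrightarrow>
     (\<forall>i\<in>B. \<forall>k\<in>B. \<forall>u\<in>ball (z i) w. \<forall>v\<in>ball (z k) w. \<eta> i u = \<eta> k v \<longrightarrow> u = v) \<longrightarrow> card B \<le> M"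
proof -
  define Nc where "Nc = (\<Sum>j<num. card (corners j))"
  define M where "M = nat \<lceil>real Nc * (256 / isolation\<^sup>2)\<rceil>"
  have "card B \<le> M" if w: "w > 0" and fin: "finite B" and l: "\<forall>i\<in>B. local_coords S (W i) (\<eta> i)"
    and dis: "\<forall>i\<in>B. \<forall>k\<in>B. i \<noteq> k \<longrightarrow> W i \<inter> W k = {}" and sub: "\<forall>i\<in>B. ball (z i) w \<subseteq> W i"
    and nc: "\<forall>i\<in>B. \<forall>u\<in>ball (z i) w. \<not> chart S (4 * w) (\<eta> i u)"
    and inj: "\<forall>i\<in>B. \<forall>k\<in>B. \<forall>u\<in>ball (z i) w. \<forall>v\<in>ball (z k) w. \<eta> i u = \<eta> k v \<longrightarrow> u = v"
    for w :: real and B :: "nat set" and W \<eta> z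
  proof -
    obtain \<zeta> where ze: "local_coords S (\<Union>i\<in>B. W i) \<zeta>" "\<forall>i\<in>B. \<forall>u\<in>W i. \<zeta> u = \<eta> i u"
    proof -
      have "\<exists>\<zeta>. local_coords S (\<Union>i\<in>B. W i) \<zeta> \<and> (\<forall>i\<in>B. \<forall>z\<in>W i. \<zeta> z = \<eta> i z)"
      proof (rule local_coords_Union)
        show "local_coords S (W i) (\<eta> i)" if "i \<in> B" for i using l that by blast
        show "\<eta> i u = \<eta> k u" if "i \<in> B" "k \<in> B" "u \<in> W i" "u \<in> W k" for i k u
          using dis that by (cases "i = k") auto
      qed
      then show thesis using that by blast
    qed
    define G where "G = (\<Union>i\<in>B. ball (z i) w)"
    have \<zeta>: "\<zeta> u = \<eta> i u" if "i \<in> B" "u \<in> ball (z i) w" for i u using ze(2) sub that by blast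
    have G: "G \<in> sets lborel" "G \<subseteq> (\<Union>i\<in>B. W i)" "inj_on \<zeta> G"
    proof -
      show "G \<in> sets lborel" unfolding G_def by (simp add: borel_open)
      show "G \<subseteq> (\<Union>i\<in>B. W i)" unfolding G_def using sub by blast
      show "inj_on \<zeta> G"
      proof (rule inj_onI)
        fix u v assume "u \<in> G" "v \<in> G" and e: "\<zeta> u = \<zeta> v"
        then obtain i k where ik: "i \<in> B" "u \<in> ball (z i) w" "k \<in> B" "v \<in> ball (z k) w" unfolding G_def by blast
        then show "u = v" using inj e \<zeta> by metis
      qed
    qed
    define R where "R = 16 * w / isolation"
    have R: "R > 0" "isolation / 4 * R = 4 * w" using isolation(1) w by (auto simp: R_def)
    have tr: "interior_trace (\<zeta> ` G) j \<subseteq> (\<Union>v\<in>corners j. ball v R)" if j: "j < num" for j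
    proof
      fix p assume p: "p \<in> interior_trace (\<zeta> ` G) j"
      then have nch: "\<not> chart S (4 * w) (cls S (j, p))" and pj: "p \<in> interior_part j"
        using nc \<zeta> by (auto simp: interior_trace_def G_def)
      show "p \<in> (\<Union>v\<in>corners j. ball v R)"
      proof (rule ccontr)
        assume "p \<notin> (\<Union>v\<in>corners j. ball v R)"
        then have "R \<le> cmod (p - v)" if "v \<in> corners j" for v using that by (force simp: dist_norm norm_minus_commute)
        then show False using chart_linear[OF interior_good[OF j pj], of R] R nch by simp
      qed
    qed
    have eb: "emeasure lborel (ball v \<rho> :: complex set) = ennreal (pi * \<rho>\<^sup>2)" if "\<rho> > 0" for v \<rho>
      using emeasure_ball[of \<rho> v] that by (simp add: unit_ball_vol_2)
    have "ennreal (real (card B) * (pi * w\<^sup>2)) = (\<Sum>i\<in>B. emeasure lborel (ball (z i) w))"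
      using w by (simp add: eb ennreal_mult'' ennreal_of_nat_eq_real_of_nat)
    also have "\<dots> = emeasure lborel G" unfolding G_def
    proof (rule sum_emeasure)
      show "disjoint_family_on (\<lambda>i. ball (z i) w) B" unfolding disjoint_family_on_def using dis sub by blast
    qed (use fin in auto)
    also have "\<dots> = (\<Sum>j<num. emeasure lborel (interior_trace (\<zeta> ` G) j))" using area_image(2)[OF ze(1) G] by simp
    also have "\<dots> \<le> (\<Sum>j<num. emeasure lborel (\<Union>v\<in>corners j. ball v R))"
      using tr by (intro sum_mono emeasure_mono) auto
    also have "\<dots> \<le> (\<Sum>j<num. \<Sum>v\<in>corners j. emeasure lborel (ball v R))"
      by (intro sum_mono emeasure_subadditive_finite) auto
    also have "\<dots> = ennreal (real Nc * (pi * R\<^sup>2))"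
      using R(1) by (simp add: eb Nc_def ennreal_of_nat_eq_real_of_nat sum_distrib_right[symmetric] ennreal_mult'' sum_nonneg flip: of_nat_sum)
    finally have "real (card B) * (pi * w\<^sup>2) \<le> real Nc * (pi * R\<^sup>2)" by (subst (asm) ennreal_le_iff) auto
    also have "\<dots> = real Nc * (256 / isolation\<^sup>2) * (pi * w\<^sup>2)" by (simp add: R_def power_divide power_mult_distrib)
    finally have "real (card B) \<le> real Nc * (256 / isolation\<^sup>2)" by (rule mult_right_le_imp_le) (use w in simp)
    then show ?thesis unfolding M_def by linarith
  qed
  then show ?thesis by blast
qed

end

locale base_disc = flat_surface +
  fixes c :: complex and r :: real and \<xi> :: complex
  assumes base: "ball c (2 * r) \<subseteq> interior_part 0" and r: "0 < r" and \<xi>: "cmod \<xi> = 1"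
begin

lemma rotate: "\<xi> * cnj \<xi> = 1" "cnj \<xi> * \<xi> = 1"
  using \<xi> complex_norm_square[of \<xi>] by (auto simp: mult.commute)

lemma rotate_back: "cnj \<xi> * (\<xi> * z) = z" using rotate by (simp add: mult.assoc[symmetric])

lemma rotate_split: "z = \<xi> * Complex (lon \<xi> z) (lat \<xi> z)"
proof -
  have "\<xi> * (cnj \<xi> * z) = z" by (simp only: mult.assoc[symmetric] rotate mult_1)
  then show ?thesis by (simp only: complex_surj lon_def lat_def)
qed

lemma lon_lat_rotated [simp]: "lon \<xi> (\<xi> * Complex s t) = s" "lat \<xi> (\<xi> * Complex s t) = t"
  by (simp_all only: lon_def lat_def rotate_back complex.sel)

lemma strip_iff: "\<xi> * Complex s t \<in> strip \<xi> l y w \<longleftrightarrow> 0 < s \<and> s < l \<and> \<bar>t - y\<bar> < w"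
  by (simp add: strip_def)

lemma norm_rotate: "cmod z \<le> \<bar>lon \<xi> z\<bar> + \<bar>lat \<xi> z\<bar>"
  using cmod_le[of "cnj \<xi> * z"] \<xi> by (simp add: norm_mult lon_def lat_def)

lemma lon_lat_le: "\<bar>lon \<xi> z\<bar> \<le> cmod z" "\<bar>lat \<xi> z\<bar> \<le> cmod z"
  using abs_Re_le_cmod[of "cnj \<xi> * z"] abs_Im_le_cmod[of "cnj \<xi> * z"] \<xi> by (simp_all add: norm_mult lon_def lat_def)

text \<open>A tube is a system of coordinates on a long strip that starts in the base disc.\<close>

definition tube :: "real \<Rightarrow> real \<Rightarrow> real \<Rightarrow> (complex \<Rightarrow> point) \<Rightarrow> bool" where
  "tube l y w \<eta> \<longleftrightarrow> local_coords S (strip \<xi> l y w) \<eta> \<and> \<bar>y\<bar> + w \<le> r \<and>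
     (\<forall>z \<in> strip \<xi> (min l r) y w. \<eta> z = cls S (0, c + z))"

lemma strip_in_base: "\<bar>y\<bar> + w \<le> r \<Longrightarrow> l \<le> r \<Longrightarrow> z \<in> strip \<xi> l y w \<Longrightarrow> c + z \<in> interior_part 0"
proof -
  assume a: "\<bar>y\<bar> + w \<le> r" "l \<le> r" "z \<in> strip \<xi> l y w"
  then have "cmod z < 2 * r" using norm_rotate[of z] by (auto simp: strip_def)
  then show ?thesis using base by (auto simp: subset_eq dist_norm)
qed

lemma tube_shrink:
  assumes "tube l y w \<eta>" "l' \<le> l" "w' \<le> w" shows "tube l' y w' \<eta>"
proof -
  have sub: "strip \<xi> m' y w' \<subseteq> strip \<xi> m y w" if "m' \<le> m" for m m' using that assms(3) by (auto simp: strip_def)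
  have "local_coords S (strip \<xi> l' y w') \<eta>"
    using assms(1) local_coords_subset[OF _ open_strip sub[OF assms(2)]] by (simp add: tube_def)
  moreover have "strip \<xi> (min l' r) y w' \<subseteq> strip \<xi> (min l r) y w" using assms(2) by (intro sub) auto
  ultimately show ?thesis using assms(1,3) unfolding tube_def by (meson add_left_mono order_trans subsetD)
qed

lemma tube_base: "\<bar>y\<bar> + w \<le> r \<Longrightarrow> tube r y w (\<lambda>z. cls S (0, c + z))"
proof -
  assume a: "\<bar>y\<bar> + w \<le> r"
  have "strip \<xi> r y w \<subseteq> ball 0 (2 * r)"
  proof
    fix z assume "z \<in> strip \<xi> r y w"
    then have "cmod z < 2 * r" using norm_rotate[of z] a by (auto simp: strip_def)
    then show "z \<in> ball 0 (2 * r)" by simp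
  qed
  then show ?thesis using local_coords_subset[OF interior_chart[OF num_pos base] open_strip] a by (simp add: tube_def)
qed

text \<open>Two points of tubes with the same image are translates of each other along with their whole history; going back to the
  base disc, where the coordinates are injective, shows that they are equal if the time lag is less than \<open>r\<close>.\<close>

lemma tube_injective:
  assumes t: "tube l y w \<eta>" "tube l' y' w' \<eta>'" and z: "z \<in> strip \<xi> l y w" "z' \<in> strip \<xi> l' y' w'"
    and eq: "\<eta> z = \<eta>' z'" and lag: "\<bar>lon \<xi> ((z' - z))\<bar> < r"
  shows "z = z'"
proof -
  define h where "h = z' - z"
  define s where "s = lon \<xi> z"
  define sh where "sh = lon \<xi> h"
  have Re': "lon \<xi> z' = s + sh" and Im': "lat \<xi> z' = lat \<xi> z + lat \<xi> h"
    by (simp_all add: s_def sh_def h_def)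
  have s: "0 < s" "s < l" "0 < s + sh" "s + sh < l'" "\<bar>sh\<bar> < r"
  proof -
    have "0 < lon \<xi> z" "lon \<xi> z < l" "0 < lon \<xi> z'" "lon \<xi> z' < l'" using z by (simp_all add: strip_def)
    then show "0 < s" "s < l" "0 < s + sh" "s + sh < l'" unfolding Re'[symmetric] by (simp_all add: s_def)
    show "\<bar>sh\<bar> < r" using lag by (simp add: sh_def h_def)
  qed
  have "max 0 (- sh) < min s (min r (r - sh))" using s r by (auto simp: abs_less_iff)
  then obtain \<sigma> where \<sigma>: "max 0 (- sh) < \<sigma>" "\<sigma> < min s (min r (r - sh))" using dense by blast
  define u where "u = \<xi> * Complex \<sigma> (lat \<xi> z)"
  have u: "u \<in> strip \<xi> (min l r) y w" "u + h \<in> strip \<xi> (min l' r) y' w'"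
  proof -
    have "lon \<xi> u = \<sigma>" "lat \<xi> u = lat \<xi> z" "lon \<xi> (u + h) = \<sigma> + sh" "lat \<xi> (u + h) = lat \<xi> z'"
      by (simp_all add: u_def sh_def Im')
    then show "u \<in> strip \<xi> (min l r) y w" "u + h \<in> strip \<xi> (min l' r) y' w'"
      using \<sigma> s z unfolding strip_def by simp_all
  qed
  have u': "u \<in> strip \<xi> l y w" "u + h \<in> strip \<xi> l' y' w'"
    using u subsetD[OF strip_mono[of "min l r" l]] subsetD[OF strip_mono[of "min l' r" l']] by auto
  have "\<eta> u = \<eta>' (u + h)"
  proof (rule local_coords_unique[of "strip \<xi> l y w" \<eta> "strip \<xi> l' y' w'" \<eta>' "strip \<xi> l y w \<inter> {x. x + h \<in> strip \<xi> l' y' w'}" h z u])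
    have "{x. x + h \<in> strip \<xi> l' y' w'} = (+) (- h) ` strip \<xi> l' y' w'"
      by (auto intro!: image_eqI[where x = "_ + h"])
    then show "connected (strip \<xi> l y w \<inter> {x. x + h \<in> strip \<xi> l' y' w'})"
      by (simp add: convex_connected convex_Int convex_strip convex_translation)
  qed (use t z eq u' in \<open>auto simp: tube_def h_def\<close>)
  then have "cls S (0, c + u) = cls S (0, c + (u + h))" using t u by (simp add: tube_def)
  moreover have "c + u \<in> interior_part 0" "c + (u + h) \<in> interior_part 0"
    using strip_in_base[of y w "min l r" u] strip_in_base[of y' w' "min l' r" "u + h"] t u by (auto simp: tube_def)
  ultimately have "c + u = c + (u + h)" using cls_interior[OF num_pos] by auto
  then show ?thesis by (simp add: h_def)
qed

text \<open>The discs of radius \<open>w\<close> around the points of the strip cover the next piece of length \<open>w\<close>.\<close>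

lemma tube_step:
  assumes "tube l y w \<eta>" "r \<le> l" "0 < w" "\<And>z. z \<in> strip \<xi> l y w \<Longrightarrow> chart S w (\<eta> z)"
  shows "\<exists>\<eta>'. tube (l + w) y w \<eta>'"
proof -
  obtain \<eta>' where e: "local_coords S (\<Union>u\<in>strip \<xi> l y w. ball u w) \<eta>'" "\<forall>u\<in>strip \<xi> l y w. \<eta>' u = \<eta> u"
    using local_coords_extend[of "strip \<xi> l y w" \<eta> w] assms convex_strip by (auto simp: tube_def)
  have "strip \<xi> (l + w) y w \<subseteq> (\<Union>u\<in>strip \<xi> l y w. ball u w)"
  proof
    fix z assume z: "z \<in> strip \<xi> (l + w) y w"
    define s where "s = lon \<xi> z"
    define t where "t = lat \<xi> z"
    have zst: "z = \<xi> * Complex s t" unfolding s_def t_def by (rule rotate_split)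
    have st: "0 < s" "s < l + w" "\<bar>t - y\<bar> < w" using z unfolding zst strip_iff by auto
    obtain s' where s': "max 0 (s - w) < s'" "s' < min s l"
      using dense[of "max 0 (s - w)" "min s l"] st assms r by auto
    have "\<xi> * Complex s' t \<in> strip \<xi> l y w" using s' st by (simp add: strip_iff)
    moreover have "dist (\<xi> * Complex s' t) z < w"
    proof -
      have "\<xi> * Complex s' t - z = \<xi> * of_real (s' - s)" unfolding zst by (simp add: complex_eq_iff algebra_simps)
      then show ?thesis using s' \<xi> by (simp add: dist_norm norm_mult flip: of_real_diff)
    qed
    ultimately show "z \<in> (\<Union>u\<in>strip \<xi> l y w. ball u w)" by auto
  qed
  then have "local_coords S (strip \<xi> (l + w) y w) \<eta>'" using local_coords_subset[OF e(1) open_strip] by blast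
  moreover have "\<eta>' z = cls S (0, c + z)" if "z \<in> strip \<xi> (min (l + w) r) y w" for z
  proof -
    have "min (l + w) r = r" "min l r = r" using assms(2,3) by auto
    then have "z \<in> strip \<xi> (min l r) y w" "z \<in> strip \<xi> l y w" using that strip_mono[OF assms(2)] by auto
    then show ?thesis using e(2) assms(1) by (auto simp: tube_def)
  qed
  ultimately show ?thesis using assms(1) by (auto simp: tube_def)
qed

lemma tube_or_corner:
  assumes "\<bar>y\<bar> + w \<le> r" "0 < w"
  shows "(\<exists>\<eta>. tube (r + real n * w) y w \<eta>) \<or>
    (\<exists>l \<eta> z. r \<le> l \<and> l \<le> r + real n * w \<and> tube l y w \<eta> \<and> z \<in> strip \<xi> l y w \<and> \<not> chart S w (\<eta> z))"
proof (induction n)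
  case 0 then show ?case using tube_base[OF assms(1)] by auto
next
  case (Suc n)
  have eq: "r + real (Suc n) * w = r + real n * w + w" by (simp add: algebra_simps)
  have nn: "0 \<le> real n * w" using assms by simp
  show ?case
  proof (cases "\<exists>l \<eta> z. r \<le> l \<and> l \<le> r + real n * w \<and> tube l y w \<eta> \<and> z \<in> strip \<xi> l y w \<and> \<not> chart S w (\<eta> z)")
    case True
    then show ?thesis unfolding eq using assms(2) by (meson add_increasing2 less_imp_le order_trans le_add_same_cancel1)
  next
    case False
    then obtain \<eta> where t: "tube (r + real n * w) y w \<eta>" using Suc by blast
    then have "\<And>z. z \<in> strip \<xi> (r + real n * w) y w \<Longrightarrow> chart S w (\<eta> z)" using False nn by fastforce
    then show ?thesis unfolding eq using tube_step[OF t _ assms(2)] nn by auto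
  qed
qed

text \<open>The centre is moved into the strip just as far as needed for the disc of radius \<open>w\<close>. Its points are at most at distance
  \<open>3w\<close> from \<open>z\<close>, so coordinates on a disc of radius \<open>4w\<close> around one of them would provide some of radius \<open>w\<close> at \<open>z\<close>.\<close>

lemma corner_disc:
  assumes t: "tube l y w \<eta>" and z: "z \<in> strip \<xi> l y w" "\<not> chart S w (\<eta> z)" and w: "0 < w" "2 * w \<le> l"
  shows "\<exists>z0. ball z0 w \<subseteq> strip \<xi> l y w \<and> (\<forall>u\<in>ball z0 w. \<not> chart S (4 * w) (\<eta> u))"
proof -
  define s where "s = lon \<xi> z"
  define s0 where "s0 = max w (min s (l - w))"
  define z0 where "z0 = \<xi> * Complex s0 y"
  have s: "0 < s" "s < l" "\<bar>lat \<xi> z - y\<bar> < w" using z by (auto simp: strip_def s_def)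
  have s0: "w \<le> s0" "s0 \<le> l - w" "\<bar>s0 - s\<bar> \<le> w" using s w by (auto simp: s0_def)
  have sub: "ball z0 w \<subseteq> strip \<xi> l y w"
  proof
    fix u assume "u \<in> ball z0 w"
    then have "cmod (u - z0) < w" by (simp add: dist_norm norm_minus_commute)
    then have "\<bar>lon \<xi> (u - z0)\<bar> < w" "\<bar>lat \<xi> (u - z0)\<bar> < w" using lon_lat_le[of "u - z0"] by linarith+
    moreover have "lon \<xi> z0 = s0" "lat \<xi> z0 = y" by (simp_all add: z0_def)
    ultimately show "u \<in> strip \<xi> l y w" using s0 by (auto simp: strip_def)
  qed
  have "\<not> chart S (4 * w) (\<eta> u)" if u: "u \<in> ball z0 w" for u
  proof
    assume ch: "chart S (4 * w) (\<eta> u)"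
    have "lon \<xi> z0 = s0" "lat \<xi> z0 = y" by (simp_all add: z0_def)
    then have "cmod (z - z0) \<le> 2 * w" using norm_rotate[of "z - z0"] s s0 by (simp add: s_def)
    moreover have "cmod (z - u) \<le> cmod (z - z0) + cmod (z0 - u)" using norm_triangle_ineq[of "z - z0" "z0 - u"] by simp
    ultimately have "cmod (z - u) + w \<le> 4 * w" using u by (simp add: dist_norm)
    then have "chart S w (\<eta> z)"
      using chart_move[of "strip \<xi> l y w" \<eta> u z "4 * w" w] t convex_strip sub u z(1) ch w(1) by (auto simp: tube_def)
    then show False using z(2) by simp
  qed
  then show ?thesis using sub by blast
qed

text \<open>Of the parallel strips of width \<open>2r/N\<close> that start in the base disc, those that run into a corner within the
  length \<open>l\<close> are \<open>O(l)\<close> in number: in each period of time of length \<open>r/2\<close> only boundedly many can do so.\<close>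

lemma long_tube: "\<exists>\<kappa>>0. \<forall>l\<ge>1. \<exists>y \<eta>. tube l y (\<kappa> / l) \<eta>"
proof -
  obtain M :: nat where M: "\<forall>w>0. \<forall>(B :: nat set) W \<eta> z. finite B \<longrightarrow> (\<forall>i\<in>B. local_coords S (W i) (\<eta> i)) \<longrightarrow>
     (\<forall>i\<in>B. \<forall>k\<in>B. i \<noteq> k \<longrightarrow> W i \<inter> W k = {}) \<longrightarrow> (\<forall>i\<in>B. ball (z i) w \<subseteq> W i) \<longrightarrow>
     (\<forall>i\<in>B. \<forall>u\<in>ball (z i) w. \<not> chart S (4 * w) (\<eta> i u)) \<longrightarrow>
     (\<forall>i\<in>B. \<forall>k\<in>B. \<forall>u\<in>ball (z i) w. \<forall>v\<in>ball (z k) w. \<eta> i u = \<eta> k v \<longrightarrow> u = v) \<longrightarrow> card B \<le> M"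
    using few_discs_near_corners by blast
  (* Below, at most M strips are lost in each of G periods of length r/2, G \<le> 2l/r + 6; so there is one left among
     N = M G + 4 strips, and N is at most the denominator times l. *)
  define \<kappa> where "\<kappa> = r / (real M * (2 / r + 6) + 5)"
  have Cpos: "real M * (2 / r + 6) + 5 > 0" using r by (intro add_nonneg_pos mult_nonneg_nonneg) auto
  have "\<exists>y \<eta>. tube l y (\<kappa> / l) \<eta>" if l: "l \<ge> 1" for l
  proof -
    define G where "G = nat \<lceil>2 * l / r\<rceil> + 5"
    define N where "N = M * G + 4"
    define w where "w = r / real N"
    have N: "4 \<le> N" by (simp add: N_def)
    have w: "0 < w" "w \<le> r / 4" "real N * w = r" using r N by (auto simp: w_def field_simps)
    have "real G \<le> 2 * l / r + 6" using r l unfolding G_def by (simp, linarith)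
    also have "\<dots> \<le> (2 / r + 6) * l" using l by (simp add: algebra_simps)
    finally have "real M * real G \<le> real M * ((2 / r + 6) * l)" by (intro mult_left_mono) auto
    then have "real N \<le> (real M * (2 / r + 6) + 5) * l" using l by (simp add: N_def algebra_simps)
    then have "r / ((real M * (2 / r + 6) + 5) * l) \<le> w" unfolding w_def using r l Cpos N
      by (intro divide_left_mono) auto
    then have wk: "\<kappa> / l \<le> w" using l by (simp add: \<kappa>_def)
    define y where "y i = - r + (2 * real i + 1) * w" for i
    have y: "\<bar>y i\<bar> + w \<le> r" if "i < N" for i
    proof -
      have "(2 * real i + 2) * w \<le> 2 * real N * w" using that w(1) by (intro mult_right_mono) auto
      then have "(2 * real i + 1) * w + w \<le> 2 * r" using w(3) by (simp add: algebra_simps)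
      moreover have "0 \<le> 2 * real i * w" using w by simp
      ultimately show ?thesis unfolding y_def by (simp add: algebra_simps abs_le_iff)
    qed
    define n where "n = nat \<lceil>l / w\<rceil>"
    have n: "l \<le> real n * w" "real n * w \<le> l + w"
    proof -
      have "l / w \<le> real n" "real n \<le> l / w + 1" using l w by (auto simp: n_def intro: real_nat_ceiling_ge) 
      then show "l \<le> real n * w" "real n * w \<le> l + w" using w by (auto simp: field_simps)
    qed
    have "\<exists>i<N. \<exists>\<eta>. tube (r + real n * w) (y i) w \<eta>"
    proof (rule ccontr)
      assume "\<not> ?thesis"
      then have "\<forall>i<N. \<exists>L \<eta> z. r \<le> L \<and> L \<le> r + real n * w \<and> tube L (y i) w \<eta> \<and> z \<in> strip \<xi> L (y i) w \<and> \<not> chart S w (\<eta> z)"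
        using tube_or_corner[OF y w(1)] by blast
      moreover have "\<exists>z0. ball z0 w \<subseteq> strip \<xi> L (y i) w \<and> (\<forall>u\<in>ball z0 w. \<not> chart S (4 * w) (\<eta> u))"
        if "r \<le> L" "tube L (y i) w \<eta>" "z \<in> strip \<xi> L (y i) w" "\<not> chart S w (\<eta> z)" for i L \<eta> z
        by (rule corner_disc[OF that(2-4) w(1)]) (use w(2) r that(1) in linarith)
      ultimately have "\<forall>i<N. \<exists>L \<eta> z. L \<le> r + real n * w \<and> tube L (y i) w \<eta> \<and> ball z w \<subseteq> strip \<xi> L (y i) w \<and> (\<forall>u\<in>ball z w. \<not> chart S (4 * w) (\<eta> u))"
        by meson
      then obtain L \<eta> z where b: "\<And>i. i < N \<Longrightarrow> L i \<le> r + real n * w" "\<And>i. i < N \<Longrightarrow> tube (L i) (y i) w (\<eta> i)"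
        "\<And>i. i < N \<Longrightarrow> ball (z i) w \<subseteq> strip \<xi> (L i) (y i) w" "\<And>i u. i < N \<Longrightarrow> u \<in> ball (z i) w \<Longrightarrow> \<not> chart S (4 * w) (\<eta> i u)"
        by metis
      define g where "g i = nat \<lfloor>lon \<xi> (z i) / (r / 2)\<rfloor>" for i
      have zs: "0 < lon \<xi> (z i)" "lon \<xi> (z i) < L i" if "i < N" for i
        using b(3)[OF that] w(1) by (auto simp: strip_def subset_eq)
      have gG: "g i < G" if "i < N" for i
      proof -
        have "lon \<xi> (z i) < r + (l + w)" using zs(2)[OF that] b(1)[OF that] n by linarith
        then have "lon \<xi> (z i) / (r / 2) < (r + (l + w)) / (r / 2)" using r by (intro divide_strict_right_mono) auto
        also have "\<dots> \<le> 2 * l / r + 3" using r w by (simp add: field_simps)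
        finally show ?thesis unfolding g_def G_def using zs(1)[OF that] r by linarith
      qed
      have fibre: "card {i. i < N \<and> g i = k} \<le> M" for k
      proof -
        let ?B = "{i. i < N \<and> g i = k}"
        have dis: "strip \<xi> (L i) (y i) w \<inter> strip \<xi> (L i') (y i') w = {}" if "i \<noteq> i'" for i i'
        proof -
          have "2 * w \<le> \<bar>y i - y i'\<bar>"
          proof -
            have "1 \<le> \<bar>real i - real i'\<bar>" using that by linarith
            then have "2 * w * 1 \<le> 2 * w * \<bar>real i - real i'\<bar>" using w by (intro mult_left_mono) auto
            also have "\<dots> = \<bar>y i - y i'\<bar>"
            proof -
              have "y i - y i' = 2 * w * (real i - real i')" by (simp add: y_def algebra_simps)
              then show ?thesis using w(1) by (simp add: abs_mult)
            qed
            finally show ?thesis by simp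
          qed
          then show ?thesis by (auto simp: strip_def)
        qed
        have inj: "u = v" if i: "i \<in> ?B" "i' \<in> ?B" and u: "u \<in> ball (z i) w" and v: "v \<in> ball (z i') w" and e: "\<eta> i u = \<eta> i' v" for i i' u v
        proof (rule tube_injective[OF b(2) b(2) _ _ e])
          have "real_of_int \<lfloor>lon \<xi> (z i) / (r / 2)\<rfloor> = real_of_int \<lfloor>lon \<xi> (z i') / (r / 2)\<rfloor>"
          proof -
            have "0 \<le> \<lfloor>lon \<xi> (z i) / (r / 2)\<rfloor>" "0 \<le> \<lfloor>lon \<xi> (z i') / (r / 2)\<rfloor>"
              using zs(1)[of i] zs(1)[of i'] i r by (simp_all add: zero_le_floor)
            moreover have "nat \<lfloor>lon \<xi> (z i) / (r / 2)\<rfloor> = nat \<lfloor>lon \<xi> (z i') / (r / 2)\<rfloor>" using i by (auto simp: g_def)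
            ultimately show ?thesis by (metis nat_eq_iff2)
          qed
          then have "\<bar>lon \<xi> (z i) / (r / 2) - lon \<xi> (z i') / (r / 2)\<bar> < 1" by linarith
          then have "(lon \<xi> (z i) - lon \<xi> (z i')) / (r / 2) < 1" "(lon \<xi> (z i') - lon \<xi> (z i)) / (r / 2) < 1"
            unfolding diff_divide_distrib by linarith+
          then have "lon \<xi> (z i) - lon \<xi> (z i') < r / 2" "lon \<xi> (z i') - lon \<xi> (z i) < r / 2"
            using r by (simp_all add: pos_divide_less_eq)
          then have 1: "\<bar>lon \<xi> (z i) - lon \<xi> (z i')\<bar> < r / 2" by linarith
          have "\<bar>lon \<xi> (u - z i)\<bar> < r / 4" "\<bar>lon \<xi> ((v - z i'))\<bar> < r / 4"
            using lon_lat_le(1)[of "u - z i"] lon_lat_le(1)[of "v - z i'"] u v w by (auto simp: dist_norm norm_minus_commute)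
          then show "\<bar>lon \<xi> ((v - u))\<bar> < r" using 1 unfolding lon_lat_linear by linarith
        qed (use i subsetD[OF b(3) u] subsetD[OF b(3) v] in auto)
        show ?thesis
          using M[rule_format, of w ?B "\<lambda>i. strip \<xi> (L i) (y i) w" \<eta> z] w(1) b dis inj by (auto simp: tube_def)
      qed
      have "{..<N} = (\<Union>k<G. {i. i < N \<and> g i = k})" using gG by auto
      then have "N \<le> (\<Sum>k<G. card {i. i < N \<and> g i = k})" using card_UN_le[of "{..<G}" "\<lambda>k. {i. i < N \<and> g i = k}"] by (metis card_lessThan finite_lessThan)
      also have "\<dots> \<le> G * M" using sum_mono[of "{..<G}" "\<lambda>k. card {i. i < N \<and> g i = k}" "\<lambda>_. M"] fibre by simp
      finally show False by (simp add: N_def mult.commute)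
    qed
    then obtain i \<eta> where i: "i < N" "tube (r + real n * w) (y i) w \<eta>" by blast
    then have "tube l (y i) (\<kappa> / l) \<eta>" by (intro tube_shrink[OF i(2)]) (use n(1) r wk in linarith)+
    then show ?thesis by blast
  qed
  moreover have "\<kappa> > 0" using r Cpos by (simp add: \<kappa>_def)
  ultimately show ?thesis by blast
qed

end

section \<open>Functions on the surface in coordinates\<close>

definition plane_gradient :: "(complex \<Rightarrow> complex) \<Rightarrow> (complex \<Rightarrow> complex) \<Rightarrow> (complex \<Rightarrow> complex) \<Rightarrow> bool" where
  "plane_gradient f g h \<longleftrightarrow> (\<forall>z. (f has_derivative (\<lambda>v. of_real (Re v) * g z + of_real (Im v) * h z)) (at z))"

lemma gradient_unique:
  fixes a b a' b' :: complex
  assumes "(f has_derivative (\<lambda>v. of_real (Re v) * a + of_real (Im v) * b)) (at z)"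
    "(f has_derivative (\<lambda>v. of_real (Re v) * a' + of_real (Im v) * b')) (at z)"
  shows "a = a'" "b = b'"
proof -
  have eq: "(\<lambda>v. of_real (Re v) * a + of_real (Im v) * b) = (\<lambda>v. of_real (Re v) * a' + of_real (Im v) * b')"
    by (rule has_derivative_unique[OF assms])
  show "a = a'" using fun_cong[OF eq, of 1] by simp
  show "b = b'" using fun_cong[OF eq, of \<i>] by simp
qed

lemma exp_phase_has_derivative:
  fixes c :: complex
  shows "((\<lambda>z. exp (c * of_real (k \<bullet> z))) has_derivative (\<lambda>v. exp (c * of_real (k \<bullet> z)) * (c * of_real (k \<bullet> v)))) (at z)"
proof -
  have "((\<lambda>z. c * complex_of_real (k \<bullet> z)) has_derivative (\<lambda>v. c * of_real (k \<bullet> v))) (at z)"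
    by (auto intro!: derivative_eq_intros)
  from has_derivative_compose[OF this, of exp "(*) (exp (c * of_real (k \<bullet> z)))"] show ?thesis
    using DERIV_exp[of "c * of_real (k \<bullet> z)"] by (simp add: has_field_derivative_def)
qed

context flat_surface
begin

text \<open>Images of compact sets under coordinates are closed: the surface is Hausdorff at regular points, and a vertex is never
  identified with a regular point.\<close>

lemma cls_coords_separated:
  assumes l: "local_coords S W \<eta>" "k \<in> W" and ne: "cls S (j, p) \<noteq> \<eta> k"
  shows "\<exists>d>0. \<forall>a\<in>ball p d. \<forall>u\<in>ball 0 d. k + u \<in> W \<and> cls S (j, a) \<noteq> \<eta> (k + u)"
proof -
  obtain d where d: "d > 0" "\<forall>v\<in>ball (0::complex) d. k + v \<in> W \<and> (\<exists>(i, b)\<in>\<eta> k. b + v \<in> region i \<and> \<eta> (k + v) = cls S (i, b + v))"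
    using local_coords_cover[OF l] by blast
  have reg: "\<eta> k \<in> regular_points S" by (rule local_coords_regular[OF l])
  have "\<exists>s>0. \<forall>x\<in>\<eta> k. \<forall>a\<in>ball p s. \<forall>b\<in>ball (snd x) s. good (fst x) b \<longrightarrow> cls S (j, a) \<noteq> cls S (fst x, b)"
  proof (rule finite_uniform_constant)
    show "finite (\<eta> k)" by (rule finite_regular[OF reg])
    fix x assume x: "x \<in> \<eta> k"
    then have "good (fst x) (snd x)" "cls S (j, p) \<noteq> cls S (fst x, snd x)"
      using regular_good[OF reg, of "fst x" "snd x"] ne by auto
    then show "\<exists>s>0. \<forall>a\<in>ball p s. \<forall>b\<in>ball (snd x) s. good (fst x) b \<longrightarrow> cls S (j, a) \<noteq> cls S (fst x, b)"
      by (rule cls_separated)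
  qed auto
  then obtain s where s: "s > 0" "\<forall>x\<in>\<eta> k. \<forall>a\<in>ball p s. \<forall>b\<in>ball (snd x) s. good (fst x) b \<longrightarrow> cls S (j, a) \<noteq> cls S (fst x, b)"
    by blast
  have "k + u \<in> W \<and> cls S (j, a) \<noteq> \<eta> (k + u)" if a: "a \<in> ball p (min d s)" and u: "u \<in> ball 0 (min d s)" for a u
  proof -
    obtain i b where ib: "(i, b) \<in> \<eta> k" "\<eta> (k + u) = cls S (i, b + u)" "k + u \<in> W" using d(2) u by fastforce
    have "good i (b + u)" using regular_good(1)[OF local_coords_regular[OF l(1) ib(3)]] ib(2) in_cls by simp
    moreover have "b + u \<in> ball b s" using u by (simp add: dist_norm)
    ultimately show ?thesis using s(2) ib a by fastforce
  qed
  then show ?thesis using d(1) s(1) by (intro exI[of _ "min d s"]) auto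
qed

lemma cls_away_from_compact:
  assumes l: "local_coords S W \<eta>" and K: "compact K" "K \<subseteq> W" and ne: "cls S (j, p) \<notin> \<eta> ` K"
  shows "\<exists>d>0. \<forall>a\<in>ball p d. cls S (j, a) \<notin> \<eta> ` K"
proof -
  have "\<forall>k\<in>K. \<exists>d>0. \<forall>a\<in>ball p d. \<forall>u\<in>ball 0 d. cls S (j, a) \<noteq> \<eta> (k + u)"
  proof
    fix k assume "k \<in> K"
    then have "k \<in> W" "cls S (j, p) \<noteq> \<eta> k" using K(2) ne by auto
    from cls_coords_separated[OF l this] show "\<exists>d>0. \<forall>a\<in>ball p d. \<forall>u\<in>ball 0 d. cls S (j, a) \<noteq> \<eta> (k + u)" by blast
  qed
  then obtain d where d: "\<And>k. k \<in> K \<Longrightarrow> d k > 0" "\<And>k a u. k \<in> K \<Longrightarrow> a \<in> ball p (d k) \<Longrightarrow> u \<in> ball 0 (d k) \<Longrightarrow> cls S (j, a) \<noteq> \<eta> (k + u)"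
    by metis
  obtain D where D: "D \<subseteq> K" "finite D" "K \<subseteq> (\<Union>k\<in>D. ball k (d k))"
  proof (rule compactE_image[OF K(1), of K "\<lambda>k. ball k (d k)"])
    show "K \<subseteq> (\<Union>k\<in>K. ball k (d k))" using d(1) by fastforce
  qed auto
  have "\<exists>s>0. \<forall>k\<in>D. s \<le> d k"
    using D(1) d(1) by (intro finite_uniform_constant[OF D(2)]) auto
  then obtain s where s: "s > 0" "\<forall>k\<in>D. s \<le> d k" by blast
  have "cls S (j, a) \<notin> \<eta> ` K" if a: "a \<in> ball p s" for a
  proof
    assume "cls S (j, a) \<in> \<eta> ` K"
    then obtain x where x: "x \<in> K" "cls S (j, a) = \<eta> x" by blast
    then obtain k where k: "k \<in> D" "x \<in> ball k (d k)" using D(3) by blast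
    have "x - k \<in> ball 0 (d k)" using k(2) by (simp add: dist_norm norm_minus_commute)
    moreover have "a \<in> ball p (d k)" using a s(2) k(1) by fastforce
    ultimately show False using d(2)[of k a "x - k"] k(1) D(1) x(2) by auto
  qed
  then show ?thesis using s(1) by blast
qed

lemma coords_away_from_compact:
  assumes l: "local_coords S W \<eta>" and K: "compact K" "K \<subseteq> W" and v: "local_coords S V \<zeta>" "v \<in> V" and ne: "\<zeta> v \<notin> \<eta> ` K"
  shows "\<exists>d>0. \<forall>u\<in>ball 0 d. v + u \<in> V \<and> \<zeta> (v + u) \<notin> \<eta> ` K"
proof -
  obtain d where d: "d > 0" "\<forall>u\<in>ball (0::complex) d. v + u \<in> V \<and> (\<exists>(i, b)\<in>\<zeta> v. b + u \<in> region i \<and> \<zeta> (v + u) = cls S (i, b + u))"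
    using local_coords_cover[OF v] by blast
  have reg: "\<zeta> v \<in> regular_points S" by (rule local_coords_regular[OF v])
  have "\<exists>s>0. \<forall>x\<in>\<zeta> v. \<forall>a\<in>ball (snd x) s. cls S (fst x, a) \<notin> \<eta> ` K"
  proof (rule finite_uniform_constant)
    show "finite (\<zeta> v)" by (rule finite_regular[OF reg])
    fix x assume x: "x \<in> \<zeta> v"
    then have "\<zeta> v = cls S (fst x, snd x)" using regular_good(2)[OF reg, of "fst x" "snd x"] by simp
    then show "\<exists>s>0. \<forall>a\<in>ball (snd x) s. cls S (fst x, a) \<notin> \<eta> ` K" using cls_away_from_compact[OF l K, of "fst x" "snd x"] ne by simp
  qed auto
  then obtain s where s: "s > 0" "\<forall>x\<in>\<zeta> v. \<forall>a\<in>ball (snd x) s. cls S (fst x, a) \<notin> \<eta> ` K" by blast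
  have "v + u \<in> V \<and> \<zeta> (v + u) \<notin> \<eta> ` K" if u: "u \<in> ball 0 (min d s)" for u
  proof -
    obtain i b where ib: "(i, b) \<in> \<zeta> v" "\<zeta> (v + u) = cls S (i, b + u)" "v + u \<in> V" using d(2) u by fastforce
    moreover have "b + u \<in> ball b s" using u by (simp add: dist_norm)
    ultimately show ?thesis using s(2) by fastforce
  qed
  then show ?thesis using d(1) s(1) by (intro exI[of _ "min d s"]) auto
qed

lemma partial_eq:
  assumes g: "has_gradient S F G H" and q: "q \<in> regular_points S" and F: "\<And>x. x \<in> regular_points S \<Longrightarrow> F' x = F x"
  shows "partial S v F' q = of_real (Re v) * G q + of_real (Im v) * H q"
proof -
  obtain r \<zeta> where r: "r > 0" and z: "local_coords S (ball 0 r) \<zeta>" "\<zeta> 0 = q" using regular_chart[OF q] by (auto simp: chart_def)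
  have d1: "((\<lambda>w. F (\<zeta> w)) has_derivative (\<lambda>v. of_real (Re v) * G (\<zeta> 0) + of_real (Im v) * H (\<zeta> 0))) (at (of_real 0 * v))"
    using g[unfolded has_gradient_def, rule_format, OF z(1), of 0] r by simp
  have d2: "((\<lambda>t. complex_of_real t * v) has_derivative (\<lambda>t. of_real t * v)) (at 0)" by (auto intro!: derivative_eq_intros)
  have d: "((\<lambda>t. F (\<zeta> (of_real t * v))) has_vector_derivative (of_real (Re v) * G q + of_real (Im v) * H q)) (at 0)"
    unfolding has_vector_derivative_def
    by (rule has_derivative_eq_rhs[OF has_derivative_compose[OF d2 d1]])
       (simp add: fun_eq_iff z(2) scaleR_conv_of_real algebra_simps)
  have "((\<lambda>t. F' (translate S q (of_real t * v))) has_vector_derivative (of_real (Re v) * G q + of_real (Im v) * H q)) (at 0)"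
  proof (rule has_vector_derivative_transform_within_open[OF d])
    show "open {t. cmod (complex_of_real t * v) < r}" by (intro open_Collect_less continuous_intros)
    show "0 \<in> {t. cmod (complex_of_real t * v) < r}" using r by simp
    fix t assume t: "t \<in> {t. cmod (complex_of_real t * v) < r}"
    have "closed_segment 0 (of_real t * v) \<subseteq> ball 0 r" using t r by (intro closed_segment_subset) auto
    then have "translate S q (of_real t * v) = \<zeta> (of_real t * v)" by (rule translate_eq(2)[OF z(1) _ z(2)])
    moreover have "\<zeta> (of_real t * v) \<in> regular_points S" using local_coords_regular[OF z(1)] t by simp
    ultimately show "F (\<zeta> (of_real t * v)) = F' (translate S q (of_real t * v))" using F by simp
  qed
  then show ?thesis unfolding partial_def by (rule vector_derivative_at)
qed

lemma laplacian_eq: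
  assumes "has_gradient S F G H" "has_gradient S G Gx Gy" "has_gradient S H Hx Hy" "q \<in> regular_points S"
  shows "laplacian S F q = Gx q + Hy q"
proof -
  have "partial S 1 F x = G x" "partial S \<i> F x = H x" if "x \<in> regular_points S" for x
    using partial_eq[OF assms(1) that, of F] by simp_all
  then have "partial S 1 (partial S 1 F) q = Gx q" "partial S \<i> (partial S \<i> F) q = Hy q"
    using partial_eq[OF assms(2,4), of "partial S 1 F"] partial_eq[OF assms(3,4), of "partial S \<i> F"] by simp_all
  then show ?thesis by (simp add: laplacian_def)
qed

end

text \<open>Coordinates \<open>\<eta>\<close> on \<open>Z\<close> that are injective up to multiples of a period \<open>h\<close>; the functions to be transported to
  the surface live in the closed set \<open>K'\<close>, whose part in \<open>Z\<close> is covered by a compact set \<open>K\<close>.\<close>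

locale periodic_coords = flat_surface +
  fixes Z :: "complex set" and \<eta> :: "complex \<Rightarrow> point" and h :: complex and K K' :: "complex set"
  assumes coords: "local_coords S Z \<eta>"
    and period: "\<And>z z'. z \<in> Z \<Longrightarrow> z' \<in> Z \<Longrightarrow> \<eta> z = \<eta> z' \<Longrightarrow> \<exists>n::int. z' = z + of_int n * h"
    and K: "compact K" "K \<subseteq> Z" and K': "closed K'" "\<And>z. z \<in> Z \<Longrightarrow> z \<in> K' \<Longrightarrow> \<eta> z \<in> \<eta> ` K"
begin

text \<open>The functions on the plane that define functions on the surface, namely zero outside of \<open>\<eta> ` Z\<close>.\<close>

definition admissible :: "(complex \<Rightarrow> complex) \<Rightarrow> bool" where
  "admissible f \<longleftrightarrow> (\<forall>z. f (z + h) = f z) \<and> (\<forall>z. z \<notin> K' \<longrightarrow> f z = 0)"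

definition descend :: "(complex \<Rightarrow> complex) \<Rightarrow> point \<Rightarrow> complex" where
  "descend f q = (if q \<in> \<eta> ` Z then f (SOME z. z \<in> Z \<and> \<eta> z = q) else 0)"

lemma admissible_period: "admissible f \<Longrightarrow> f (z + of_int n * h) = f z"
proof (induction n rule: int_induct[of _ 0])
  case (step1 i)
  have "z + of_int (i + 1) * h = (z + of_int i * h) + h" by (simp add: algebra_simps)
  then show ?case using step1 by (metis admissible_def)
next
  case (step2 i)
  have "z + of_int i * h = (z + of_int (i - 1) * h) + h" by (simp add: algebra_simps)
  then show ?case using step2 by (metis admissible_def)
qed simp

lemma descend_coords: "admissible f \<Longrightarrow> z \<in> Z \<Longrightarrow> descend f (\<eta> z) = f z"
proof -
  assume a: "admissible f" "z \<in> Z"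
  define y where "y = (SOME y. y \<in> Z \<and> \<eta> y = \<eta> z)"
  have "y \<in> Z \<and> \<eta> y = \<eta> z" unfolding y_def by (rule someI[of _ z]) (use a in simp)
  then obtain n :: int where "z = y + of_int n * h" using period[of y z] a(2) by blast
  then have "f z = f y" using admissible_period[OF a(1)] by simp
  then show ?thesis using a(2) by (simp add: descend_def y_def)
qed

lemma descend_zero: "admissible f \<Longrightarrow> q \<notin> \<eta> ` K \<Longrightarrow> descend f q = 0"
proof (cases "q \<in> \<eta> ` Z")
  case True
  assume a: "admissible f" "q \<notin> \<eta> ` K"
  obtain z where z: "z \<in> Z" "q = \<eta> z" using True by blast
  then have "z \<notin> K'" using a K'(2) by blast
  then show ?thesis using descend_coords[OF a(1) z(1)] z a(1) by (simp add: admissible_def)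
qed (simp add: descend_def)

text \<open>The support stays inside the closed set \<open>\<eta> ` K\<close>, so the extension by zero is as regular as the function in coordinates.\<close>

lemma descend_continuous:
  assumes f: "admissible f" "continuous_on UNIV f" shows "continuous_on_surface S (descend f)"
  unfolding continuous_on_surface_def
proof (intro allI impI)
  fix j assume j: "j < num"
  show "continuous_on (region j) (\<lambda>z. descend f (cls S (j, z)))"
    unfolding continuous_on_eq_continuous_within
  proof
    fix p assume p: "p \<in> region j"
    show "continuous (at p within region j) (\<lambda>z. descend f (cls S (j, z)))"
    proof (cases "cls S (j, p) \<in> \<eta> ` K")
      case True
      then obtain k where k: "k \<in> K" "\<eta> k = cls S (j, p)" by auto
      then have kZ: "k \<in> Z" using K by blast
      obtain d where d: "d > 0" "\<forall>(j, p)\<in>\<eta> k. \<forall>p'\<in>region j. dist p' p < d \<longrightarrow> k + (p' - p) \<in> Z \<and> \<eta> (k + (p' - p)) = cls S (j, p')"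
        using local_coords_rep[OF coords kZ] by blast
      have eq: "f (k + (p' - p)) = descend f (cls S (j, p'))" if "p' \<in> region j" "dist p' p < d" for p'
        using d(2) k(2) in_cls[of "(j, p)"] that descend_coords[OF f(1), of "k + (p' - p)"] by fastforce
      have "continuous (at p within region j) (\<lambda>p'. f (k + (p' - p)))"
      proof (rule continuous_within_compose3[where g = f and f = "\<lambda>p'. k + (p' - p)"])
        show "isCont f (k + (p - p))" using f(2) by (simp add: continuous_on_eq_continuous_at)
      qed (intro continuous_intros)
      then show ?thesis by (rule continuous_transform_within[OF _ d(1) p]) (use eq in auto)
    next
      case False
      obtain d where d: "d > 0" "\<forall>a\<in>ball p d. cls S (j, a) \<notin> \<eta> ` K" using cls_away_from_compact[OF coords K False] by blast
      have "continuous (at p within region j) (\<lambda>p'. 0 :: complex)" by simp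
      then show ?thesis
        by (rule continuous_transform_within[OF _ d(1) p]) (use d(2) descend_zero[OF f(1)] in \<open>auto simp: dist_commute\<close>)
    qed
  qed
qed

lemma descend_gradient:
  assumes "admissible f" "admissible f1" "admissible f2" "plane_gradient f f1 f2"
  shows "has_gradient S (descend f) (descend f1) (descend f2)"
  unfolding has_gradient_def
proof (intro allI impI ballI)
  fix V \<zeta> v assume V: "local_coords S V \<zeta>" and v: "v \<in> V"
  show "((\<lambda>w. descend f (\<zeta> w)) has_derivative (\<lambda>u. of_real (Re u) * descend f1 (\<zeta> v) + of_real (Im u) * descend f2 (\<zeta> v))) (at v)"
  proof (cases "\<zeta> v \<in> \<eta> ` K")
    case True
    then obtain k where k: "k \<in> Z" "\<eta> k = \<zeta> v" using K by auto
    obtain d where d: "d > 0" "\<forall>u\<in>ball (0::complex) d. k + u \<in> Z \<and> v + u \<in> V \<and> \<eta> (k + u) = \<zeta> (v + u)"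
      using local_coords_agree_near[OF coords k(1) V v k(2)] by blast
    have "(f has_derivative (\<lambda>u. of_real (Re u) * f1 k + of_real (Im u) * f2 k)) (at (k + (v - v)))"
      using assms(4) by (simp add: plane_gradient_def)
    moreover have "((\<lambda>w. k + (w - v)) has_derivative (\<lambda>u. u)) (at v)" by (auto intro!: derivative_eq_intros)
    ultimately have "((\<lambda>w. f (k + (w - v))) has_derivative (\<lambda>u. of_real (Re u) * f1 k + of_real (Im u) * f2 k)) (at v)"
      using has_derivative_compose[of "\<lambda>w. k + (w - v)" "\<lambda>u. u" v UNIV f] by simp
    then have "((\<lambda>w. descend f (\<zeta> w)) has_derivative (\<lambda>u. of_real (Re u) * f1 k + of_real (Im u) * f2 k)) (at v)"
    proof (rule has_derivative_transform_within[OF _ d(1)])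
      fix w assume "dist w v < d"
      then have "w - v \<in> ball 0 d" unfolding mem_ball_0 dist_norm .
      then show "f (k + (w - v)) = descend f (\<zeta> w)" using d(2) descend_coords[OF assms(1), of "k + (w - v)"] by fastforce
    qed simp
    then show ?thesis using descend_coords[OF _ k(1)] assms(2,3) k(2) by metis
  next
    case False
    obtain d where d: "d > 0" "\<forall>u\<in>ball (0::complex) d. v + u \<in> V \<and> \<zeta> (v + u) \<notin> \<eta> ` K"
      using coords_away_from_compact[OF coords K V v False] by blast
    have "((\<lambda>w. 0 :: complex) has_derivative (\<lambda>u. of_real (Re u) * 0 + of_real (Im u) * 0)) (at v)" by simp
    then have "((\<lambda>w. descend f (\<zeta> w)) has_derivative (\<lambda>u. of_real (Re u) * 0 + of_real (Im u) * 0)) (at v)"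
    proof (rule has_derivative_transform_within[OF _ d(1)])
      fix w assume "dist w v < d"
      then have "w - v \<in> ball 0 d" unfolding mem_ball_0 dist_norm .
      then have "\<zeta> (v + (w - v)) \<notin> \<eta> ` K" using d(2) by blast
      then show "0 = descend f (\<zeta> w)" using descend_zero[OF assms(1)] by simp
    qed simp
    then show ?thesis using descend_zero[OF _ False] assms(2,3) by simp
  qed
qed

lemma admissible_gradient:
  assumes a: "admissible f" and g: "plane_gradient f f1 f2" shows "admissible f1" "admissible f2"
proof -
  have per: "f1 (z + h) = f1 z \<and> f2 (z + h) = f2 z" for z
  proof -
    have "(f has_derivative (\<lambda>u. of_real (Re u) * f1 (z + h) + of_real (Im u) * f2 (z + h))) (at (z + h))"
      using g by (simp add: plane_gradient_def)
    moreover have "((\<lambda>w. w + h) has_derivative (\<lambda>u. u)) (at z)" by (auto intro!: derivative_eq_intros)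
    ultimately have "((\<lambda>w. f (w + h)) has_derivative (\<lambda>u. of_real (Re u) * f1 (z + h) + of_real (Im u) * f2 (z + h))) (at z)"
      using has_derivative_compose[of "\<lambda>w. w + h" "\<lambda>u. u" z UNIV f] by simp
    moreover have "(\<lambda>w. f (w + h)) = f" using a by (auto simp: admissible_def)
    ultimately have "(f has_derivative (\<lambda>u. of_real (Re u) * f1 (z + h) + of_real (Im u) * f2 (z + h))) (at z)" by simp
    from gradient_unique[OF this g[unfolded plane_gradient_def, rule_format]] show ?thesis by simp
  qed
  have "f1 z = 0 \<and> f2 z = 0" if z: "z \<notin> K'" for z
  proof -
    have "((\<lambda>w. 0 :: complex) has_derivative (\<lambda>u. of_real (Re u) * 0 + of_real (Im u) * 0)) (at z)" by simp
    then have "(f has_derivative (\<lambda>u. of_real (Re u) * 0 + of_real (Im u) * 0)) (at z)"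
      by (rule has_derivative_transform_within_open[of _ _ _ _ "- K'"]) (use z K'(1) a in \<open>auto simp: admissible_def open_Compl\<close>)
    from gradient_unique[OF this g[unfolded plane_gradient_def, rule_format]] show ?thesis by simp
  qed
  then show "admissible f1" "admissible f2" using per by (auto simp: admissible_def)
qed

lemma descend_Ck: "admissible f \<Longrightarrow> Ck_plane n f \<Longrightarrow> Ck_surface S n (descend f)"
proof (induction n arbitrary: f)
  case 0 then show ?case by (simp add: descend_continuous)
next
  case (Suc n)
  then obtain f1 f2 where f: "plane_gradient f f1 f2" "Ck_plane n f1" "Ck_plane n f2" "continuous_on UNIV f"
    by (auto simp: plane_gradient_def)
  note ad = admissible_gradient[OF Suc.prems(1) f(1)]
  show ?case using Suc.IH[OF ad(1) f(2)] Suc.IH[OF ad(2) f(3)] descend_gradient[OF Suc.prems(1) ad f(1)]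
      descend_continuous[OF Suc.prems(1) f(4)] by auto
qed

end

section \<open>Wave packets in the plane\<close>

text \<open>\<open>bump 0\<close> is \<open>(1 - x\<^sup>2)\<^sup>3\<close> cut off outside of \<open>[-1, 1]\<close>; \<open>bump 1\<close> and \<open>bump 2\<close> are its derivatives.\<close>

definition bump :: "nat \<Rightarrow> real \<Rightarrow> real" where
  "bump m x = (let p = max 0 (1 - x\<^sup>2) in
     if m = 0 then p ^ 3 else if m = 1 then - 6 * x * p\<^sup>2 else - 6 * p\<^sup>2 + 24 * x\<^sup>2 * p)"

lemma max_power_deriv: "((\<lambda>u::real. max 0 u ^ Suc (Suc n)) has_real_derivative (real n + 2) * max 0 u ^ Suc n) (at u)"
proof -
  consider "u > 0" | "u < 0" | "u = 0" by linarith
  then show ?thesis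
  proof cases
    case 1
    have "((\<lambda>u::real. u ^ Suc (Suc n)) has_real_derivative (real n + 2) * max 0 u ^ Suc n) (at u)"
      using DERIV_pow[of "Suc (Suc n)" u UNIV] 1 by (simp add: max_def add.commute)
    then show ?thesis by (rule has_field_derivative_transform_within_open[of _ _ _ "{0<..}"]) (use 1 in auto)
  next
    case 2
    have "((\<lambda>u::real. 0) has_real_derivative (real n + 2) * max 0 u ^ Suc n) (at u)"
      using 2 by (auto intro!: derivative_eq_intros)
    then show ?thesis by (rule has_field_derivative_transform_within_open[of _ _ _ "{..<0}"]) (use 2 in auto)
  next
    case 3
    have "((\<lambda>t::real. (max 0 (0 + t) ^ Suc (Suc n) - max 0 0 ^ Suc (Suc n)) / t) \<longlongrightarrow> 0) (at 0)"
    proof (rule Lim_null_comparison)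
      show "\<forall>\<^sub>F t::real in at 0. norm ((max 0 (0 + t) ^ Suc (Suc n) - max 0 0 ^ Suc (Suc n)) / t) \<le> \<bar>t\<bar> ^ Suc n"
      proof (intro always_eventually allI)
        fix t :: real
        show "norm ((max 0 (0 + t) ^ Suc (Suc n) - max 0 0 ^ Suc (Suc n)) / t) \<le> \<bar>t\<bar> ^ Suc n"
        proof (cases "0 < t")
          case False
          then have "max 0 (0 + t) = 0" by simp
          then show ?thesis by (simp del: power_Suc)
        qed (simp add: abs_mult power_abs)
      qed
      show "((\<lambda>t::real. \<bar>t\<bar> ^ Suc n) \<longlongrightarrow> 0) (at 0)" by (auto intro!: tendsto_eq_intros)
    qed
    then show ?thesis using 3 by (simp add: DERIV_def)
  qed
qed

lemma bump_deriv: "m \<le> 1 \<Longrightarrow> (bump m has_real_derivative bump (Suc m) x) (at x)"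
proof -
  have inner: "((\<lambda>x::real. 1 - x\<^sup>2) has_real_derivative - 2 * x) (at x)" by (auto intro!: derivative_eq_intros)
  have d3: "((\<lambda>x::real. max 0 (1 - x\<^sup>2) ^ 3) has_real_derivative 3 * max 0 (1 - x\<^sup>2) ^ 2 * (- 2 * x)) (at x)"
    using DERIV_chain2[where f = "\<lambda>u. max 0 u ^ Suc (Suc 1)" and g = "\<lambda>x. 1 - x\<^sup>2", OF max_power_deriv inner]
    by (simp add: numeral_3_eq_3 numeral_2_eq_2)
  have d2: "((\<lambda>x::real. max 0 (1 - x\<^sup>2) ^ 2) has_real_derivative 2 * max 0 (1 - x\<^sup>2) * (- 2 * x)) (at x)"
    using DERIV_chain2[where f = "\<lambda>u. max 0 u ^ Suc (Suc 0)" and g = "\<lambda>x. 1 - x\<^sup>2", OF max_power_deriv inner]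
    by (simp add: numeral_2_eq_2)
  assume "m \<le> 1"
  then consider "m = 0" | "m = 1" by linarith
  then show ?thesis
  proof cases
    case 1
    then show ?thesis using d3 by (simp add: bump_def[abs_def] Let_def mult_ac)
  next
    case 2
    have "((\<lambda>x. - 6 * x * max 0 (1 - x\<^sup>2) ^ 2) has_real_derivative
        - 6 * (max 0 (1 - x\<^sup>2) ^ 2) + (- 6 * x) * (2 * max 0 (1 - x\<^sup>2) * (- 2 * x))) (at x)"
      by (rule derivative_eq_intros d2 refl)+ (simp add: algebra_simps)
    then show ?thesis using 2 by (simp add: bump_def[abs_def] Let_def power2_eq_square algebra_simps)
  qed
qed

lemma bump_cont: "continuous_on A (bump m)"
proof -
  have "continuous_on A (\<lambda>x::real. max 0 (1 - x\<^sup>2))" by (intro continuous_intros)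
  then show ?thesis unfolding bump_def[abs_def] Let_def
    by (cases "m = 0"; cases "m = 1") (simp_all add: continuous_intros)
qed

lemma bump_bound: "\<bar>bump m x\<bar> \<le> 30"
proof -
  define p where "p = max 0 (1 - x\<^sup>2)"
  show ?thesis
  proof (cases "\<bar>x\<bar> \<le> 1")
    case True
    then have x: "x\<^sup>2 \<le> 1" by (simp add: abs_square_le_1)
    then have p: "0 \<le> p" "p \<le> 1" by (auto simp: p_def)
    have "\<bar>p ^ 3\<bar> \<le> 1" "\<bar>p\<^sup>2\<bar> \<le> 1" using p by (auto simp: power_le_one)
    moreover have "\<bar>x * p\<^sup>2\<bar> \<le> 1 * 1" unfolding abs_mult using True calculation by (intro mult_mono) auto
    moreover have "\<bar>x\<^sup>2 * p\<bar> \<le> 1 * 1" unfolding abs_mult using x p by (intro mult_mono) auto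
    ultimately have "\<bar>p ^ 3\<bar> \<le> 30" "\<bar>- 6 * (x * p\<^sup>2)\<bar> \<le> 30" "\<bar>- 6 * p\<^sup>2 + 24 * (x\<^sup>2 * p)\<bar> \<le> 30" by linarith+
    then show ?thesis unfolding bump_def p_def[symmetric] Let_def by (simp add: mult.assoc)
  next
    case False
    then have "1 - x\<^sup>2 < 0" using abs_square_le_1[of x] by linarith
    then have "p = 0" by (simp add: p_def)
    then show ?thesis unfolding bump_def p_def[symmetric] Let_def by simp
  qed
qed

lemma bump_zero: "1 \<le> \<bar>x\<bar> \<Longrightarrow> bump m x = 0"
proof -
  assume "1 \<le> \<bar>x\<bar>"
  then have "1 - x\<^sup>2 \<le> 0" using abs_le_square_iff[of 1 x] by simp
  then have "max 0 (1 - x\<^sup>2) = 0" by simp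
  then show ?thesis unfolding bump_def Let_def by simp
qed

lemma bump_ge: "\<bar>x\<bar> \<le> 1 / 2 \<Longrightarrow> 27 / 64 \<le> bump 0 x"
proof -
  assume "\<bar>x\<bar> \<le> 1 / 2"
  then have "\<bar>x\<bar> * \<bar>x\<bar> \<le> (1 / 2) * (1 / 2)" by (intro mult_mono) auto
  then have "x\<^sup>2 \<le> 1 / 4" by (simp add: power2_eq_square)
  then have "3 / 4 \<le> max 0 (1 - x\<^sup>2)" by simp
  then have "(3 / 4) ^ 3 \<le> max 0 (1 - x\<^sup>2) ^ 3" by (rule power_mono) simp
  moreover have "(3 / 4 :: real) ^ 3 = 27 / 64" by (simp add: power3_eq_cube)
  ultimately show ?thesis unfolding bump_def Let_def by (simp only: if_True refl)
qed

text \<open>The modulated bumps are closed under differentiation up to the order two.\<close>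

context
  fixes a b k :: complex and a0 b0 :: real
begin

definition packet :: "nat \<Rightarrow> nat \<Rightarrow> complex \<Rightarrow> complex" where
  "packet m n z = of_real (bump m (a \<bullet> z - a0) * bump n (b \<bullet> z - b0)) * exp (\<i> * of_real (k \<bullet> z))"

lemma packet_cont: "continuous_on A (packet m n)"
proof -
  have "continuous_on A (\<lambda>z. bump m (a \<bullet> z - a0))" "continuous_on A (\<lambda>z. bump n (b \<bullet> z - b0))"
    by (auto intro!: continuous_on_compose2[OF bump_cont[of UNIV]] continuous_intros)
  then show ?thesis unfolding packet_def[abs_def] by (auto intro!: continuous_intros)
qed

lemma packet_gradient:
  assumes "m \<le> 1" "n \<le> 1"
  shows "plane_gradient (packet m n)
    (\<lambda>z. of_real (Re a) * packet (Suc m) n z + of_real (Re b) * packet m (Suc n) z + \<i> * of_real (Re k) * packet m n z)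
    (\<lambda>z. of_real (Im a) * packet (Suc m) n z + of_real (Im b) * packet m (Suc n) z + \<i> * of_real (Im k) * packet m n z)"
  unfolding plane_gradient_def
proof
  fix z
  have in_d: "((\<lambda>z. c \<bullet> z - d) has_derivative (\<lambda>v. c \<bullet> v)) (at z)" for c :: complex and d :: real
    by (auto intro!: derivative_eq_intros)
  have d: "((\<lambda>z. bump l (c \<bullet> z - d)) has_derivative (\<lambda>v. bump (Suc l) (c \<bullet> z - d) * (c \<bullet> v))) (at z)"
    if "l \<le> 1" for l and c :: complex and d
    using has_derivative_compose[OF in_d[of c d], of "bump l" "\<lambda>t. bump (Suc l) (c \<bullet> z - d) * t"] bump_deriv[OF that, of "c \<bullet> z - d"]
    by (simp add: has_field_derivative_def)
  have e: "((\<lambda>z. exp (\<i> * of_real (k \<bullet> z))) has_derivative (\<lambda>v. exp (\<i> * of_real (k \<bullet> z)) * (\<i> * of_real (k \<bullet> v)))) (at z)"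
    by (rule exp_phase_has_derivative)
  show "(packet m n has_derivative (\<lambda>v. of_real (Re v) * (of_real (Re a) * packet (Suc m) n z + of_real (Re b) * packet m (Suc n) z + \<i> * of_real (Re k) * packet m n z) +
     of_real (Im v) * (of_real (Im a) * packet (Suc m) n z + of_real (Im b) * packet m (Suc n) z + \<i> * of_real (Im k) * packet m n z))) (at z)"
    unfolding packet_def[abs_def]
    by (rule derivative_eq_intros d[OF assms(1)] d[OF assms(2)] e refl)+
       (auto simp: fun_eq_iff inner_complex_def algebra_simps)
qed

end

lemma plane_gradient_add:
  "plane_gradient f f1 f2 \<Longrightarrow> plane_gradient g g1 g2 \<Longrightarrow> plane_gradient (\<lambda>z. f z + g z) (\<lambda>z. f1 z + g1 z) (\<lambda>z. f2 z + g2 z)"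
  unfolding plane_gradient_def by (auto intro!: derivative_eq_intros simp: algebra_simps)

lemma plane_gradient_mult:
  "plane_gradient f f1 f2 \<Longrightarrow> plane_gradient (\<lambda>z. c * f z) (\<lambda>z. c * f1 z) (\<lambda>z. c * f2 z)"
  unfolding plane_gradient_def by (auto intro!: derivative_eq_intros simp: algebra_simps)

lemma packet_second_gradient:
  fixes a b k \<alpha> \<beta> \<gamma> :: complex and a0 b0 :: real
  defines "P \<equiv> packet a b k a0 b0"
  defines "X m n \<equiv> (\<lambda>z. of_real (Re a) * P (Suc m) n z + of_real (Re b) * P m (Suc n) z + \<i> * of_real (Re k) * P m n z)"
  defines "Y m n \<equiv> (\<lambda>z. of_real (Im a) * P (Suc m) n z + of_real (Im b) * P m (Suc n) z + \<i> * of_real (Im k) * P m n z)"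
  shows "plane_gradient (\<lambda>z. \<alpha> * P 1 0 z + \<beta> * P 0 1 z + \<gamma> * P 0 0 z)
    (\<lambda>z. \<alpha> * X 1 0 z + \<beta> * X 0 1 z + \<gamma> * X 0 0 z) (\<lambda>z. \<alpha> * Y 1 0 z + \<beta> * Y 0 1 z + \<gamma> * Y 0 0 z)"
  unfolding X_def Y_def P_def by (intro plane_gradient_add plane_gradient_mult packet_gradient) auto

section \<open>Lebesgue measure of the plane\<close>

lemma lborel_complex: "lborel = distr (lborel \<Otimes>\<^sub>M lborel) borel (\<lambda>(x, y). Complex x y)"
proof (rule lborel_eqI)
  have m: "(\<lambda>(x, y). Complex x y) \<in> borel_measurable (lborel \<Otimes>\<^sub>M lborel)"
  proof -
    have "continuous_on UNIV (\<lambda>p. Complex (fst p) (snd p))"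
      unfolding Complex_eq by (intro continuous_intros)
    then have "(\<lambda>p. Complex (fst p) (snd p)) \<in> borel_measurable borel" by (rule borel_measurable_continuous_onI)
    then show ?thesis by (simp add: case_prod_beta' lborel_prod)
  qed
  fix l u :: complex
  assume lu: "\<And>b. b \<in> Basis \<Longrightarrow> l \<bullet> b \<le> u \<bullet> b"
  have le: "Re l \<le> Re u" "Im l \<le> Im u" using lu[of 1] lu[of \<i>] by (auto simp: Basis_complex_def)
  have "emeasure (distr (lborel \<Otimes>\<^sub>M lborel) borel (\<lambda>(x, y). Complex x y)) (box l u)
      = emeasure (lborel \<Otimes>\<^sub>M lborel) ({Re l<..<Re u} \<times> {Im l<..<Im u})"
    by (subst emeasure_distr[OF m]) (auto intro!: arg_cong2[where f = emeasure] simp: box_def Basis_complex_def space_pair_measure)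
  also have "\<dots> = ennreal (Re u - Re l) * ennreal (Im u - Im l)"
    using le by (subst lborel.emeasure_pair_measure_Times) auto
  also have "\<dots> = ennreal (\<Prod>b\<in>Basis. (u - l) \<bullet> b)"
    using le by (simp add: Basis_complex_def ennreal_mult)
  finally show "emeasure (distr (lborel \<Otimes>\<^sub>M lborel) borel (\<lambda>(x, y). Complex x y)) (box l u) = (\<Prod>b\<in>Basis. (u - l) \<bullet> b)" .
qed simp

lemma integrable_product:
  fixes f :: "'a::euclidean_space \<Rightarrow> 'c::{real_normed_field, banach, second_countable_topology}" and g :: "'b::euclidean_space \<Rightarrow> 'c"
  assumes "integrable lborel f" "integrable lborel g"
  shows "integrable (lborel \<Otimes>\<^sub>M lborel) (\<lambda>p. f (fst p) * g (snd p))"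
proof -
  have [measurable]: "f \<in> borel_measurable borel" "g \<in> borel_measurable borel" using assms by auto
  show ?thesis
  proof (rule lborel_pair.Fubini_integrable)
    show "integrable lborel (\<lambda>x. LINT y|lborel. norm (f (fst (x, y)) * g (snd (x, y))))"
      using assms by (simp add: norm_mult integrable_norm)
  qed (use assms in \<open>auto intro: integrable_mult_right\<close>)
qed

lemma integral_product_plane:
  fixes f g :: "real \<Rightarrow> complex"
  assumes "integrable lborel f" "integrable lborel g"
  shows "integrable lborel (\<lambda>z. f (Re z) * g (Im z))" "(LINT z|lborel. f (Re z) * g (Im z)) = (LINT x|lborel. f x) * (LINT x|lborel. g x)"
proof -
  have m: "(\<lambda>(x, y). Complex x y) \<in> borel_measurable (lborel \<Otimes>\<^sub>M lborel)"
  proof -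
    have "continuous_on UNIV (\<lambda>p. Complex (fst p) (snd p))"
      unfolding Complex_eq by (intro continuous_intros)
    then have "(\<lambda>p. Complex (fst p) (snd p)) \<in> borel_measurable borel" by (rule borel_measurable_continuous_onI)
    then show ?thesis by (simp add: case_prod_beta' lborel_prod)
  qed
  have [measurable]: "f \<in> borel_measurable borel" "g \<in> borel_measurable borel" using assms by auto
  have m2: "(\<lambda>z. f (Re z) * g (Im z)) \<in> borel_measurable borel" by measurable
  have i: "integrable (lborel \<Otimes>\<^sub>M lborel) (\<lambda>(x, y). f x * g y)"
    using integrable_product[OF assms] by (simp add: case_prod_beta')
  then show "integrable lborel (\<lambda>z. f (Re z) * g (Im z))"
    by (subst lborel_complex, subst integrable_distr_eq[OF m m2]) (simp add: case_prod_beta')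
  have "(LINT z|lborel. f (Re z) * g (Im z)) = (LINT p|(lborel \<Otimes>\<^sub>M lborel). (\<lambda>(x, y). f x * g y) p)"
    by (subst lborel_complex, subst integral_distr[OF m m2]) (simp add: case_prod_beta')
  also have "\<dots> = (LINT x|lborel. LINT y|lborel. f x * g y)" using lborel_pair.integral_fst'[OF i] by simp
  also have "\<dots> = (LINT x|lborel. f x) * (LINT x|lborel. g x)" by simp
  finally show "(LINT z|lborel. f (Re z) * g (Im z)) = (LINT x|lborel. f x) * (LINT x|lborel. g x)" .
qed

lemma plane_affine_integral:
  fixes f :: "complex \<Rightarrow> 'b::{banach, second_countable_topology}" and c :: real and t :: complex
  assumes "f \<in> borel_measurable borel" "c > 0"
  shows "(LINT x|lborel. f x) = c\<^sup>2 *\<^sub>R (LINT x|lborel. f (t + of_real c * x))"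
    and "integrable lborel f \<Longrightarrow> integrable lborel (\<lambda>x. f (t + of_real c * x))"
proof -
  have lb: "lborel = density (distr lborel borel (\<lambda>x. t + c *\<^sub>R x)) (\<lambda>_. ennreal (c\<^sup>2))"
    using lborel_affine[of c t] assms(2) by simp
  have "(LINT x|lborel. f x) = c\<^sup>2 *\<^sub>R (LINT x|distr lborel borel (\<lambda>x. t + c *\<^sub>R x). f x)"
    by (subst lb, subst integral_density) (use assms in auto)
  also have "(LINT x|distr lborel borel (\<lambda>x. t + c *\<^sub>R x). f x) = (LINT x|lborel. f (t + of_real c * x))"
    by (subst integral_distr) (use assms in \<open>auto simp: scaleR_conv_of_real\<close>)
  finally show "(LINT x|lborel. f x) = c\<^sup>2 *\<^sub>R (LINT x|lborel. f (t + of_real c * x))" .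
  assume "integrable lborel f"
  then have "integrable (density (distr lborel borel (\<lambda>x. t + c *\<^sub>R x)) (\<lambda>_. ennreal (c\<^sup>2))) f" by (subst lb[symmetric])
  then have "integrable (distr lborel borel (\<lambda>x. t + c *\<^sub>R x)) (\<lambda>x. c\<^sup>2 *\<^sub>R f x)"
    by (subst (asm) integrable_density) (use assms in auto)
  then have "integrable (distr lborel borel (\<lambda>x. t + c *\<^sub>R x)) (\<lambda>x. (1 / c\<^sup>2) *\<^sub>R (c\<^sup>2 *\<^sub>R f x))"
    by (rule integrable_scaleR_right)
  then have "integrable (distr lborel borel (\<lambda>x. t + c *\<^sub>R x)) f" using assms(2) by simp
  then show "integrable lborel (\<lambda>x. f (t + of_real c * x))"
    by (subst (asm) integrable_distr_eq) (use assms in \<open>auto simp: scaleR_conv_of_real\<close>)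
qed

text \<open>The integrable function against which Fourier transforms are compared.\<close>

definition weight :: "complex \<Rightarrow> real" where
  "weight u = 1 / ((1 + (Re u)\<^sup>2) * (1 + (Im u)\<^sup>2))"

lemma weight_pos: "0 < weight u" by (simp add: weight_def add_pos_nonneg)

lemma weight_integrable: "integrable lborel weight"
proof -
  have "integrable lborel (\<lambda>x::real. inverse (1 + x\<^sup>2))"
    using integrable_inverse_1_plus_square by (simp add: set_integrable_def einterval_def)
  then have "integrable lborel (\<lambda>x. complex_of_real (inverse (1 + x\<^sup>2)))" by (rule integrable_of_real)
  from integral_product_plane(1)[OF this this] have "integrable lborel (\<lambda>z. complex_of_real (weight z))"
    by (simp add: weight_def divide_simps)
  then show ?thesis using integrable_norm[of lborel "\<lambda>z. complex_of_real (weight z)"] weight_pos by (simp add: less_imp_le)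
qed

definition gauss :: "complex \<Rightarrow> real" where "gauss z = exp (- (cmod z)\<^sup>2 / 2)"

lemma gauss_integrable: "integrable lborel (\<lambda>z. complex_of_real (gauss z))"
  and gauss_transform: "(LINT s|lborel. exp (\<i> * of_real (s \<bullet> t)) * of_real (gauss s)) = of_real (2 * pi * gauss t)"
proof -
  let ?n = "\<lambda>t x. iexp (t * x) * complex_of_real (std_normal_density x)"
  have 1: "integrable lborel (?n t)" for t
  proof -
    have "integrable lborel (\<lambda>x. complex_of_real (std_normal_density x))"
      by (intro integrable_of_real integrable_normal_density) auto
    then show ?thesis
      by (rule Bochner_Integration.integrable_bound) (auto simp: norm_mult)
  qed
  have 2: "(LINT x|lborel. ?n t x) = of_real (exp (- t\<^sup>2 / 2))" for t
  proof -
    have "char std_normal_distribution t = (LINT x|lborel. std_normal_density x *\<^sub>R iexp (t * x))"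
      unfolding char_def by (subst integral_density) (auto intro: borel_measurable_continuous_onI continuous_intros)
    then show ?thesis by (simp add: char_std_normal_distribution scaleR_conv_of_real mult.commute)
  qed
  have eq: "?n (Re t) (Re s) * ?n (Im t) (Im s) = (1 / (2 * of_real pi)) * (exp (\<i> * of_real (s \<bullet> t)) * of_real (gauss s))" for s t
  proof -
    have "std_normal_density (Re s) * std_normal_density (Im s) = 1 / (2 * pi) * gauss s"
    proof -
      have "(1 / sqrt (2 * pi)) * (1 / sqrt (2 * pi)) = 1 / (2 * pi)" by simp
      moreover have "exp (- (Re s)\<^sup>2 / 2) * exp (- (Im s)\<^sup>2 / 2) = gauss s"
        unfolding gauss_def cmod_power2 mult_exp_exp by (simp add: add_divide_distrib)
      ultimately show ?thesis unfolding std_normal_density_def by (simp add: mult.commute mult.left_commute)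
    qed
    then have "complex_of_real (std_normal_density (Re s)) * of_real (std_normal_density (Im s)) = 1 / (2 * of_real pi) * of_real (gauss s)"
      by (metis of_real_mult of_real_divide of_real_1 of_real_numeral)
    moreover have "iexp (Re t * Re s) * iexp (Im t * Im s) = exp (\<i> * of_real (s \<bullet> t))"
      by (simp add: inner_complex_def exp_add[symmetric] algebra_simps)
    moreover have "?n (Re t) (Re s) * ?n (Im t) (Im s) = (iexp (Re t * Re s) * iexp (Im t * Im s)) *
        (complex_of_real (std_normal_density (Re s)) * of_real (std_normal_density (Im s)))" by (simp only: mult_ac)
    ultimately show ?thesis by (simp only: mult_ac)
  qed
  note i = integral_product_plane[OF 1[of "Re t"] 1[of "Im t"]]
  note i0 = integral_product_plane[OF 1[of "Re 0"] 1[of "Im 0"]]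
  show "integrable lborel (\<lambda>z. complex_of_real (gauss z))"
    using integrable_mult_right[OF i0(1), of "2 * of_real pi"] unfolding eq by simp
  have "(LINT s|lborel. exp (\<i> * of_real (s \<bullet> t)) * of_real (gauss s)) * (1 / (2 * of_real pi)) = of_real (exp (- (Re t)\<^sup>2 / 2)) * of_real (exp (- (Im t)\<^sup>2 / 2))"
    using i(2) unfolding eq 2 by (simp add: mult.commute)
  also have "\<dots> = of_real (gauss t)"
    unfolding gauss_def cmod_power2 of_real_mult[symmetric] mult_exp_exp by (simp add: add_divide_distrib)
  finally show "(LINT s|lborel. exp (\<i> * of_real (s \<bullet> t)) * of_real (gauss s)) = of_real (2 * pi * gauss t)"
    by (simp add: field_simps)
qed

section \<open>Decay and inversion of Fourier transforms\<close>

lemma test_bounded: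
  assumes "continuous_on UNIV (b :: complex \<Rightarrow> complex)" "compact (closure {\<xi>. b \<xi> \<noteq> 0})"
  obtains R B where "R > 0" "B > 0" "\<And>\<xi>. R \<le> cmod \<xi> \<Longrightarrow> b \<xi> = 0" "\<And>\<xi>. cmod (b \<xi>) \<le> B"
proof -
  obtain R0 where R0: "closure {\<xi>. b \<xi> \<noteq> 0} \<subseteq> ball 0 R0" "R0 > 0"
    using compact_imp_bounded[OF assms(2)] bounded_subset_ballD by blast
  have z: "b \<xi> = 0" if "R0 \<le> cmod \<xi>" for \<xi> using that R0(1) closure_subset[of "{\<xi>. b \<xi> \<noteq> 0}"] by force
  have "compact (b ` cball 0 R0)" using continuous_on_subset[OF assms(1)] by (intro compact_continuous_image) auto
  then obtain B where B: "B > 0" "\<forall>x\<in>b ` cball 0 R0. cmod x \<le> B" using compact_imp_bounded bounded_pos by metis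
  have "cmod (b \<xi>) \<le> B" for \<xi> using B z[of \<xi>] by (cases "cmod \<xi> \<le> R0") auto
  then show thesis using that[OF R0(2) B(1)] z by blast
qed

lemma test_integrable:
  assumes "continuous_on UNIV (b :: complex \<Rightarrow> complex)" "\<And>\<xi>. R \<le> cmod \<xi> \<Longrightarrow> b \<xi> = 0"
  shows "integrable lborel b"
proof -
  have "integrable lborel (\<lambda>x. indicator (cball 0 R) x *\<^sub>R b x)"
    by (rule borel_integrable_compact) (use continuous_on_subset[OF assms(1)] in auto)
  moreover have "(\<lambda>x. indicator (cball 0 R) x *\<^sub>R b x) = b" using assms(2) by (auto simp: indicator_def fun_eq_iff)
  ultimately show ?thesis by simp
qed

text \<open>The integral of a derivative of a compactly supported function vanishes, because the integral of the function is
  invariant under translations.\<close>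

lemma integral_gradient_zero:
  assumes g: "plane_gradient F G H" "continuous_on UNIV G" "continuous_on UNIV H"
    and R: "\<And>\<xi>. R \<le> cmod \<xi> \<Longrightarrow> F \<xi> = 0 \<and> G \<xi> = 0 \<and> H \<xi> = 0" and v: "v = 1 \<or> v = \<i>"
  shows "(LINT \<xi>|lborel. of_real (Re v) * G \<xi> + of_real (Im v) * H \<xi>) = 0"
proof -
  let ?D = "\<lambda>\<xi> v. of_real (Re v) * G \<xi> + of_real (Im v) * H \<xi>"
  have cF: "continuous_on UNIV F"
    using g(1) unfolding plane_gradient_def continuous_on_eq_continuous_within by (metis has_derivative_continuous)
  have iF: "integrable lborel F" by (rule test_integrable[OF cF, of R]) (use R in auto)
  have [measurable]: "F \<in> borel_measurable borel" "G \<in> borel_measurable borel" "H \<in> borel_measurable borel"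
    using cF g by (auto intro: borel_measurable_continuous_onI)
  have nv: "cmod v = 1" using v by auto
  obtain B where B: "B > 0" "\<And>\<xi>. cmod (?D \<xi> v) \<le> B"
  proof -
    have "continuous_on UNIV (\<lambda>\<xi>. ?D \<xi> v)" using g by (intro continuous_intros)
    then have "compact ((\<lambda>\<xi>. ?D \<xi> v) ` cball 0 R)"
      by (intro compact_continuous_image[OF continuous_on_subset]) auto
    then have "bounded ((\<lambda>\<xi>. ?D \<xi> v) ` cball 0 R)" by (rule compact_imp_bounded)
    then obtain B where B: "B > 0" "\<forall>x\<in>(\<lambda>\<xi>. ?D \<xi> v) ` cball 0 R. cmod x \<le> B" unfolding bounded_pos by blast
    have "cmod (?D \<xi> v) \<le> B" for \<xi> using B R[of \<xi>] by (cases "cmod \<xi> \<le> R") auto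
    then show thesis using that B(1) by blast
  qed
  define f where "f n \<xi> = of_real (real (Suc n)) * (F (\<xi> + of_real (1 / real (Suc n)) * v) - F \<xi>)" for n \<xi>
  have line: "((\<lambda>t. F (\<xi> + of_real t * v)) has_vector_derivative ?D (\<xi> + of_real t * v) v) (at t within T)" for \<xi> t T
  proof -
    have "(F has_derivative ?D (\<xi> + of_real t * v)) (at (\<xi> + of_real t * v))" using g(1) by (simp add: plane_gradient_def)
    moreover have "((\<lambda>t. \<xi> + complex_of_real t * v) has_derivative (\<lambda>s. of_real s * v)) (at t within T)"
      by (auto intro!: derivative_eq_intros)
    ultimately have "((\<lambda>t. F (\<xi> + of_real t * v)) has_derivative (\<lambda>s. ?D (\<xi> + of_real t * v) (of_real s * v))) (at t within T)"
      by (rule has_derivative_compose[rotated])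
    then show ?thesis by (simp add: has_vector_derivative_def scaleR_conv_of_real algebra_simps)
  qed
  have bound: "cmod (f n \<xi>) \<le> B" for n \<xi>
  proof -
    let ?s = "1 / real (Suc n)"
    have "norm (F (\<xi> + of_real ?s * v) - F (\<xi> + of_real 0 * v)) \<le> B * norm (?s - 0)"
    proof (rule differentiable_bound[of "{0..?s}"])
      show "((\<lambda>t. F (\<xi> + of_real t * v)) has_derivative (\<lambda>s. s *\<^sub>R ?D (\<xi> + of_real t * v) v)) (at t within {0..?s})" for t
        using line[of \<xi> t] by (simp add: has_vector_derivative_def)
      show "onorm (\<lambda>s. s *\<^sub>R ?D (\<xi> + of_real t * v) v) \<le> B" for t
      proof (rule onorm_le)
        fix s :: real
        have "\<bar>s\<bar> * cmod (?D (\<xi> + of_real t * v) v) \<le> \<bar>s\<bar> * B" using B(2) by (rule mult_left_mono) simp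
        then show "norm (s *\<^sub>R ?D (\<xi> + of_real t * v) v) \<le> B * norm s" unfolding norm_scaleR real_norm_def by (simp only: mult.commute)
      qed
    qed auto
    then have "cmod (F (\<xi> + of_real ?s * v) - F \<xi>) \<le> B * ?s" by simp
    then have "real (Suc n) * cmod (F (\<xi> + of_real ?s * v) - F \<xi>) \<le> real (Suc n) * (B * ?s)" by (rule mult_left_mono) simp
    moreover have "real (Suc n) * (B * ?s) = B" by simp
    ultimately show ?thesis unfolding f_def norm_mult norm_of_real by simp
  qed
  have lim: "(\<lambda>n. f n \<xi>) \<longlonglongrightarrow> ?D \<xi> v" for \<xi>
  proof -
    have "((\<lambda>t. (F (\<xi> + of_real t * v) - F \<xi>) /\<^sub>R t) \<longlongrightarrow> ?D \<xi> v) (at 0)"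
    proof -
      let ?p = "\<lambda>t. F (\<xi> + of_real t * v)"
      have "(?p has_derivative (\<lambda>t. t *\<^sub>R ?D \<xi> v)) (at 0)" using line[of \<xi> 0 UNIV] by (simp add: has_vector_derivative_def)
      then have "((\<lambda>t. norm (?p (0 + t) - ?p 0 - t *\<^sub>R ?D \<xi> v) / norm t) \<longlongrightarrow> 0) (at 0)" unfolding has_derivative_at by blast
      moreover have "\<forall>\<^sub>F t in at 0. norm (?p (0 + t) - ?p 0 - t *\<^sub>R ?D \<xi> v) / norm t = norm ((?p t - F \<xi>) /\<^sub>R t - ?D \<xi> v)"
        unfolding eventually_at_filter
      proof (intro always_eventually allI impI)
        fix t :: real assume "t \<noteq> 0"
        then have "(?p t - F \<xi>) /\<^sub>R t - ?D \<xi> v = (1 / t) *\<^sub>R (?p (0 + t) - ?p 0 - t *\<^sub>R ?D \<xi> v)"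
          by (simp add: scaleR_diff_right divide_inverse)
        then show "norm (?p (0 + t) - ?p 0 - t *\<^sub>R ?D \<xi> v) / norm t = norm ((?p t - F \<xi>) /\<^sub>R t - ?D \<xi> v)"
          by (simp only: norm_scaleR) (simp add: divide_inverse mult.commute)
      qed
      ultimately have "((\<lambda>t. norm ((?p t - F \<xi>) /\<^sub>R t - ?D \<xi> v)) \<longlongrightarrow> 0) (at 0)" by (rule Lim_transform_eventually)
      then show ?thesis unfolding tendsto_norm_zero_iff using Lim_null by blast
    qed
    moreover have "filterlim (\<lambda>n. 1 / real (Suc n)) (at 0) sequentially"
      using LIMSEQ_Suc[OF lim_1_over_n] by (simp add: filterlim_at del: of_nat_Suc)
    ultimately have "(\<lambda>n. (F (\<xi> + of_real (1 / real (Suc n)) * v) - F \<xi>) /\<^sub>R (1 / real (Suc n))) \<longlonglongrightarrow> ?D \<xi> v"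
      by (rule filterlim_compose)
    then show ?thesis by (simp add: f_def scaleR_conv_of_real)
  qed
  have zero: "f n \<xi> = 0" if "R + 1 \<le> cmod \<xi>" for n \<xi>
  proof -
    have "cmod (of_real (1 / real (Suc n)) * v) \<le> 1" unfolding norm_mult norm_of_real nv by simp
    moreover have "cmod \<xi> \<le> cmod (\<xi> + of_real (1 / real (Suc n)) * v) + cmod (of_real (1 / real (Suc n)) * v)"
      using norm_triangle_ineq4[of "\<xi> + of_real (1 / real (Suc n)) * v" "of_real (1 / real (Suc n)) * v"] by simp
    ultimately have "R \<le> cmod (\<xi> + of_real (1 / real (Suc n)) * v)" using that by linarith
    then show ?thesis using R that by (simp add: f_def)
  qed
  have z: "(LINT \<xi>|lborel. f n \<xi>) = 0" for n
  proof -
    have i: "integrable lborel (\<lambda>\<xi>. F (of_real (1 / real (Suc n)) * v + of_real 1 * \<xi>))"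
      by (rule plane_affine_integral(2)) (use iF in auto)
    have "(LINT \<xi>|lborel. F \<xi>) = (LINT \<xi>|lborel. F (of_real (1 / real (Suc n)) * v + of_real 1 * \<xi>))"
      using plane_affine_integral(1)[of F 1 "of_real (1 / real (Suc n)) * v"] by simp
    then show ?thesis unfolding f_def using i iF by (simp add: add.commute del: of_real_divide)
  qed
  have "(\<lambda>n. LINT \<xi>|lborel. f n \<xi>) \<longlonglongrightarrow> (LINT \<xi>|lborel. ?D \<xi> v)"
  proof (rule integral_dominated_convergence[where w = "\<lambda>\<xi>. indicator (cball 0 (R + 1)) \<xi> *\<^sub>R B"])
    show "integrable lborel (\<lambda>\<xi> :: complex. indicator (cball 0 (R + 1)) \<xi> *\<^sub>R B)"
      by (rule borel_integrable_compact) auto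
    show "f n \<in> borel_measurable lborel" for n unfolding f_def by measurable
    show "AE \<xi> in lborel. (\<lambda>n. f n \<xi>) \<longlonglongrightarrow> ?D \<xi> v" using lim by simp
    show "AE \<xi> in lborel. norm (f n \<xi>) \<le> indicator (cball 0 (R + 1)) \<xi> *\<^sub>R B" for n
      using bound zero B(1) by (intro always_eventually) (auto simp: indicator_def)
  qed measurable
  then have "(\<lambda>n. 0) \<longlonglongrightarrow> (LINT \<xi>|lborel. ?D \<xi> v)" unfolding z .
  from LIMSEQ_unique[OF this tendsto_const] show ?thesis .
qed

definition fourier :: "(complex \<Rightarrow> complex) \<Rightarrow> complex \<Rightarrow> complex" where
  "fourier b u = (LINT \<xi>|lborel. exp (- \<i> * of_real (u \<bullet> \<xi>)) * b \<xi>)"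

lemma test_gradient:
  assumes "test_function b"
  obtains g h where "plane_gradient b g h" "test_function g" "test_function h"
proof -
  have cb: "Ck_plane k b" for k using assms by (simp add: test_function_def)
  have "\<exists>g h. plane_gradient b g h \<and> Ck_plane k g \<and> Ck_plane k h" for k
    using cb[of "Suc k"] by (auto simp: plane_gradient_def)
  then obtain g h where gh: "\<And>k. plane_gradient b (g k) (h k)" "\<And>k. Ck_plane k (g k)" "\<And>k. Ck_plane k (h k)" by metis
  have eq: "g k = g 0 \<and> h k = h 0" for k
    using gradient_unique gh(1)[of k] gh(1)[of 0] unfolding plane_gradient_def by (auto simp: fun_eq_iff) blast+
  have zero: "g 0 z = 0 \<and> h 0 z = 0" if z: "z \<notin> closure {\<xi>. b \<xi> \<noteq> 0}" for z
  proof -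
    have "((\<lambda>w. 0 :: complex) has_derivative (\<lambda>u. of_real (Re u) * 0 + of_real (Im u) * 0)) (at z)" by simp
    then have "(b has_derivative (\<lambda>u. of_real (Re u) * 0 + of_real (Im u) * 0)) (at z)"
      by (rule has_derivative_transform_within_open[of _ _ _ _ "- closure {\<xi>. b \<xi> \<noteq> 0}"])
         (use z closure_subset[of "{\<xi>. b \<xi> \<noteq> 0}"] in \<open>auto simp: open_Compl\<close>)
    from gradient_unique[OF this gh(1)[of 0, unfolded plane_gradient_def, rule_format]] show ?thesis by simp
  qed
  have supp: "compact (closure {\<xi>. f \<xi> \<noteq> 0})" if "\<And>z. z \<notin> closure {\<xi>. b \<xi> \<noteq> 0} \<Longrightarrow> f z = 0" for f :: "complex \<Rightarrow> complex"
  proof -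
    have "closure {\<xi>. f \<xi> \<noteq> 0} \<subseteq> closure {\<xi>. b \<xi> \<noteq> 0}" using that by (intro closure_minimal) auto
    then show ?thesis using assms by (metis test_function_def closed_closure compact_Int_closed inf.absorb_iff2)
  qed
  show thesis
  proof (rule that[of "g 0" "h 0"])
    show "test_function (g 0)" "test_function (h 0)" unfolding test_function_def
      using supp[of "g 0"] supp[of "h 0"] zero gh(2,3) eq by metis+
  qed (rule gh)
qed

lemma Ck_plane_continuous: "Ck_plane k f \<Longrightarrow> continuous_on UNIV f"
  by (cases k) auto

lemma test_continuous: "test_function b \<Longrightarrow> continuous_on UNIV b"
  using Ck_plane_continuous by (auto simp: test_function_def)

text \<open>Integration by parts: the modulated function \<open>exp (- \<i> u \<bullet> \<xi>) b(\<xi>)\<close> has compact support.\<close>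

lemma fourier_gradient:
  assumes "plane_gradient b g h" "test_function b" "test_function g" "test_function h"
  shows "fourier g u = \<i> * of_real (Re u) * fourier b u" "fourier h u = \<i> * of_real (Im u) * fourier b u"
proof -
  let ?e = "\<lambda>\<xi>. exp (- \<i> * of_real (u \<bullet> \<xi>))"
  let ?F = "\<lambda>\<xi>. ?e \<xi> * b \<xi>"
  let ?G = "\<lambda>\<xi>. ?e \<xi> * (g \<xi> - \<i> * of_real (Re u) * b \<xi>)" and ?H = "\<lambda>\<xi>. ?e \<xi> * (h \<xi> - \<i> * of_real (Im u) * b \<xi>)"
  note ct = test_continuous[OF assms(2)] test_continuous[OF assms(3)] test_continuous[OF assms(4)]
  have ce: "continuous_on UNIV ?e" by (intro continuous_intros)
  obtain R1 where R1: "\<And>\<xi>. R1 \<le> cmod \<xi> \<Longrightarrow> b \<xi> = 0" using test_bounded[OF ct(1)] assms(2) unfolding test_function_def by metis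
  obtain R2 where R2: "\<And>\<xi>. R2 \<le> cmod \<xi> \<Longrightarrow> g \<xi> = 0" using test_bounded[OF ct(2)] assms(3) unfolding test_function_def by metis
  obtain R3 where R3: "\<And>\<xi>. R3 \<le> cmod \<xi> \<Longrightarrow> h \<xi> = 0" using test_bounded[OF ct(3)] assms(4) unfolding test_function_def by metis
  define R where "R = max R1 (max R2 R3)"
  have R: "b \<xi> = 0 \<and> g \<xi> = 0 \<and> h \<xi> = 0" if "R \<le> cmod \<xi>" for \<xi> using that R1 R2 R3 by (simp add: R_def)
  have grad: "plane_gradient ?F ?G ?H"
    unfolding plane_gradient_def
  proof
    fix z
    have b: "(b has_derivative (\<lambda>v. of_real (Re v) * g z + of_real (Im v) * h z)) (at z)" using assms(1) by (simp add: plane_gradient_def)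
    have e: "(?e has_derivative (\<lambda>v. ?e z * (- \<i> * of_real (u \<bullet> v)))) (at z)"
      by (rule exp_phase_has_derivative)
    show "(?F has_derivative (\<lambda>v. of_real (Re v) * ?G z + of_real (Im v) * ?H z)) (at z)"
      by (rule has_derivative_eq_rhs[OF has_derivative_mult[OF e b]])
         (auto simp: fun_eq_iff inner_complex_def algebra_simps)
  qed
  have i: "integrable lborel (\<lambda>\<xi>. ?e \<xi> * b \<xi>)" "integrable lborel (\<lambda>\<xi>. ?e \<xi> * g \<xi>)" "integrable lborel (\<lambda>\<xi>. ?e \<xi> * h \<xi>)"
    by (rule test_integrable[of _ R]; use ct ce R in \<open>auto intro!: continuous_intros\<close>)+
  have cG: "continuous_on UNIV ?G" "continuous_on UNIV ?H" using ct by (auto intro!: continuous_intros)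
  have "(LINT \<xi>|lborel. ?G \<xi>) = 0" "(LINT \<xi>|lborel. ?H \<xi>) = 0"
    using integral_gradient_zero[OF grad cG, of R 1] integral_gradient_zero[OF grad cG, of R \<i>] R by auto
  moreover have "(LINT \<xi>|lborel. ?G \<xi>) = fourier g u - \<i> * of_real (Re u) * fourier b u"
  proof -
    have "(LINT \<xi>|lborel. ?G \<xi>) = (LINT \<xi>|lborel. ?e \<xi> * g \<xi> - (\<i> * of_real (Re u)) * (?e \<xi> * b \<xi>))"
      by (rule Bochner_Integration.integral_cong) (auto simp: algebra_simps)
    then show ?thesis using i by (simp add: fourier_def)
  qed
  moreover have "(LINT \<xi>|lborel. ?H \<xi>) = fourier h u - \<i> * of_real (Im u) * fourier b u"
  proof -
    have "(LINT \<xi>|lborel. ?H \<xi>) = (LINT \<xi>|lborel. ?e \<xi> * h \<xi> - (\<i> * of_real (Im u)) * (?e \<xi> * b \<xi>))"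
      by (rule Bochner_Integration.integral_cong) (auto simp: algebra_simps)
    then show ?thesis using i by (simp add: fourier_def)
  qed
  ultimately show "fourier g u = \<i> * of_real (Re u) * fourier b u" "fourier h u = \<i> * of_real (Im u) * fourier b u" by simp_all
qed

lemma fourier_powers:
  "test_function b \<Longrightarrow> \<exists>b'. test_function b' \<and> (\<forall>u. fourier b' u = (\<i> * of_real (Re u)) ^ m * (\<i> * of_real (Im u)) ^ n * fourier b u)"
proof (induction "m + n" arbitrary: m n)
  case (Suc l)
  show ?case
  proof (cases m)
    case 0
    then obtain n' where n: "n = Suc n'" using Suc by (cases n) auto
    then obtain b' where b': "test_function b'" "\<forall>u. fourier b' u = (\<i> * of_real (Re u)) ^ m * (\<i> * of_real (Im u)) ^ n' * fourier b u"
      using Suc.hyps(1)[of m n'] Suc.hyps(2) Suc.prems by auto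
    obtain g h where "plane_gradient b' g h" "test_function g" "test_function h" using test_gradient[OF b'(1)] by blast
    then show ?thesis using fourier_gradient(2)[of b' g h] b' n by (intro exI[of _ h]) (simp add: algebra_simps)
  next
    case m: (Suc m')
    then obtain b' where b': "test_function b'" "\<forall>u. fourier b' u = (\<i> * of_real (Re u)) ^ m' * (\<i> * of_real (Im u)) ^ n * fourier b u"
      using Suc.hyps(1)[of m' n] Suc.hyps(2) Suc.prems by auto
    obtain g h where "plane_gradient b' g h" "test_function g" "test_function h" using test_gradient[OF b'(1)] by blast
    then show ?thesis using fourier_gradient(1)[of b' g h] b' m by (intro exI[of _ g]) (simp add: algebra_simps)
  qed
qed auto

lemma fourier_bounded: "test_function b \<Longrightarrow> \<exists>C. \<forall>u. cmod (fourier b u) \<le> C"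
proof (intro exI allI)
  fix u assume b: "test_function b"
  have "cmod (fourier b u) \<le> (LINT \<xi>|lborel. cmod (exp (- \<i> * of_real (u \<bullet> \<xi>)) * b \<xi>))"
    unfolding fourier_def by (rule integral_norm_bound)
  then show "cmod (fourier b u) \<le> (LINT \<xi>|lborel. cmod (b \<xi>))" by (simp add: norm_mult)
qed

text \<open>Products of powers of \<open>Re u\<close> and \<open>Im u\<close> times the transform are transforms of derivatives, hence bounded.\<close>

lemma fourier_decay:
  assumes "test_function b" shows "\<exists>C>0. \<forall>u. (1 + cmod u) * cmod (fourier b u) \<le> C * weight u"
proof -
  have "\<exists>C. \<forall>u. \<bar>Re u\<bar> ^ m * \<bar>Im u\<bar> ^ n * cmod (fourier b u) \<le> C" for m n
  proof -
    obtain b' where b': "test_function b'" "\<forall>u. fourier b' u = (\<i> * of_real (Re u)) ^ m * (\<i> * of_real (Im u)) ^ n * fourier b u"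
      using fourier_powers[OF assms] by blast
    then obtain C where "\<forall>u. cmod (fourier b' u) \<le> C" using fourier_bounded by blast
    then show ?thesis using b'(2) by (intro exI[of _ C]) (simp add: norm_mult norm_power)
  qed
  then obtain C where C: "\<And>m n u. \<bar>Re u\<bar> ^ m * \<bar>Im u\<bar> ^ n * cmod (fourier b u) \<le> C m n" by metis
  define D where "D = C 0 0 + C 4 0 + C 0 4 + C 4 4"
  have D: "(1 + \<bar>Re u\<bar> ^ 4) * (1 + \<bar>Im u\<bar> ^ 4) * cmod (fourier b u) \<le> D" for u
    using C[of u 0 0] C[of u 4 0] C[of u 0 4] C[of u 4 4] by (simp add: D_def algebra_simps)
  have Dn: "0 \<le> D" by (rule order_trans[OF _ D[of 0]]) simp
  have poly: "(1 + x) * (1 + x\<^sup>2) \<le> 4 * (1 + x ^ 4)" if "0 \<le> x" for x :: real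
  proof (cases "x \<le> 1")
    case True
    then have "(1 + x) * (1 + x\<^sup>2) \<le> 2 * 2" using that by (intro mult_mono) (auto simp: power_le_one)
    then show ?thesis using that by (smt (verit) zero_le_power)
  next
    case False
    then have "x \<le> x ^ 4" "x\<^sup>2 \<le> x ^ 4" "x ^ 3 \<le> x ^ 4" using power_increasing[of 1 4 x] power_increasing[of 2 4 x] power_increasing[of 3 4 x] by auto
    moreover have "0 \<le> x ^ 4" by simp
    moreover have "(1 + x) * (1 + x\<^sup>2) = 1 + x + x\<^sup>2 + x ^ 3" by (simp add: algebra_simps power2_eq_square power3_eq_cube)
    ultimately have "(1 + x) * (1 + x\<^sup>2) \<le> 1 + 3 * x ^ 4" by linarith
    also have "\<dots> \<le> 4 * (1 + x ^ 4)" by simp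
    finally show ?thesis .
  qed
  have "(1 + cmod u) * cmod (fourier b u) \<le> 16 * D * weight u" for u
  proof -
    let ?x = "\<bar>Re u\<bar>" and ?y = "\<bar>Im u\<bar>" and ?f = "cmod (fourier b u)"
    have "1 + cmod u \<le> (1 + ?x) * (1 + ?y)" using cmod_le[of u] by (simp add: algebra_simps) (smt (verit) abs_ge_zero mult_nonneg_nonneg)
    then have "(1 + cmod u) * ?f * ((1 + ?x\<^sup>2) * (1 + ?y\<^sup>2)) \<le> ((1 + ?x) * (1 + ?y)) * ?f * ((1 + ?x\<^sup>2) * (1 + ?y\<^sup>2))"
      by (intro mult_right_mono) auto
    also have "\<dots> = (((1 + ?x) * (1 + ?x\<^sup>2)) * ((1 + ?y) * (1 + ?y\<^sup>2))) * ?f" by (simp only: mult_ac)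
    also have "\<dots> \<le> ((4 * (1 + ?x ^ 4)) * (4 * (1 + ?y ^ 4))) * ?f"
      by (intro mult_right_mono mult_mono poly) auto
    also have "\<dots> = 16 * ((1 + ?x ^ 4) * (1 + ?y ^ 4) * ?f)" by (simp add: algebra_simps)
    also have "\<dots> \<le> 16 * D" using D[of u] by simp
    finally have "(1 + cmod u) * ?f * ((1 + ?x\<^sup>2) * (1 + ?y\<^sup>2)) \<le> 16 * D" .
    moreover have "0 < (1 + (Re u)\<^sup>2) * (1 + (Im u)\<^sup>2)" by (intro mult_pos_pos add_pos_nonneg) auto
    ultimately show ?thesis by (simp add: weight_def pos_le_divide_eq)
  qed
  moreover have "16 * D * weight u \<le> (16 * D + 1) * weight u" for u using weight_pos[of u] by (simp add: algebra_simps)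
  ultimately show ?thesis using Dn by (intro exI[of _ "16 * D + 1"]) (auto intro: order_trans)
qed

lemma fourier_measurable: "test_function b \<Longrightarrow> fourier b \<in> borel_measurable borel"
proof -
  assume "test_function b"
  then have [measurable]: "b \<in> borel_measurable borel" by (intro borel_measurable_continuous_onI test_continuous)
  show ?thesis unfolding fourier_def[abs_def] by measurable
qed

lemma fourier_integrable:
  assumes "test_function b" shows "integrable lborel (fourier b)" "integrable lborel (\<lambda>u. cmod u * cmod (fourier b u))"
proof -
  obtain C where C: "C > 0" "\<forall>u. (1 + cmod u) * cmod (fourier b u) \<le> C * weight u" using fourier_decay[OF assms] by blast
  have w: "integrable lborel (\<lambda>u. C * weight u)" using weight_integrable by simp
  have [measurable]: "fourier b \<in> borel_measurable borel" by (rule fourier_measurable[OF assms])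
  have wp: "0 \<le> C * weight u" for u using C(1) weight_pos[of u] by simp
  have "cmod (fourier b u) \<le> C * weight u" "cmod u * cmod (fourier b u) \<le> C * weight u" for u
    using C(2)[rule_format, of u] by (auto simp: algebra_simps intro: order_trans[rotated])
  then show "integrable lborel (fourier b)" "integrable lborel (\<lambda>u. cmod u * cmod (fourier b u))"
    by - (rule Bochner_Integration.integrable_bound[OF w]; simp add: order_trans[OF _ abs_ge_self])+
qed

text \<open>Inversion: insert the factor \<open>gauss (d u)\<close>, for which Fubini's theorem applies, and let \<open>d\<close> tend to zero.\<close>

theorem fourier_inversion:
  assumes b: "test_function b"
  shows "(LINT u|lborel. fourier b u * exp (\<i> * of_real (u \<bullet> \<eta>))) = of_real ((2 * pi)\<^sup>2) * b \<eta>"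
proof -
  have cb: "continuous_on UNIV b" by (rule test_continuous[OF b])
  obtain R B where RB: "R > 0" "B > 0" "\<And>\<xi>. R \<le> cmod \<xi> \<Longrightarrow> b \<xi> = 0" "\<And>\<xi>. cmod (b \<xi>) \<le> B"
    using test_bounded[OF cb] b unfolding test_function_def by metis
  have ib: "integrable lborel b" by (rule test_integrable[OF cb RB(3)])
  have [measurable]: "b \<in> borel_measurable borel" "fourier b \<in> borel_measurable borel" "gauss \<in> borel_measurable borel"
    using cb fourier_measurable[OF b] by (auto intro!: borel_measurable_continuous_onI continuous_intros simp: gauss_def[abs_def])
  have g1: "0 < gauss z" "gauss z \<le> 1" for z by (auto simp: gauss_def)
  define d where "d n = 1 / real (Suc n)" for n
  have d: "d n > 0" for n by (simp add: d_def)
  have d0: "d \<longlonglongrightarrow> 0" unfolding d_def by (rule LIMSEQ_Suc[OF lim_1_over_n])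
  have ig: "integrable lborel (\<lambda>u. complex_of_real (gauss (of_real (d n) * u)))" for n
    using plane_affine_integral(2)[of "\<lambda>z. complex_of_real (gauss z)" "d n" 0] gauss_integrable d by simp
  have transform: "(LINT u|lborel. exp (\<i> * of_real (u \<bullet> t)) * of_real (gauss (of_real (d n) * u))) = of_real ((1 / d n)\<^sup>2) * of_real (2 * pi * gauss (of_real (1 / d n) * t))" for n t
  proof -
    have "(LINT u|lborel. exp (\<i> * of_real (u \<bullet> t)) * of_real (gauss (of_real (d n) * u)))
        = ((1 / d n)\<^sup>2) *\<^sub>R (LINT s|lborel. exp (\<i> * of_real ((0 + of_real (1 / d n) * s) \<bullet> t)) * of_real (gauss (of_real (d n) * (0 + of_real (1 / d n) * s))))"
      by (rule plane_affine_integral(1)) (use d in auto)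
    also have "\<dots> = ((1 / d n)\<^sup>2) *\<^sub>R (LINT s|lborel. exp (\<i> * of_real (s \<bullet> (of_real (1 / d n) * t))) * of_real (gauss s))"
    proof -
      have "(0 + of_real (1 / d n) * s) \<bullet> t = s \<bullet> (of_real (1 / d n) * t)" for s
        by (simp add: inner_complex_def algebra_simps)
      moreover have "of_real (d n) * (0 + of_real (1 / d n) * s) = s" for s :: complex using d[of n] by simp
      ultimately show ?thesis by simp
    qed
    finally show ?thesis by (simp add: gauss_transform scaleR_conv_of_real)
  qed
  define J where "J n = (LINT u|lborel. fourier b u * exp (\<i> * of_real (u \<bullet> \<eta>)) * of_real (gauss (of_real (d n) * u)))" for n
  have Jeq: "J n = of_real (2 * pi) * (LINT s|lborel. b (\<eta> + of_real (d n) * s) * of_real (gauss s))" for n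
  proof -
    define f where "f = (\<lambda>u \<xi>. exp (- \<i> * of_real (u \<bullet> \<xi>)) * b \<xi> * (exp (\<i> * of_real (u \<bullet> \<eta>)) * complex_of_real (gauss (of_real (d n) * u))))"
    have "integrable (lborel \<Otimes>\<^sub>M lborel) (\<lambda>p. complex_of_real (gauss (of_real (d n) * fst p)) * b (snd p))"
      by (rule integrable_product[OF ig ib])
    then have i: "integrable (lborel \<Otimes>\<^sub>M lborel) (case_prod f)"
    proof (rule Bochner_Integration.integrable_bound)
      have "continuous_on UNIV (case_prod f)"
      proof -
        have "continuous_on UNIV (\<lambda>p. b (snd p :: complex))" for p :: "complex \<times> complex"
          by (rule continuous_on_compose2[OF cb continuous_on_snd[OF continuous_on_id]]) auto
        then show ?thesis unfolding f_def case_prod_beta' gauss_def by (intro continuous_intros) auto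
      qed
      then show "case_prod f \<in> borel_measurable (lborel \<Otimes>\<^sub>M lborel)"
        using borel_measurable_continuous_onI by (simp add: lborel_prod)
    qed (auto simp: f_def norm_mult)
    have "J n = (LINT u|lborel. LINT \<xi>|lborel. f u \<xi>)"
      unfolding J_def fourier_def f_def by (simp add: mult.assoc flip: integral_mult_left_zero)
    also have "\<dots> = (LINT \<xi>|lborel. LINT u|lborel. f u \<xi>)" using lborel_pair.Fubini_integral[OF i] by simp
    also have "\<dots> = (LINT \<xi>|lborel. b \<xi> * (of_real ((1 / d n)\<^sup>2) * of_real (2 * pi * gauss (of_real (1 / d n) * (\<eta> - \<xi>)))))"
    proof (rule Bochner_Integration.integral_cong[OF refl])
      fix \<xi>
      have "f u \<xi> = b \<xi> * (exp (\<i> * of_real (u \<bullet> (\<eta> - \<xi>))) * of_real (gauss (of_real (d n) * u)))" for u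
      proof -
        have "exp (- \<i> * of_real (u \<bullet> \<xi>)) * exp (\<i> * of_real (u \<bullet> \<eta>)) = exp (\<i> * of_real (u \<bullet> (\<eta> - \<xi>)))"
          by (simp add: exp_add[symmetric] inner_diff_right algebra_simps)
        then show ?thesis unfolding f_def by (metis (no_types, lifting) mult.assoc mult.left_commute)
      qed
      then show "(LINT u|lborel. f u \<xi>) = b \<xi> * (of_real ((1 / d n)\<^sup>2) * of_real (2 * pi * gauss (of_real (1 / d n) * (\<eta> - \<xi>))))"
        by (simp add: transform)
    qed
    also have "\<dots> = (d n)\<^sup>2 *\<^sub>R (LINT s|lborel. b (\<eta> + of_real (d n) * s) * (of_real ((1 / d n)\<^sup>2) * of_real (2 * pi * gauss (of_real (1 / d n) * (\<eta> - (\<eta> + of_real (d n) * s))))))"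
      by (rule plane_affine_integral(1)) (use d in measurable)
    also have "\<dots> = (d n)\<^sup>2 *\<^sub>R (LINT s|lborel. (of_real ((1 / d n)\<^sup>2) * of_real (2 * pi)) * (b (\<eta> + of_real (d n) * s) * of_real (gauss s)))"
    proof -
      have "gauss (of_real (1 / d n) * (\<eta> - (\<eta> + of_real (d n) * s))) = gauss s" for s
        using d[of n] by (simp add: gauss_def norm_mult norm_divide)
      then show ?thesis by (simp add: mult_ac)
    qed
    also have "\<dots> = of_real (2 * pi) * (LINT s|lborel. b (\<eta> + of_real (d n) * s) * of_real (gauss s))"
      using d[of n] by (simp add: scaleR_conv_of_real power_divide)
    finally show ?thesis .
  qed
  have "(\<lambda>n. LINT s|lborel. b (\<eta> + of_real (d n) * s) * of_real (gauss s)) \<longlonglongrightarrow> (LINT s|lborel. b \<eta> * of_real (gauss s))"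
  proof (rule integral_dominated_convergence[where w = "\<lambda>s. B * gauss s"])
    show "integrable lborel (\<lambda>s. B * gauss s)"
      using integrable_norm[OF gauss_integrable] g1 by (simp add: less_imp_le)
    show "AE s in lborel. (\<lambda>n. b (\<eta> + of_real (d n) * s) * of_real (gauss s)) \<longlonglongrightarrow> b \<eta> * of_real (gauss s)"
    proof (intro always_eventually allI tendsto_mult tendsto_const)
      fix s
      have "(\<lambda>n. \<eta> + of_real (d n) * s) \<longlonglongrightarrow> \<eta> + of_real 0 * s" by (intro tendsto_intros d0)
      then show "(\<lambda>n. b (\<eta> + of_real (d n) * s)) \<longlonglongrightarrow> b \<eta>"
        using cb by (intro continuous_on_tendsto_compose[OF cb]) auto
    qed
    show "AE s in lborel. norm (b (\<eta> + of_real (d n) * s) * of_real (gauss s)) \<le> B * gauss s" for n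
      using RB(4) g1 by (intro always_eventually) (auto simp: norm_mult less_imp_le intro!: mult_mono)
  qed measurable
  moreover have gi: "(LINT s|lborel. b \<eta> * of_real (gauss s)) = b \<eta> * of_real (2 * pi)"
    using gauss_transform[of 0] by (simp add: gauss_def)
  ultimately have "(\<lambda>n. LINT s|lborel. b (\<eta> + of_real (d n) * s) * of_real (gauss s)) \<longlonglongrightarrow> b \<eta> * of_real (2 * pi)"
    by (simp only: gi)
  then have "(\<lambda>n. of_real (2 * pi) * (LINT s|lborel. b (\<eta> + of_real (d n) * s) * of_real (gauss s))) \<longlonglongrightarrow> of_real (2 * pi) * (b \<eta> * of_real (2 * pi))"
    by (intro tendsto_mult tendsto_const)
  then have "J \<longlonglongrightarrow> of_real (2 * pi) * (b \<eta> * of_real (2 * pi))" unfolding ext[of J, OF Jeq] .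
  moreover have "J \<longlonglongrightarrow> (LINT u|lborel. fourier b u * exp (\<i> * of_real (u \<bullet> \<eta>)))"
    unfolding J_def
  proof (rule integral_dominated_convergence[where w = "\<lambda>u. cmod (fourier b u)"])
    show "integrable lborel (\<lambda>u. cmod (fourier b u))" using fourier_integrable(1)[OF b] by simp
    show "AE u in lborel. (\<lambda>n. fourier b u * exp (\<i> * of_real (u \<bullet> \<eta>)) * of_real (gauss (of_real (d n) * u))) \<longlonglongrightarrow> fourier b u * exp (\<i> * of_real (u \<bullet> \<eta>))"
    proof (intro always_eventually allI)
      fix u
      have "(\<lambda>n. gauss (of_real (d n) * u)) \<longlonglongrightarrow> gauss (of_real 0 * u)" unfolding gauss_def by (intro tendsto_intros d0) simp
      then have "(\<lambda>n. fourier b u * exp (\<i> * of_real (u \<bullet> \<eta>)) * of_real (gauss (of_real (d n) * u))) \<longlonglongrightarrow> fourier b u * exp (\<i> * of_real (u \<bullet> \<eta>)) * of_real (gauss (of_real 0 * u))"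
        by (intro tendsto_intros)
      then show "(\<lambda>n. fourier b u * exp (\<i> * of_real (u \<bullet> \<eta>)) * of_real (gauss (of_real (d n) * u))) \<longlonglongrightarrow> fourier b u * exp (\<i> * of_real (u \<bullet> \<eta>))"
        by (simp add: gauss_def)
    qed
    show "AE u in lborel. norm (fourier b u * exp (\<i> * of_real (u \<bullet> \<eta>)) * of_real (gauss (of_real (d n) * u))) \<le> cmod (fourier b u)" for n
      using g1 by (intro always_eventually) (auto simp: norm_mult less_imp_le intro!: mult_left_le)
  qed measurable
  ultimately show ?thesis using LIMSEQ_unique by (fastforce simp: power2_eq_square mult_ac)
qed

section \<open>Wave packets on the surface\<close>

text \<open>Half-open parallelograms, described by their dual vectors; half-open, because they serve as fundamental domains.\<close>

definition parallelogram :: "complex \<Rightarrow> complex \<Rightarrow> complex \<Rightarrow> real \<Rightarrow> complex set" where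
  "parallelogram \<alpha> \<beta> p e = {z. - e \<le> \<alpha> \<bullet> (z - p) \<and> \<alpha> \<bullet> (z - p) < e \<and> \<bar>\<beta> \<bullet> (z - p)\<bar> \<le> e}"

lemma parallelogram_borel [measurable]: "parallelogram \<alpha> \<beta> p e \<in> sets borel"
  unfolding parallelogram_def by measurable

lemma parallelogram_half: "measure lborel (parallelogram \<alpha> \<beta> p 1) = 4 * measure lborel (parallelogram \<alpha> \<beta> p (1 / 2))"
proof -
  have "measure lborel (parallelogram \<alpha> \<beta> p 1) = (LINT z|lborel. indicator (parallelogram \<alpha> \<beta> p 1) z)" by simp
  also have "\<dots> = 2\<^sup>2 *\<^sub>R (LINT z|lborel. indicator (parallelogram \<alpha> \<beta> p 1) (- p + of_real 2 * z))"
    by (rule plane_affine_integral(1)) auto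
  also have "(\<lambda>z. indicator (parallelogram \<alpha> \<beta> p 1) (- p + of_real 2 * z) :: real) = indicator (parallelogram \<alpha> \<beta> p (1 / 2))"
  proof
    fix z
    have "c \<bullet> (- p + of_real 2 * z - p) = 2 * (c \<bullet> (z - p))" for c by (simp add: inner_complex_def algebra_simps)
    then have "- p + of_real 2 * z \<in> parallelogram \<alpha> \<beta> p 1 \<longleftrightarrow> z \<in> parallelogram \<alpha> \<beta> p (1 / 2)"
      unfolding parallelogram_def mem_Collect_eq by (simp only:) auto
    then show "indicator (parallelogram \<alpha> \<beta> p 1) (- p + of_real 2 * z) = (indicator (parallelogram \<alpha> \<beta> p (1 / 2)) z :: real)"
      by (simp add: indicator_def)
  qed
  finally show ?thesis by simp
qed

lemma parallelogram_ball:
  assumes "cmod \<alpha> * s \<le> 1 / 2" "cmod \<beta> * s \<le> 1 / 2"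
  shows "ball p s \<subseteq> parallelogram \<alpha> \<beta> p (1 / 2)"
proof
  fix z assume "z \<in> ball p s"
  then have z: "cmod (z - p) < s" by (simp add: dist_norm norm_minus_commute)
  have *: "\<bar>c \<bullet> (z - p)\<bar> < 1 / 2" if "cmod c * s \<le> 1 / 2" for c
  proof (cases "c = 0")
    case False
    have "\<bar>c \<bullet> (z - p)\<bar> \<le> cmod c * cmod (z - p)" by (rule Cauchy_Schwarz_ineq2)
    also have "\<dots> < cmod c * s" using z False by simp
    finally show ?thesis using that by simp
  qed simp
  show "z \<in> parallelogram \<alpha> \<beta> p (1 / 2)"
    unfolding parallelogram_def mem_Collect_eq using *[OF assms(1)] *[OF assms(2)] by linarith
qed

lemma Ck_plane_2I:
  assumes "plane_gradient f f1 f2" "plane_gradient f1 f11 f12" "plane_gradient f2 f21 f22"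
    and "continuous_on UNIV f" "continuous_on UNIV f1" "continuous_on UNIV f2"
    and "continuous_on UNIV f11" "continuous_on UNIV f12" "continuous_on UNIV f21" "continuous_on UNIV f22"
  shows "Ck_plane 2 f"
  using assms unfolding numeral_2_eq_2 plane_gradient_def by (simp add: plane_gradient_def) blast

text \<open>The first three conditions make the function a quasimode. By the last three it is, on the scale \<open>\<mu>\<^bsup>-1/2\<^esup>\<close> of its wave
  length, a plane wave in a direction close to \<open>\<xi>\<close>: its gradient is \<open>\<i>k\<close> times the function, with \<open>k\<close> of order \<open>\<mu>\<^bsup>1/2\<^esup>\<close>, up to
  an error of order \<open>\<mu>\<^bsup>1/4\<^esup>\<close>, and the vertices are far away from its support.\<close>

definition (in flat_surface) normalized_quasimode ::
    "real \<Rightarrow> complex \<Rightarrow> real \<Rightarrow> (point \<Rightarrow> complex) \<Rightarrow> complex \<Rightarrow> bool" where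
  "normalized_quasimode C \<xi> \<mu> \<phi> k \<longleftrightarrow>
     Ck_surface S 2 \<phi> \<and> L2_norm S \<phi> = 1 \<and>
     L2_norm S (\<lambda>q. laplacian S \<phi> q + of_real \<mu> * \<phi> q) \<le> C * \<mu> powr (3 / 8) \<and>
     cmod (k / of_real (sqrt \<mu>) - \<xi>) \<le> C * \<mu> powr (- 1 / 8) \<and>
     (\<exists>G H. has_gradient S \<phi> G H \<and> (\<forall>q\<in>regular_points S.
        cmod (G q - \<i> * of_real (Re k) * \<phi> q) \<le> C * \<mu> powr (1 / 4) \<and>
        cmod (H q - \<i> * of_real (Im k) * \<phi> q) \<le> C * \<mu> powr (1 / 4))) \<and>
     (\<forall>q\<in>regular_points S. \<phi> q \<noteq> 0 \<longrightarrow> chart S (\<mu> powr (- 1 / 8) / C) q)"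

lemma (in flat_surface) continuous_on_surface_norm_integrable:
  "continuous_on_surface S f \<Longrightarrow> surface_integrable (\<lambda>q. (cmod (f q))\<^sup>2)"
  by (intro continuous_integrable) (auto simp: continuous_on_surface_def intro!: continuous_intros)

context periodic_coords
begin

lemma descend_mult: "descend (\<lambda>z. c * f z) q = c * descend f q" by (simp add: descend_def)

text \<open>The defect of the packet as a quasimode is governed by the frequencies \<open>k \<bullet> a\<close>, \<open>k \<bullet> b\<close> of the amplitude in the
  direction of the wave vector and by the Laplacian of the amplitude. All norms are compared on one fundamental domain, so
  that they only depend on the ratio of its area to that of its middle half.\<close>

lemma packet_quasimode:
  fixes a b k \<alpha> p :: complex and a0 b0 A E \<mu> s \<rho> C :: real
  defines "G e \<equiv> parallelogram \<alpha> b p e"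
  assumes K'_eq: "K' = {z. \<bar>a \<bullet> z - a0\<bar> \<le> 1 \<and> \<bar>b \<bullet> z - b0\<bar> \<le> 1}"
    and per: "a \<bullet> h = 0" "b \<bullet> h = 0" "exp (\<i> * of_real (k \<bullet> h)) = 1"
    and orth: "a \<bullet> b = 0" and k: "k \<bullet> k = \<mu>"
    and A: "cmod a \<le> A" "cmod b \<le> A" "0 \<le> A" and E: "\<bar>k \<bullet> a\<bar> \<le> E" "\<bar>k \<bullet> b\<bar> \<le> E"
    and G: "G 1 \<subseteq> Z" "inj_on \<eta> (G 1)" "bounded (G 1)"
    and cover: "\<And>z. z \<in> Z \<Longrightarrow> \<bar>a \<bullet> z - a0\<bar> < 1 \<Longrightarrow> \<bar>b \<bullet> z - b0\<bar> < 1 \<Longrightarrow> \<eta> z \<in> \<eta> ` G 1"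
    and mid: "\<And>z. z \<in> G (1 / 2) \<Longrightarrow> \<bar>a \<bullet> z - a0\<bar> \<le> 1 / 2 \<and> \<bar>b \<bullet> z - b0\<bar> \<le> 1 / 2"
    and s: "0 < s" "ball p s \<subseteq> G (1 / 2)"
    and margin: "0 < \<rho>" "\<And>z. z \<in> K \<Longrightarrow> ball z \<rho> \<subseteq> Z"
    and C: "(900 * (2 * A\<^sup>2 + 4 * E)) * 16 \<le> C * \<mu> powr (3 / 8)" "cmod (k / of_real (sqrt \<mu>) - \<xi>) \<le> C * \<mu> powr (- 1 / 8)"
       "900 * (2 * A) * 8 / s \<le> C * \<mu> powr (1 / 4)" "\<mu> powr (- 1 / 8) / C \<le> \<rho>"
  shows "\<exists>\<phi>. normalized_quasimode C \<xi> \<mu> \<phi> k"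
proof -
  define P where "P = packet a b k a0 b0"
  let ?X = "\<lambda>m n z. of_real (Re a) * P (Suc m) n z + of_real (Re b) * P m (Suc n) z + \<i> * of_real (Re k) * P m n z"
  let ?Y = "\<lambda>m n z. of_real (Im a) * P (Suc m) n z + of_real (Im b) * P m (Suc n) z + \<i> * of_real (Im k) * P m n z"
  define f where "f = P 0 0"
  define f1 where "f1 = (\<lambda>z. of_real (Re a) * P 1 0 z + of_real (Re b) * P 0 1 z + \<i> * of_real (Re k) * P 0 0 z)"
  define f2 where "f2 = (\<lambda>z. of_real (Im a) * P 1 0 z + of_real (Im b) * P 0 1 z + \<i> * of_real (Im k) * P 0 0 z)"
  define f11 where "f11 = (\<lambda>z. of_real (Re a) * ?X 1 0 z + of_real (Re b) * ?X 0 1 z + \<i> * of_real (Re k) * ?X 0 0 z)"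
  define f12 where "f12 = (\<lambda>z. of_real (Re a) * ?Y 1 0 z + of_real (Re b) * ?Y 0 1 z + \<i> * of_real (Re k) * ?Y 0 0 z)"
  define f21 where "f21 = (\<lambda>z. of_real (Im a) * ?X 1 0 z + of_real (Im b) * ?X 0 1 z + \<i> * of_real (Im k) * ?X 0 0 z)"
  define f22 where "f22 = (\<lambda>z. of_real (Im a) * ?Y 1 0 z + of_real (Im b) * ?Y 0 1 z + \<i> * of_real (Im k) * ?Y 0 0 z)"
  have cP: "continuous_on UNIV (P m n)" for m n unfolding P_def by (rule packet_cont)
  have c2: "continuous_on UNIV f11" "continuous_on UNIV f12" "continuous_on UNIV f21" "continuous_on UNIV f22"
    unfolding f11_def f12_def f21_def f22_def by (intro continuous_intros cP)+
  have c1: "continuous_on UNIV f" "continuous_on UNIV f1" "continuous_on UNIV f2"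
    unfolding f_def f1_def f2_def by (intro continuous_intros cP)+
  have grad: "plane_gradient f f1 f2"
    using packet_gradient[of 0 0 a b k a0 b0] unfolding f_def f1_def f2_def P_def by simp
  have grad1: "plane_gradient f1 f11 f12" and grad2: "plane_gradient f2 f21 f22"
    unfolding f1_def f11_def f12_def f2_def f21_def f22_def P_def by (rule packet_second_gradient)+
  have Pb: "cmod (P m n z) \<le> 900" for m n z
  proof -
    have "\<bar>bump m (a \<bullet> z - a0)\<bar> * \<bar>bump n (b \<bullet> z - b0)\<bar> \<le> 30 * 30" by (intro mult_mono bump_bound) auto
    then show ?thesis by (simp add: P_def packet_def norm_mult)
  qed
  have Pz: "P m n z = 0" if "\<not> (\<bar>a \<bullet> z - a0\<bar> < 1 \<and> \<bar>b \<bullet> z - b0\<bar> < 1)" for m n z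
    using that bump_zero[of "a \<bullet> z - a0" m] bump_zero[of "b \<bullet> z - b0" n] by (auto simp: P_def packet_def not_less)
  have adm: "admissible f"
    unfolding admissible_def
  proof (intro conjI allI impI)
    fix z
    have "exp (\<i> * of_real (k \<bullet> (z + h))) = exp (\<i> * of_real (k \<bullet> z))"
      using per(3) by (simp add: inner_add_right distrib_left exp_add)
    then show "f (z + h) = f z" using per by (simp add: f_def P_def packet_def inner_add_right)
    show "f z = 0" if "z \<notin> K'" using that Pz[of z 0 0] unfolding K'_eq f_def by auto
  qed
  note adm1 = admissible_gradient[OF adm grad]
  note adm11 = admissible_gradient[OF adm1(1) grad1] and adm22 = admissible_gradient[OF adm1(2) grad2]
  define F where "F = descend f"
  have contF: "continuous_on_surface S F" unfolding F_def by (rule descend_continuous[OF adm c1(1)])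
  have gF: "has_gradient S F (descend f1) (descend f2)" unfolding F_def by (rule descend_gradient[OF adm adm1 grad])
  have lap: "laplacian S F q = descend f11 q + descend f22 q" if "q \<in> regular_points S" for q
    by (rule laplacian_eq[OF gF descend_gradient[OF adm1(1) adm11 grad1] descend_gradient[OF adm1(2) adm22 grad2] that])
  have Gb: "G 1 \<in> sets lborel" "G (1 / 2) \<in> sets lborel" by (simp_all add: G_def)
  have Gsub: "G (1 / 2) \<subseteq> G 1" by (auto simp: G_def parallelogram_def)
  have fin: "emeasure lborel (G 1) < \<infinity>" "emeasure lborel (G (1 / 2)) < \<infinity>"
    using emeasure_bounded_finite[OF G(3)] emeasure_bounded_finite[OF bounded_subset[OF G(3) Gsub]] by auto
  have m4: "measure lborel (G 1) = 4 * measure lborel (G (1 / 2))" unfolding G_def by (rule parallelogram_half)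
  have mpos: "2 * s\<^sup>2 \<le> measure lborel (G (1 / 2))"
  proof -
    have "measure lborel (ball p s) \<le> measure lborel (G (1 / 2))"
      using s(2) Gb fin by (intro measure_mono_fmeasurable) (auto simp: fmeasurable_def)
    moreover have "measure lborel (ball p s) = pi * s\<^sup>2" using content_ball[of s p] s(1) by (simp add: unit_ball_vol_2)
    moreover have "2 * s\<^sup>2 \<le> pi * s\<^sup>2" using pi_ge_two by (intro mult_right_mono) auto
    ultimately show ?thesis by linarith
  qed
  let ?m = "measure lborel (G (1 / 2))"
  have "0 < s\<^sup>2" using s(1) by simp
  then have mp: "0 < ?m" using mpos by linarith
  (* On the middle half both bumps are at least 27/64, and (27/64) * (27/64) > 1/8. *)
  have lower: "(1 / 64) * ?m \<le> surface_integral S (\<lambda>q. (cmod (F q))\<^sup>2)"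
  proof (rule surface_integral_ge_image[OF coords Gb(2)])
    show "inj_on \<eta> (G (1 / 2))" using inj_on_subset[OF G(2) Gsub] .
    show "surface_integrable (\<lambda>q. (cmod (F q))\<^sup>2)" by (rule continuous_on_surface_norm_integrable[OF contF])
    show "1 / 64 \<le> (cmod (F (\<eta> z)))\<^sup>2" if z: "z \<in> G (1 / 2)" for z
    proof -
      have zz: "z \<in> Z" using z Gsub G(1) by blast
      have m: "27 / 64 \<le> bump 0 (a \<bullet> z - a0)" "27 / 64 \<le> bump 0 (b \<bullet> z - b0)" 
        by (rule bump_ge, use mid[OF z] in blast)+
      then have "27 / 64 * (27 / 64) \<le> bump 0 (a \<bullet> z - a0) * bump 0 (b \<bullet> z - b0)" by (intro mult_mono) auto
      also have "\<dots> \<le> cmod (F (\<eta> z))"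
        unfolding F_def descend_coords[OF adm zz] by (simp add: f_def P_def packet_def norm_mult flip: abs_mult)
      finally have "1 / 8 \<le> cmod (F (\<eta> z))" by simp
      then have "(1 / 8)\<^sup>2 \<le> (cmod (F (\<eta> z)))\<^sup>2" by (intro power_mono) auto
      then show ?thesis by (simp add: power_divide)
    qed
  qed (use G(1) Gsub fin in auto)
  define n where "n = L2_norm S F"
  have n: "0 < n" "n\<^sup>2 = surface_integral S (\<lambda>q. (cmod (F q))\<^sup>2)" "?m \<le> 64 * n\<^sup>2" "s \<le> 8 * n"
  proof -
    show n2: "n\<^sup>2 = surface_integral S (\<lambda>q. (cmod (F q))\<^sup>2)" using lower mp by (simp add: n_def L2_norm_def)
    show "?m \<le> 64 * n\<^sup>2" using lower n2 by simp
    show "0 < n" using lower mp unfolding n_def L2_norm_def by simp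
    have "s\<^sup>2 \<le> (8 * n)\<^sup>2" proof -
      have "0 \<le> s\<^sup>2" by simp
      then have "s\<^sup>2 \<le> 64 * n\<^sup>2" using mpos lower n2 by linarith
      then show ?thesis by (simp add: power_mult_distrib)
    qed
    then show "s \<le> 8 * n" by (rule power2_le_imp_le) (use \<open>0 < n\<close> in simp)
  qed
  (* Each bump and its derivatives are bounded by 30, their products by 900. *)
  define B where "B = 900 * (2 * A\<^sup>2 + 4 * E)"
  have B0: "0 \<le> B" using A(3) E(1) by (simp add: B_def)
  have val: "f11 z + f22 z + of_real \<mu> * f z = of_real (a \<bullet> a) * P 2 0 z + of_real (b \<bullet> b) * P 0 2 z
      + 2 * \<i> * of_real (k \<bullet> a) * P 1 0 z + 2 * \<i> * of_real (k \<bullet> b) * P 0 1 z" for z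
  proof -
    have "f11 z + f22 z + of_real \<mu> * f z = of_real (a \<bullet> a) * P 2 0 z + of_real (b \<bullet> b) * P 0 2 z + 2 * of_real (a \<bullet> b) * P 1 1 z
      + 2 * \<i> * of_real (k \<bullet> a) * P 1 0 z + 2 * \<i> * of_real (k \<bullet> b) * P 0 1 z + of_real (\<mu> - k \<bullet> k) * P 0 0 z"
      unfolding f11_def f22_def f_def inner_complex_def by (simp add: algebra_simps numeral_2_eq_2)
    then show ?thesis using orth k by simp
  qed
  have valb: "cmod (f11 z + f22 z + of_real \<mu> * f z) \<le> B" for z
  proof -
    have t: "cmod (c * P m n z) \<le> d * 900" if "cmod c \<le> d" for c d m n
      unfolding norm_mult using that Pb by (intro mult_mono) (auto intro: order_trans[OF norm_ge_zero])
    have a2: "a \<bullet> a \<le> A\<^sup>2" "b \<bullet> b \<le> A\<^sup>2" using A by (auto simp: dot_square_norm intro!: power_mono)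
    have "cmod (of_real (a \<bullet> a) * P 2 0 z) \<le> A\<^sup>2 * 900" "cmod (of_real (b \<bullet> b) * P 0 2 z) \<le> A\<^sup>2 * 900"
      "cmod (2 * \<i> * of_real (k \<bullet> a) * P 1 0 z) \<le> (2 * E) * 900" "cmod (2 * \<i> * of_real (k \<bullet> b) * P 0 1 z) \<le> (2 * E) * 900"
      by (rule t; use a2 E in \<open>simp add: norm_mult\<close>)+
    then show ?thesis unfolding val B_def by (smt (verit) norm_triangle_ineq)
  qed
  have errb: "cmod (laplacian S F q + of_real \<mu> * F q) \<le> B \<and> (q \<notin> \<eta> ` G 1 \<longrightarrow> laplacian S F q + of_real \<mu> * F q = 0)" if q: "q \<in> regular_points S" for q
  proof (cases "q \<in> \<eta> ` Z")
    case True
    then obtain z where z: "z \<in> Z" "q = \<eta> z" by blast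
    have eq: "laplacian S F q + of_real \<mu> * F q = f11 z + f22 z + of_real \<mu> * f z"
      unfolding lap[OF q] unfolding F_def z(2) by (simp add: descend_coords[OF _ z(1)] adm adm11 adm22)
    moreover have "f11 z + f22 z + of_real \<mu> * f z = 0" if "q \<notin> \<eta> ` G 1"
    proof -
      have "\<not> (\<bar>a \<bullet> z - a0\<bar> < 1 \<and> \<bar>b \<bullet> z - b0\<bar> < 1)" using cover[OF z(1)] that z(2) by blast
      then show ?thesis unfolding val using Pz[of z] by simp
    qed
    ultimately show ?thesis using valb[of z] by simp
  next
    case False
    then have "q \<notin> \<eta> ` K" using K(2) by blast
    then show ?thesis unfolding lap[OF q] unfolding F_def using B0 by (simp add: descend_zero adm adm11 adm22)
  qed
  have gb: "cmod (descend f1 q - \<i> * of_real (Re k) * F q) \<le> 900 * (2 * A) \<and> cmod (descend f2 q - \<i> * of_real (Im k) * F q) \<le> 900 * (2 * A)" for q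
  proof (cases "q \<in> \<eta> ` Z")
    case True
    then obtain z where z: "z \<in> Z" "q = \<eta> z" by blast
    have t: "cmod (of_real c * P m n z) \<le> A * 900" if "\<bar>c\<bar> \<le> A" for c m n
      unfolding norm_mult using that Pb A(3) by (intro mult_mono) auto
    have c: "\<bar>Re a\<bar> \<le> A" "\<bar>Re b\<bar> \<le> A" "\<bar>Im a\<bar> \<le> A" "\<bar>Im b\<bar> \<le> A"
      using A abs_Re_le_cmod abs_Im_le_cmod by (meson order_trans)+
    have "descend f1 q - \<i> * of_real (Re k) * F q = of_real (Re a) * P 1 0 z + of_real (Re b) * P 0 1 z"
      "descend f2 q - \<i> * of_real (Im k) * F q = of_real (Im a) * P 1 0 z + of_real (Im b) * P 0 1 z"
      unfolding F_def z(2) descend_coords[OF adm z(1)] descend_coords[OF adm1(1) z(1)] descend_coords[OF adm1(2) z(1)]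
      by (simp_all add: f1_def f2_def f_def)
    then show ?thesis using t[OF c(1), of 1 0] t[OF c(2), of 0 1] t[OF c(3), of 1 0] t[OF c(4), of 0 1]
        norm_triangle_ineq[of "of_real (Re a) * P 1 0 z" "of_real (Re b) * P 0 1 z"] norm_triangle_ineq[of "of_real (Im a) * P 1 0 z" "of_real (Im b) * P 0 1 z"]
      by (simp only:) linarith
  next
    case False
    then have "q \<notin> \<eta> ` K" using K(2) by blast
    then show ?thesis unfolding F_def using A(3) by (simp add: descend_zero adm adm1)
  qed
  define c where "c = complex_of_real (1 / n)"
  have cn: "cmod c = 1 / n" using n(1) by (simp add: c_def norm_divide)
  define \<phi> where "\<phi> = descend (\<lambda>z. c * f z)"
  have phi: "\<phi> q = c * F q" for q by (simp add: \<phi>_def F_def descend_mult)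
  have admc: "admissible (\<lambda>z. c * g z)" if "admissible g" for g using that by (simp add: admissible_def)
  have L2c: "L2_norm S (\<lambda>q. c * g q) = L2_norm S g / n" for g
    unfolding L2_norm_def norm_mult power_mult_distrib surface_integral_mult cn using n(1)
    by (simp add: real_sqrt_mult power_divide real_sqrt_divide)
  have gradc: "plane_gradient (\<lambda>z. c * f z) (\<lambda>z. c * f1 z) (\<lambda>z. c * f2 z)" by (rule plane_gradient_mult[OF grad])
  have gphi: "has_gradient S \<phi> (descend (\<lambda>z. c * f1 z)) (descend (\<lambda>z. c * f2 z))"
    unfolding \<phi>_def by (rule descend_gradient[OF admc[OF adm] admc[OF adm1(1)] admc[OF adm1(2)] gradc])
  have lapc: "laplacian S \<phi> q = c * laplacian S F q" if "q \<in> regular_points S" for q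
    using laplacian_eq[OF gphi descend_gradient[OF admc[OF adm1(1)] admc[OF adm11(1)] admc[OF adm11(2)] plane_gradient_mult[OF grad1]]
        descend_gradient[OF admc[OF adm1(2)] admc[OF adm22(1)] admc[OF adm22(2)] plane_gradient_mult[OF grad2]] that] lap[OF that]
    by (simp add: descend_mult distrib_left)
  have "normalized_quasimode C \<xi> \<mu> \<phi> k"
    unfolding normalized_quasimode_def
  proof (intro conjI exI ballI impI)
    have "Ck_plane 2 (\<lambda>z. c * f z)"
      by (rule Ck_plane_2I[OF gradc plane_gradient_mult[OF grad1] plane_gradient_mult[OF grad2]]) (intro continuous_intros c1 c2)+
    then show "Ck_surface S 2 \<phi>" unfolding \<phi>_def by (rule descend_Ck[OF admc[OF adm]])
    show "L2_norm S \<phi> = 1" unfolding phi using L2c[of F] n(1) by (simp add: n_def)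
    have "L2_norm S (\<lambda>q. laplacian S \<phi> q + of_real \<mu> * \<phi> q) \<le> B * 16"
    proof -
      have "surface_integral S (\<lambda>q. (cmod (laplacian S \<phi> q + of_real \<mu> * \<phi> q))\<^sup>2) \<le> (B / n)\<^sup>2 * measure lborel (G 1)"
      proof (rule surface_integral_le_image[OF coords Gb(1) G(1,2) fin(1)])
        fix q assume q: "q \<in> regular_points S"
        have eq: "laplacian S \<phi> q + of_real \<mu> * \<phi> q = c * (laplacian S F q + of_real \<mu> * F q)"
          by (simp add: lapc[OF q] phi distrib_left)
        have "cmod (laplacian S \<phi> q + of_real \<mu> * \<phi> q) \<le> B / n"
          unfolding eq norm_mult cn using errb[OF q] n(1) by (simp add: divide_right_mono)
        then show "(cmod (laplacian S \<phi> q + of_real \<mu> * \<phi> q))\<^sup>2 \<le> (B / n)\<^sup>2" by (intro power_mono) auto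
        show "(cmod (laplacian S \<phi> q + of_real \<mu> * \<phi> q))\<^sup>2 \<le> 0" if "q \<notin> \<eta> ` G 1"
          unfolding eq using errb[OF q] that by simp
      qed simp
      also have "\<dots> \<le> (B / n)\<^sup>2 * (16 * n)\<^sup>2" using n(3) m4 by (intro mult_left_mono) (auto simp: power_mult_distrib)
      also have "\<dots> = (B * 16)\<^sup>2" using n(1) by (simp add: power_mult_distrib power_divide)
      finally show ?thesis unfolding L2_norm_def using B0 by (intro real_le_lsqrt) auto
    qed
    then show "L2_norm S (\<lambda>q. laplacian S \<phi> q + of_real \<mu> * \<phi> q) \<le> C * \<mu> powr (3 / 8)" using C(1) by (simp add: B_def)
    show "has_gradient S \<phi> (descend (\<lambda>z. c * f1 z)) (descend (\<lambda>z. c * f2 z))" by (rule gphi)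
    have nb: "900 * (2 * A) / n \<le> C * \<mu> powr (1 / 4)"
    proof -
      have "1 / n \<le> 8 / s" using n(1,4) s(1) by (simp add: field_simps)
      then have "900 * (2 * A) * (1 / n) \<le> 900 * (2 * A) * (8 / s)" using A(3) by (intro mult_left_mono) auto
      then show ?thesis using C(3) by simp
    qed
    have sc: "cmod (c * x - \<i> * of_real y * (c * w)) = cmod (x - \<i> * of_real y * w) / n" for x w :: complex and y
    proof -
      have "c * x - \<i> * of_real y * (c * w) = c * (x - \<i> * of_real y * w)" by (simp add: algebra_simps)
      then show ?thesis by (simp add: norm_mult cn)
    qed
    fix q
    show "cmod (descend (\<lambda>z. c * f1 z) q - \<i> * of_real (Re k) * \<phi> q) \<le> C * \<mu> powr (1 / 4)"
      "cmod (descend (\<lambda>z. c * f2 z) q - \<i> * of_real (Im k) * \<phi> q) \<le> C * \<mu> powr (1 / 4)"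
      unfolding phi descend_mult sc by (rule order_trans[OF divide_right_mono nb]; use gb[of q] n(1) in simp)+
    assume "\<phi> q \<noteq> 0"
    then have "q \<in> \<eta> ` K" using descend_zero[OF adm, of q] by (auto simp: phi F_def)
    then obtain z where "z \<in> K" "q = \<eta> z" by blast
    then show "chart S (\<mu> powr (- 1 / 8) / C) q" using chart_mono[OF chart_ball[OF coords margin(2)] C(4)] by blast
  qed (rule C(2))
  then show ?thesis by blast
qed

end

section \<open>Quasimodes in tubes and in cylinders\<close>

context base_disc
begin

lemma inner_lon_lat: "\<xi> \<bullet> z = lon \<xi> z" "(\<i> * \<xi>) \<bullet> z = lat \<xi> z"
  by (simp_all add: lon_lat_inner)

lemma unit_products: "\<xi> \<bullet> \<xi> = 1" "\<xi> \<bullet> (\<i> * \<xi>) = 0" "cmod (\<i> * \<xi>) = 1"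
  using \<xi> by (simp_all add: dot_square_norm norm_mult) (simp add: inner_complex_def)

text \<open>If the strip does not overlap itself, the packet is a plane wave in the direction of the strip with an amplitude that
  varies on the scale \<open>T\<close> along it and on the scale \<open>w\<close> across it.\<close>

lemma embedded_strip_quasimode:
  fixes T \<kappa> w C y :: real
  assumes t: "tube (8 * T) y w \<eta>" and T: "1 \<le> T" and \<kappa>: "0 < \<kappa>" "\<kappa> \<le> 1" and w: "w = \<kappa> / (8 * T)"
    and inj: "inj_on \<eta> (strip \<xi> T y (w / 8))"
    and lam: "sqrt \<mu> = T ^ 4" "\<mu> = T ^ 8" "\<mu> powr (3 / 8) = T ^ 3" "\<mu> powr (1 / 4) = T\<^sup>2" "\<mu> powr (- 1 / 8) = 1 / T"
    and C: "16 * 900 * (2 * (512 / \<kappa>)\<^sup>2 + 4 * 4) \<le> C" "900 * 16 * 512 * 1024 / \<kappa>\<^sup>2 \<le> C" "512 / \<kappa> \<le> C"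
  shows "\<exists>\<phi> k. normalized_quasimode C \<xi> \<mu> \<phi> k"
proof -
  have w0: "0 < w" "w \<le> 1 / 8"
  proof -
    show "0 < w" using w \<kappa> T by simp
    have "\<kappa> \<le> T" using \<kappa> T by linarith
    then have "\<kappa> / (8 * T) \<le> T / (8 * T)" using T by (intro divide_right_mono) auto
    then show "w \<le> 1 / 8" using w T by simp
  qed
  define a where "a = (4 / T) *\<^sub>R \<xi>"
  define b where "b = (16 / w) *\<^sub>R (\<i> * \<xi>)"
  define p where "p = \<xi> * Complex (T / 2) y"
  have az: "a \<bullet> z = 4 / T * lon \<xi> z" and bz: "b \<bullet> z = 16 / w * lat \<xi> z" for z
    by (simp_all add: a_def b_def inner_lon_lat)
  have lp: "lon \<xi> p = T / 2" "lat \<xi> p = y" by (simp_all add: p_def)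
  define a0 where "a0 = a \<bullet> p"
  define b0 where "b0 = b \<bullet> p"
  have ad: "a \<bullet> z - a0 = 4 / T * (lon \<xi> z - T / 2)" and bd: "b \<bullet> z - b0 = 16 / w * (lat \<xi> z - y)" for z
    by (simp_all only: a0_def b0_def az bz lp right_diff_distrib)
  define K where "K = {z. \<bar>a \<bullet> z - a0\<bar> \<le> 1 \<and> \<bar>b \<bullet> z - b0\<bar> \<le> 1}"
  have Kiff: "z \<in> K \<longleftrightarrow> \<bar>lon \<xi> z - T / 2\<bar> \<le> T / 4 \<and> \<bar>lat \<xi> z - y\<bar> \<le> w / 16" for z
  proof -
    have e: "\<bar>s * x\<bar> \<le> 1 \<longleftrightarrow> \<bar>x\<bar> \<le> 1 / s" if "0 < s" for s x :: real
      using that by (simp add: abs_mult pos_le_divide_eq mult.commute)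
    have s: "0 < 4 / T" "0 < 16 / w" "1 / (4 / T) = T / 4" "1 / (16 / w) = w / 16" using T w0 by simp_all
    show ?thesis unfolding K_def mem_Collect_eq ad bd e[OF s(1)] e[OF s(2)] s(3,4) ..
  qed
  let ?Z = "strip \<xi> T y (w / 8)"
  have KZ: "K \<subseteq> ?Z"
  proof
    fix z assume "z \<in> K"
    then have *: "\<bar>lon \<xi> z - T / 2\<bar> \<le> T / 4" "\<bar>lat \<xi> z - y\<bar> \<le> w / 16" using Kiff by auto
    have "0 < lon \<xi> z" "lon \<xi> z < T" "\<bar>lat \<xi> z - y\<bar> < w / 8" using * T w0 by linarith+
    then show "z \<in> ?Z" by (simp add: strip_def)
  qed
  have "closed K" unfolding K_def by (intro closed_Collect_conj closed_Collect_le continuous_intros)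
  moreover have "bounded K"
  proof (rule boundedI)
    fix z assume "z \<in> K"
    then have *: "\<bar>lon \<xi> z - T / 2\<bar> \<le> T / 4" "\<bar>lat \<xi> z - y\<bar> \<le> w / 16" using Kiff by auto
    then show "cmod z \<le> T + (\<bar>y\<bar> + w)" using norm_rotate[of z] T w0 by linarith
  qed
  ultimately have cK: "compact K" "closed K" by (auto simp: compact_eq_bounded_closed)
  have coordsZ: "local_coords S ?Z \<eta>"
  proof -
    have "?Z \<subseteq> strip \<xi> (8 * T) y w" using T w0 by (auto simp: strip_def)
    then show ?thesis using t local_coords_subset[OF _ open_strip] by (auto simp: tube_def)
  qed
  interpret pc: periodic_coords S ?Z \<eta> 0 K K
  proof
    show "\<exists>n::int. z' = z + of_int n * 0" if "z \<in> ?Z" "z' \<in> ?Z" "\<eta> z = \<eta> z'" for z z'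
      using inj that by (auto simp: inj_on_def)
  qed (use coordsZ cK KZ in auto)
  have Gd: "parallelogram a b p e = {z. - e \<le> a \<bullet> z - a0 \<and> a \<bullet> z - a0 < e \<and> \<bar>b \<bullet> z - b0\<bar> \<le> e}" for e
    by (auto simp: parallelogram_def a0_def b0_def inner_diff_right)
  have GK: "parallelogram a b p 1 \<subseteq> K" unfolding Gd K_def by auto
  have na: "cmod a = 4 / T" "cmod b = 16 / w" using \<xi> T w0 by (simp_all add: a_def b_def unit_products)
  have wT: "1 / w = 8 * T / \<kappa>" using w by simp
  define k where "k = of_real (T ^ 4) * \<xi>"
  have k': "k = T ^ 4 *\<^sub>R \<xi>" by (simp add: k_def scaleR_conv_of_real)
  have T23: "T\<^sup>2 \<le> T ^ 3" "1 / T \<le> T" using T power_increasing[of 2 3 T] by (auto simp: field_simps power2_eq_square[symmetric])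
  have "\<exists>\<phi>. normalized_quasimode C \<xi> \<mu> \<phi> k"
  proof (rule pc.packet_quasimode[where a = a and b = b and \<alpha> = a and p = p and ?a0.0 = a0 and ?b0.0 = b0 and A = "512 * T / \<kappa>" and E = "4 * T ^ 3" and s = "w / 128" and \<rho> = "w / 64"])
    show "K = {z. \<bar>a \<bullet> z - a0\<bar> \<le> 1 \<and> \<bar>b \<bullet> z - b0\<bar> \<le> 1}" by (rule K_def)
    show "a \<bullet> b = 0" by (simp add: a_def b_def unit_products)
    show "k \<bullet> k = \<mu>" unfolding k' by (simp add: unit_products lam(2) flip: power_add)
    have "4 / T \<le> 512 * T / \<kappa>"
    proof -
      have "4 / T \<le> 512 * T" using T23 T by simp
      also have "\<dots> \<le> 512 * T / \<kappa>" using \<kappa> T by (simp add: field_simps)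
      finally show ?thesis .
    qed
    then show "cmod a \<le> 512 * T / \<kappa>" by (simp add: na)
    show "cmod b \<le> 512 * T / \<kappa>" using wT T \<kappa> by (simp add: na w divide_right_mono)
    show "0 \<le> 512 * T / \<kappa>" using T \<kappa> by simp
    have "T ^ 4 * (4 / T) = 4 * T ^ 3" using T by (simp add: power_numeral_reduce)
    moreover have "k \<bullet> a = T ^ 4 * (4 / T)"
      unfolding k' a_def by (simp add: unit_products)
    ultimately show "\<bar>k \<bullet> a\<bar> \<le> 4 * T ^ 3" using T by simp
    show "\<bar>k \<bullet> b\<bar> \<le> 4 * T ^ 3" unfolding k' b_def using T by (simp add: unit_products)
    show "parallelogram a b p 1 \<subseteq> ?Z" using GK KZ by blast
    then show "inj_on \<eta> (parallelogram a b p 1)" using inj inj_on_subset by blast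
    show "bounded (parallelogram a b p 1)" using bounded_subset[OF \<open>bounded K\<close> GK] .
    show "\<eta> z \<in> \<eta> ` parallelogram a b p 1" if "\<bar>a \<bullet> z - a0\<bar> < 1" "\<bar>b \<bullet> z - b0\<bar> < 1" for z
      using that unfolding Gd by (intro imageI) (auto simp: abs_less_iff)
    show "\<bar>a \<bullet> z - a0\<bar> \<le> 1 / 2 \<and> \<bar>b \<bullet> z - b0\<bar> \<le> 1 / 2" if "z \<in> parallelogram a b p (1 / 2)" for z
      using that unfolding Gd mem_Collect_eq by (elim conjE, intro conjI; linarith)
    show "0 < w / 128" "0 < w / 64" using w0 by auto
    show "ball p (w / 128) \<subseteq> parallelogram a b p (1 / 2)"
    proof (rule parallelogram_ball)
      have "4 / T \<le> 4" using T divide_left_mono[of 1 T 4] by simp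
      then have "4 / T * (w / 128) \<le> 4 * (w / 128)" using w0 by (intro mult_right_mono) auto
      then show "cmod a * (w / 128) \<le> 1 / 2" using w0 by (simp add: na)
      show "cmod b * (w / 128) \<le> 1 / 2" using w0 by (simp add: na)
    qed
    show "ball z (w / 64) \<subseteq> ?Z" if "z \<in> K" for z
    proof
      fix u assume "u \<in> ball z (w / 64)"
      then have u: "\<bar>lon \<xi> (u - z)\<bar> < w / 64" "\<bar>lat \<xi> (u - z)\<bar> < w / 64"
        using lon_lat_le[of "u - z"] by (auto simp: dist_norm norm_minus_commute)
      have *: "\<bar>lon \<xi> z - T / 2\<bar> \<le> T / 4" "\<bar>lat \<xi> z - y\<bar> \<le> w / 16" using Kiff that by auto
      have "0 < lon \<xi> u" "lon \<xi> u < T" "\<bar>lat \<xi> u - y\<bar> < w / 8" using u * T w0 unfolding lon_lat_linear by linarith+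
      then show "u \<in> ?Z" by (simp add: strip_def)
    qed
    show "(900 * (2 * (512 * T / \<kappa>)\<^sup>2 + 4 * (4 * T ^ 3))) * 16 \<le> C * \<mu> powr (3 / 8)"
    proof -
      have "(512 * T / \<kappa>)\<^sup>2 = (512 / \<kappa>)\<^sup>2 * T\<^sup>2" by (simp add: power_divide power_mult_distrib)
      also have "\<dots> \<le> (512 / \<kappa>)\<^sup>2 * T ^ 3" using T23 by (intro mult_left_mono) auto
      finally have "(900 * (2 * (512 * T / \<kappa>)\<^sup>2 + 4 * (4 * T ^ 3))) * 16 \<le> (16 * 900 * (2 * (512 / \<kappa>)\<^sup>2 + 4 * 4)) * T ^ 3"
        by (simp add: algebra_simps)
      also have "\<dots> \<le> C * T ^ 3" using C(1) T by (intro mult_right_mono) auto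
      finally show ?thesis by (simp only: lam(3))
    qed
    have "0 < 512 / \<kappa>" using \<kappa> by simp
    then have C0: "0 < C" using C(3) by linarith
    have "k / of_real (sqrt \<mu>) = \<xi>" using T by (simp add: k_def lam(1))
    moreover have "0 \<le> C * \<mu> powr (- 1 / 8)" unfolding lam(5) using C0 T by simp
    ultimately show "cmod (k / of_real (sqrt \<mu>) - \<xi>) \<le> C * \<mu> powr (- 1 / 8)" by simp
    have "900 * (2 * (512 * T / \<kappa>)) * 8 / (w / 128) = 900 * 2 * 512 * 8 * 128 * T / \<kappa> * (1 / w)" by simp
    also have "\<dots> = 900 * 16 * 512 * 1024 / \<kappa>\<^sup>2 * T\<^sup>2" unfolding wT by (simp add: power2_eq_square)
    also have "\<dots> \<le> C * T\<^sup>2" using C(2) by (intro mult_right_mono) auto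
    finally show "900 * (2 * (512 * T / \<kappa>)) * 8 / (w / 128) \<le> C * \<mu> powr (1 / 4)" by (simp only: lam(4))
    have "1 / (T * C) \<le> 1 / (T * (512 / \<kappa>))" using C(3) C0 T \<kappa> by (intro divide_left_mono mult_left_mono mult_pos_pos) auto
    also have "\<dots> = w / 64" using w T \<kappa> by simp
    finally show "\<mu> powr (- 1 / 8) / C \<le> w / 64" unfolding lam(5) by simp
  qed (use T in auto)
  then show ?thesis by blast
qed

text \<open>If the strip overlaps itself with a lag \<open>h\<close>, it winds around a cylinder of closed geodesics with holonomy \<open>h\<close>. The
  component of the wave vector along \<open>h\<close> is the largest multiple of \<open>2\<pi> / |h|\<close> up to \<open>\<surd>\<mu>\<close>; as it misses \<open>\<surd>\<mu>\<close> by a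
  bounded amount only, the component across that makes up for the length is of order \<open>\<mu>\<^bsup>1/4\<^esup>\<close>.\<close>

lemma cylinder_wave_vector:
  fixes h :: complex and \<mu> :: real
  assumes h: "r \<le> cmod h" and \<mu>: "1 \<le> \<mu>"
  defines "e \<equiv> h / of_real (cmod h)"
  shows "\<exists>k. k \<bullet> k = \<mu> \<and> exp (\<i> * of_real (k \<bullet> h)) = 1 \<and> \<bar>k \<bullet> (\<i> * e)\<bar> \<le> sqrt (4 * pi / r) * sqrt (sqrt \<mu>) \<and>
    cmod (k / of_real (sqrt \<mu>) - e) \<le> 2 * pi / r / sqrt \<mu> + sqrt (4 * pi / r) * sqrt (sqrt \<mu>) / sqrt \<mu>"
proof -
  let ?l = "cmod h" and ?R = "sqrt \<mu>"
  have l: "0 < ?l" using h r by linarith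
  have R: "1 \<le> ?R" "?R * ?R = \<mu>" using \<mu> by auto
  have e: "cmod e = 1" "e \<bullet> e = 1" using l by (simp_all add: e_def norm_divide dot_square_norm)
  have ei: "e \<bullet> (\<i> * e) = 0" "(\<i> * e) \<bullet> (\<i> * e) = 1"
    using e by (simp_all add: dot_square_norm norm_mult) (simp add: inner_complex_def)
  have he: "h = ?l *\<^sub>R e" using l by (simp add: e_def scaleR_conv_of_real)
  define n where "n = \<lfloor>?R * ?l / (2 * pi)\<rfloor>"
  define x where "x = 2 * pi * of_int n / ?l"
  have "of_int n \<le> ?R * ?l / (2 * pi)" "?R * ?l / (2 * pi) < of_int n + 1" by (simp_all add: n_def)
  then have x1: "x \<le> ?R" "?R < x + 2 * pi / ?l" using l by (auto simp: x_def field_simps)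
  have "0 \<le> n" using R l by (simp add: n_def)
  then have x0: "0 \<le> x" using l by (simp add: x_def)
  have gap: "?R - x \<le> 2 * pi / r"
  proof -
    have "2 * pi / ?l \<le> 2 * pi / r" using h r l by (intro divide_left_mono) auto
    then show ?thesis using x1 by linarith
  qed
  define v where "v = sqrt (\<mu> - x * x)"
  have xx: "x * x \<le> \<mu>" using mult_mono[OF x1(1) x1(1)] x0 R by simp
  have v: "0 \<le> v" "v * v = \<mu> - x * x" using xx by (auto simp: v_def)
  have "v \<le> sqrt (4 * pi / r * ?R)"
    unfolding v_def
  proof (rule real_sqrt_le_mono)
    have "\<mu> - x * x = (?R - x) * (?R + x)" using R by (simp add: algebra_simps)
    also have "\<dots> \<le> (2 * pi / r) * (2 * ?R)" using gap x1 x0 R r by (intro mult_mono) auto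
    finally show "\<mu> - x * x \<le> 4 * pi / r * ?R" by simp
  qed
  then have vb: "v \<le> sqrt (4 * pi / r) * sqrt ?R" by (simp only: real_sqrt_mult)
  define k where "k = x *\<^sub>R e + v *\<^sub>R (\<i> * e)"
  have "k \<bullet> k = x * x + v * v" using e ei by (simp add: k_def inner_add_left inner_add_right inner_commute[of "\<i> * e" e])
  then have kk: "k \<bullet> k = \<mu>" using v by simp
  have "k \<bullet> h = x * ?l" using e ei by (subst he) (simp add: k_def inner_add_left inner_commute[of "\<i> * e" e])
  then have "k \<bullet> h = 2 * pi * of_int n" using l by (simp add: x_def)
  then have ex: "exp (\<i> * of_real (k \<bullet> h)) = 1" unfolding exp_eq_1 by (auto intro!: exI[of _ n])
  have kb: "\<bar>k \<bullet> (\<i> * e)\<bar> \<le> sqrt (4 * pi / r) * sqrt ?R" using e ei vb v by (simp add: k_def inner_add_left)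
  have "k - of_real ?R * e = of_real (x - ?R) * e + of_real v * (\<i> * e)" by (simp add: k_def scaleR_conv_of_real algebra_simps)
  then have "cmod (k - of_real ?R * e) \<le> cmod (of_real (x - ?R) * e) + cmod (of_real v * (\<i> * e))" by (metis norm_triangle_ineq)
  also have "\<dots> = (?R - x) + v" using e x1 v by (simp add: norm_mult del: of_real_diff)
  finally have "cmod (k - of_real ?R * e) \<le> 2 * pi / r + sqrt (4 * pi / r) * sqrt ?R" using gap vb by linarith
  moreover have "k / of_real ?R - e = (k - of_real ?R * e) / of_real ?R" using R by (simp add: field_simps)
  ultimately have "cmod (k / of_real ?R - e) \<le> (2 * pi / r + sqrt (4 * pi / r) * sqrt ?R) / ?R"
    using R by (simp add: norm_divide divide_right_mono)
  then show ?thesis using kk ex kb by (intro exI[of _ k]) (simp add: add_divide_distrib)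
qed

lemma lon_lat_mult: "lon \<xi> (h * \<omega>) = lon \<xi> h * Re \<omega> - lat \<xi> h * Im \<omega>" "lat \<xi> (h * \<omega>) = lon \<xi> h * Im \<omega> + lat \<xi> h * Re \<omega>"
  by (simp_all add: lon_def lat_def algebra_simps)

text \<open>The strip is used as a chart of a cylinder. That \<open>h\<close> is almost the shortest lag excludes other overlaps: modulo \<open>h\<close>, they
  would lead to a lag of at most about half its length. The amplitude is constant along the cylinder, so that all norms are
  compared on a fundamental domain for the translation by \<open>h\<close>.\<close>

lemma cylinder_quasimode:
  fixes T \<kappa> w C y :: real and h :: complex
  assumes t: "tube (8 * T) y w \<eta>" and T: "1 \<le> T" and \<kappa>: "0 < \<kappa>" "\<kappa> \<le> 1" and w: "w = \<kappa> / (8 * T)"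
    and h: "r \<le> lon \<xi> h" "lon \<xi> h \<le> T" "\<bar>lat \<xi> h\<bar> < w / 4"
    and hol: "\<And>u. u \<in> strip \<xi> (8 * T) y w \<Longrightarrow> u + h \<in> strip \<xi> (8 * T) y w \<Longrightarrow> \<eta> u = \<eta> (u + h)"
    and minimal: "\<And>h' z. 0 < lon \<xi> h' \<Longrightarrow> \<bar>lat \<xi> h'\<bar> < w / 4 \<Longrightarrow> z \<in> strip \<xi> (8 * T) y w \<Longrightarrow>
        z + h' \<in> strip \<xi> (8 * T) y w \<Longrightarrow> \<eta> z = \<eta> (z + h') \<Longrightarrow> 2 / 3 * lon \<xi> h < lon \<xi> h'"
    and lam: "1 \<le> \<mu>" "sqrt \<mu> = T ^ 4" "\<mu> powr (3 / 8) = T ^ 3" "\<mu> powr (1 / 4) = T\<^sup>2" "\<mu> powr (- 1 / 8) = 1 / T"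
    and C: "16 * 900 * (2 * (512 / \<kappa>)\<^sup>2 + 4 * (512 / \<kappa> * sqrt (4 * pi / r))) \<le> C" "900 * 16 * 512 * 1024 / \<kappa>\<^sup>2 \<le> C" "512 / \<kappa> \<le> C"
       "2 * pi / r + sqrt (4 * pi / r) + 1 / r \<le> C"
  shows "\<exists>\<phi> k. normalized_quasimode C \<xi> \<mu> \<phi> k"
proof -
  let ?W = "strip \<xi> (8 * T) y w"
  have w0: "0 < w" "w \<le> 1 / 8" "w \<le> r"
  proof -
    show "0 < w" using w \<kappa> T by simp
    have "\<kappa> \<le> T" using \<kappa> T by linarith
    then have "\<kappa> / (8 * T) \<le> T / (8 * T)" using T by (intro divide_right_mono) auto
    then show "w \<le> 1 / 8" using w T by simp
    show "w \<le> r" using t abs_ge_zero[of y] unfolding tube_def by linarith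
  qed
  define \<sigma> where "\<sigma> = w / 32"
  define L where "L = lon \<xi> h"
  define d where "d = lat \<xi> h"
  have L: "0 < L" "r \<le> L" "L \<le> T" "\<bar>d\<bar> < w / 4" using h r by (auto simp: L_def d_def)
  let ?l = "cmod h"
  have l: "L \<le> ?l" "\<bar>d\<bar> \<le> ?l" "?l \<le> L + \<bar>d\<bar>" "0 < ?l"
    using lon_lat_le[of h] norm_rotate[of h] L by (auto simp: L_def d_def)
  have hn: "h \<noteq> 0" using l by auto
  (* The real part of \<omega> counts turns around the cylinder. A turn has about the length of h, at most T; from the start
     at 3T the strip of length 8T has room for the turns from -2 to 3. *)
  define p0 where "p0 = \<xi> * Complex (3 * T) y"
  define \<omega> where "\<omega> z = (z - p0) / h" for z
  have z\<omega>: "z = p0 + h * \<omega> z" for z using hn by (simp add: \<omega>_def)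
  have \<omega>_shift: "\<omega> (z + of_int n * h) = \<omega> z + of_int n" for z n using hn by (simp add: \<omega>_def add_divide_distrib diff_divide_distrib)
  define tall where "tall z \<longleftrightarrow> \<bar>Im (\<omega> z)\<bar> * ?l < \<sigma>" for z
  have inW: "z \<in> ?W" if "- 2 < Re (\<omega> z)" "Re (\<omega> z) < 3" "tall z" for z
  proof -
    have lz: "lon \<xi> z = 3 * T + (L * Re (\<omega> z) - d * Im (\<omega> z))" "lat \<xi> z = y + (L * Im (\<omega> z) + d * Re (\<omega> z))"
    proof -
      have p0: "lon \<xi> p0 = 3 * T" "lat \<xi> p0 = y" by (simp_all add: p0_def)
      have "lon \<xi> z = lon \<xi> (p0 + h * \<omega> z)" "lat \<xi> z = lat \<xi> (p0 + h * \<omega> z)" using z\<omega>[of z] by simp_all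
      then show "lon \<xi> z = 3 * T + (L * Re (\<omega> z) - d * Im (\<omega> z))" "lat \<xi> z = y + (L * Im (\<omega> z) + d * Re (\<omega> z))"
        unfolding lon_lat_linear lon_lat_mult p0 L_def d_def by simp_all
    qed
    have i: "\<bar>d * Im (\<omega> z)\<bar> < \<sigma>" "\<bar>L * Im (\<omega> z)\<bar> < \<sigma>"
    proof -
      have "\<bar>d\<bar> * \<bar>Im (\<omega> z)\<bar> \<le> ?l * \<bar>Im (\<omega> z)\<bar>" "L * \<bar>Im (\<omega> z)\<bar> \<le> ?l * \<bar>Im (\<omega> z)\<bar>" using l by (auto intro: mult_right_mono)
      then show "\<bar>d * Im (\<omega> z)\<bar> < \<sigma>" "\<bar>L * Im (\<omega> z)\<bar> < \<sigma>" using that(3) L by (auto simp: tall_def abs_mult mult.commute)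
    qed
    have "L * (- 2) \<le> L * Re (\<omega> z)" "L * Re (\<omega> z) \<le> L * 3" 
      using mult_left_mono[of "- 2" "Re (\<omega> z)" L] mult_left_mono[of "Re (\<omega> z)" 3 L] that L by auto
    then have lon: "0 < lon \<xi> z" "lon \<xi> z < 8 * T" using i L T w0 unfolding lz \<sigma>_def by linarith+
    have "\<bar>d * Re (\<omega> z)\<bar> \<le> \<bar>d\<bar> * 3" unfolding abs_mult using that by (intro mult_left_mono) auto
    then have "\<bar>lat \<xi> z - y\<bar> < w" using i L w0 unfolding lz \<sigma>_def by linarith
    then show ?thesis using lon by (simp add: strip_def)
  qed
  have tall_shift: "tall (z + of_int n * h) \<longleftrightarrow> tall z" for z n by (simp add: tall_def \<omega>_shift)
  have shift_nat: "\<eta> z = \<eta> (z + of_int (int n) * h)" if "- 2 < Re (\<omega> z)" "Re (\<omega> z) + n < 3" "tall z" for z n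
    using that
  proof (induction n)
    case (Suc n)
    have eq: "z + of_int (int (Suc n)) * h = (z + of_int (int n) * h) + h" by (simp add: algebra_simps)
    have inside: "z + of_int (int m) * h \<in> ?W" if "m \<le> Suc n" for m
    proof (rule inW)
      show "- 2 < Re (\<omega> (z + of_int (int m) * h))" "Re (\<omega> (z + of_int (int m) * h)) < 3"
        unfolding \<omega>_shift using Suc.prems that by simp_all
      show "tall (z + of_int (int m) * h)" unfolding tall_shift by (rule Suc.prems(3))
    qed
    have "z + of_int (int n) * h \<in> ?W" "z + of_int (int (Suc n)) * h \<in> ?W" by (rule inside, simp)+
    then show ?case using Suc hol[of "z + of_int (int n) * h"] unfolding eq by simp
  qed simp
  have shift: "\<eta> z = \<eta> (z + of_int n * h)" if "- 2 < Re (\<omega> z)" "Re (\<omega> z) < 3" "- 2 < Re (\<omega> z) + of_int n" "Re (\<omega> z) + of_int n < 3" "tall z" for z n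
  proof (cases "0 \<le> n")
    case True
    then show ?thesis using shift_nat[of z "nat n"] that by simp
  next
    case False
    let ?z = "z + of_int n * h"
    have "\<eta> ?z = \<eta> (?z + of_int (int (nat (- n))) * h)"
      using False that by (intro shift_nat) (auto simp: \<omega>_shift tall_shift)
    then show ?thesis using False by simp
  qed
  define Z where "Z = {z. - 1 < Re (\<omega> z) \<and> Re (\<omega> z) < 2 \<and> tall z}"
  have "open Z" unfolding Z_def tall_def \<omega>_def using hn by (intro open_Collect_conj open_Collect_less continuous_intros) auto
  moreover have ZW: "Z \<subseteq> ?W" using inW by (auto simp: Z_def)
  ultimately have coordsZ: "local_coords S Z \<eta>" using t local_coords_subset by (auto simp: tube_def)
  have period: "\<exists>n::int. z' = z + of_int n * h" if z: "z \<in> Z" "z' \<in> Z" "\<eta> z = \<eta> z'" for z z'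
  proof -
    define n where "n = - round (Re (\<omega> z') - Re (\<omega> z))"
    define z2 where "z2 = z' + of_int n * h"
    define \<theta> where "\<theta> = \<omega> z2 - \<omega> z"
    have n: "\<bar>Re (\<omega> z') + of_int n - Re (\<omega> z)\<bar> \<le> 1 / 2"
      using of_int_round_abs_le[of "Re (\<omega> z') - Re (\<omega> z)"] by (simp add: n_def abs_minus_commute algebra_simps)
    have n': "Re (\<omega> z') + of_int n \<le> Re (\<omega> z) + 1 / 2" "Re (\<omega> z) \<le> Re (\<omega> z') + of_int n + 1 / 2" using n by linarith+
    have z2: "\<eta> z' = \<eta> z2" unfolding z2_def using z n' by (intro shift) (auto simp: Z_def)
    have z2W: "z2 \<in> ?W" "tall z2" using z n' by (auto intro!: inW simp: z2_def \<omega>_shift tall_shift Z_def)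
    have zW: "z \<in> ?W" using z ZW by blast
    define g where "g = z2 - z"
    have "h * \<omega> z2 = z2 - p0" "h * \<omega> z = z - p0" using hn by (simp_all add: \<omega>_def)
    then have g: "g = h * \<theta>" by (simp add: g_def \<theta>_def right_diff_distrib)
    have R\<theta>: "\<bar>Re \<theta>\<bar> \<le> 1 / 2" using n by (simp add: \<theta>_def z2_def \<omega>_shift)
    have I\<theta>: "\<bar>Im \<theta>\<bar> * ?l < 2 * \<sigma>"
    proof -
      have "\<bar>Im \<theta>\<bar> * ?l \<le> (\<bar>Im (\<omega> z2)\<bar> + \<bar>Im (\<omega> z)\<bar>) * ?l" unfolding \<theta>_def by (intro mult_right_mono) auto
      then show ?thesis using z2W(2) z(1) by (simp add: Z_def tall_def distrib_right)
    qed
    have i: "\<bar>d * Im \<theta>\<bar> < 2 * \<sigma>" "\<bar>L * Im \<theta>\<bar> < 2 * \<sigma>"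
    proof -
      have "\<bar>d\<bar> * \<bar>Im \<theta>\<bar> \<le> ?l * \<bar>Im \<theta>\<bar>" "L * \<bar>Im \<theta>\<bar> \<le> ?l * \<bar>Im \<theta>\<bar>" using l by (auto intro: mult_right_mono)
      then show "\<bar>d * Im \<theta>\<bar> < 2 * \<sigma>" "\<bar>L * Im \<theta>\<bar> < 2 * \<sigma>" using I\<theta> L by (auto simp: abs_mult mult.commute)
    qed
    have R: "\<bar>L * Re \<theta>\<bar> \<le> L / 2" "\<bar>d * Re \<theta>\<bar> \<le> \<bar>d\<bar> / 2"
      using mult_left_mono[OF R\<theta>, of L] mult_left_mono[OF R\<theta>, of "\<bar>d\<bar>"] L by (auto simp: abs_mult)
    have lg: "lon \<xi> g = L * Re \<theta> - d * Im \<theta>" "lat \<xi> g = L * Im \<theta> + d * Re \<theta>" by (simp_all add: g lon_lat_mult L_def d_def)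
    have latg: "\<bar>lat \<xi> g\<bar> < w / 4" using i R L unfolding lg \<sigma>_def by linarith
    have long: "\<bar>lon \<xi> g\<bar> \<le> 2 / 3 * L" using i R L w0 unfolding lg \<sigma>_def by linarith
    have eq: "\<eta> z = \<eta> z2" using z(3) z2 by simp
    have neg: "lon \<xi> (- g) = - lon \<xi> g" "lat \<xi> (- g) = - lat \<xi> g" by (simp_all add: lon_def lat_def)
    have "lon \<xi> g = 0"
    proof (rule ccontr)
      assume "lon \<xi> g \<noteq> 0"
      then consider "0 < lon \<xi> g" | "0 < lon \<xi> (- g)" unfolding neg by linarith
      then show False
      proof cases
        case 1
        have "2 / 3 * lon \<xi> h < lon \<xi> g" by (rule minimal[OF 1 latg zW]) (use z2W eq in \<open>simp_all add: g_def\<close>)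
        then show False using long unfolding L_def by linarith
      next
        case 2
        have "\<bar>lat \<xi> (- g)\<bar> < w / 4" using latg by (simp only: neg abs_minus_cancel)
        then have "2 / 3 * lon \<xi> h < lon \<xi> (- g)" by (rule minimal[OF 2 _ z2W(1)]) (use zW eq in \<open>simp_all add: g_def\<close>)
        then show False using long unfolding neg L_def by linarith
      qed
    qed
    then have "z = z2" using tube_injective[OF t t zW z2W(1) eq] r by (simp add: g_def)
    then have "z' = z + of_int (- n) * h" by (simp add: z2_def algebra_simps)
    then show ?thesis by blast
  qed
  define e where "e = h / of_real ?l"
  have e1: "cmod e = 1" using l by (simp add: e_def norm_divide)
  define b where "b = (2 / \<sigma>) *\<^sub>R (\<i> * e)"
  define b0 where "b0 = b \<bullet> p0"
  have \<sigma>0: "0 < \<sigma>" using w0 by (simp add: \<sigma>_def)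
  have bz: "b \<bullet> z - b0 = 2 / \<sigma> * (?l * Im (\<omega> z))" for z
  proof -
    have "z - p0 = h * \<omega> z" using hn by (simp add: \<omega>_def)
    then have "b \<bullet> z - b0 = b \<bullet> (h * \<omega> z)" by (simp only: b0_def inner_diff_right[symmetric])
    also have "\<dots> = 2 / \<sigma> * ((\<i> * e) \<bullet> (of_real ?l * e * \<omega> z))" using l by (simp add: b_def e_def)
    also have "(\<i> * e) \<bullet> (of_real ?l * e * \<omega> z) = ?l * Im (\<omega> z) * (e \<bullet> e)" by (simp add: inner_complex_def algebra_simps)
    also have "e \<bullet> e = 1" using e1 by (simp add: dot_square_norm)
    finally show ?thesis by simp
  qed
  define K' where "K' = {z. \<bar>(0::complex) \<bullet> z - 0\<bar> \<le> 1 \<and> \<bar>b \<bullet> z - b0\<bar> \<le> 1}"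
  have K'iff: "z \<in> K' \<longleftrightarrow> \<bar>Im (\<omega> z)\<bar> * ?l \<le> \<sigma> / 2" for z
    using \<sigma>0 l by (simp add: K'_def bz abs_mult field_simps)
  define K where "K = {z. 0 \<le> Re (\<omega> z) \<and> Re (\<omega> z) \<le> 1 \<and> z \<in> K'}"
  have "closed K'" unfolding K'_def by (intro closed_Collect_conj closed_Collect_le continuous_intros)
  then have "closed K" unfolding K_def \<omega>_def using hn
    by (intro closed_Collect_conj closed_Collect_le continuous_intros) auto
  moreover have bK: "bounded K"
  proof (rule boundedI)
    fix z assume z: "z \<in> K"
    have "cmod z \<le> cmod p0 + ?l * cmod (\<omega> z)" by (subst z\<omega>[of z]) (metis norm_mult norm_triangle_ineq)
    also have "?l * cmod (\<omega> z) \<le> ?l * (\<bar>Re (\<omega> z)\<bar> + \<bar>Im (\<omega> z)\<bar>)" by (intro mult_left_mono cmod_le) auto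
    also have "\<dots> \<le> ?l * 1 + \<sigma> / 2" using z l unfolding distrib_left
      by (intro add_mono mult_left_mono) (auto simp: K_def K'iff mult.commute)
    finally show "cmod z \<le> cmod p0 + (?l * 1 + \<sigma> / 2)" by simp
  qed
  ultimately have cK: "compact K" by (simp add: compact_eq_bounded_closed)
  have K'tall: "tall z" if "z \<in> K'" for z using that \<sigma>0 by (simp add: K'iff tall_def)
  have KZ: "K \<subseteq> Z" using K'tall by (auto simp: K_def Z_def)
  have reduce: "\<exists>u. \<eta> u = \<eta> z \<and> 0 \<le> Re (\<omega> u) \<and> Re (\<omega> u) < 1 \<and> Im (\<omega> u) = Im (\<omega> z)" if "z \<in> Z" for z
  proof -
    define m where "m = \<lfloor>Re (\<omega> z)\<rfloor>"
    have f: "of_int m \<le> Re (\<omega> z)" "Re (\<omega> z) < of_int m + 1" unfolding m_def by linarith+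
    let ?u = "z + of_int (- m) * h"
    have "\<eta> ?u = \<eta> z" by (rule shift[symmetric]) (use that f in \<open>auto simp: Z_def\<close>)
    moreover have "0 \<le> Re (\<omega> ?u)" "Re (\<omega> ?u) < 1" "Im (\<omega> ?u) = Im (\<omega> z)" unfolding \<omega>_shift using f by auto
    ultimately show ?thesis by blast
  qed
  interpret pc: periodic_coords S Z \<eta> h K K'
  proof
    show "\<eta> z \<in> \<eta> ` K" if "z \<in> Z" "z \<in> K'" for z
    proof -
      from reduce[OF that(1)] obtain u where u: "\<eta> u = \<eta> z" "0 \<le> Re (\<omega> u)" "Re (\<omega> u) < 1" "Im (\<omega> u) = Im (\<omega> z)" by blast
      then have "u \<in> K" using that(2) unfolding K_def K'iff by simp
      then show ?thesis using u(1) by (metis image_eqI)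
    qed
  qed (use coordsZ period cK KZ \<open>closed K'\<close> in auto)
  define \<alpha> where "\<alpha> = (2 / ?l) *\<^sub>R e"
  define p where "p = p0 + h / 2"
  have be: "b \<bullet> h = 0"
  proof -
    have "b \<bullet> h = 2 / \<sigma> * ((\<i> * e) \<bullet> (of_real ?l * e))" using l by (simp add: b_def e_def)
    also have "(\<i> * e) \<bullet> (of_real ?l * e) = 0" by (simp add: inner_complex_def)
    finally show ?thesis by simp
  qed
  have \<alpha>z: "\<alpha> \<bullet> (z - p) = 2 * (Re (\<omega> z) - 1 / 2)" for z
  proof -
    have "z - p = of_real ?l * e * (\<omega> z - 1 / 2)" using z\<omega>[of z] l by (simp add: p_def e_def algebra_simps)
    then have "\<alpha> \<bullet> (z - p) = 2 / ?l * (e \<bullet> (of_real ?l * e * (\<omega> z - 1 / 2)))" by (simp add: \<alpha>_def)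
    also have "e \<bullet> (of_real ?l * e * (\<omega> z - 1 / 2)) = ?l * (Re (\<omega> z) - 1 / 2) * (e \<bullet> e)" by (simp add: inner_complex_def algebra_simps)
    also have "e \<bullet> e = 1" using e1 by (simp add: dot_square_norm)
    finally show ?thesis using l by simp
  qed
  have bp: "b \<bullet> (z - p) = b \<bullet> z - b0" for z
  proof -
    have "b \<bullet> (h / 2) = 0" using be by (simp add: inner_complex_def)
    then show ?thesis by (simp add: p_def b0_def inner_diff_right inner_add_right)
  qed
  have Gd: "parallelogram \<alpha> b p x = {z. - x \<le> 2 * (Re (\<omega> z) - 1 / 2) \<and> 2 * (Re (\<omega> z) - 1 / 2) < x \<and> \<bar>b \<bullet> z - b0\<bar> \<le> x}" for x
    unfolding parallelogram_def \<alpha>z bp ..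
  have GK: "parallelogram \<alpha> b p 1 \<subseteq> K" unfolding Gd K_def K'_def by auto
  have nb: "cmod b = 2 / \<sigma>" "cmod \<alpha> = 2 / ?l" using e1 \<sigma>0 l by (simp_all add: b_def \<alpha>_def norm_mult)
  have wT: "1 / w = 8 * T / \<kappa>" "1 / \<sigma> = 256 * T / \<kappa>" using w by (simp_all add: \<sigma>_def)
  have rl: "r \<le> ?l" using L l by linarith
  let ?q = "sqrt (4 * pi / r)"
  have T4: "sqrt (sqrt \<mu>) = T\<^sup>2" unfolding lam(2) using T by (intro real_sqrt_unique) (auto simp flip: power_mult)
  obtain k where k: "k \<bullet> k = \<mu>" "exp (\<i> * of_real (k \<bullet> h)) = 1" "\<bar>k \<bullet> (\<i> * e)\<bar> \<le> ?q * T\<^sup>2"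
    "cmod (k / of_real (sqrt \<mu>) - e) \<le> 2 * pi / r / sqrt \<mu> + ?q * T\<^sup>2 / sqrt \<mu>"
    using cylinder_wave_vector[OF rl lam(1), folded e_def, unfolded T4] by blast
  have T23: "T\<^sup>2 \<le> T ^ 3" using T power_increasing[of 2 3 T] by auto
  have q0: "0 \<le> ?q" using r by simp
  have "\<exists>\<phi>. normalized_quasimode C \<xi> \<mu> \<phi> k"
  proof (rule pc.packet_quasimode[where a = 0 and b = b and \<alpha> = \<alpha> and p = p and ?a0.0 = 0 and ?b0.0 = b0 and A = "512 * T / \<kappa>" and E = "512 / \<kappa> * ?q * T ^ 3" and s = "w / 128" and \<rho> = "w / 64"])
    show "K' = {z. \<bar>0 \<bullet> z - 0\<bar> \<le> 1 \<and> \<bar>b \<bullet> z - b0\<bar> \<le> 1}" by (rule K'_def)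
    show "b \<bullet> h = 0" by (rule be)
    show "cmod b \<le> 512 * T / \<kappa>" unfolding nb using wT(2) by simp
    show "0 \<le> 512 * T / \<kappa>" "cmod 0 \<le> 512 * T / \<kappa>" using T \<kappa> by auto
    show "\<bar>k \<bullet> 0\<bar> \<le> 512 / \<kappa> * ?q * T ^ 3" using T \<kappa> q0 by simp
    have "\<bar>k \<bullet> b\<bar> = 2 / \<sigma> * \<bar>k \<bullet> (\<i> * e)\<bar>" using \<sigma>0 by (simp add: b_def abs_mult)
    also have "\<dots> \<le> 2 / \<sigma> * (?q * T\<^sup>2)" using k(3) \<sigma>0 by (intro mult_left_mono) auto
    also have "\<dots> = 2 * (1 / \<sigma>) * (?q * T\<^sup>2)" by simp
    also have "\<dots> = 512 / \<kappa> * ?q * T ^ 3" unfolding wT(2) by (simp add: power2_eq_square power3_eq_cube)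
    finally show "\<bar>k \<bullet> b\<bar> \<le> 512 / \<kappa> * ?q * T ^ 3" .
    show "parallelogram \<alpha> b p 1 \<subseteq> Z" using GK KZ by blast
    show "inj_on \<eta> (parallelogram \<alpha> b p 1)"
    proof (rule inj_onI)
      fix x y' assume xy: "x \<in> parallelogram \<alpha> b p 1" "y' \<in> parallelogram \<alpha> b p 1" "\<eta> x = \<eta> y'"
      then obtain n :: int where n: "y' = x + of_int n * h" using period[of x y'] GK KZ by blast
      then have "Re (\<omega> y') = Re (\<omega> x) + of_int n" by (simp add: \<omega>_shift)
      then have "\<bar>of_int n\<bar> < (1 :: real)" using xy(1,2) unfolding Gd by auto
      then have "n = 0" by linarith
      then show "x = y'" using n by simp
    qed
    show "bounded (parallelogram \<alpha> b p 1)" using bounded_subset[OF bK GK] .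
    show "\<eta> z \<in> \<eta> ` parallelogram \<alpha> b p 1" if z: "z \<in> Z" and "\<bar>b \<bullet> z - b0\<bar> < 1" for z
    proof -
      obtain u where u: "\<eta> u = \<eta> z" "0 \<le> Re (\<omega> u)" "Re (\<omega> u) < 1" "Im (\<omega> u) = Im (\<omega> z)" using reduce[OF z] by blast
      then have "u \<in> parallelogram \<alpha> b p 1" using that(2) unfolding Gd bz by simp
      then show ?thesis using u(1) by (metis image_eqI)
    qed
    show "\<bar>0 \<bullet> z - 0\<bar> \<le> 1 / 2 \<and> \<bar>b \<bullet> z - b0\<bar> \<le> 1 / 2" if "z \<in> parallelogram \<alpha> b p (1 / 2)" for z
      using that unfolding Gd by auto
    show "0 < w / 128" "0 < w / 64" using w0 by auto
    show "ball p (w / 128) \<subseteq> parallelogram \<alpha> b p (1 / 2)"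
    proof (rule parallelogram_ball)
      show "cmod b * (w / 128) \<le> 1 / 2" using w0 by (simp add: nb \<sigma>_def)
      have "w \<le> ?l" using rl w0 by linarith
      then show "cmod \<alpha> * (w / 128) \<le> 1 / 2" using l w0 by (simp add: nb field_simps)
    qed
    show "ball z (w / 64) \<subseteq> Z" if "z \<in> K" for z
    proof
      fix u assume "u \<in> ball z (w / 64)"
      then have u: "cmod (u - z) < \<sigma> / 2" by (simp add: dist_norm norm_minus_commute \<sigma>_def)
      have eq: "\<omega> u = \<omega> z + (u - z) / h" by (simp add: \<omega>_def diff_divide_distrib)
      have c: "cmod ((u - z) / h) * ?l < \<sigma> / 2" using u l by (simp add: norm_divide)
      have "cmod ((u - z) / h) < 1"
      proof -
        have "\<sigma> / 2 \<le> ?l" using rl w0 by (simp add: \<sigma>_def)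
        then have "cmod ((u - z) / h) * ?l < 1 * ?l" using c by linarith
        then show ?thesis using l by (simp only: mult_less_cancel_right)
      qed
      then have "\<bar>Re ((u - z) / h)\<bar> < 1" using abs_Re_le_cmod le_less_trans by blast
      moreover have "\<bar>Im (\<omega> u)\<bar> * ?l < \<sigma>"
      proof -
        have "\<bar>Im (\<omega> u)\<bar> * ?l \<le> (\<bar>Im (\<omega> z)\<bar> + cmod ((u - z) / h)) * ?l"
          unfolding eq using abs_Im_le_cmod[of "(u - z) / h"] by (intro mult_right_mono) auto
        then show ?thesis using c that by (simp add: K_def K'iff distrib_right)
      qed
      ultimately show "u \<in> Z" using that by (auto simp: Z_def tall_def K_def eq)
    qed
    show "(900 * (2 * (512 * T / \<kappa>)\<^sup>2 + 4 * (512 / \<kappa> * ?q * T ^ 3))) * 16 \<le> C * \<mu> powr (3 / 8)"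
    proof -
      have "(512 * T / \<kappa>)\<^sup>2 = (512 / \<kappa>)\<^sup>2 * T\<^sup>2" by (simp add: power_divide power_mult_distrib)
      also have "\<dots> \<le> (512 / \<kappa>)\<^sup>2 * T ^ 3" using T23 by (intro mult_left_mono) auto
      finally have "(900 * (2 * (512 * T / \<kappa>)\<^sup>2 + 4 * (512 / \<kappa> * ?q * T ^ 3))) * 16 \<le> (16 * 900 * (2 * (512 / \<kappa>)\<^sup>2 + 4 * (512 / \<kappa> * ?q))) * T ^ 3"
        by (simp add: algebra_simps)
      also have "\<dots> \<le> C * T ^ 3" using C(1) T by (intro mult_right_mono) auto
      finally show ?thesis by (simp only: lam)
    qed
    show "cmod (k / of_real (sqrt \<mu>) - \<xi>) \<le> C * \<mu> powr (- 1 / 8)"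
    proof -
      have 1: "2 * pi / r / sqrt \<mu> \<le> 2 * pi / r / T"
        unfolding lam(2) using T r power_increasing[of 1 4 T] by (intro divide_left_mono) auto
      have 2: "?q * T\<^sup>2 / sqrt \<mu> \<le> ?q / T"
      proof -
        have "T ^ 3 \<le> T ^ 4" using T by (intro power_increasing) auto
        then have "?q * T ^ 3 \<le> ?q * T ^ 4" using q0 by (intro mult_left_mono)
        then show ?thesis unfolding lam(2) using T by (simp add: field_simps power2_eq_square power3_eq_cube)
      qed
      have 3: "cmod (e - \<xi>) \<le> 1 / r / T"
      proof -
        have "cnj \<xi> * h = Complex L d" by (simp add: L_def d_def lon_def lat_def complex_eq_iff)
        then have "h = \<xi> * Complex L d" using rotate_split[of h] by (simp add: L_def d_def)
        then have "h - of_real ?l * \<xi> = \<xi> * (Complex L d - of_real ?l)" by (simp add: algebra_simps)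
        then have "cmod (h - of_real ?l * \<xi>) = cmod (Complex (L - ?l) d)" using \<xi>
          by (simp add: norm_mult) (metis complex_diff complex_of_real_def diff_zero)
        also have "\<dots> \<le> \<bar>L - ?l\<bar> + \<bar>d\<bar>" using cmod_le[of "Complex (L - ?l) d"] by simp
        also have "\<dots> \<le> 2 * \<bar>d\<bar>" using l by linarith
        also have "\<dots> \<le> w" using L by linarith
        finally have "cmod (h - of_real ?l * \<xi>) \<le> w" .
        moreover have "e - \<xi> = (h - of_real ?l * \<xi>) / of_real ?l" using l by (simp add: e_def field_simps)
        ultimately have "cmod (e - \<xi>) \<le> w / ?l" using l by (simp add: norm_divide divide_right_mono)
        also have "\<dots> \<le> w / r" using rl r w0 l by (intro divide_left_mono) auto
        also have "\<dots> \<le> 1 / T / r"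
        proof -
          have "w \<le> 1 / T" using w \<kappa> T by (simp add: field_simps)
          then show ?thesis using r by (intro divide_right_mono) auto
        qed
        finally show ?thesis by (simp add: mult.commute)
      qed
      have "cmod (k / of_real (sqrt \<mu>) - \<xi>) \<le> cmod (k / of_real (sqrt \<mu>) - e) + cmod (e - \<xi>)"
        using norm_triangle_ineq[of "k / of_real (sqrt \<mu>) - e" "e - \<xi>"] by simp
      also have "\<dots> \<le> (2 * pi / r + ?q + 1 / r) / T" using k(4) 1 2 3 unfolding add_divide_distrib by linarith
      also have "\<dots> \<le> C / T" using C(4) T by (intro divide_right_mono) auto
      finally show ?thesis unfolding lam(5) by simp
    qed
    have "900 * (2 * (512 * T / \<kappa>)) * 8 / (w / 128) = 900 * 2 * 512 * 8 * 128 * T / \<kappa> * (1 / w)" by simp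
    also have "\<dots> = 900 * 16 * 512 * 1024 / \<kappa>\<^sup>2 * T\<^sup>2" unfolding wT by (simp add: power2_eq_square)
    also have "\<dots> \<le> C * T\<^sup>2" using C(2) by (intro mult_right_mono) auto
    finally show "900 * (2 * (512 * T / \<kappa>)) * 8 / (w / 128) \<le> C * \<mu> powr (1 / 4)" by (simp only: lam)
    have "0 < 512 / \<kappa>" using \<kappa> by simp
    then have C0: "0 < C" using C(3) by linarith
    have "1 / (T * C) \<le> 1 / (T * (512 / \<kappa>))" using C(3) C0 T \<kappa> by (intro divide_left_mono mult_left_mono mult_pos_pos) auto
    also have "\<dots> = w / 64" using w T \<kappa> by simp
    finally show "\<mu> powr (- 1 / 8) / C \<le> w / 64" unfolding lam(5) by simp
  qed (use k in auto)
  then show ?thesis by blast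
qed

text \<open>An overlap at one point propagates along the strip, since the points that stay in it under the translation by \<open>h\<close> form
  a convex set.\<close>

lemma tube_translation:
  assumes t: "tube l y w \<eta>" and z: "z \<in> strip \<xi> l y w" "z + h \<in> strip \<xi> l y w" "\<eta> z = \<eta> (z + h)"
    and u: "u \<in> strip \<xi> l y w" "u + h \<in> strip \<xi> l y w"
  shows "\<eta> u = \<eta> (u + h)"
proof (rule local_coords_unique[of "strip \<xi> l y w" \<eta> "strip \<xi> l y w" \<eta> "strip \<xi> l y w \<inter> {x. x + h \<in> strip \<xi> l y w}" h z u])
  have "{x. x + h \<in> strip \<xi> l y w} = (+) (- h) ` strip \<xi> l y w"
    by (auto intro!: image_eqI[where x = "_ + h"])
  then show "connected (strip \<xi> l y w \<inter> {x. x + h \<in> strip \<xi> l y w})"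
    by (simp add: convex_connected convex_Int convex_strip convex_translation)
qed (use t z u in \<open>auto simp: tube_def\<close>)

text \<open>Either the first eighth of a strip, narrowed to an eighth of the width, is embedded, or it overlaps itself with a lag of at
  most \<open>T\<close>; then the rest of the strip is the room for the turns around the cylinder. The lag is chosen among those that do
  not exceed \<open>T\<close> and that are less than \<open>3/2\<close> times the infimum of all lags.\<close>

theorem quasimodes_exist: "\<exists>C>0. \<forall>\<mu>\<ge>1. \<exists>\<phi> k. normalized_quasimode C \<xi> \<mu> \<phi> k"
proof -
  obtain \<kappa>0 where \<kappa>0: "\<kappa>0 > 0" "\<forall>l\<ge>1. \<exists>y \<eta>. tube l y (\<kappa>0 / l) \<eta>" using long_tube by blast
  define \<kappa> where "\<kappa> = min \<kappa>0 1"
  have \<kappa>: "0 < \<kappa>" "\<kappa> \<le> 1" "\<kappa> \<le> \<kappa>0" using \<kappa>0(1) by (auto simp: \<kappa>_def)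
  let ?q = "sqrt (4 * pi / r)"
  define C where "C = 16 * 900 * (2 * (512 / \<kappa>)\<^sup>2 + 4 * 4) + 16 * 900 * (2 * (512 / \<kappa>)\<^sup>2 + 4 * (512 / \<kappa> * ?q))
    + 900 * 16 * 512 * 1024 / \<kappa>\<^sup>2 + 512 / \<kappa> + (2 * pi / r + ?q + 1 / r)"
  have nn: "0 \<le> 16 * 900 * (2 * (512 / \<kappa>)\<^sup>2 + 4 * 4)" "0 \<le> 16 * 900 * (2 * (512 / \<kappa>)\<^sup>2 + 4 * (512 / \<kappa> * ?q))"
    "0 \<le> 900 * 16 * 512 * 1024 / \<kappa>\<^sup>2" "0 < 512 / \<kappa>" "0 \<le> 2 * pi / r + ?q + 1 / r"
    using \<kappa> r by (auto intro!: add_nonneg_nonneg mult_nonneg_nonneg)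
  have C: "16 * 900 * (2 * (512 / \<kappa>)\<^sup>2 + 4 * 4) \<le> C" "16 * 900 * (2 * (512 / \<kappa>)\<^sup>2 + 4 * (512 / \<kappa> * ?q)) \<le> C"
    "900 * 16 * 512 * 1024 / \<kappa>\<^sup>2 \<le> C" "512 / \<kappa> \<le> C" "2 * pi / r + ?q + 1 / r \<le> C" "0 < C"
    using nn unfolding C_def by linarith+
  have "\<exists>\<phi> k. normalized_quasimode C \<xi> \<mu> \<phi> k" if \<mu>: "1 \<le> \<mu>" for \<mu>
  proof -
    define T where "T = \<mu> powr (1 / 8)"
    have T: "1 \<le> T" using \<mu> by (simp add: T_def ge_one_powr_ge_zero)
    have Tn: "T ^ n = \<mu> powr (real n / 8)" for n using \<mu> by (simp add: T_def powr_power)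
    have lam: "sqrt \<mu> = T ^ 4" "\<mu> = T ^ 8" "\<mu> powr (3 / 8) = T ^ 3" "\<mu> powr (1 / 4) = T\<^sup>2" "\<mu> powr (- 1 / 8) = 1 / T"
      using \<mu> by (simp_all add: Tn powr_half_sqrt) (simp add: T_def powr_minus_divide)
    define w where "w = \<kappa> / (8 * T)"
    have w0: "0 < w" using \<kappa> T by (simp add: w_def)
    have "1 \<le> 8 * T" using T by simp
    then obtain y \<eta>0 where "tube (8 * T) y (\<kappa>0 / (8 * T)) \<eta>0" using \<kappa>0(2) by blast
    then have "tube (8 * T) y w \<eta>0"
      by (rule tube_shrink) (use \<kappa>(3) T in \<open>simp_all add: w_def divide_right_mono\<close>)
    then obtain \<eta> where t: "tube (8 * T) y w \<eta>" by blast
    show ?thesis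
    proof (cases "inj_on \<eta> (strip \<xi> T y (w / 8))")
      case True
      show ?thesis by (rule embedded_strip_quasimode[OF t T \<kappa>(1,2) w_def True lam C(1,3,4)])
    next
      case False
      let ?W = "strip \<xi> (8 * T) y w"
      define H where "H = {h. 0 < lon \<xi> h \<and> \<bar>lat \<xi> h\<bar> < w / 4 \<and> (\<exists>z. z \<in> ?W \<and> z + h \<in> ?W \<and> \<eta> z = \<eta> (z + h))}"
      obtain z z' where zz: "z \<in> strip \<xi> T y (w / 8)" "z' \<in> strip \<xi> T y (w / 8)" "\<eta> z = \<eta> z'" "z \<noteq> z'"
        using False by (auto simp: inj_on_def)
      have sub: "strip \<xi> T y (w / 8) \<subseteq> ?W" using T w0 by (auto simp: strip_def)
      have ge: "r \<le> lon \<xi> h" if "h \<in> H" for h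
      proof (rule ccontr)
        assume "\<not> r \<le> lon \<xi> h"
        moreover obtain u where u: "u \<in> ?W" "u + h \<in> ?W" "\<eta> u = \<eta> (u + h)" and "0 < lon \<xi> h" using \<open>h \<in> H\<close> by (auto simp: H_def)
        ultimately have "u = u + h" using tube_injective[OF t t u] by simp
        then show False using \<open>0 < lon \<xi> h\<close> by (simp add: lon_def)
      qed
      have "lon \<xi> z' \<noteq> lon \<xi> z"
      proof
        assume "lon \<xi> z' = lon \<xi> z"
        then have "\<bar>lon \<xi> (z' - z)\<bar> < r" using r by simp
        then have "z = z'" using tube_injective[OF t t _ _ zz(3)] zz(1,2) sub by blast
        then show False using zz(4) by simp
      qed
      then obtain u u' where uu: "u \<in> strip \<xi> T y (w / 8)" "u' \<in> strip \<xi> T y (w / 8)" "\<eta> u = \<eta> u'" "lon \<xi> u < lon \<xi> u'"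
        using zz by (metis linorder_neqE)
      define h1 where "h1 = u' - u"
      have "0 < lon \<xi> h1" "lon \<xi> h1 \<le> T" "\<bar>lat \<xi> h1\<bar> < w / 4"
      proof -
        have "0 < lon \<xi> u" "lon \<xi> u' < T" "\<bar>lat \<xi> u - y\<bar> < w / 8" "\<bar>lat \<xi> u' - y\<bar> < w / 8" using uu by (auto simp: strip_def)
        then show "0 < lon \<xi> h1" "lon \<xi> h1 \<le> T" "\<bar>lat \<xi> h1\<bar> < w / 4"
          using uu(4) unfolding h1_def lon_lat_linear by linarith+
      qed
      then have h1: "h1 \<in> H" "lon \<xi> h1 \<le> T" using uu sub by (auto simp: H_def h1_def intro!: exI[of _ u])
      define m where "m = Inf (lon \<xi> ` H)"
      have bdd: "bdd_below (lon \<xi> ` H)" by (rule bdd_belowI2[of _ r]) (rule ge)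
      have m: "r \<le> m" "\<And>h. h \<in> H \<Longrightarrow> m \<le> lon \<xi> h"
        unfolding m_def using h1(1) ge bdd by (auto intro!: cINF_greatest cINF_lower)
      have "m < 3 / 2 * m" using m(1) r by simp
      then obtain h2 where h2: "h2 \<in> H" "lon \<xi> h2 < 3 / 2 * m" 
        using cINF_less_iff[OF _ bdd, of "3 / 2 * m"] h1(1) unfolding m_def by blast
      define h where "h = (if lon \<xi> h1 < 3 / 2 * m then h1 else h2)"
      have h: "h \<in> H" "lon \<xi> h < 3 / 2 * m" "lon \<xi> h \<le> T" using h1 h2 by (auto simp: h_def)
      then obtain z0 where z0: "z0 \<in> ?W" "z0 + h \<in> ?W" "\<eta> z0 = \<eta> (z0 + h)" by (auto simp: H_def)
      show ?thesis
      proof (rule cylinder_quasimode[OF t T \<kappa>(1,2) w_def _ _ _ _ _ \<mu> lam(1,3,4,5) C(2,3,4,5)])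
        show "r \<le> lon \<xi> h" "lon \<xi> h \<le> T" "\<bar>lat \<xi> h\<bar> < w / 4" using h ge by (auto simp: H_def)
        show "\<eta> u = \<eta> (u + h)" if "u \<in> ?W" "u + h \<in> ?W" for u by (rule tube_translation[OF t z0 that])
        show "2 / 3 * lon \<xi> h < lon \<xi> h'" if "0 < lon \<xi> h'" "\<bar>lat \<xi> h'\<bar> < w / 4" "z \<in> ?W" "z + h' \<in> ?W" "\<eta> z = \<eta> (z + h')" for h' z
        proof -
          have "h' \<in> H" using that by (auto simp: H_def)
          then show ?thesis using m(2) h(2) by force
        qed
      qed
    qed
  qed
  then show ?thesis using C(6) by blast
qed

end

section \<open>Weyl quantization of functions of the momentum\<close>

context flat_surface
begin

lemma translatable_coords:
  assumes "v \<in> translatable S x"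
  obtains W \<eta> where "local_coords S W \<eta>" "closed_segment 0 v \<subseteq> W" "\<eta> 0 = x" "translate S x v = \<eta> v"
proof -
  from assms[unfolded translatable_def mem_Collect_eq]
  obtain W \<eta> where W: "local_coords S W \<eta>" "closed_segment 0 v \<subseteq> W" "\<eta> 0 = x" by blast
  show thesis by (rule that[OF W translate_eq(2)[OF W]])
qed

lemma chart_translatable: "chart S \<rho> q \<Longrightarrow> cmod v < \<rho> \<Longrightarrow> v \<in> translatable S q"
proof -
  assume "chart S \<rho> q" and v: "cmod v < \<rho>"
  then obtain \<zeta> where z: "local_coords S (ball 0 \<rho>) \<zeta>" "\<zeta> 0 = q" by (auto simp: chart_def)
  have "0 < \<rho>" using v norm_ge_zero le_less_trans by blast
  then have "closed_segment 0 v \<subseteq> ball 0 \<rho>" using v by (intro closed_segment_subset) auto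
  then show ?thesis by (rule translate_eq(1)[OF z(1) _ z(2)])
qed

lemma translate_regular: "v \<in> translatable S x \<Longrightarrow> translate S x v \<in> regular_points S"
proof -
  assume "v \<in> translatable S x"
  then obtain W \<eta> where W: "local_coords S W \<eta>" "closed_segment 0 v \<subseteq> W" "translate S x v = \<eta> v"
    by (rule translatable_coords)
  have "v \<in> W" using W(2) by auto
  then show ?thesis using local_coords_regular[OF W(1)] W(3) by simp
qed

text \<open>If the gradient of a function nearly is \<open>\<i>k\<close> times the function, then a translation nearly
  multiplies it by a phase.\<close>

lemma translate_phase:
  assumes g: "has_gradient S \<phi> G H" and v: "v \<in> translatable S x"
    and D: "\<And>q. q \<in> regular_points S \<Longrightarrow> cmod (G q - \<i> * of_real (Re k) * \<phi> q) \<le> D"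
      "\<And>q. q \<in> regular_points S \<Longrightarrow> cmod (H q - \<i> * of_real (Im k) * \<phi> q) \<le> D"
  shows "cmod (\<phi> (translate S x v) - exp (\<i> * of_real (k \<bullet> v)) * \<phi> x) \<le> 2 * D * cmod v"
proof -
  obtain W \<eta> where W: "local_coords S W \<eta>" "closed_segment 0 v \<subseteq> W" "\<eta> 0 = x" "translate S x v = \<eta> v"
    by (rule translatable_coords[OF v])
  have tW: "of_real t * v \<in> W" if "t \<in> {0..1}" for t
    using W(2) that by (auto simp: closed_segment_def scaleR_conv_of_real)
  let ?X = "\<lambda>q. G q - \<i> * of_real (Re k) * \<phi> q" and ?Y = "\<lambda>q. H q - \<i> * of_real (Im k) * \<phi> q"
  define e where "e t = exp (- \<i> * of_real (k \<bullet> v) * of_real t)" for t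
  define p where "p t = e t * \<phi> (\<eta> (of_real t * v))" for t
  define p' where "p' t = e t * (of_real (Re v) * ?X (\<eta> (of_real t * v)) + of_real (Im v) * ?Y (\<eta> (of_real t * v)))" for t
  have ne: "cmod (e t) = 1" for t by (simp add: e_def)
  have der: "(p has_derivative (\<lambda>s. s *\<^sub>R p' t)) (at t within {0..1})" if t: "t \<in> {0..1}" for t
  proof -
    have "((\<lambda>w. \<phi> (\<eta> w)) has_derivative (\<lambda>u. of_real (Re u) * G (\<eta> (of_real t * v)) + of_real (Im u) * H (\<eta> (of_real t * v)))) (at (of_real t * v))"
      using g[unfolded has_gradient_def, rule_format, OF W(1) tW[OF t]] .
    moreover have "((\<lambda>t. complex_of_real t * v) has_derivative (\<lambda>s. of_real s * v)) (at t within {0..1})"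
      by (auto intro!: derivative_eq_intros)
    ultimately have 1: "((\<lambda>t. \<phi> (\<eta> (of_real t * v))) has_derivative (\<lambda>s. of_real (Re (of_real s * v)) * G (\<eta> (of_real t * v)) + of_real (Im (of_real s * v)) * H (\<eta> (of_real t * v)))) (at t within {0..1})"
      by (rule has_derivative_compose[rotated])
    have "((\<lambda>t. - \<i> * of_real (k \<bullet> v) * complex_of_real t) has_derivative (\<lambda>s. - \<i> * of_real (k \<bullet> v) * of_real s)) (at t within {0..1})"
      by (auto intro!: derivative_eq_intros)
    then have "((\<lambda>t. exp (- \<i> * of_real (k \<bullet> v) * complex_of_real t)) has_derivative (\<lambda>s. exp (- \<i> * of_real (k \<bullet> v) * of_real t) * (- \<i> * of_real (k \<bullet> v) * of_real s))) (at t within {0..1})"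
      by (rule has_derivative_compose) (simp flip: has_field_derivative_def)
    then have 2: "(e has_derivative (\<lambda>s. e t * (- \<i> * of_real (k \<bullet> v) * of_real s))) (at t within {0..1})"
      unfolding e_def[abs_def] .
    show ?thesis unfolding p_def[abs_def]
      by (rule has_derivative_eq_rhs[OF has_derivative_mult[OF 2 1]])
         (simp add: fun_eq_iff p'_def inner_complex_def scaleR_conv_of_real algebra_simps)
  qed
  have bound: "onorm (\<lambda>s. s *\<^sub>R p' t) \<le> 2 * D * cmod v" if t: "t \<in> {0..1}" for t
  proof (rule onorm_le)
    fix s :: real
    have q: "\<eta> (of_real t * v) \<in> regular_points S" using local_coords_regular[OF W(1) tW[OF t]] .
    have D0: "0 \<le> D" using D(1)[OF q] norm_ge_zero order_trans by blast
    have ab: "cmod (of_real (Re v) * ?X (\<eta> (of_real t * v))) \<le> cmod v * D" "cmod (of_real (Im v) * ?Y (\<eta> (of_real t * v))) \<le> cmod v * D"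
      unfolding norm_mult using D[OF q] D0 abs_Re_le_cmod abs_Im_le_cmod by (auto intro!: mult_mono)
    have "cmod (p' t) = cmod (of_real (Re v) * ?X (\<eta> (of_real t * v)) + of_real (Im v) * ?Y (\<eta> (of_real t * v)))"
      unfolding p'_def norm_mult ne by simp
    also have "\<dots> \<le> cmod (of_real (Re v) * ?X (\<eta> (of_real t * v))) + cmod (of_real (Im v) * ?Y (\<eta> (of_real t * v)))"
      by (rule norm_triangle_ineq)
    also have "\<dots> \<le> cmod v * D + cmod v * D" by (rule add_mono[OF ab])
    finally have "cmod (p' t) \<le> 2 * D * cmod v" by simp
    then have "\<bar>s\<bar> * cmod (p' t) \<le> \<bar>s\<bar> * (2 * D * cmod v)" by (rule mult_left_mono) simp
    then show "norm (s *\<^sub>R p' t) \<le> 2 * D * cmod v * norm s" by (simp add: mult.commute)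
  qed
  have "norm (p 1 - p 0) \<le> 2 * D * cmod v * norm (1 - 0 :: real)"
    by (rule differentiable_bound[OF convex_real_interval(5) der bound]) auto
  moreover have "p 1 - p 0 = exp (- \<i> * of_real (k \<bullet> v)) * (\<phi> (translate S x v) - exp (\<i> * of_real (k \<bullet> v)) * \<phi> x)"
    by (simp add: p_def e_def W(3,4) right_diff_distrib exp_minus)
  ultimately show ?thesis by (simp add: norm_mult)
qed

text \<open>The domain of translation in the position in a polygon and the displacement jointly. It is relatively open and translation
  is continuous on it, because coordinates along a segment also serve for the neighbouring segments; so the quantized
  observable applied to a function is measurable.\<close>

definition reachable :: "nat \<Rightarrow> (complex \<times> complex) set" where
  "reachable j = {(z, v). good j z \<and> v \<in> translatable S (cls S (j, z))}"

lemma reachable_near: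
  assumes "(z0, v0) \<in> reachable j"
  shows "\<exists>d>0. \<exists>W \<eta>. local_coords S W \<eta> \<and> v0 \<in> W \<and> (\<forall>z v. good j z \<longrightarrow> dist z z0 < d \<longrightarrow> dist v v0 < d \<longrightarrow>
     (z, v) \<in> reachable j \<and> z - z0 + v \<in> W \<and> translate S (cls S (j, z)) v = \<eta> (z - z0 + v))"
proof -
  have "v0 \<in> translatable S (cls S (j, z0))" using assms by (simp add: reachable_def)
  then obtain W \<eta> where W: "local_coords S W \<eta>" "closed_segment 0 v0 \<subseteq> W" "\<eta> 0 = cls S (j, z0)"
    by (rule translatable_coords)
  have "0 \<in> W" "v0 \<in> W" using W(2) by auto
  obtain d1 where d1: "d1 > 0" "\<forall>(i, p)\<in>\<eta> 0. \<forall>p'\<in>region i. dist p' p < d1 \<longrightarrow> 0 + (p' - p) \<in> W \<and> \<eta> (0 + (p' - p)) = cls S (i, p')"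
    using local_coords_rep[OF W(1) \<open>0 \<in> W\<close>] by blast
  have "\<forall>p'\<in>region j. dist p' z0 < d1 \<longrightarrow> p' - z0 \<in> W \<and> \<eta> (p' - z0) = cls S (j, p')"
    using bspec[OF d1(2), of "(j, z0)"] in_cls[of "(j, z0)"] W(3) by simp
  then have near: "\<eta> (z - z0) = cls S (j, z)" if "good j z" "dist z z0 < d1" for z
    using that by (simp add: good_def)
  obtain d2 where d2': "d2 > 0" "(\<Union>u\<in>closed_segment 0 v0. ball u d2) \<subseteq> W"
    by (rule compact_subset_open_imp_ball_epsilon_subset[OF compact_segment local_coords_open[OF W(1)] W(2)])
  have d2: "d2 > 0" "\<And>u. u \<in> closed_segment 0 v0 \<Longrightarrow> ball u d2 \<subseteq> W" using d2' by blast+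
  define d where "d = min d1 (d2 / 2)"
  have d: "d > 0" using d1 d2 by (simp add: d_def)
  have "(z, v) \<in> reachable j \<and> z - z0 + v \<in> W \<and> translate S (cls S (j, z)) v = \<eta> (z - z0 + v)"
    if z: "good j z" "dist z z0 < d" and v: "dist v v0 < d" for z v
  proof -
    have seg: "closed_segment (z - z0) (z - z0 + v) \<subseteq> W"
    proof
      fix u assume "u \<in> closed_segment (z - z0) (z - z0 + v)"
      then obtain s where s: "0 \<le> s" "s \<le> 1" "u = z - z0 + of_real s * v"
        by (auto simp: closed_segment_def scaleR_conv_of_real algebra_simps)
      have 1: "of_real s * v0 \<in> closed_segment 0 v0" using s by (auto simp: closed_segment_def scaleR_conv_of_real)
      have "dist (of_real s * v0) u \<le> cmod (z - z0) + s * cmod (v - v0)"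
      proof -
        have eq: "u - of_real s * v0 = (z - z0) + of_real s * (v - v0)" by (simp add: s(3) algebra_simps)
        have "cmod (u - of_real s * v0) \<le> cmod (z - z0) + cmod (of_real s * (v - v0))"
          unfolding eq by (rule norm_triangle_ineq)
        also have "cmod (of_real s * (v - v0)) = s * cmod (v - v0)" using s by (simp add: norm_mult)
        finally show ?thesis unfolding dist_norm norm_minus_commute[of "of_real s * v0"] .
      qed
      also have "s * cmod (v - v0) \<le> 1 * cmod (v - v0)" using s by (intro mult_right_mono) auto
      finally have "dist (of_real s * v0) u < d2" using z(2) v by (simp add: d_def dist_norm)
      then show "u \<in> W" using d2(2)[OF 1] by auto
    qed
    have e: "\<eta> (z - z0) = cls S (j, z)" using near z by (simp add: d_def)
    have "z - z0 + v \<in> W" using seg by auto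
    then show ?thesis using translate_local_coords[OF W(1) seg] e z(1) by (simp add: reachable_def)
  qed
  then show ?thesis using d W(1) \<open>v0 \<in> W\<close> by blast
qed

lemma good_borel: "{z. good j z} \<in> sets borel"
proof (cases "j < num")
  case True
  then have "{z. good j z} = region j - corners j" by (auto simp: good_def)
  moreover have "corners j \<in> sets borel" by (simp add: borel_closed finite_imp_closed)
  ultimately show ?thesis using region_borel[OF True] by simp
qed (simp add: good_def)

lemma reachable_borel: "reachable j \<in> sets borel"
proof -
  have "\<forall>p\<in>reachable j. \<exists>d>0. \<forall>z v. good j z \<longrightarrow> dist z (fst p) < d \<longrightarrow> dist v (snd p) < d \<longrightarrow> (z, v) \<in> reachable j"
    using reachable_near[of "fst _" "snd _" j] by (metis prod.collapse)
  then obtain d where d: "\<And>p. p \<in> reachable j \<Longrightarrow> d p > 0"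
    "\<And>p z v. p \<in> reachable j \<Longrightarrow> good j z \<Longrightarrow> dist z (fst p) < d p \<Longrightarrow> dist v (snd p) < d p \<Longrightarrow> (z, v) \<in> reachable j" by metis
  define U where "U = (\<Union>p\<in>reachable j. ball (fst p) (d p) \<times> ball (snd p) (d p))"
  have "open U" unfolding U_def by (intro open_UN ballI open_Times open_ball)
  moreover have "reachable j = ({z. good j z} \<times> UNIV) \<inter> U"
  proof (intro set_eqI iffI)
    fix p assume p: "p \<in> reachable j"
    then have "p \<in> ball (fst p) (d p) \<times> ball (snd p) (d p)" using d(1)[OF p] by (simp add: mem_Times_iff)
    then have "p \<in> U" unfolding U_def using p by blast
    then show "p \<in> ({z. good j z} \<times> UNIV) \<inter> U" using p by (auto simp: reachable_def)
  next
    fix p assume p: "p \<in> ({z. good j z} \<times> UNIV) \<inter> U"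
    then obtain q where "q \<in> reachable j" "p \<in> ball (fst q) (d q) \<times> ball (snd q) (d q)" by (auto simp: U_def)
    then show "p \<in> reachable j" using d(2)[of q "fst p" "snd p"] p by (auto simp: dist_commute mem_Times_iff)
  qed
  moreover have "{z. good j z} \<times> (UNIV :: complex set) \<in> sets (borel \<Otimes>\<^sub>M borel)"
    by (rule pair_measureI[OF good_borel]) simp
  then have "{z. good j z} \<times> (UNIV :: complex set) \<in> sets borel" by (simp only: borel_prod)
  ultimately show ?thesis using borel_open sets.Int by metis
qed

lemma reachable_continuous:
  assumes g: "has_gradient S \<phi> G H"
  shows "continuous_on (reachable j) (\<lambda>p. \<phi> (translate S (cls S (j, fst p)) (snd p)))"
  unfolding continuous_on_eq_continuous_within
proof
  fix p assume p: "p \<in> reachable j"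
  obtain d W \<eta> where d: "d > 0" and W: "local_coords S W \<eta>" "snd p \<in> W"
    and n: "\<forall>z v. good j z \<longrightarrow> dist z (fst p) < d \<longrightarrow> dist v (snd p) < d \<longrightarrow>
     (z, v) \<in> reachable j \<and> z - fst p + v \<in> W \<and> translate S (cls S (j, z)) v = \<eta> (z - fst p + v)"
    using reachable_near[of "fst p" "snd p" j] p by auto
  have "isCont (\<lambda>w. \<phi> (\<eta> w)) (fst p - fst p + snd p)"
    using has_derivative_continuous[OF g[unfolded has_gradient_def, rule_format, OF W]] by simp
  then have "continuous (at p within reachable j) (\<lambda>q. \<phi> (\<eta> (fst q - fst p + snd q)))"
    by (intro continuous_within_compose3[where g = "\<lambda>w. \<phi> (\<eta> w)" and f = "\<lambda>q. fst q - fst p + snd q"] continuous_intros) simp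
  then show "continuous (at p within reachable j) (\<lambda>p. \<phi> (translate S (cls S (j, fst p)) (snd p)))"
  proof (rule continuous_transform_within[OF _ d p])
    fix q assume q: "q \<in> reachable j" "dist q p < d"
    have "dist (fst q) (fst p) < d" "dist (snd q) (snd p) < d" using q(2) dist_fst_le dist_snd_le le_less_trans by blast+
    moreover have "good j (fst q)" using q(1) by (auto simp: reachable_def)
    ultimately show "\<phi> (\<eta> (fst q - fst p + snd q)) = \<phi> (translate S (cls S (j, fst q)) (snd q))" using n by simp
  qed
qed

lemma reachable_measurable:
  assumes "has_gradient S \<phi> G H"
  shows "(\<lambda>p. indicator (reachable j) p *\<^sub>R \<phi> (translate S (cls S (j, fst p)) (snd p))) \<in> borel_measurable borel"
  by (rule borel_measurable_continuous_on_indicator[OF reachable_borel reachable_continuous[OF assms]])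

definition transported :: "(point \<Rightarrow> complex) \<Rightarrow> point \<Rightarrow> complex \<Rightarrow> complex" where
  "transported \<phi> q v = indicator (translatable S q) v *\<^sub>R \<phi> (translate S q v)"

lemma transported_reachable:
  "good j z \<Longrightarrow> transported \<phi> (cls S (j, z)) v = indicator (reachable j) (z, v) *\<^sub>R \<phi> (translate S (cls S (j, z)) v)"
  by (simp add: transported_def reachable_def indicator_def)

lemma transported_measurable:
  assumes "has_gradient S \<phi> G H" "q \<in> regular_points S" shows "transported \<phi> q \<in> borel_measurable borel"
proof -
  obtain j z where "(j, z) \<in> q" using regular_rep[OF assms(2)] by blast
  then have q: "good j z" "q = cls S (j, z)" using regular_good[OF assms(2)] by auto
  have "(\<lambda>v. (z, v)) \<in> borel_measurable borel" by (intro borel_measurable_continuous_onI continuous_intros)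
  from measurable_compose[OF this reachable_measurable[OF assms(1), of j]]
  have "(\<lambda>v. transported \<phi> q v) \<in> borel_measurable borel"
    unfolding q(2) transported_reachable[OF q(1)] by simp
  then show ?thesis .
qed

text \<open>For an observable that depends on the momentum only, the inner integral is its Fourier transform at \<open>v / h\<close>; rescaling
  \<open>v\<close> cancels the factor \<open>h\<^sup>2\<close>.\<close>

lemma Op_weyl_momentum:
  assumes "h > 0" "has_gradient S \<phi> G H" "q \<in> regular_points S" "test_function b"
  shows "Op_weyl S h (\<lambda>x \<xi>. b \<xi>) \<phi> q = 1 / (2 * of_real pi)\<^sup>2 * (LINT u|lborel. fourier b u * transported \<phi> q (of_real h * u))"
proof -
  have [measurable]: "transported \<phi> q \<in> borel_measurable borel" "fourier b \<in> borel_measurable borel"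
    using transported_measurable[OF assms(2,3)] fourier_measurable[OF assms(4)] by auto
  have k: "(LINT \<xi>|lborel. exp (\<i> / of_real h * of_real ((- v) \<bullet> \<xi>)) * b \<xi>) = fourier b (v / of_real h)" for v
  proof -
    have "\<i> / of_real h * of_real ((- v) \<bullet> \<xi>) = - \<i> * of_real ((v / of_real h) \<bullet> \<xi>)" for \<xi>
      using assms(1) by (simp add: inner_complex_def field_simps)
    then show ?thesis unfolding fourier_def by simp
  qed
  have "(LINT v:translatable S q|lborel. (LINT \<xi>|lborel. exp (\<i> / of_real h * of_real ((- v) \<bullet> \<xi>)) * b \<xi>) * \<phi> (translate S q v))
      = (LINT v|lborel. fourier b (v / of_real h) * transported \<phi> q v)"
    unfolding k set_lebesgue_integral_def transported_def by (simp add: mult.commute)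
  also have "\<dots> = h\<^sup>2 *\<^sub>R (LINT u|lborel. fourier b ((0 + of_real h * u) / of_real h) * transported \<phi> q (0 + of_real h * u))"
    by (rule plane_affine_integral(1)) (use assms(1) in measurable)
  also have "\<dots> = (of_real h)\<^sup>2 * (LINT u|lborel. fourier b u * transported \<phi> q (of_real h * u))"
    using assms(1) by (simp add: scaleR_conv_of_real)
  finally show ?thesis using assms(1) unfolding Op_weyl_def by (simp add: power_mult_distrib)
qed

lemma transported_bounded:
  assumes "\<And>q. q \<in> regular_points S \<Longrightarrow> cmod (\<phi> q) \<le> M" "0 \<le> M"
  shows "cmod (transported \<phi> q v) \<le> M"
  using assms translate_regular[of v q] by (auto simp: transported_def indicator_def)

lemma kernel_integrable:
  assumes "has_gradient S \<phi> G H" "q \<in> regular_points S" "test_function b"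
    and M: "\<And>q. q \<in> regular_points S \<Longrightarrow> cmod (\<phi> q) \<le> M"
  shows "integrable lborel (\<lambda>u. fourier b u * transported \<phi> q (of_real h * u))"
proof -
  have [measurable]: "transported \<phi> q \<in> borel_measurable borel" "fourier b \<in> borel_measurable borel"
    using transported_measurable[OF assms(1,2)] fourier_measurable[OF assms(3)] by auto
  have M0: "0 \<le> M" using M[OF assms(2)] norm_ge_zero order_trans by blast
  have "integrable lborel (\<lambda>u. of_real M * fourier b u)" using fourier_integrable(1)[OF assms(3)] by simp
  then show ?thesis
    by (rule Bochner_Integration.integrable_bound)
       (use transported_bounded[OF M M0] M0 in \<open>auto simp: norm_mult mult.commute[of M] intro!: mult_left_mono\<close>)
qed

lemma Op_weyl_combination:
  assumes "h > 0" "test_function b" "q \<in> regular_points S"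
    and "has_gradient S f f1 f2" "has_gradient S g g1 g2" "has_gradient S (\<lambda>q. x * f q + y * g q) p1 p2"
    and "\<And>q. q \<in> regular_points S \<Longrightarrow> cmod (f q) \<le> M" "\<And>q. q \<in> regular_points S \<Longrightarrow> cmod (g q) \<le> M"
  shows "Op_weyl S h (\<lambda>x \<xi>. b \<xi>) (\<lambda>q. x * f q + y * g q) q = x * Op_weyl S h (\<lambda>x \<xi>. b \<xi>) f q + y * Op_weyl S h (\<lambda>x \<xi>. b \<xi>) g q"
proof -
  have "transported (\<lambda>q. x * f q + y * g q) q v = x * transported f q v + y * transported g q v" for v
    by (simp add: transported_def indicator_def)
  then have "(LINT u|lborel. fourier b u * transported (\<lambda>q. x * f q + y * g q) q (of_real h * u))
     = (LINT u|lborel. x * (fourier b u * transported f q (of_real h * u)) + y * (fourier b u * transported g q (of_real h * u)))"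
    by (simp add: algebra_simps)
  also have "\<dots> = x * (LINT u|lborel. fourier b u * transported f q (of_real h * u)) + y * (LINT u|lborel. fourier b u * transported g q (of_real h * u))"
    using kernel_integrable[OF assms(4,3,2,7)] kernel_integrable[OF assms(5,3,2,8)] by simp
  finally show ?thesis
    unfolding Op_weyl_momentum[OF assms(1,4,3,2)] Op_weyl_momentum[OF assms(1,5,3,2)] Op_weyl_momentum[OF assms(1,6,3,2)]
    by (simp add: algebra_simps add_divide_distrib)
qed

definition moment :: "(complex \<Rightarrow> complex) \<Rightarrow> real" where
  "moment b = (LINT u|lborel. cmod u * cmod (fourier b u))"

lemma moment_nonneg: "0 \<le> moment b"
  unfolding moment_def by (intro Bochner_Integration.integral_nonneg) simp

text \<open>The kernel of the quantization lives on the scale \<open>h\<close>. On this scale \<open>\<phi>\<close> behaves like a plane wave, for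
  which Fourier inversion evaluates the operator exactly.\<close>

lemma Op_weyl_plane_wave:
  assumes h: "h > 0" and b: "test_function b" and q: "q \<in> regular_points S" and g: "has_gradient S \<phi> G H"
    and M: "\<And>q. q \<in> regular_points S \<Longrightarrow> cmod (\<phi> q) \<le> M"
    and D: "\<And>q. q \<in> regular_points S \<Longrightarrow> cmod (G q - \<i> * of_real (Re k) * \<phi> q) \<le> D"
      "\<And>q. q \<in> regular_points S \<Longrightarrow> cmod (H q - \<i> * of_real (Im k) * \<phi> q) \<le> D"
    and \<rho>: "\<rho> > 0" "\<phi> q \<noteq> 0 \<Longrightarrow> chart S \<rho> q"
  shows "cmod (Op_weyl S h (\<lambda>x \<xi>. b \<xi>) \<phi> q - b (of_real h * k) * \<phi> q) \<le> h * (2 * D + cmod (\<phi> q) / \<rho>) * moment b"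
proof -
  let ?t = "\<lambda>u. transported \<phi> q (of_real h * u)" and ?e = "\<lambda>u. exp (\<i> * of_real (u \<bullet> (of_real h * k))) * \<phi> q"
  have D0: "0 \<le> D" using D(1)[OF q] norm_ge_zero order_trans by blast
  have i1: "integrable lborel (\<lambda>u. fourier b u * ?t u)" by (rule kernel_integrable[OF g q b M])
  have i2: "integrable lborel (\<lambda>u. fourier b u * ?e u)"
  proof -
    have [measurable]: "fourier b \<in> borel_measurable borel" by (rule fourier_measurable[OF b])
    have "(\<lambda>u. exp (\<i> * of_real (u \<bullet> (of_real h * k)))) \<in> borel_measurable borel"
      by (intro borel_measurable_continuous_onI continuous_intros)
    then have [measurable]: "(\<lambda>u. ?e u) \<in> borel_measurable borel" by measurable
    have "integrable lborel (\<lambda>u. \<phi> q * fourier b u)" using fourier_integrable(1)[OF b] by simp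
    then show ?thesis by (rule Bochner_Integration.integrable_bound) (auto simp: norm_mult)
  qed
  have inv: "(LINT u|lborel. fourier b u * ?e u) = of_real ((2 * pi)\<^sup>2) * b (of_real h * k) * \<phi> q"
  proof -
    have "(LINT u|lborel. fourier b u * ?e u) = (LINT u|lborel. fourier b u * exp (\<i> * of_real (u \<bullet> (of_real h * k)))) * \<phi> q"
      by (simp add: mult.assoc[symmetric])
    then show ?thesis using fourier_inversion[OF b, of "of_real h * k"] by simp
  qed
  have point: "cmod (?t u - ?e u) \<le> h * (2 * D + cmod (\<phi> q) / \<rho>) * cmod u" for u
  proof (cases "of_real h * u \<in> translatable S q")
    case True
    have "k \<bullet> (of_real h * u) = u \<bullet> (of_real h * k)" by (simp add: inner_complex_def algebra_simps)
    then have "cmod (?t u - ?e u) \<le> 2 * D * cmod (of_real h * u)"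
      using translate_phase[OF g True D] True by (simp add: transported_def)
    also have "\<dots> = h * (2 * D) * cmod u" using h by (simp add: norm_mult)
    also have "\<dots> \<le> h * (2 * D + cmod (\<phi> q) / \<rho>) * cmod u" using h \<rho>(1) by (intro mult_right_mono mult_left_mono) auto
    finally show ?thesis .
  next
    case False
    have "cmod (\<phi> q) \<le> cmod (\<phi> q) / \<rho> * (h * cmod u)"
    proof (cases "\<phi> q = 0")
      case nz: False
      then have "\<rho> \<le> cmod (of_real h * u)" using chart_translatable[OF \<rho>(2)] False by (meson not_le)
      then have "cmod (\<phi> q) * \<rho> \<le> cmod (\<phi> q) * (h * cmod u)" using h by (intro mult_left_mono) (auto simp: norm_mult)
      then show ?thesis using \<rho>(1) by (simp add: field_simps)
    qed simp
    also have "\<dots> \<le> h * (2 * D + cmod (\<phi> q) / \<rho>) * cmod u" using h D0 \<rho>(1) by (simp add: algebra_simps)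
    finally show ?thesis using False by (simp add: transported_def norm_mult)
  qed
  have "cmod ((LINT u|lborel. fourier b u * ?t u) - (LINT u|lborel. fourier b u * ?e u)) = cmod (LINT u|lborel. fourier b u * (?t u - ?e u))"
    using i1 i2 by (simp add: right_diff_distrib)
  also have "\<dots> \<le> (LINT u|lborel. h * (2 * D + cmod (\<phi> q) / \<rho>) * (cmod u * cmod (fourier b u)))"
  proof (rule Bochner_Integration.integral_norm_bound_integral)
    show "integrable lborel (\<lambda>u. fourier b u * (?t u - ?e u))" using i1 i2 by (simp add: right_diff_distrib)
    show "integrable lborel (\<lambda>u. h * (2 * D + cmod (\<phi> q) / \<rho>) * (cmod u * cmod (fourier b u)))"
      using fourier_integrable(2)[OF b] by simp
    show "norm (fourier b u * (?t u - ?e u)) \<le> h * (2 * D + cmod (\<phi> q) / \<rho>) * (cmod u * cmod (fourier b u))" for u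
      using mult_left_mono[OF point[of u], of "cmod (fourier b u)"] by (simp add: norm_mult mult_ac)
  qed
  also have "\<dots> = h * (2 * D + cmod (\<phi> q) / \<rho>) * moment b" by (simp add: moment_def)
  finally have est: "cmod ((LINT u|lborel. fourier b u * ?t u) - of_real ((2 * pi)\<^sup>2) * b (of_real h * k) * \<phi> q) \<le> h * (2 * D + cmod (\<phi> q) / \<rho>) * moment b"
    unfolding inv .
  have "Op_weyl S h (\<lambda>x \<xi>. b \<xi>) \<phi> q - b (of_real h * k) * \<phi> q
      = 1 / (2 * of_real pi)\<^sup>2 * ((LINT u|lborel. fourier b u * ?t u) - of_real ((2 * pi)\<^sup>2) * b (of_real h * k) * \<phi> q)"
    unfolding Op_weyl_momentum[OF h g q b] by (simp add: field_simps)
  then have "cmod (Op_weyl S h (\<lambda>x \<xi>. b \<xi>) \<phi> q - b (of_real h * k) * \<phi> q) = 1 / (2 * pi)\<^sup>2 * cmod ((LINT u|lborel. fourier b u * ?t u) - of_real ((2 * pi)\<^sup>2) * b (of_real h * k) * \<phi> q)"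
    by (simp add: norm_mult norm_divide norm_power)
  also have "\<dots> \<le> 1 * cmod ((LINT u|lborel. fourier b u * ?t u) - of_real ((2 * pi)\<^sup>2) * b (of_real h * k) * \<phi> q)"
  proof (rule mult_right_mono)
    have "1 \<le> (2 * pi)\<^sup>2" using pi_ge_two by (intro one_le_power) linarith
    then show "1 / (2 * pi)\<^sup>2 \<le> 1" by simp
  qed simp
  finally show ?thesis using est by linarith
qed

lemma Op_weyl_measurable:
  assumes h: "h > 0" and b: "test_function b" and g: "has_gradient S \<phi> G H" and j: "j < num"
  shows "(\<lambda>z. indicator (region j) z *\<^sub>R Op_weyl S h (\<lambda>x \<xi>. b \<xi>) \<phi> (cls S (j, z))) \<in> borel_measurable borel"
proof -
  have [measurable]: "fourier b \<in> borel_measurable borel" by (rule fourier_measurable[OF b])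
  let ?r = "\<lambda>p. indicator (reachable j) p *\<^sub>R \<phi> (translate S (cls S (j, fst p)) (snd p))"
  let ?f = "\<lambda>z. LINT u|lborel. fourier b u * ?r (z, of_real h * u)"
  have [measurable]: "?r \<in> borel_measurable borel" by (rule reachable_measurable[OF g])
  have "(\<lambda>p. (fst p, complex_of_real h * snd p)) \<in> borel_measurable borel"
    by (intro borel_measurable_continuous_onI continuous_intros)
  from measurable_compose[OF this \<open>?r \<in> borel_measurable borel\<close>]
  have "(\<lambda>p. ?r (fst p, complex_of_real h * snd p)) \<in> borel_measurable borel" .
  moreover have "sets (borel \<Otimes>\<^sub>M lborel) = sets (borel :: (complex \<times> complex) measure)"
    unfolding borel_prod[symmetric] by (rule sets_pair_measure_cong) simp_all
  then have "borel_measurable (borel \<Otimes>\<^sub>M lborel) = (borel_measurable borel :: (complex \<times> complex \<Rightarrow> complex) set)"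
    by (rule measurable_cong_sets) simp
  ultimately have "(\<lambda>p. ?r (fst p, complex_of_real h * snd p)) \<in> borel_measurable (borel \<Otimes>\<^sub>M lborel)" by (simp only:)
  moreover have "(\<lambda>p :: complex \<times> complex. fourier b (snd p)) \<in> borel_measurable (borel \<Otimes>\<^sub>M lborel)" by measurable
  ultimately have "(\<lambda>p. fourier b (snd p) * ?r (fst p, complex_of_real h * snd p)) \<in> borel_measurable (borel \<Otimes>\<^sub>M lborel)"
    by (intro borel_measurable_times)
  then have "case_prod (\<lambda>z u. fourier b u * ?r (z, of_real h * u)) \<in> borel_measurable (borel \<Otimes>\<^sub>M lborel)"
    by (simp only: case_prod_beta')
  then have "?f \<in> borel_measurable borel" by (rule lborel.borel_measurable_lebesgue_integral)
  then have "(\<lambda>z. indicator {z. good j z} z *\<^sub>R (1 / (2 * of_real pi)\<^sup>2 * ?f z)) \<in> borel_measurable borel"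
    using good_borel[of j] by measurable
  then show ?thesis
  proof (rule measurable_discrete_difference[where X = "corners j"])
    fix z assume "z \<in> space borel" "z \<notin> corners j"
    then have "indicator (region j) z = (indicator {z. good j z} z :: real)" using j by (simp add: good_def indicator_def)
    moreover have "Op_weyl S h (\<lambda>x \<xi>. b \<xi>) \<phi> (cls S (j, z)) = 1 / (2 * of_real pi)\<^sup>2 * ?f z" if "good j z"
      unfolding Op_weyl_momentum[OF h g good_regular[OF that] b] transported_reachable[OF that] by simp
    ultimately show "indicator {z. good j z} z *\<^sub>R (1 / (2 * of_real pi)\<^sup>2 * ?f z) = indicator (region j) z *\<^sub>R Op_weyl S h (\<lambda>x \<xi>. b \<xi>) \<phi> (cls S (j, z))"
      by (auto simp: indicator_def)
  qed (auto intro: countable_finite)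
qed

end

section \<open>Linear combinations and interpolation\<close>

context flat_surface
begin

lemma has_gradient_combination:
  assumes "has_gradient S f f1 f2" "has_gradient S g g1 g2"
  shows "has_gradient S (\<lambda>q. x * f q + y * g q) (\<lambda>q. x * f1 q + y * g1 q) (\<lambda>q. x * f2 q + y * g2 q)"
  unfolding has_gradient_def
proof (intro allI impI ballI)
  fix W \<eta> z assume l: "local_coords S W \<eta>" "z \<in> W"
  note f = assms(1)[unfolded has_gradient_def, rule_format, OF l] and g = assms(2)[unfolded has_gradient_def, rule_format, OF l]
  show "((\<lambda>w. x * f (\<eta> w) + y * g (\<eta> w)) has_derivative
      (\<lambda>v. of_real (Re v) * (x * f1 (\<eta> z) + y * g1 (\<eta> z)) + of_real (Im v) * (x * f2 (\<eta> z) + y * g2 (\<eta> z)))) (at z)"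
    by (rule has_derivative_eq_rhs[OF has_derivative_add[OF has_derivative_mult_right[OF f] has_derivative_mult_right[OF g]]])
       (simp add: algebra_simps)
qed

lemma continuous_on_surface_combination:
  "continuous_on_surface S f \<Longrightarrow> continuous_on_surface S g \<Longrightarrow> continuous_on_surface S (\<lambda>q. x * f q + y * g q)"
  unfolding continuous_on_surface_def by (auto intro!: continuous_intros)

lemma Ck_surface_combination:
  "Ck_surface S n f \<Longrightarrow> Ck_surface S n g \<Longrightarrow> Ck_surface S n (\<lambda>q. x * f q + y * g q)"
proof (induction n arbitrary: f g)
  case 0 then show ?case by (simp add: continuous_on_surface_combination)
next
  case (Suc n)
  obtain f1 f2 where f: "has_gradient S f f1 f2" "Ck_surface S n f1" "Ck_surface S n f2" using Suc.prems(1) by auto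
  obtain g1 g2 where g: "has_gradient S g g1 g2" "Ck_surface S n g1" "Ck_surface S n g2" using Suc.prems(2) by auto
  have "continuous_on_surface S (\<lambda>q. x * f q + y * g q)" using Suc.prems by (simp add: continuous_on_surface_combination)
  then show ?case using has_gradient_combination[OF f(1) g(1)] Suc.IH[OF f(2) g(2)] Suc.IH[OF f(3) g(3)] by auto
qed

lemma C2_derivatives:
  assumes "Ck_surface S 2 f"
  obtains f1 f2 f11 f12 f21 f22 where "has_gradient S f f1 f2" "has_gradient S f1 f11 f12" "has_gradient S f2 f21 f22"
    "\<forall>g\<in>{f, f1, f2, f11, f12, f21, f22}. continuous_on_surface S g"
proof -
  have f: "Ck_surface S (Suc (Suc 0)) f" using assms by (simp add: numeral_2_eq_2)
  then obtain f1 f2 where 1: "has_gradient S f f1 f2" "Ck_surface S (Suc 0) f1" "Ck_surface S (Suc 0) f2" by auto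
  obtain f11 f12 where 2: "has_gradient S f1 f11 f12" "continuous_on_surface S f11" "continuous_on_surface S f12" using 1(2) by auto
  obtain f21 f22 where 3: "has_gradient S f2 f21 f22" "continuous_on_surface S f21" "continuous_on_surface S f22" using 1(3) by auto
  show ?thesis by (rule that[OF 1(1) 2(1) 3(1)]) (use f 1 2 3 in auto)
qed

lemma continuous_on_surface_bounded:
  assumes "continuous_on_surface S f" shows "\<exists>M. \<forall>q\<in>regular_points S. cmod (f q) \<le> M"
proof -
  have "bounded (\<Union>j<num. (\<lambda>z. f (cls S (j, z))) ` region j)"
    using assms compact_region unfolding continuous_on_surface_def
    by (intro bounded_UN ballI compact_imp_bounded compact_continuous_image) auto
  then obtain M where M: "\<And>x. x \<in> (\<Union>j<num. (\<lambda>z. f (cls S (j, z))) ` region j) \<Longrightarrow> norm x \<le> M"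
    unfolding bounded_iff by blast
  have "cmod (f q) \<le> M" if q: "q \<in> regular_points S" for q
  proof -
    obtain j z where "(j, z) \<in> q" using regular_rep[OF q] by blast
    then have "good j z" "q = cls S (j, z)" using regular_good[OF q] by auto
    then show ?thesis by (intro M) (auto simp: good_def)
  qed
  then show ?thesis by blast
qed

lemma regular_points_nonempty: "regular_points S \<noteq> {}"
  using interior_part_nonempty[OF num_pos] interior_good[OF num_pos] good_regular by blast

text \<open>In a linear interpolation the differences are multiples of one fixed function, so this bound yields continuity in the
  parameter.\<close>

lemma C2_norm_scaled:
  assumes "Ck_surface S 2 f"
  shows "\<exists>B. \<forall>c. 0 \<le> C2_norm S (\<lambda>q. c * f q) \<and> C2_norm S (\<lambda>q. c * f q) \<le> cmod c * B"
proof -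
  obtain f1 f2 f11 f12 f21 f22 where g: "has_gradient S f f1 f2" "has_gradient S f1 f11 f12" "has_gradient S f2 f21 f22"
    and c: "\<forall>g\<in>{f, f1, f2, f11, f12, f21, f22}. continuous_on_surface S g" by (rule C2_derivatives[OF assms])
  define N where "N q = cmod (f q) + (cmod (f1 q) + cmod (f2 q)) + ((cmod (f11 q) + cmod (f21 q)) + (cmod (f12 q) + cmod (f22 q)))" for q
  have "\<forall>g\<in>{f, f1, f2, f11, f12, f21, f22}. \<exists>M. \<forall>q\<in>regular_points S. cmod (g q) \<le> M"
    using c continuous_on_surface_bounded by blast
  then obtain M where M: "\<And>g q. g \<in> {f, f1, f2, f11, f12, f21, f22} \<Longrightarrow> q \<in> regular_points S \<Longrightarrow> cmod (g q) \<le> M g"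
    unfolding bchoice_iff by blast
  define B where "B = M f + (M f1 + M f2) + ((M f11 + M f21) + (M f12 + M f22))"
  have NB: "N q \<le> B" if "q \<in> regular_points S" for q
    unfolding N_def B_def using that by (intro add_mono M) auto
  have "0 \<le> C2_norm S (\<lambda>q. c * f q) \<and> C2_norm S (\<lambda>q. c * f q) \<le> cmod c * B" for c
  proof -
    have gc: "has_gradient S (\<lambda>q. c * u q) (\<lambda>q. c * v q) (\<lambda>q. c * w q)" if "has_gradient S u v w" for u v w
      using has_gradient_combination[OF that that, of c 0] by simp
    have p: "partial S 1 (\<lambda>q. c * u q) q = c * v q \<and> partial S \<i> (\<lambda>q. c * u q) q = c * w q"
      if "has_gradient S u v w" "q \<in> regular_points S" for u v w q
      using partial_eq[OF gc[OF that(1)] that(2), of "\<lambda>q. c * u q"] by simp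
    have p2: "partial S v (partial S 1 (\<lambda>q. c * f q)) q = c * (of_real (Re v) * f11 q + of_real (Im v) * f12 q)"
      "partial S v (partial S \<i> (\<lambda>q. c * f q)) q = c * (of_real (Re v) * f21 q + of_real (Im v) * f22 q)"
      if "q \<in> regular_points S" for v q
      using partial_eq[OF gc[OF g(2)] that, of "partial S 1 (\<lambda>q. c * f q)" v] partial_eq[OF gc[OF g(3)] that, of "partial S \<i> (\<lambda>q. c * f q)" v] p[OF g(1)]
      by (simp_all add: distrib_left mult.left_commute)
    have eq: "C2_norm S (\<lambda>q. c * f q) = (SUP q\<in>regular_points S. cmod c * N q)"
      unfolding C2_norm_def
    proof (rule SUP_cong[OF refl])
      fix q assume q: "q \<in> regular_points S"
      show "cmod (c * f q) + (\<Sum>v\<in>{1, \<i>}. cmod (partial S v (\<lambda>q. c * f q) q))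
        + (\<Sum>v\<in>{1, \<i>}. \<Sum>w\<in>{1, \<i>}. cmod (partial S v (partial S w (\<lambda>q. c * f q)) q)) = cmod c * N q"
        using p[OF g(1) q] p2[OF q] by (simp add: N_def norm_mult distrib_left)
    qed
    have le: "cmod c * N q \<le> cmod c * B" if "q \<in> regular_points S" for q using NB[OF that] by (intro mult_left_mono) auto
    obtain q0 where q0: "q0 \<in> regular_points S" using regular_points_nonempty by blast
    have "0 \<le> cmod c * N q0" by (simp add: N_def)
    moreover have "bdd_above ((\<lambda>q. cmod c * N q) ` regular_points S)" by (rule bdd_aboveI2[OF le])
    ultimately have "0 \<le> (SUP q\<in>regular_points S. cmod c * N q)" using q0 by (intro cSUP_upper2[of _ _ q0]) auto
    moreover have "(SUP q\<in>regular_points S. cmod c * N q) \<le> cmod c * B"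
      using regular_points_nonempty le by (rule cSUP_least)
    ultimately show ?thesis unfolding eq by simp
  qed
  then show ?thesis by blast
qed

text \<open>Only finitely many points of the polygons represent vertices, so two functions that agree at the regular points are
  indistinguishable by integration, without any measurability requirement.\<close>

lemma regular_agree_integral:
  fixes f g :: "point \<Rightarrow> 'b::{banach, second_countable_topology}"
  assumes "\<And>q. q \<in> regular_points S \<Longrightarrow> f q = g q"
  shows "surface_integrable f \<longleftrightarrow> surface_integrable g" "surface_integral S f = surface_integral S g"
proof -
  have eq: "indicator (region j) z *\<^sub>R f (cls S (j, z)) = indicator (region j) z *\<^sub>R g (cls S (j, z))" if "j < num" "z \<notin> corners j" for j z
    using assms[OF good_regular[of j z]] that by (cases "z \<in> region j") (auto simp: good_def)
  have X: "countable (corners j)" for j by (simp add: countable_finite)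
  have "set_integrable lborel (region j) (\<lambda>z. f (cls S (j, z))) \<longleftrightarrow> set_integrable lborel (region j) (\<lambda>z. g (cls S (j, z)))" if "j < num" for j
    unfolding set_integrable_def by (rule integrable_discrete_difference[OF X]) (use eq[OF that] in auto)
  then show "surface_integrable f \<longleftrightarrow> surface_integrable g" by (auto simp: surface_integrable_def)
  have "(LINT z:region j|lborel. f (cls S (j, z))) = (LINT z:region j|lborel. g (cls S (j, z)))" if "j < num" for j
    unfolding set_lebesgue_integral_def by (rule integral_discrete_difference[OF X]) (use eq[OF that] in auto)
  then show "surface_integral S f = surface_integral S g" by (simp add: surface_integral_def)
qed

lemma laplacian_combination:
  assumes "Ck_surface S 2 f" "Ck_surface S 2 g" "q \<in> regular_points S"
  shows "laplacian S (\<lambda>q. x * f q + y * g q) q = x * laplacian S f q + y * laplacian S g q"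
proof -
  obtain f1 f2 f11 f12 f21 f22 where f: "has_gradient S f f1 f2" "has_gradient S f1 f11 f12" "has_gradient S f2 f21 f22"
    by (rule C2_derivatives[OF assms(1)])
  obtain g1 g2 g11 g12 g21 g22 where g: "has_gradient S g g1 g2" "has_gradient S g1 g11 g12" "has_gradient S g2 g21 g22"
    by (rule C2_derivatives[OF assms(2)])
  show ?thesis
    unfolding laplacian_eq[OF f assms(3)] laplacian_eq[OF g assms(3)]
      laplacian_eq[OF has_gradient_combination[OF f(1) g(1)] has_gradient_combination[OF f(2) g(2)] has_gradient_combination[OF f(3) g(3)] assms(3)]
    by (simp add: algebra_simps)
qed

lemma laplacian_square_integrable:
  assumes "Ck_surface S 2 f" shows "surface_integrable (\<lambda>q. (cmod (laplacian S f q + c * f q))\<^sup>2)"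
proof -
  obtain f1 f2 f11 f12 f21 f22 where f: "has_gradient S f f1 f2" "has_gradient S f1 f11 f12" "has_gradient S f2 f21 f22"
    and co: "\<forall>g\<in>{f, f1, f2, f11, f12, f21, f22}. continuous_on_surface S g" by (rule C2_derivatives[OF assms])
  have "continuous_on_surface S (\<lambda>q. 1 * (1 * f11 q + 1 * f22 q) + c * f q)"
    using co by (intro continuous_on_surface_combination) auto
  then have "surface_integrable (\<lambda>q. (cmod (1 * (1 * f11 q + 1 * f22 q) + c * f q))\<^sup>2)" by (rule continuous_on_surface_norm_integrable)
  then show ?thesis by (subst regular_agree_integral(1)) (use laplacian_eq[OF f] in auto)
qed

lemma surface_integral_nonneg: "(\<And>q. 0 \<le> u q) \<Longrightarrow> 0 \<le> surface_integral S (u :: point \<Rightarrow> real)"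
  unfolding surface_integral_def set_lebesgue_integral_def by (intro sum_nonneg Bochner_Integration.integral_nonneg) auto

lemma L2_norm_square: "(L2_norm S f)\<^sup>2 = surface_integral S (\<lambda>q. (cmod (f q))\<^sup>2)"
  unfolding L2_norm_def by (intro real_sqrt_pow2 surface_integral_nonneg) simp

lemma Re_product_integrable:
  assumes "continuous_on_surface S f" "continuous_on_surface S g" shows "surface_integrable (\<lambda>q. Re (f q * cnj (g q)))"
  using assms by (intro continuous_integrable) (auto simp: continuous_on_surface_def intro!: continuous_intros)

lemma cmod_real_combination:
  fixes x y :: real and z w :: complex
  shows "(cmod (of_real x * z + of_real y * w))\<^sup>2 = x\<^sup>2 * (cmod z)\<^sup>2 + y\<^sup>2 * (cmod w)\<^sup>2 + 2 * x * y * Re (z * cnj w)"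
  unfolding cmod_power2 by (simp add: power2_eq_square algebra_simps)

text \<open>Two unit vectors at an angle of at most ninety degrees cannot cancel each other.\<close>

lemma interpolation_lower_bound:
  assumes c: "continuous_on_surface S f" "continuous_on_surface S g" and n: "L2_norm S f = 1" "L2_norm S g = 1"
    and pos: "0 \<le> surface_integral S (\<lambda>q. Re (f q * cnj (g q)))" and x: "0 \<le> x" "0 \<le> y" "x + y = 1"
  shows "1 / 2 \<le> (L2_norm S (\<lambda>q. of_real x * f q + of_real y * g q))\<^sup>2"
proof -
  have i: "surface_integrable (\<lambda>q. c * u q)" if "surface_integrable u" for c :: real and u
    using that by (simp add: surface_integrable_def)
  have ia: "surface_integrable (\<lambda>q. u q + v q)" if "surface_integrable u" "surface_integrable v" for u v :: "point \<Rightarrow> real"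
    using that by (simp add: surface_integrable_def)
  note if' = continuous_on_surface_norm_integrable[OF c(1)] and ig = continuous_on_surface_norm_integrable[OF c(2)]
  have "(L2_norm S (\<lambda>q. of_real x * f q + of_real y * g q))\<^sup>2
     = surface_integral S (\<lambda>q. (x\<^sup>2 * (cmod (f q))\<^sup>2 + y\<^sup>2 * (cmod (g q))\<^sup>2) + 2 * x * y * Re (f q * cnj (g q)))"
    unfolding L2_norm_square cmod_real_combination ..
  also have "\<dots> = x\<^sup>2 * (L2_norm S f)\<^sup>2 + y\<^sup>2 * (L2_norm S g)\<^sup>2 + 2 * x * y * surface_integral S (\<lambda>q. Re (f q * cnj (g q)))"
    unfolding L2_norm_square
    by (simp only: surface_integral_add[OF ia[OF i[OF if'] i[OF ig]] i[OF Re_product_integrable[OF c]]] surface_integral_add[OF i[OF if'] i[OF ig]] surface_integral_mult)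
  also have "\<dots> \<ge> x\<^sup>2 + y\<^sup>2" using n pos x by simp
  moreover have "1 / 2 \<le> x\<^sup>2 + y\<^sup>2"
  proof -
    have "0 \<le> (x - y)\<^sup>2" by simp
    moreover have "(x + y)\<^sup>2 = 1" using x by simp
    ultimately show ?thesis by (simp add: power2_eq_square algebra_simps)
  qed
  ultimately show ?thesis by linarith
qed

text \<open>Moving the eigenvalue by at most one costs no more than the norms of the functions.\<close>

lemma interpolation_defect:
  assumes f: "Ck_surface S 2 f" "L2_norm S f = 1" "L2_norm S (\<lambda>q. laplacian S f q + of_real m * f q) \<le> E"
    and g: "Ck_surface S 2 g" "L2_norm S g = 1" "L2_norm S (\<lambda>q. laplacian S g q + of_real n * g q) \<le> E"
    and x: "\<bar>x\<bar> \<le> 1" "\<bar>y\<bar> \<le> 1" and l: "\<bar>l - m\<bar> \<le> 1" "\<bar>l - n\<bar> \<le> 1"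
  defines "\<psi> \<equiv> \<lambda>q. of_real x * f q + of_real y * g q"
  shows "L2_norm S (\<lambda>q. laplacian S \<psi> q + of_real l * \<psi> q) \<le> sqrt (8 * E\<^sup>2 + 8)"
proof -
  let ?e = "\<lambda>q. laplacian S f q + of_real m * f q" and ?d = "\<lambda>q. laplacian S g q + of_real n * g q"
  let ?w = "\<lambda>q. 4 * (((cmod (?e q))\<^sup>2 + (cmod (f q))\<^sup>2) + ((cmod (?d q))\<^sup>2 + (cmod (g q))\<^sup>2))"
  have ia: "surface_integrable (\<lambda>q. u q + v q)" if "surface_integrable u" "surface_integrable v" for u v :: "point \<Rightarrow> real"
    using that by (simp add: surface_integrable_def)
  have cf: "continuous_on_surface S f" "continuous_on_surface S g"
    using f(1) g(1) by (auto simp: numeral_2_eq_2)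
  note i = laplacian_square_integrable[OF f(1), of "of_real m"] continuous_on_surface_norm_integrable[OF cf(1)]
    laplacian_square_integrable[OF g(1), of "of_real n"] continuous_on_surface_norm_integrable[OF cf(2)]
  have ic: "surface_integrable (\<lambda>q. c * u q)" if "surface_integrable u" for c :: real and u
    using that by (simp add: surface_integrable_def)
  have iw: "surface_integrable ?w" by (rule ic[OF ia[OF ia[OF i(1,2)] ia[OF i(3,4)]]])
  have E0: "0 \<le> E" using f(3) by (rule order_trans[rotated]) (simp add: L2_norm_def surface_integral_nonneg)
  have "surface_integral S (\<lambda>q. (cmod (laplacian S \<psi> q + of_real l * \<psi> q))\<^sup>2) \<le> surface_integral S ?w"
  proof (rule surface_integral_mono[OF iw])
    fix q assume q: "q \<in> regular_points S"
    have eq: "laplacian S \<psi> q + of_real l * \<psi> q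
        = (of_real x * ?e q + of_real (x * (l - m)) * f q) + (of_real y * ?d q + of_real (y * (l - n)) * g q)"
      unfolding \<psi>_def laplacian_combination[OF f(1) g(1) q] by (simp add: algebra_simps)
    have t: "cmod (of_real c * z) \<le> cmod z" if "\<bar>c\<bar> \<le> 1" for c z using that by (simp add: norm_mult mult_left_le_one_le)
    have "\<bar>x * (l - m)\<bar> \<le> 1" "\<bar>y * (l - n)\<bar> \<le> 1" unfolding abs_mult using x l by (auto intro: mult_le_one)
    then have "cmod (of_real x * ?e q) + cmod (of_real (x * (l - m)) * f q) + (cmod (of_real y * ?d q) + cmod (of_real (y * (l - n)) * g q))
        \<le> (cmod (?e q) + cmod (f q)) + (cmod (?d q) + cmod (g q))"
      using t x by (intro add_mono) blast+
    moreover have "cmod (laplacian S \<psi> q + of_real l * \<psi> q)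
        \<le> cmod (of_real x * ?e q) + cmod (of_real (x * (l - m)) * f q) + (cmod (of_real y * ?d q) + cmod (of_real (y * (l - n)) * g q))"
      unfolding eq by (rule order_trans[OF norm_triangle_ineq add_mono[OF norm_triangle_ineq norm_triangle_ineq]])
    ultimately have "cmod (laplacian S \<psi> q + of_real l * \<psi> q) \<le> (cmod (?e q) + cmod (f q)) + (cmod (?d q) + cmod (g q))" by linarith
    then have "(cmod (laplacian S \<psi> q + of_real l * \<psi> q))\<^sup>2 \<le> ((cmod (?e q) + cmod (f q)) + (cmod (?d q) + cmod (g q)))\<^sup>2"
      by (intro power_mono) auto
    also have "\<dots> \<le> ?w q"
    proof -
      have sq: "(a + b)\<^sup>2 \<le> 2 * (a\<^sup>2 + b\<^sup>2)" for a b :: real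
        using zero_le_power2[of "a - b"] by (simp add: power2_eq_square algebra_simps)
      have "((cmod (?e q) + cmod (f q)) + (cmod (?d q) + cmod (g q)))\<^sup>2 \<le> 2 * ((cmod (?e q) + cmod (f q))\<^sup>2 + (cmod (?d q) + cmod (g q))\<^sup>2)"
        by (rule sq)
      also have "\<dots> \<le> 2 * (2 * ((cmod (?e q))\<^sup>2 + (cmod (f q))\<^sup>2) + 2 * ((cmod (?d q))\<^sup>2 + (cmod (g q))\<^sup>2))"
        by (rule mult_left_mono[OF add_mono[OF sq sq]]) simp
      finally show ?thesis by simp
    qed
    finally show "(cmod (laplacian S \<psi> q + of_real l * \<psi> q))\<^sup>2 \<le> ?w q" .
    show "0 \<le> ?w q" by simp
  qed
  also have "\<dots> = 4 * (((L2_norm S ?e)\<^sup>2 + (L2_norm S f)\<^sup>2) + ((L2_norm S ?d)\<^sup>2 + (L2_norm S g)\<^sup>2))"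
    unfolding L2_norm_square surface_integral_mult surface_integral_add[OF ia[OF i(1,2)] ia[OF i(3,4)]] surface_integral_add[OF i(1,2)] surface_integral_add[OF i(3,4)] ..
  also have "\<dots> \<le> 4 * ((E\<^sup>2 + 1) + (E\<^sup>2 + 1))"
    using f(2,3) g(2,3) by (intro mult_left_mono add_mono power_mono) (auto simp: L2_norm_def surface_integral_nonneg)
  finally show ?thesis unfolding L2_norm_def[of S "\<lambda>q. laplacian S \<psi> q + of_real l * \<psi> q"] by (intro real_sqrt_le_mono) simp
qed

section \<open>The momentum distribution of interpolated wave packets\<close>

text \<open>If the operator nearly acts on two functions as multiplication by \<open>\<beta>\<close>, it does so on their combinations, whose momentum
  distribution is then nearly \<open>\<beta>\<close>.\<close>

lemma momentum_distribution_estimate: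
  assumes h: "h > 0" and b: "test_function b"
    and f: "Ck_surface S 2 f" "L2_norm S f = 1" "has_gradient S f f1 f2"
    and g: "Ck_surface S 2 g" "L2_norm S g = 1" "has_gradient S g g1 g2"
    and est: "\<And>q. q \<in> regular_points S \<Longrightarrow> cmod (Op_weyl S h (\<lambda>x \<xi>. b \<xi>) f q - \<beta> * f q) \<le> A0 + A1 * cmod (f q)"
      "\<And>q. q \<in> regular_points S \<Longrightarrow> cmod (Op_weyl S h (\<lambda>x \<xi>. b \<xi>) g q - \<beta> * g q) \<le> A0 + A1 * cmod (g q)"
    and A: "0 \<le> A0" "0 \<le> A1" and x: "\<bar>x\<bar> \<le> 1" "\<bar>y\<bar> \<le> 1"
  defines "\<psi> \<equiv> \<lambda>q. of_real x * f q + of_real y * g q"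
  assumes low: "1 / 2 \<le> (L2_norm S \<psi>)\<^sup>2"
  shows "cmod (momentum_distribution S h \<psi> b - \<beta>) \<le> 8 * A0 * (2 * total_area + 2) + 16 * A1"
proof -
  define n where "n = L2_norm S \<psi>"
  have "0 \<le> n" by (simp add: n_def L2_norm_def surface_integral_nonneg)
  moreover have n0: "n \<noteq> 0" using low by (auto simp: n_def)
  ultimately have n: "0 < n" "1 / n \<le> 2"
  proof -
    show "0 < n" using \<open>0 \<le> n\<close> n0 by simp
    moreover have "(1 / 2)\<^sup>2 \<le> n\<^sup>2" using low by (simp add: n_def power_divide)
    then have "1 / 2 \<le> n" using \<open>0 \<le> n\<close> by (rule power2_le_imp_le)
    ultimately show "1 / n \<le> 2" by (simp add: field_simps)
  qed
  define s where "s = x / n"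
  define t where "t = y / n"
  have st: "\<bar>s\<bar> \<le> 2" "\<bar>t\<bar> \<le> 2"
  proof -
    have "\<bar>s\<bar> = \<bar>x\<bar> * (1 / n)" "\<bar>t\<bar> = \<bar>y\<bar> * (1 / n)" using n by (simp_all add: s_def t_def)
    then show "\<bar>s\<bar> \<le> 2" "\<bar>t\<bar> \<le> 2" using x n mult_mono[OF x(1) n(2)] mult_mono[OF x(2) n(2)] by auto
  qed
  define \<phi> where "\<phi> = (\<lambda>q. of_real s * f q + of_real t * g q)"
  have phi: "(\<lambda>q. \<psi> q / of_real (L2_norm S \<psi>)) = \<phi>"
    unfolding n_def[symmetric] by (simp add: \<phi>_def \<psi>_def s_def t_def add_divide_distrib)
  let ?Op = "Op_weyl S h (\<lambda>x \<xi>. b \<xi>)"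
  have cf: "continuous_on_surface S f" "continuous_on_surface S g" using f(1) g(1) by (auto simp: numeral_2_eq_2)
  have cphi: "continuous_on_surface S \<phi>" unfolding \<phi>_def by (rule continuous_on_surface_combination[OF cf])
  have gphi: "has_gradient S \<phi> (\<lambda>q. of_real s * f1 q + of_real t * g1 q) (\<lambda>q. of_real s * f2 q + of_real t * g2 q)"
    unfolding \<phi>_def by (rule has_gradient_combination[OF f(3) g(3)])
  obtain M1 M2 where M: "\<And>q. q \<in> regular_points S \<Longrightarrow> cmod (f q) \<le> M1" "\<And>q. q \<in> regular_points S \<Longrightarrow> cmod (g q) \<le> M2"
    using continuous_on_surface_bounded[OF cf(1)] continuous_on_surface_bounded[OF cf(2)] by blast
  let ?w = "\<lambda>q. 8 * A0 * 2 + (8 * A0 + 8 * A1) * ((cmod (f q))\<^sup>2 + (cmod (g q))\<^sup>2)"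
  have pt: "cmod (?Op \<phi> q * cnj (\<phi> q) - \<beta> * (\<phi> q * cnj (\<phi> q))) \<le> ?w q" if q: "q \<in> regular_points S" for q
  proof -
    let ?a = "cmod (f q)" and ?b = "cmod (g q)"
    have "?Op \<phi> q = of_real s * ?Op f q + of_real t * ?Op g q"
      unfolding \<phi>_def
    proof (rule Op_weyl_combination[OF h b q f(3) g(3)])
      show "has_gradient S (\<lambda>q. of_real s * f q + of_real t * g q) (\<lambda>q. of_real s * f1 q + of_real t * g1 q) (\<lambda>q. of_real s * f2 q + of_real t * g2 q)"
        by (rule has_gradient_combination[OF f(3) g(3)])
      show "cmod (f q) \<le> max M1 M2" "cmod (g q) \<le> max M1 M2" if "q \<in> regular_points S" for q
        using M[OF that] by auto
    qed
    then have "?Op \<phi> q - \<beta> * \<phi> q = of_real s * (?Op f q - \<beta> * f q) + of_real t * (?Op g q - \<beta> * g q)"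
      by (simp add: \<phi>_def algebra_simps)
    also have "cmod \<dots> \<le> \<bar>s\<bar> * cmod (?Op f q - \<beta> * f q) + \<bar>t\<bar> * cmod (?Op g q - \<beta> * g q)"
      by (rule order_trans[OF norm_triangle_ineq]) (simp add: norm_mult)
    also have "\<dots> \<le> 2 * (A0 + A1 * ?a) + 2 * (A0 + A1 * ?b)" using st est[OF q] by (intro add_mono mult_mono) auto
    finally have 1: "cmod (?Op \<phi> q - \<beta> * \<phi> q) \<le> 4 * A0 + 2 * A1 * (?a + ?b)" by (simp add: algebra_simps)
    have "cmod (\<phi> q) \<le> \<bar>s\<bar> * ?a + \<bar>t\<bar> * ?b" unfolding \<phi>_def by (rule order_trans[OF norm_triangle_ineq]) (simp add: norm_mult)
    also have "\<dots> \<le> 2 * ?a + 2 * ?b" using st by (intro add_mono mult_right_mono) auto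
    finally have 2: "cmod (\<phi> q) \<le> 2 * (?a + ?b)" by simp
    have "?Op \<phi> q * cnj (\<phi> q) - \<beta> * (\<phi> q * cnj (\<phi> q)) = (?Op \<phi> q - \<beta> * \<phi> q) * cnj (\<phi> q)" by (simp add: algebra_simps)
    then have "cmod (?Op \<phi> q * cnj (\<phi> q) - \<beta> * (\<phi> q * cnj (\<phi> q))) = cmod (?Op \<phi> q - \<beta> * \<phi> q) * cmod (\<phi> q)" by (simp add: norm_mult)
    also have "\<dots> \<le> (4 * A0 + 2 * A1 * (?a + ?b)) * (2 * (?a + ?b))" using 1 2 A by (intro mult_mono) auto
    also have "\<dots> = 8 * A0 * (?a + ?b) + 4 * A1 * (?a + ?b)\<^sup>2" by (simp add: power2_eq_square algebra_simps)
    also have "\<dots> \<le> 8 * A0 * (2 + (?a\<^sup>2 + ?b\<^sup>2)) + 4 * A1 * (2 * (?a\<^sup>2 + ?b\<^sup>2))"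
    proof (rule add_mono[OF mult_left_mono mult_left_mono])
      have "c \<le> 1 + c\<^sup>2" for c :: real
      proof -
        have "2 * c \<le> 1 + c\<^sup>2" using zero_le_power2[of "c - 1"] by (simp add: power2_eq_square algebra_simps)
        moreover have "0 \<le> c\<^sup>2" by simp
        ultimately show ?thesis by linarith
      qed
      from this[of ?a] this[of ?b] show "?a + ?b \<le> 2 + (?a\<^sup>2 + ?b\<^sup>2)" by linarith
      show "(?a + ?b)\<^sup>2 \<le> 2 * (?a\<^sup>2 + ?b\<^sup>2)" using zero_le_power2[of "?a - ?b"] by (simp add: power2_eq_square algebra_simps)
    qed (use A in auto)
    finally show ?thesis by (simp add: algebra_simps)
  qed
  have ia: "surface_integrable (\<lambda>q. u q + v q)" if "surface_integrable u" "surface_integrable v" for u v :: "point \<Rightarrow> real"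
    using that by (simp add: surface_integrable_def)
  have ic: "surface_integrable (\<lambda>q. c * u q)" if "surface_integrable u" for c :: real and u
    using that by (simp add: surface_integrable_def)
  note if' = continuous_on_surface_norm_integrable[OF cf(1)] and ig = continuous_on_surface_norm_integrable[OF cf(2)]
  have iw: "surface_integrable ?w" by (intro ia ic surface_integrable_const if' ig)
  have iphi: "surface_integrable (\<lambda>q. \<beta> * (\<phi> q * cnj (\<phi> q)))"
    using cphi by (intro continuous_integrable) (auto simp: continuous_on_surface_def intro!: continuous_intros)
  have meas: "(\<lambda>z. indicator (region j) z *\<^sub>R (?Op \<phi> (cls S (j, z)) * cnj (\<phi> (cls S (j, z))))) \<in> borel_measurable borel" if j: "j < num" for j
  proof -
    have [measurable]: "(\<lambda>z. indicator (region j) z *\<^sub>R ?Op \<phi> (cls S (j, z))) \<in> borel_measurable borel"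
      by (rule Op_weyl_measurable[OF h b gphi j])
    have "continuous_on (region j) (\<lambda>z. cnj (\<phi> (cls S (j, z))))"
      using cphi j by (auto simp: continuous_on_surface_def intro!: continuous_intros)
    then have [measurable]: "(\<lambda>z. indicator (region j) z *\<^sub>R cnj (\<phi> (cls S (j, z)))) \<in> borel_measurable borel"
      by (rule borel_measurable_continuous_on_indicator[OF region_borel[OF j]])
    have "(\<lambda>z. (indicator (region j) z *\<^sub>R ?Op \<phi> (cls S (j, z))) * (indicator (region j) z *\<^sub>R cnj (\<phi> (cls S (j, z))))) \<in> borel_measurable borel"
      by measurable
    moreover have "(\<lambda>z. (indicator (region j) z *\<^sub>R ?Op \<phi> (cls S (j, z))) * (indicator (region j) z *\<^sub>R cnj (\<phi> (cls S (j, z)))))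
       = (\<lambda>z. indicator (region j) z *\<^sub>R (?Op \<phi> (cls S (j, z)) * cnj (\<phi> (cls S (j, z)))))"
      by (auto simp: indicator_def)
    ultimately show ?thesis by simp
  qed
  let ?F = "\<lambda>q. ?Op \<phi> q * cnj (\<phi> q) - \<beta> * (\<phi> q * cnj (\<phi> q))"
  have iF: "surface_integrable ?F"
    unfolding surface_integrable_def
  proof (intro allI impI)
    fix j assume j: "j < num"
    show "set_integrable lborel (region j) (\<lambda>z. ?F (cls S (j, z)))"
      unfolding set_integrable_def
    proof (rule Bochner_Integration.integrable_bound)
      show "integrable lborel (\<lambda>z. indicator (region j) z *\<^sub>R ?w (cls S (j, z)))"
        using iw j by (simp add: surface_integrable_def set_integrable_def)
      have "(\<lambda>z. indicator (region j) z *\<^sub>R (\<beta> * (\<phi> (cls S (j, z)) * cnj (\<phi> (cls S (j, z)))))) \<in> borel_measurable borel"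
        using iphi j by (auto simp: surface_integrable_def set_integrable_def dest: borel_measurable_integrable)
      then have "(\<lambda>z. indicator (region j) z *\<^sub>R (?Op \<phi> (cls S (j, z)) * cnj (\<phi> (cls S (j, z)))) - indicator (region j) z *\<^sub>R (\<beta> * (\<phi> (cls S (j, z)) * cnj (\<phi> (cls S (j, z)))))) \<in> borel_measurable borel"
        by (rule borel_measurable_diff[OF meas[OF j]])
      then show "(\<lambda>z. indicator (region j) z *\<^sub>R ?F (cls S (j, z))) \<in> borel_measurable lborel"
        by (simp add: scaleR_diff_right)
      show "AE z in lborel. norm (indicator (region j) z *\<^sub>R ?F (cls S (j, z))) \<le> norm (indicator (region j) z *\<^sub>R ?w (cls S (j, z)))"
        using AE_good[OF j]
      proof eventually_elim
        case (elim z)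
        show ?case
        proof (cases "z \<in> region j")
          case True
          then have "cmod (?F (cls S (j, z))) \<le> ?w (cls S (j, z))" using elim by (intro pt good_regular) auto
          then show ?thesis using True by simp
        qed simp
      qed
    qed
  qed
  have "surface_integral S (\<lambda>q. ?Op \<phi> q * cnj (\<phi> q)) = surface_integral S (\<lambda>q. ?F q + \<beta> * (\<phi> q * cnj (\<phi> q)))" by simp
  also have "\<dots> = surface_integral S ?F + \<beta> * surface_integral S (\<lambda>q. \<phi> q * cnj (\<phi> q))"
    unfolding surface_integral_add[OF iF iphi] surface_integral_mult ..
  also have "surface_integral S (\<lambda>q. \<phi> q * cnj (\<phi> q)) = 1"
  proof -
    have "surface_integral S (\<lambda>q. \<phi> q * cnj (\<phi> q)) = surface_integral S (\<lambda>q. complex_of_real ((cmod (\<phi> q))\<^sup>2))"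
      by (simp only: complex_norm_square)
    also have "\<dots> = of_real (surface_integral S (\<lambda>q. (cmod (\<phi> q))\<^sup>2))"
    proof -
      have "indicator A z *\<^sub>R complex_of_real u = complex_of_real (indicator A z *\<^sub>R u)" for A and z :: complex and u
        by (simp add: scaleR_conv_of_real)
      then show ?thesis by (simp only: surface_integral_def set_lebesgue_integral_def of_real_sum integral_complex_of_real[symmetric])
    qed
    also have "surface_integral S (\<lambda>q. (cmod (\<phi> q))\<^sup>2) = surface_integral S (\<lambda>q. (1 / n)\<^sup>2 * (cmod (\<psi> q))\<^sup>2)"
      using n unfolding phi[symmetric] n_def[symmetric] by (simp add: norm_divide power_divide)
    also have "\<dots> = (1 / n)\<^sup>2 * n\<^sup>2" unfolding surface_integral_mult n_def L2_norm_square ..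
    also have "\<dots> = 1" using n by (simp add: power_divide)
    finally show ?thesis by simp
  qed
  finally have "momentum_distribution S h \<psi> b - \<beta> = surface_integral S ?F"
    unfolding momentum_distribution_def wigner_def Let_def L2_inner_def phi by simp
  also have "cmod \<dots> \<le> surface_integral S (\<lambda>q. cmod (?F q))"
    unfolding surface_integral_def set_lebesgue_integral_def
    by (rule order_trans[OF norm_sum]) (rule sum_mono, rule order_trans[OF integral_norm_bound], simp)
  also have "\<dots> \<le> surface_integral S ?w"
    by (rule surface_integral_mono[OF iw pt]) (use A in \<open>auto intro!: add_nonneg_nonneg\<close>)
  also have "\<dots> = (8 * A0 * 2) * total_area + (8 * A0 + 8 * A1) * ((L2_norm S f)\<^sup>2 + (L2_norm S g)\<^sup>2)"
    unfolding surface_integral_add[OF surface_integrable_const ic[OF ia[OF if' ig]]] surface_integral_const surface_integral_mult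
      surface_integral_add[OF if' ig] L2_norm_square ..
  also have "\<dots> = 8 * A0 * (2 * total_area + 2) + 16 * A1" using f(2) g(2) by (simp add: algebra_simps)
  finally show ?thesis .
qed

lemma normalized_quasimode_minus:
  assumes "normalized_quasimode C \<xi> \<mu> \<phi> k" shows "normalized_quasimode C \<xi> \<mu> (\<lambda>q. - \<phi> q) k"
proof -
  have c: "Ck_surface S 2 \<phi>" using assms by (simp add: normalized_quasimode_def)
  obtain G H where g: "has_gradient S \<phi> G H" and D: "\<forall>q\<in>regular_points S. cmod (G q - \<i> * of_real (Re k) * \<phi> q) \<le> C * \<mu> powr (1 / 4) \<and>
        cmod (H q - \<i> * of_real (Im k) * \<phi> q) \<le> C * \<mu> powr (1 / 4)"
    using assms by (auto simp: normalized_quasimode_def)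
  have g': "has_gradient S (\<lambda>q. - \<phi> q) (\<lambda>q. - G q) (\<lambda>q. - H q)"
    using has_gradient_combination[OF g g, of "-1" 0] by simp
  have c': "Ck_surface S 2 (\<lambda>q. - \<phi> q)" using Ck_surface_combination[OF c c, of "-1" 0] by simp
  have n: "L2_norm S (\<lambda>q. - u q) = L2_norm S u" for u by (simp add: L2_norm_def)
  have lap: "laplacian S (\<lambda>q. - \<phi> q) q = - laplacian S \<phi> q" if "q \<in> regular_points S" for q
    using laplacian_combination[OF c c that, of "-1" 0] by simp
  have "surface_integral S (\<lambda>q. (cmod (laplacian S (\<lambda>q. - \<phi> q) q + of_real \<mu> * - \<phi> q))\<^sup>2)
      = surface_integral S (\<lambda>q. (cmod (laplacian S \<phi> q + of_real \<mu> * \<phi> q))\<^sup>2)"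
  proof (rule regular_agree_integral(2))
    fix q assume "q \<in> regular_points S"
    then have "laplacian S (\<lambda>q. - \<phi> q) q + of_real \<mu> * - \<phi> q = - (laplacian S \<phi> q + of_real \<mu> * \<phi> q)" by (simp add: lap)
    then show "(cmod (laplacian S (\<lambda>q. - \<phi> q) q + of_real \<mu> * - \<phi> q))\<^sup>2 = (cmod (laplacian S \<phi> q + of_real \<mu> * \<phi> q))\<^sup>2"
      by (simp only: norm_minus_cancel)
  qed
  then have eq: "L2_norm S (\<lambda>q. laplacian S (\<lambda>q. - \<phi> q) q + of_real \<mu> * - \<phi> q) = L2_norm S (\<lambda>q. laplacian S \<phi> q + of_real \<mu> * \<phi> q)"
    by (simp only: L2_norm_def)
  have l: "L2_norm S (\<lambda>q. laplacian S (\<lambda>q. - \<phi> q) q + of_real \<mu> * - \<phi> q) \<le> C * \<mu> powr (3 / 8)"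
    unfolding eq using assms by (simp add: normalized_quasimode_def)
  have m: "cmod (- a - b * - d) = cmod (a - b * d)" for a b d :: complex by (simp add: norm_minus_commute)
  show ?thesis
    unfolding normalized_quasimode_def
  proof (intro conjI exI ballI)
    show "has_gradient S (\<lambda>q. - \<phi> q) (\<lambda>q. - G q) (\<lambda>q. - H q)" by (rule g')
    show "L2_norm S (\<lambda>q. - \<phi> q) = 1" unfolding n using assms by (simp add: normalized_quasimode_def)
    fix q assume q: "q \<in> regular_points S"
    show "cmod (- G q - \<i> * of_real (Re k) * - \<phi> q) \<le> C * \<mu> powr (1 / 4)" "cmod (- H q - \<i> * of_real (Im k) * - \<phi> q) \<le> C * \<mu> powr (1 / 4)"
      unfolding m using D q by auto
    show "- \<phi> q \<noteq> 0 \<longrightarrow> chart S (\<mu> powr (- 1 / 8) / C) q" using assms q by (simp add: normalized_quasimode_def)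
  qed (use assms c' l in \<open>auto simp: normalized_quasimode_def\<close>)
qed

text \<open>With \<open>h\<close> of order \<open>l\<^bsup>-1/2\<^esup>\<close>, the error in the gradient contributes \<open>h l\<^bsup>1/4\<^esup>\<close> and the distance from the
  vertices \<open>h l\<^bsup>1/8\<^esup>\<close>.\<close>

lemma quasimode_observable:
  assumes q: "normalized_quasimode C \<xi> \<mu> \<phi> k" "x \<in> regular_points S" and C: "0 < C" and l: "1 \<le> l" "0 < \<mu>" "\<mu> \<le> 2 * l" and b: "test_function b"
  defines "h \<equiv> l powr (- 1 / 2)"
  shows "cmod (Op_weyl S h (\<lambda>x \<xi>. b \<xi>) \<phi> x - b \<xi> * \<phi> x)
     \<le> 4 * C * moment b * l powr (- 1 / 4) + (2 * C * moment b * l powr (- 1 / 4) + cmod (b (of_real h * k) - b \<xi>)) * cmod (\<phi> x)"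
proof -
  let ?Op = "Op_weyl S h (\<lambda>x \<xi>. b \<xi>) \<phi> x"
  have h: "0 < h" using l by (simp add: h_def)
  let ?D = "C * \<mu> powr (1 / 4)"
  obtain G H where g: "has_gradient S \<phi> G H" and D: "\<And>q. q \<in> regular_points S \<Longrightarrow> cmod (G q - \<i> * of_real (Re k) * \<phi> q) \<le> ?D"
      "\<And>q. q \<in> regular_points S \<Longrightarrow> cmod (H q - \<i> * of_real (Im k) * \<phi> q) \<le> ?D"
    using q(1) unfolding normalized_quasimode_def by blast
  have "continuous_on_surface S \<phi>" using q(1) by (simp add: normalized_quasimode_def numeral_2_eq_2)
  then obtain M where M: "\<And>q. q \<in> regular_points S \<Longrightarrow> cmod (\<phi> q) \<le> M" using continuous_on_surface_bounded by blast
  let ?\<rho> = "\<mu> powr (- 1 / 8) / C"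
  have ch: "chart S ?\<rho> x" if "\<phi> x \<noteq> 0" using q that by (simp add: normalized_quasimode_def)
  have p2: "2 powr a \<le> (2 :: real)" if "a \<le> 1" for a using powr_mono[of a 1 2] that by simp
  have pw: "\<mu> powr a \<le> 2 * l powr a" if "0 \<le> a" "a \<le> 1" for a
  proof -
    have "\<mu> powr a \<le> (2 * l) powr a" using l that by (intro powr_mono2) auto
    also have "\<dots> = 2 powr a * l powr a" using l by (simp add: powr_mult)
    also have "\<dots> \<le> 2 * l powr a" using p2[OF that(2)] by (intro mult_right_mono) auto
    finally show ?thesis .
  qed
  have hD: "h * (2 * ?D) \<le> 4 * C * l powr (- 1 / 4)"
  proof -
    have "h * (2 * ?D) \<le> h * (2 * (C * (2 * l powr (1 / 4))))" using h C pw[of "1 / 4"] by (intro mult_left_mono) auto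
    also have "\<dots> = 4 * C * (l powr (- 1 / 2) * l powr (1 / 4))" by (simp add: h_def)
    also have "l powr (- 1 / 2) * l powr (1 / 4) = l powr (- 1 / 4)" by (simp flip: powr_add)
    finally show ?thesis .
  qed
  have hr: "h / ?\<rho> \<le> 2 * C * l powr (- 1 / 4)"
  proof -
    have "h / ?\<rho> = h * C * \<mu> powr (1 / 8)" using l by (simp add: powr_minus_divide)
    also have "\<dots> \<le> h * C * (2 * l powr (1 / 8))" using h C pw[of "1 / 8"] by (intro mult_left_mono) auto
    also have "\<dots> = 2 * C * (l powr (- 1 / 2) * l powr (1 / 8))" by (simp add: h_def)
    also have "l powr (- 1 / 2) * l powr (1 / 8) = l powr (- 3 / 8)" by (simp flip: powr_add)
    also have "2 * C * l powr (- 3 / 8) \<le> 2 * C * l powr (- 1 / 4)" using l C by (intro mult_left_mono powr_mono) auto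
    finally show ?thesis .
  qed
  have "cmod (?Op - b (of_real h * k) * \<phi> x) \<le> h * (2 * ?D + cmod (\<phi> x) / ?\<rho>) * moment b"
    by (rule Op_weyl_plane_wave[OF h b q(2) g M D]) (use l C ch in auto)
  also have "\<dots> = (h * (2 * ?D) + h / ?\<rho> * cmod (\<phi> x)) * moment b" by (simp add: distrib_left)
  also have "\<dots> \<le> (4 * C * l powr (- 1 / 4) + 2 * C * l powr (- 1 / 4) * cmod (\<phi> x)) * moment b"
    using hD hr moment_nonneg by (intro mult_right_mono add_mono) auto
  finally have 1: "cmod (?Op - b (of_real h * k) * \<phi> x) \<le> 4 * C * moment b * l powr (- 1 / 4) + 2 * C * moment b * l powr (- 1 / 4) * cmod (\<phi> x)"
    by (simp add: algebra_simps)
  have "?Op - b \<xi> * \<phi> x = (?Op - b (of_real h * k) * \<phi> x) + (b (of_real h * k) - b \<xi>) * \<phi> x" by (simp add: algebra_simps)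
  then have "cmod (?Op - b \<xi> * \<phi> x) \<le> cmod (?Op - b (of_real h * k) * \<phi> x) + cmod (b (of_real h * k) - b \<xi>) * cmod (\<phi> x)"
    by (metis norm_mult norm_triangle_ineq)
  then show ?thesis using 1 by (simp add: distrib_right)
qed

end

lemma rescaled_wave_vectors:
  fixes k :: "nat \<Rightarrow> complex" and \<mu> :: "nat \<Rightarrow> real" and n :: "real \<Rightarrow> nat"
  assumes k: "\<And>m. cmod (k m / of_real (sqrt (\<mu> m)) - \<xi>) \<le> C * \<mu> m powr (- 1 / 8)"
    and \<mu>: "\<And>m. 0 < \<mu> m" and n: "\<forall>\<^sub>F l in at_top. \<bar>\<mu> (n l) - l\<bar> \<le> 1"
  shows "((\<lambda>l. of_real (l powr (- 1 / 2)) * k (n l)) \<longlongrightarrow> \<xi>) at_top"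
proof -
  have b: "\<forall>\<^sub>F l in at_top. l - 1 \<le> \<mu> (n l) \<and> \<mu> (n l) \<le> l + 1" using n by eventually_elim auto
  have lim: "filterlim (\<lambda>l. \<mu> (n l)) at_top at_top"
  proof (rule filterlim_at_top_mono)
    show "filterlim (\<lambda>l :: real. l - 1) at_top at_top"
      using filterlim_tendsto_add_at_top[OF tendsto_const filterlim_ident, of "- 1 :: real"] by simp
    show "\<forall>\<^sub>F l in at_top. l - 1 \<le> \<mu> (n l)" using b by eventually_elim auto
  qed
  have "((\<lambda>x :: real. C * x powr (- 1 / 8)) \<longlongrightarrow> C * 0) at_top"
    by (intro tendsto_intros tendsto_neg_powr filterlim_ident) auto
  then have "((\<lambda>x :: real. C * x powr (- 1 / 8)) \<longlongrightarrow> 0) at_top" by simp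
  from filterlim_compose[OF this lim]
  have "((\<lambda>l. k (n l) / of_real (sqrt (\<mu> (n l))) - \<xi>) \<longlongrightarrow> 0) at_top"
    by (rule Lim_null_comparison[rotated]) (use k in auto)
  then have 1: "((\<lambda>l. k (n l) / of_real (sqrt (\<mu> (n l)))) \<longlongrightarrow> \<xi>) at_top" by (simp add: LIM_zero_iff)
  have "((\<lambda>l. \<mu> (n l) / l) \<longlongrightarrow> 1) at_top"
  proof (rule LIM_zero_cancel, rule Lim_null_comparison[OF _ tendsto_inverse_0_at_top[OF filterlim_ident]])
    show "\<forall>\<^sub>F l in at_top. norm (\<mu> (n l) / l - 1) \<le> inverse l"
      using n eventually_gt_at_top[of 0]
    proof eventually_elim
      case (elim l)
      have "\<mu> (n l) / l - 1 = (\<mu> (n l) - l) / l" using elim by (simp add: field_simps)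
      then show ?case using elim by (simp add: divide_right_mono inverse_eq_divide)
    qed
  qed
  then have "((\<lambda>l. complex_of_real (sqrt (\<mu> (n l) / l))) \<longlongrightarrow> of_real (sqrt 1)) at_top" by (intro tendsto_intros)
  from tendsto_mult[OF this 1] have "((\<lambda>l. complex_of_real (sqrt (\<mu> (n l) / l)) * (k (n l) / of_real (sqrt (\<mu> (n l))))) \<longlongrightarrow> \<xi>) at_top" by simp
  then show ?thesis
  proof (rule Lim_transform_eventually)
    show "\<forall>\<^sub>F l in at_top. complex_of_real (sqrt (\<mu> (n l) / l)) * (k (n l) / of_real (sqrt (\<mu> (n l)))) = of_real (l powr (- 1 / 2)) * k (n l)"
      using eventually_gt_at_top[of 0]
    proof eventually_elim
      case (elim l)
      have "sqrt (\<mu> (n l)) \<noteq> 0" using \<mu>[of "n l"] by simp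
      then show ?case using elim by (simp add: real_sqrt_divide powr_minus_divide powr_half_sqrt)
    qed
  qed
qed

theorem theorem1p1:
  fixes S :: gluing and \<xi>\<^sub>0 :: complex and \<epsilon> :: real
  assumes "translation_surface S" and "\<xi>\<^sub>0 \<in> sphere 0 1" and "\<epsilon> > 0"
  shows "\<exists>\<Lambda> :: real \<Rightarrow> point \<Rightarrow> complex.
    continuous_C2_family S \<Lambda> \<and>
    (\<forall>l>0. L2_norm S (\<Lambda> l) \<noteq> 0) \<and>
    (\<lambda>l. L2_norm S (\<lambda>q. laplacian S (\<Lambda> l) q + of_real l * \<Lambda> l q) / L2_norm S (\<Lambda> l))
      \<in> O[at_top](\<lambda>l. l powr (3 / 8 + \<epsilon>)) \<and>
    weak_star_limit (\<lambda>l. momentum_distribution S (l powr (- 1 / 2)) (\<Lambda> l)) (dirac \<xi>\<^sub>0)"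
proof -
  interpret flat_surface S by unfold_locales (rule assms(1))
  obtain c r where r: "0 < r" "ball c r \<subseteq> interior_part 0"
    using interior_part_nonempty[OF num_pos] open_interior_part[of 0] open_contains_ball by (metis ex_in_conv)
  interpret base_disc S c "r / 2" \<xi>\<^sub>0
    by standard (use r assms(2) in \<open>auto simp: dist_norm\<close>)
  obtain C where C: "C > 0" "\<And>\<mu>. 1 \<le> \<mu> \<Longrightarrow> \<exists>\<phi> k. normalized_quasimode C \<xi>\<^sub>0 \<mu> \<phi> k"
    using quasimodes_exist by blast
  (* The packets exist for eigenvalues from 1 on; the first one also serves for 0. *)
  define \<mu> where "\<mu> m = max 1 (real m)" for m
  have \<mu>1: "1 \<le> \<mu> m" for m by (simp add: \<mu>_def)
  let ?re = "\<lambda>f g. surface_integral S (\<lambda>q. Re (f q * cnj (g q)))"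
  (* The sign of each packet is adapted to its predecessor. *)
  have "\<exists>F. \<forall>m. (\<exists>k. normalized_quasimode C \<xi>\<^sub>0 (\<mu> m) (F m) k) \<and> 0 \<le> ?re (F m) (F (Suc m))"
  proof (rule dependent_nat_choice)
    show "\<exists>\<phi> k. normalized_quasimode C \<xi>\<^sub>0 (\<mu> 0) \<phi> k" using C(2)[OF \<mu>1] .
    show "\<exists>g. (\<exists>k. normalized_quasimode C \<xi>\<^sub>0 (\<mu> (Suc m)) g k) \<and> 0 \<le> ?re f g" for f m
    proof -
      obtain g k where g: "normalized_quasimode C \<xi>\<^sub>0 (\<mu> (Suc m)) g k" using C(2)[OF \<mu>1] by blast
      show ?thesis
      proof (cases "0 \<le> ?re f g")
        case True
        then show ?thesis using g by blast
      next
        case False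
        have "?re f (\<lambda>q. - g q) = - ?re f g"
          using surface_integral_mult[of "- 1" "\<lambda>q. Re (f q * cnj (g q))"] by simp
        then have "0 \<le> ?re f (\<lambda>q. - g q)" using False by simp
        then show ?thesis using normalized_quasimode_minus[OF g] by blast
      qed
    qed
  qed
  then obtain F where F0: "\<And>m. \<exists>k. normalized_quasimode C \<xi>\<^sub>0 (\<mu> m) (F m) k" and pos: "\<And>m. 0 \<le> ?re (F m) (F (Suc m))" by blast
  define k where "k m = (SOME k. normalized_quasimode C \<xi>\<^sub>0 (\<mu> m) (F m) k)" for m
  have F: "normalized_quasimode C \<xi>\<^sub>0 (\<mu> m) (F m) (k m)" for m
    unfolding k_def by (rule someI_ex[OF F0])
  have FC: "Ck_surface S 2 (F m)" and Fn: "L2_norm S (F m) = 1"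
    and Fe: "L2_norm S (\<lambda>q. laplacian S (F m) q + of_real (\<mu> m) * F m q) \<le> C * \<mu> m powr (3 / 8)"
    and Fk: "cmod (k m / of_real (sqrt (\<mu> m)) - \<xi>\<^sub>0) \<le> C * \<mu> m powr (- 1 / 8)" for m
    using F[of m] by (auto simp: normalized_quasimode_def)
  have Fc: "continuous_on_surface S (F m)" for m using FC[of m] by (simp add: numeral_2_eq_2)
  obtain G H where FG: "\<And>m. has_gradient S (F m) (G m) (H m)"
  proof -
    have "\<exists>p. has_gradient S (F m) (fst p) (snd p)" for m using F[of m] by (auto simp: normalized_quasimode_def)
    then obtain p where "\<And>m. has_gradient S (F m) (fst (p m)) (snd (p m))" by metis
    then show ?thesis by (rule that)
  qed
  define n where "n l = nat \<lfloor>l\<rfloor>" for l :: real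
  define \<Lambda> where "\<Lambda> l = (\<lambda>q. of_real (real (Suc (n l)) - l) * F (n l) q + of_real (l - real (n l)) * F (Suc (n l)) q)" for l
  have nl: "real (n l) \<le> l" "l < real (n l) + 1" if "0 \<le> l" for l
    using that unfolding n_def by (simp_all add: of_nat_nat)
  have \<Lambda>_eq: "\<Lambda> l = (\<lambda>q. of_real (real (Suc m) - l) * F m q + of_real (l - real m) * F (Suc m) q)"
    if "real m \<le> l" "l \<le> real m + 1" for l m
  proof (cases "l = real m + 1")
    case True
    then have "n l = Suc m" by (simp add: n_def nat_add_distrib)
    then show ?thesis using True by (simp add: \<Lambda>_def)
  next
    case False
    then have "\<lfloor>l\<rfloor> = int m" using that by (intro floor_unique) auto
    then show ?thesis by (simp add: \<Lambda>_def n_def)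
  qed
  have \<Lambda>C: "Ck_surface S 2 (\<Lambda> l)" for l unfolding \<Lambda>_def by (rule Ck_surface_combination[OF FC FC])
  have low: "1 / 2 \<le> (L2_norm S (\<Lambda> l))\<^sup>2" if "0 \<le> l" for l
    unfolding \<Lambda>_def by (rule interpolation_lower_bound[OF Fc Fc Fn Fn pos]) (use nl[OF that] in auto)
  have "continuous_C2_family S \<Lambda>"
    unfolding continuous_C2_family_def
  proof (intro conjI allI impI)
    fix l :: real assume l: "0 < l"
    have "\<exists>B. \<forall>c. 0 \<le> C2_norm S (\<lambda>q. c * (1 * F (Suc m) q + (- 1) * F m q)) \<and> C2_norm S (\<lambda>q. c * (1 * F (Suc m) q + (- 1) * F m q)) \<le> cmod c * B" for m
      by (rule C2_norm_scaled[OF Ck_surface_combination[OF FC FC]])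
    then obtain B where B: "\<And>m c. 0 \<le> C2_norm S (\<lambda>q. c * (1 * F (Suc m) q + (- 1) * F m q))"
      "\<And>m c. C2_norm S (\<lambda>q. c * (1 * F (Suc m) q + (- 1) * F m q)) \<le> cmod c * B m" by metis
    have step: "0 \<le> C2_norm S (\<lambda>q. \<Lambda> x q - \<Lambda> l q) \<and> C2_norm S (\<lambda>q. \<Lambda> x q - \<Lambda> l q) \<le> \<bar>x - l\<bar> * B m"
      if "real m \<le> x" "x \<le> real m + 1" "real m \<le> l" "l \<le> real m + 1" for x m
    proof -
      have "(\<lambda>q. \<Lambda> x q - \<Lambda> l q) = (\<lambda>q. of_real (x - l) * (1 * F (Suc m) q + (- 1) * F m q))"
        unfolding \<Lambda>_eq[OF that(1,2)] \<Lambda>_eq[OF that(3,4)] by (auto simp: algebra_simps)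
      then show ?thesis using B[of "of_real (x - l)" m] B(2)[of "of_real (x - l)" m] by (simp del: of_real_diff)
    qed
    define a where "a = nat (\<lceil>l\<rceil> - 1)"
    have a: "real a < l" "l \<le> real a + 1" using l unfolding a_def by (simp_all add: of_nat_nat) linarith+
    note n0 = nl[OF less_imp_le[OF l]]
    define M where "M = max (B a) (B (n l))"
    have near: "0 \<le> C2_norm S (\<lambda>q. \<Lambda> x q - \<Lambda> l q) \<and> C2_norm S (\<lambda>q. \<Lambda> x q - \<Lambda> l q) \<le> \<bar>x - l\<bar> * M"
      if "real a < x" "x < real (n l) + 1" for x
    proof (cases "x \<le> l")
      case True
      have "\<bar>x - l\<bar> * B a \<le> \<bar>x - l\<bar> * M" by (intro mult_left_mono) (auto simp: M_def)
      moreover have "0 \<le> C2_norm S (\<lambda>q. \<Lambda> x q - \<Lambda> l q) \<and> C2_norm S (\<lambda>q. \<Lambda> x q - \<Lambda> l q) \<le> \<bar>x - l\<bar> * B a"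
        by (rule step) (use that True a in auto)
      ultimately show ?thesis by linarith
    next
      case False
      have "\<bar>x - l\<bar> * B (n l) \<le> \<bar>x - l\<bar> * M" by (intro mult_left_mono) (auto simp: M_def)
      moreover have "0 \<le> C2_norm S (\<lambda>q. \<Lambda> x q - \<Lambda> l q) \<and> C2_norm S (\<lambda>q. \<Lambda> x q - \<Lambda> l q) \<le> \<bar>x - l\<bar> * B (n l)"
        by (rule step) (use that False n0 in auto)
      ultimately show ?thesis by linarith
    qed
    have ev: "\<forall>\<^sub>F x in at l. real a < x \<and> x < real (n l) + 1"
      using a n0 by (intro eventually_at_in_open'[of "{real a<..<real (n l) + 1}", simplified]) auto
    show "((\<lambda>m. C2_norm S (\<lambda>q. \<Lambda> m q - \<Lambda> l q)) \<longlongrightarrow> 0) (at l)"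
    proof (rule tendsto_sandwich[OF _ _ tendsto_const])
      show "\<forall>\<^sub>F x in at l. 0 \<le> C2_norm S (\<lambda>q. \<Lambda> x q - \<Lambda> l q)" "\<forall>\<^sub>F x in at l. C2_norm S (\<lambda>q. \<Lambda> x q - \<Lambda> l q) \<le> \<bar>x - l\<bar> * M"
        by (rule eventually_mono[OF ev], use near in blast)+
      have "((\<lambda>x. \<bar>x - l\<bar> * M) \<longlongrightarrow> \<bar>l - l\<bar> * M) (at l)" by (intro tendsto_intros)
      then show "((\<lambda>x. \<bar>x - l\<bar> * M) \<longlongrightarrow> 0) (at l)" by simp
    qed
  qed (rule \<Lambda>C)
  moreover have "\<forall>l>0. L2_norm S (\<Lambda> l) \<noteq> 0"
  proof (intro allI impI notI)
    fix l :: real assume "0 < l" "L2_norm S (\<Lambda> l) = 0"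
    then show False using low[of l] by simp
  qed
  moreover have "(\<lambda>l. L2_norm S (\<lambda>q. laplacian S (\<Lambda> l) q + of_real l * \<Lambda> l q) / L2_norm S (\<Lambda> l)) \<in> O[at_top](\<lambda>l. l powr (3 / 8 + \<epsilon>))"
  proof (rule bigoI)
    show "\<forall>\<^sub>F l in at_top. norm (L2_norm S (\<lambda>q. laplacian S (\<Lambda> l) q + of_real l * \<Lambda> l q) / L2_norm S (\<Lambda> l))
        \<le> (2 * sqrt (32 * C\<^sup>2 + 8)) * norm (l powr (3 / 8 + \<epsilon>))"
      using eventually_ge_at_top[of 2]
    proof eventually_elim
      case (elim l)
      have l: "0 \<le> l" "1 \<le> l" "l \<ge> 1" using elim by auto
      note nn = nl[OF l(1)]
      have n1: "1 \<le> real (n l)" using nn elim by linarith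
      have lam: "\<mu> (n l) = real (n l)" "\<mu> (Suc (n l)) = real (n l) + 1" using n1 by (auto simp: \<mu>_def)
      define E where "E = C * (2 * l powr (3 / 8))"
      have p: "\<mu> m powr (3 / 8) \<le> 2 * l powr (3 / 8)" if "m = n l \<or> m = Suc (n l)" for m
      proof -
        have "\<mu> m powr (3 / 8) \<le> (2 * l) powr (3 / 8)"
          using that lam nn elim \<mu>1[of m] by (intro powr_mono2) auto
        also have "\<dots> = 2 powr (3 / 8) * l powr (3 / 8)" using l by (simp add: powr_mult)
        also have "\<dots> \<le> 2 * l powr (3 / 8)" using powr_mono[of "3 / 8" 1 "2 :: real"] by (intro mult_right_mono) auto
        finally show ?thesis .
      qed
      have eE: "L2_norm S (\<lambda>q. laplacian S (F m) q + of_real (\<mu> m) * F m q) \<le> E" if "m = n l \<or> m = Suc (n l)" for m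
        unfolding E_def by (rule order_trans[OF Fe]) (use p[OF that] C in \<open>intro mult_left_mono; simp\<close>)
      have "L2_norm S (\<lambda>q. laplacian S (\<Lambda> l) q + of_real l * \<Lambda> l q) \<le> sqrt (8 * E\<^sup>2 + 8)"
        unfolding \<Lambda>_def
        by (rule interpolation_defect[OF FC Fn eE FC Fn eE]) (use nn lam in auto)
      also have "\<dots> \<le> sqrt ((32 * C\<^sup>2 + 8) * (l powr (3 / 8))\<^sup>2)"
      proof (rule real_sqrt_le_mono)
        have "1 \<le> l powr (3 / 8)" using l by (intro ge_one_powr_ge_zero) auto
        then have "1 \<le> (l powr (3 / 8))\<^sup>2" by (rule one_le_power)
        then show "8 * E\<^sup>2 + 8 \<le> (32 * C\<^sup>2 + 8) * (l powr (3 / 8))\<^sup>2"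
          by (simp add: E_def power_mult_distrib distrib_right)
      qed
      also have "\<dots> = sqrt (32 * C\<^sup>2 + 8) * l powr (3 / 8)" by (simp add: real_sqrt_mult)
      finally have num: "L2_norm S (\<lambda>q. laplacian S (\<Lambda> l) q + of_real l * \<Lambda> l q) \<le> sqrt (32 * C\<^sup>2 + 8) * l powr (3 / 8)" .
      have N0: "0 \<le> L2_norm S u" for u by (simp add: L2_norm_def surface_integral_nonneg)
      have "(1 / 2)\<^sup>2 \<le> (L2_norm S (\<Lambda> l))\<^sup>2" using low[OF l(1)] by (simp add: power_divide)
      then have N: "1 / 2 \<le> L2_norm S (\<Lambda> l)" using N0 by (rule power2_le_imp_le)
      have "norm (L2_norm S (\<lambda>q. laplacian S (\<Lambda> l) q + of_real l * \<Lambda> l q) / L2_norm S (\<Lambda> l))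
          = L2_norm S (\<lambda>q. laplacian S (\<Lambda> l) q + of_real l * \<Lambda> l q) / L2_norm S (\<Lambda> l)" using N0 by simp
      also have "\<dots> \<le> (sqrt (32 * C\<^sup>2 + 8) * l powr (3 / 8)) / (1 / 2)"
        using num N N0 by (intro frac_le) auto
      also have "\<dots> = (2 * sqrt (32 * C\<^sup>2 + 8)) * l powr (3 / 8)" by simp
      also have "\<dots> \<le> (2 * sqrt (32 * C\<^sup>2 + 8)) * l powr (3 / 8 + \<epsilon>)"
        using l assms(3) by (intro mult_left_mono powr_mono) auto
      finally show ?case by simp
    qed
  qed
  moreover have "weak_star_limit (\<lambda>l. momentum_distribution S (l powr (- 1 / 2)) (\<Lambda> l)) (dirac \<xi>\<^sub>0)"
    unfolding weak_star_limit_def dirac_def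
  proof (intro allI impI)
    fix b assume b: "test_function b"
    let ?o = "\<lambda>m l. cmod (b (of_real (l powr (- 1 / 2)) * k m) - b \<xi>\<^sub>0)"
    let ?A0 = "\<lambda>l. 4 * C * moment b * l powr (- 1 / 4)"
    let ?A1 = "\<lambda>l. 2 * C * moment b * l powr (- 1 / 4) + (?o (n l) l + ?o (Suc (n l)) l)"
    let ?R = "\<lambda>l. 8 * ?A0 l * (2 * total_area + 2) + 16 * ?A1 l"
    have ev: "\<forall>\<^sub>F l in at_top. \<bar>\<mu> (n l) - l\<bar> \<le> 1 \<and> \<bar>\<mu> (Suc (n l)) - l\<bar> \<le> 1"
      using eventually_ge_at_top[of 2]
    proof eventually_elim
      case (elim l)
      then have "real (n l) \<le> l" "l < real (n l) + 1" using nl[of l] by auto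
      then show ?case using elim by (auto simp: \<mu>_def)
    qed
    have "isCont b \<xi>\<^sub>0" using test_continuous[OF b] by (simp add: continuous_on_eq_continuous_at)
    then have ob: "((\<lambda>l. ?o (m l) l) \<longlongrightarrow> 0) at_top" if "\<forall>\<^sub>F l in at_top. \<bar>\<mu> (m l) - l\<bar> \<le> 1" for m
    proof -
      have "((\<lambda>l. of_real (l powr (- 1 / 2)) * k (m l)) \<longlongrightarrow> \<xi>\<^sub>0) at_top"
        by (rule rescaled_wave_vectors[OF Fk _ that]) (rule less_le_trans[OF zero_less_one \<mu>1])
      then have "((\<lambda>l. b (of_real (l powr (- 1 / 2)) * k (m l))) \<longlongrightarrow> b \<xi>\<^sub>0) at_top" by (rule isCont_tendsto_compose[OF \<open>isCont b \<xi>\<^sub>0\<close>])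
      then have "((\<lambda>l. b (of_real (l powr (- 1 / 2)) * k (m l)) - b \<xi>\<^sub>0) \<longlongrightarrow> 0) at_top" by (simp add: LIM_zero)
      then show ?thesis by (rule tendsto_norm_zero)
    qed
    have pw: "((\<lambda>l :: real. l powr (- 1 / 4)) \<longlongrightarrow> 0) at_top" by (rule tendsto_neg_powr[OF _ filterlim_ident]) simp
    have o1: "((\<lambda>l. ?o (n l) l) \<longlongrightarrow> 0) at_top" "((\<lambda>l. ?o (Suc (n l)) l) \<longlongrightarrow> 0) at_top"
      by (rule ob; use ev in \<open>eventually_elim, simp\<close>)+
    have R: "(?R \<longlongrightarrow> 0) at_top"
    proof -
      have "(?R \<longlongrightarrow> 8 * (4 * C * moment b * 0) * (2 * total_area + 2) + 16 * (2 * C * moment b * 0 + (0 + 0))) at_top"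
        by (intro tendsto_intros pw o1)
      then show ?thesis by simp
    qed
    have "\<forall>\<^sub>F l in at_top. cmod (momentum_distribution S (l powr (- 1 / 2)) (\<Lambda> l) b - b \<xi>\<^sub>0) \<le> ?R l"
      using ev eventually_ge_at_top[of 2]
    proof eventually_elim
      case (elim l)
      then have l: "0 \<le> l" "1 \<le> l" "0 < l" by auto
      note nn = nl[OF l(1)]
      have le: "\<mu> (n l) \<le> 2 * l" "\<mu> (Suc (n l)) \<le> 2 * l" using elim by auto
      have m0: "0 \<le> ?A0 l" using C moment_nonneg by simp
      have m1: "0 \<le> 2 * C * moment b * l powr (- 1 / 4)" using C moment_nonneg by simp
      have lp: "0 < \<mu> m" for m using \<mu>1[of m] by linarith
      show ?case unfolding \<Lambda>_def
      proof (rule momentum_distribution_estimate[OF _ b FC Fn FG FC Fn FG])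
        show "cmod (Op_weyl S (l powr (- 1 / 2)) (\<lambda>x \<xi>. b \<xi>) (F (n l)) q - b \<xi>\<^sub>0 * F (n l) q) \<le> ?A0 l + ?A1 l * cmod (F (n l) q)"
          if "q \<in> regular_points S" for q
          by (rule order_trans[OF quasimode_observable[OF F that C(1) l(2) lp le(1) b]]) (intro add_left_mono mult_right_mono, auto)
        show "cmod (Op_weyl S (l powr (- 1 / 2)) (\<lambda>x \<xi>. b \<xi>) (F (Suc (n l))) q - b \<xi>\<^sub>0 * F (Suc (n l)) q) \<le> ?A0 l + ?A1 l * cmod (F (Suc (n l)) q)"
          if "q \<in> regular_points S" for q
          by (rule order_trans[OF quasimode_observable[OF F that C(1) l(2) lp le(2) b]]) (intro add_left_mono mult_right_mono, auto)
        show "0 \<le> ?A0 l" by (rule m0)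
        show "0 \<le> ?A1 l" using m1 by simp
        show "1 / 2 \<le> (L2_norm S (\<lambda>q. of_real (real (Suc (n l)) - l) * F (n l) q + of_real (l - real (n l)) * F (Suc (n l)) q))\<^sup>2"
          using low[OF l(1)] by (simp only: \<Lambda>_def)
      qed (use l nn in auto)
    qed
    then have "((\<lambda>l. momentum_distribution S (l powr (- 1 / 2)) (\<Lambda> l) b - b \<xi>\<^sub>0) \<longlongrightarrow> 0) at_top"
      by (rule Lim_null_comparison[OF _ R])
    then show "((\<lambda>l. momentum_distribution S (l powr (- 1 / 2)) (\<Lambda> l) b) \<longlongrightarrow> b \<xi>\<^sub>0) at_top" by (simp add: LIM_zero_iff)
  qed
  ultimately show ?thesis by blast
qed

end
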